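(* Let $\mathcal{Y}'$ be a stationary random planar tessellation with convex cells and let $\mathcal{Y}$ be the column tessellation of $\mathbb{R}^3$ constructed from $\mathcal{Y}'$ and the positive cell marks $\rho_z$. Let $\lambda'_{\mathsf V},\lambda'_{\mathsf Z}$ be the intensities of vertices and cells of $\mathcal{Y}'$, let $\bar\rho_{\mathsf Z}=\mathbb{E}'_{\mathsf Z}(\rho_z)$ be the mean mark of the typical cell of $\mathcal{Y}'$, and let $\bar\alpha_{\mathsf V}=\mathbb{E}'_{\mathsf V}(\alpha_v)$, where $\alpha_v=\sum_{\{z\in\mathsf{Z}:\,z\ni v\}}\rho_z$ for a vertex $v$ of $\mathcal{Y}'$. Then the intensities $\lambda_{\mathsf V},\lambda_{\mathsf E},\lambda_{\mathsf P},\lambda_{\mathsf Z}$ of vertices, edges, plates and cells of $\mathcal{Y}$ are (i) $\lambda_{\mathsf V}=\lambda'_{\mathsf V}\bar\alpha_{\mathsf V}$, (ii) $\lambda_{\mathsf E}=2\lambda'_{\mathsf V}\bar\alpha_{\mathsf V}$, (iii) $\lambda_{\mathsf P}=\lambda'_{\mathsf V}\bar\alpha_{\mathsf V}+\lambda'_{\mathsf Z}\bar\rho_{\mathsf Z}$, (iv) $\lambda_{\mathsf Z}=\lambda'_{\mathsf Z}\bar\rho_{\mathsf Z}$. Moreover, for the intensities of the horizontal and vertical edges and of the horizontal and vertical plates of $\mathcal{Y}$, (v) $\lambda_{\mathsf{E[hor]}}=\lambda_{\mathsf{E[vert]}}=\lambda'_{\mathsf V}\bar\alpha_{\mathsf V}$,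 (vi) $\lambda_{\mathsf{P[hor]}}=\lambda'_{\mathsf Z}\bar\rho_{\mathsf Z}$ and $\lambda_{\mathsf{P[vert]}}=\lambda'_{\mathsf V}\bar\alpha_{\mathsf V}$.
   Context: All tessellations are stationary random tessellations whose cells are convex polytopes. All intensities are assumed to lie in $(0,\infty)$. Planar tessellation $\mathcal{Y}'$ in a horizontal plane $\mathcal{E}\cong\mathbb{R}^2$: $\mathsf{V}$, $\mathsf{E}$, $\mathsf{Z}$ are the classes of vertices (corners of cells), edges (one-dimensional intersections of two cells; they have no vertices in their relative interior) and cells. Cells need not meet side-to-side. Quantities of $\mathcal{Y}'$ carry a prime. Intensity and typical objects: the intensity of a class $\mathsf X$ is the mean number of centroids of $\mathsf X$-objects per unit area (for $\mathcal{Y}'$) or unit volume (for $\mathcal{Y}$); $\mathbb{E}'_{\mathsf X}$ (resp. $\mathbb{E}_{\mathsf X}$) is expectation with respect to the Palm distribution of the typical $\mathsf X$-object of $\mathcal{Y}'$ (resp. $\mathcal{Y}$), i.e. $\lambda_{\mathsf X}\mathbb{E}_{\mathsf X}[f(x)]$ is the mean of the sum of $f(x)$ over all $\mathsf X$-objects $x$ with centroid in the unit cube. Column tessellation: each cell $z$ of $\mathcal{Y}'$ carries a mark $\rho_z>0$, a non-random function of $\mathcal{Y}'$ as viewed from $z$ (e.g. of the size, shape or environment of $z$). On the vertical line through the centroid of $z$ take a stationary point process of intensity $\rho_z$; given $\mathcal{Y}'$, the point processes on different lines are conditionally independent. The infinite vertical column with cross-section $z$ is cut by horizontal plates (translates of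 $z$), one through each point of the point process of $z$. The resulting tessellation of $\mathbb{R}^3$ is $\mathcal{Y}$; its cells are right prisms, and almost surely no two plates in different columns are at the same height. Primitive elements of $\mathcal{Y}$: cells ($\mathsf Z$); plates ($\mathsf P$, the two-dimensional intersections of two cells); vertices ($\mathsf V$, the corners of plates); edges ($\mathsf E$, the segments into which the vertices divide the union of the boundaries of plates). Primitive elements contain no lower-dimensional primitive elements in their relative interior. All edges and all plates of $\mathcal{Y}$ are horizontal or vertical; $\mathsf{E[hor]},\mathsf{E[vert]},\mathsf{P[hor]},\mathsf{P[vert]}$ are the corresponding subclasses. *)

theory Defs
  imports "HOL-Probability.Probability"
begin

text \<open>
  The plane carrying the tessellation \<open>Y'\<close> is \<open>real^2\<close>; three-dimensional space is
  \<open>(real^2) \<times> real\<close>, the second component being the height.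
\<close>

subsection \<open>Tessellations and their random versions\<close>

text \<open>Cells need not meet side-to-side, so nothing is required of the intersection of two cells
  beyond the disjointness of the interiors.\<close>

definition tessellation :: "'a::euclidean_space set set \<Rightarrow> bool" where
  "tessellation T \<longleftrightarrow>
     (\<forall>z\<in>T. polytope z \<and> interior z \<noteq> {}) \<and>
     (\<forall>z\<in>T. \<forall>z'\<in>T. z \<noteq> z' \<longrightarrow> interior z \<inter> interior z' = {}) \<and>
     \<Union>T = UNIV \<and>
     (\<forall>B. bounded B \<longrightarrow> finite {z\<in>T. z \<inter> B \<noteq> {}})"

text \<open>The Borel \<open>\<sigma>\<close>-algebra (Fell topology, equivalently Hausdorff metric) on compact sets,
  generated by the sets of compact sets that hit a given open set.\<close>

definition body_algebra :: "'a::euclidean_space set measure" where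
  "body_algebra =
     sigma {K. compact K} {{K. compact K \<and> K \<inter> G \<noteq> {}} | G. open G}"

text \<open>Simple point processes are treated as random sets; their \<open>\<sigma>\<close>-algebra is generated by the
  numbers of points in measurable sets.\<close>

definition config_algebra :: "'b measure \<Rightarrow> 'b set measure" where
  "config_algebra S =
     sigma (Pow (space S))
       {{X \<in> Pow (space S). emeasure (count_space UNIV) (X \<inter> A) = of_nat n} | A n. A \<in> sets S}"

definition tess_algebra :: "'a::euclidean_space set set measure" where
  "tess_algebra = restrict_space (config_algebra body_algebra) {T. tessellation T}"

definition translate_tess :: "'a::euclidean_space \<Rightarrow> 'a set set \<Rightarrow> 'a set set" where
  "translate_tess x T = (\<lambda>z. (+) x ` z) ` T"

definition stationary_tessellation ::
    "'w measure \<Rightarrow> ('w \<Rightarrow> 'a::euclidean_space set set) \<Rightarrow> bool" where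
  "stationary_tessellation M T \<longleftrightarrow>
     T \<in> M \<rightarrow>\<^sub>M tess_algebra \<and>
     (\<forall>x. distr M tess_algebra (\<lambda>w. translate_tess x (T w)) = distr M tess_algebra T)"

subsection \<open>Centroids, intensities and typical objects\<close>

text \<open>The centroid of a polytope \<open>K\<close> of any dimension. Adding to \<open>K\<close> the unit ball of the orthogonal
  complement of its direction space gives a body \<open>C\<close> of positive volume, and by symmetry the centre
  of mass of \<open>C\<close> is that of \<open>K\<close> with respect to the Lebesgue measure on the affine hull of \<open>K\<close>.
  If \<open>K\<close> is full-dimensional, then \<open>C = K\<close>.\<close>

definition centroid :: "'a::euclidean_space set \<Rightarrow> 'a" where
  "centroid K =
     (let C = {x + u | x u. x \<in> K \<and> norm u \<le> 1 \<and> (\<forall>y\<in>K. \<forall>y'\<in>K. u \<bullet> (y - y') = 0)}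
      in (LINT x:C|lborel. x) /\<^sub>R measure lborel C)"

text \<open>Half-open, so that its integer translates partition the space.\<close>

definition unit_cube :: "'a::euclidean_space set" where
  "unit_cube = {x. \<forall>b\<in>Basis. 0 \<le> x \<bullet> b \<and> x \<bullet> b < 1}"

text \<open>\<open>X w\<close> is the class of objects in the realization \<open>w\<close>, and \<open>c\<close> sends an object to its centroid;
  \<open>c = id\<close> if the objects are points.\<close>

definition mean_sum ::
    "'w measure \<Rightarrow> ('x \<Rightarrow> 'a::euclidean_space) \<Rightarrow> ('w \<Rightarrow> 'x set) \<Rightarrow> ('w \<Rightarrow> 'x \<Rightarrow> ennreal) \<Rightarrow> ennreal"
  where
  "mean_sum M c X f =
     (\<integral>\<^sup>+w. (\<integral>\<^sup>+x. f w x \<partial>count_space {x \<in> X w. c x \<in> unit_cube}) \<partial>M)"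

definition intensity ::
    "'w measure \<Rightarrow> ('x \<Rightarrow> 'a::euclidean_space) \<Rightarrow> ('w \<Rightarrow> 'x set) \<Rightarrow> ennreal" where
  "intensity M c X = mean_sum M c X (\<lambda>w x. 1)"

text \<open>Mean of \<open>f\<close> at the typical object, i.e. under the Palm distribution.\<close>

definition palm_mean ::
    "'w measure \<Rightarrow> ('x \<Rightarrow> 'a::euclidean_space) \<Rightarrow> ('w \<Rightarrow> 'x set) \<Rightarrow> ('w \<Rightarrow> 'x \<Rightarrow> ennreal) \<Rightarrow> ennreal"
  where
  "palm_mean M c X f = mean_sum M c X f / intensity M c X"

subsection \<open>Column tessellations\<close>

definition cell_corners :: "'a::euclidean_space set set \<Rightarrow> 'a set" where
  "cell_corners T = {v. \<exists>z\<in>T. v extreme_point_of z}"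

text \<open>\<open>\<rho> T z\<close> is the mark of the cell \<open>z\<close> of \<open>T\<close>; translation invariance expresses that it
  depends only on \<open>T\<close> as viewed from \<open>z\<close>.\<close>

definition cell_mark :: "((real^2) set set \<Rightarrow> (real^2) set \<Rightarrow> real) \<Rightarrow> bool" where
  "cell_mark \<rho> \<longleftrightarrow>
     (\<lambda>(T, z). \<rho> T z) \<in> borel_measurable (tess_algebra \<Otimes>\<^sub>M body_algebra) \<and>
     (\<forall>T. tessellation T \<longrightarrow>
        (\<forall>z\<in>T. \<rho> T z > 0 \<and> (\<forall>x. \<rho> (translate_tess x T) ((+) x ` z) = \<rho> T z)))"

definition stationary_line_process ::
    "'b measure \<Rightarrow> ('b \<Rightarrow> real set) \<Rightarrow> real \<Rightarrow> bool" where
  "stationary_line_process Q X r \<longleftrightarrow>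
     X \<in> Q \<rightarrow>\<^sub>M config_algebra borel \<and>
     (AE w in Q. \<forall>a b. finite (X w \<inter> {a..b})) \<and>
     (\<forall>s. distr Q (config_algebra borel) (\<lambda>w. (+) s ` X w) = distr Q (config_algebra borel) X) \<and>
     intensity Q id X = ennreal r"

text \<open>\<open>\<kappa>\<close> is a regular conditional distribution of \<open>X\<close> given \<open>T\<close>.\<close>

definition conditional_distribution ::
    "'w measure \<Rightarrow> 't measure \<Rightarrow> ('w \<Rightarrow> 't) \<Rightarrow> 's measure \<Rightarrow> ('w \<Rightarrow> 's) \<Rightarrow> ('t \<Rightarrow> 's measure) \<Rightarrow> bool"
  where
  "conditional_distribution M N T S X \<kappa> \<longleftrightarrow>
     T \<in> M \<rightarrow>\<^sub>M N \<and> X \<in> M \<rightarrow>\<^sub>M S \<and> \<kappa> \<in> N \<rightarrow>\<^sub>M prob_algebra S \<and>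
     (\<forall>A\<in>sets N. \<forall>B\<in>sets S.
        emeasure M {w \<in> space M. T w \<in> A \<and> X w \<in> B} = (\<integral>\<^sup>+t\<in>A. emeasure (\<kappa> t) B \<partial>distr M N T))"

text \<open>A pair \<open>(z, h) \<in> \<Psi> w\<close> stands for the plate at height \<open>h\<close> in the column over the cell \<open>z\<close>, so
  \<open>\<Psi> w `` {z}\<close> is the point process of \<open>z\<close>, recorded by its heights on the vertical line through
  the centroid of \<open>z\<close>. The conditional distribution given the planar tessellation makes
  these processes independent and stationary with the intensities given by the marks.\<close>

definition column_process ::
    "'w measure \<Rightarrow> ('w \<Rightarrow> (real^2) set set) \<Rightarrow> ((real^2) set set \<Rightarrow> (real^2) set \<Rightarrow> real)
     \<Rightarrow> ('w \<Rightarrow> ((real^2) set \<times> real) set) \<Rightarrow> bool" where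
  "column_process M T \<rho> \<Psi> \<longleftrightarrow>
     (\<forall>w\<in>space M. \<Psi> w \<subseteq> T w \<times> UNIV) \<and>
     (\<exists>\<kappa>. conditional_distribution M tess_algebra T
            (config_algebra (body_algebra \<Otimes>\<^sub>M borel)) \<Psi> \<kappa> \<and>
          (AE t in distr M tess_algebra T.
             prob_space.indep_vars (\<kappa> t) (\<lambda>z. config_algebra borel) (\<lambda>z \<psi>. \<psi> `` {z}) t \<and>
             (\<forall>z\<in>t. stationary_line_process (\<kappa> t) (\<lambda>\<psi>. \<psi> `` {z}) (\<rho> t z))))"

text \<open>The cells of the column tessellation: the pieces into which the plates cut the columns.\<close>

definition column_cells ::
    "(real^2) set set \<Rightarrow> ((real^2) set \<times> real) set \<Rightarrow> ((real^2) \<times> real) set set" where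
  "column_cells T \<psi> = {z \<times> closure I | z I. z \<in> T \<and> I \<in> components (- (\<psi> `` {z}))}"

subsection \<open>Primitive elements of a spatial tessellation\<close>

definition plates :: "((real^2) \<times> real) set set \<Rightarrow> ((real^2) \<times> real) set set" where
  "plates Y = {p. \<exists>c\<in>Y. \<exists>c'\<in>Y. c \<noteq> c' \<and> p = c \<inter> c' \<and> aff_dim p = 2}"

definition vertices :: "((real^2) \<times> real) set set \<Rightarrow> ((real^2) \<times> real) set" where
  "vertices Y = {v. \<exists>p\<in>plates Y. v extreme_point_of p}"

definition edges :: "((real^2) \<times> real) set set \<Rightarrow> ((real^2) \<times> real) set set" where
  "edges Y = closure ` components ((\<Union>p\<in>plates Y. rel_frontier p) - vertices Y)"

definition horizontal :: "((real^2) \<times> real) set \<Rightarrow> bool" where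
  "horizontal S \<longleftrightarrow> (\<forall>x\<in>S. \<forall>y\<in>S. snd x = snd y)"

text \<open>The affine hull is invariant under vertical translations.\<close>

definition vertical :: "((real^2) \<times> real) set \<Rightarrow> bool" where
  "vertical S \<longleftrightarrow> (\<forall>x\<in>affine hull S. \<forall>t. x + (0, t) \<in> affine hull S)"

end

theory Submission
  imports Defs
begin

text \<open>
  In realizations where the plate heights of every column are locally finite and unbounded in both
  directions and where no two columns share a height, all primitive elements can be listed. A
  horizontal plate is a cell of the plane with a height of its column; a horizontal edge is such a
  plate with a neighbour of its cell; a vertex is such a plate with a corner of its cell. The cells,
  vertical plates and vertical edges extend from such a height \<open>h\<close> to the next height found in the
  column, in the two neighbouring columns, or in all columns around the corner, respectively. So
  edges and plates are flags (cell, neighbour, height), and because every corner \<open>v\<close> of the plane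
  that lies in a cell \<open>z\<close>, even in the interior of a side of \<open>z\<close>, is an end point of exactly two of
  the segments that \<open>z\<close> shares with its neighbours, vertices and vertical edges are half as many as
  flags with a chosen end of the common segment.

  Given the planar tessellation, the heights of the column over \<open>z\<close> contribute the mean number \<open>\<rho>\<^sub>z\<close>
  to a unit window; replacing a height by the midpoint between it and its successor is a
  shift-covariant displacement and does not change this number. Hence every intensity becomes a mean
  sum of \<open>\<rho>\<^sub>z\<close> over cells or over pairs of neighbouring cells, localized at the centroid of the cell
  or at the midpoint or an end of the common segment. By planar mass transport the choice between
  midpoint and ends is irrelevant, and with the ends the sum is that of \<open>\<alpha>\<^sub>v\<close> over the corners.
\<close>

subsection \<open>Random compact sets and point configurations\<close>

text \<open>Measurability shapes the argument. Plates, vertices and edges are defined through affine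
  dimension, extreme points and connected components, and nothing makes their counts measurable on
  \<open>M\<close>; they are only shown to agree almost surely with sums over cells and plates,
  which are measurable because they can be expressed by hitting events and counts. Adding two
  intensities rests on this almost sure agreement. The conditional independence of the columns
  enters twice: it excludes common heights, and it makes the joint law of finitely many columns
  invariant under a common vertical shift, as midpoints between heights of different columns
  require. Almost sure facts travel both ways through the conditional distribution: unboundedness of
  the heights comes from the cells of \<open>Y\<close> being polytopes, so it is known under
  \<open>M\<close> and passed to the kernels, while the absence of common heights is proved under
  the kernels and passed back. All sums live in \<open>ennreal\<close>, so interchanges need no
  integrability; positivity and finiteness of the planar intensities undo the normalization in
  \<open>palm_mean\<close>.\<close>

abbreviation ecount :: "'a set \<Rightarrow> ennreal" where
  "ecount X \<equiv> emeasure (count_space UNIV) X"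

lemma space_config: "space (config_algebra S) = Pow (space S)"
  unfolding config_algebra_def by (rule space_measure_of) auto

lemma sets_config:
  "sets (config_algebra S) = sigma_sets (Pow (space S))
       {{X \<in> Pow (space S). ecount (X \<inter> A) = of_nat n} | A n. A \<in> sets S}"
  unfolding config_algebra_def by (rule sets_measure_of) auto

lemma ecount_cases: "(\<exists>n. ecount X = of_nat n) \<or> ecount X = \<infinity>"
  by (auto simp: emeasure_count_space)

text \<open>The generators of \<open>config_algebra\<close> speak of finite counts only. The event
  of an infinite count is the complement of countably many of them, and a function with countably
  many values is measurable once its fibres are.\<close>

lemma measurable_ennreal_of_nat_or_top:
  fixes f :: "'a \<Rightarrow> ennreal"
  assumes n: "\<And>n::nat. {x \<in> space M. f x = of_nat n} \<in> sets M"
    and r: "\<And>x. x \<in> space M \<Longrightarrow> (\<exists>n::nat. f x = of_nat n) \<or> f x = \<infinity>"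
  shows "f \<in> borel_measurable M"
proof (rule measurableI)
  fix B :: "ennreal set" assume "B \<in> sets borel"
  have i: "{x \<in> space M. f x = \<infinity>} = space M - (\<Union>n::nat. {x \<in> space M. f x = of_nat n})"
    using r by (auto simp: ennreal_of_nat_eq_real_of_nat)
  have m: "{x \<in> space M. f x = \<infinity>} \<in> sets M"
    unfolding i using n by auto
  have "f -` B \<inter> space M = (\<Union>n\<in>{n::nat. of_nat n \<in> B}. {x \<in> space M. f x = of_nat n}) \<union>
     (if \<infinity> \<in> B then {x \<in> space M. f x = \<infinity>} else {})"
    (is "?L = ?R")
  proof (intro set_eqI iffI)
    fix x assume x: "x \<in> ?L"
    with r[of x] consider n :: nat where "f x = of_nat n" | "f x = \<infinity>" by blast
    then show "x \<in> ?R" using x by cases auto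
  next
    fix x assume "x \<in> ?R"
    then show "x \<in> ?L" by (cases "\<infinity> \<in> B") auto
  qed
  also have "\<dots> \<in> sets M" using n m by (auto intro!: sets.countable_UN')
  finally show "f -` B \<inter> space M \<in> sets M" .
qed auto

lemma measurable_ecount_Int:
  assumes "A \<in> sets S"
  shows "(\<lambda>X. ecount (X \<inter> A)) \<in> borel_measurable (config_algebra S)"
proof (rule measurable_ennreal_of_nat_or_top)
  fix n
  show "{X \<in> space (config_algebra S). ecount (X \<inter> A) = of_nat n} \<in> sets (config_algebra S)"
    unfolding sets_config space_config using assms by (intro sigma_sets.Basic) auto
qed (use ecount_cases in blast)

lemma measurable_config_algebraI:
  assumes "\<And>x. x \<in> space N \<Longrightarrow> g x \<subseteq> space S"
    and "\<And>A. A \<in> sets S \<Longrightarrow> (\<lambda>x. ecount (g x \<inter> A)) \<in> borel_measurable N"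
  shows "g \<in> N \<rightarrow>\<^sub>M config_algebra S"
  unfolding config_algebra_def
proof (rule measurable_measure_of)
  fix Y assume "Y \<in> {{X \<in> Pow (space S). ecount (X \<inter> A) = of_nat n} |A n. A \<in> sets S}"
  then obtain A n where A: "A \<in> sets S" and Y: "Y = {X \<in> Pow (space S). ecount (X \<inter> A) = of_nat n}"
    by auto
  have "g -` Y \<inter> space N = {x \<in> space N. ecount (g x \<inter> A) = of_nat n}"
    using assms(1) by (auto simp: Y)
  also have "\<dots> \<in> sets N" using assms(2)[OF A] by measurable
  finally show "g -` Y \<inter> space N \<in> sets N" .
qed (use assms in auto)

text \<open>Counting measure on \<open>g x \<inter> B\<close>, divided by one plus the number of
  points, is a subprobability kernel, and integrals against such kernels depend measurably on the
  parameter. Multiplying the factor back in recovers the sum.\<close>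

lemma measurable_nn_integral_finite_config:
  assumes g: "g \<in> N \<rightarrow>\<^sub>M config_algebra S"
    and fin: "\<And>x. x \<in> space N \<Longrightarrow> finite (g x \<inter> B)"
    and B: "B \<in> sets S"
    and f: "(\<lambda>(x, y). f x y) \<in> borel_measurable (N \<Otimes>\<^sub>M S)"
  shows "(\<lambda>x. \<integral>\<^sup>+y. f x y \<partial>count_space (g x \<inter> B)) \<in> borel_measurable N"
proof (cases "space S = {}")
  case True
  have "g x = {}" if "x \<in> space N" for x
    using measurable_space[OF g that] True by (simp add: space_config)
  then show ?thesis by (simp cong: measurable_cong add: nn_integral_empty)
next
  case False
  have gS: "g x \<subseteq> space S" if "x \<in> space N" for x
    using measurable_space[OF g that] by (simp add: space_config)
  have cm: "(\<lambda>x. ecount (g x \<inter> A)) \<in> borel_measurable N" if "A \<in> sets S" for A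
    using measurable_compose[OF g measurable_ecount_Int[OF that]] .
  \<comment> \<open>The added 1 keeps the divisor away from zero where the configuration misses
    \<open>B\<close>.\<close>
  define c where "c x = 1 + ecount (g x \<inter> B)" for x
  have c[measurable]: "c \<in> borel_measurable N" using cm[OF B] unfolding c_def by measurable
  have c0: "c x \<noteq> 0" for x by (simp add: c_def)
  have ci: "c x < \<infinity>" if "x \<in> space N" for x
    using fin[OF that] by (simp add: c_def emeasure_count_space_finite of_nat_less_top)
  define L where "L x = scale_measure (1 / c x) (distr (count_space (g x \<inter> B)) S (\<lambda>y. y))" for x
  have idm: "(\<lambda>y. y) \<in> count_space (g x \<inter> B) \<rightarrow>\<^sub>M S" if "x \<in> space N" for x
    using gS[OF that] by auto
  have em: "emeasure (L x) A = (1 / c x) * ecount (g x \<inter> (B \<inter> A))" if "x \<in> space N" "A \<in> sets S" for x A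
    using idm[OF that(1)] that(2) fin[OF that(1)]
    by (simp add: L_def emeasure_distr) (subst emeasure_count_space_finite, auto simp: Int_ac emeasure_count_space_finite)
  have Lm: "L \<in> N \<rightarrow>\<^sub>M subprob_algebra S"
  proof (rule measurable_subprob_algebra)
    fix x assume x: "x \<in> space N"
    show "sets (L x) = sets S" by (simp add: L_def)
    have "emeasure (L x) (space S) = (1 / c x) * ecount (g x \<inter> B)"
      using em[OF x sets.top[of S]] gS[OF x] sets.sets_into_space[OF B] by (simp add: Int_absorb2)
    also have "\<dots> \<le> (1 / c x) * c x" by (intro mult_left_mono) (auto simp: c_def)
    also have "\<dots> = 1"
      using c0[of x] ci[OF x] by (simp add: ennreal_divide_times ennreal_divide_self)
    finally have 1: "emeasure (L x) (space (L x)) \<le> 1" by (simp add: L_def space_scale_measure)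
    have "space (L x) \<noteq> {}" using False by (simp add: L_def space_scale_measure)
    then show "subprob_space (L x)" using 1 by (intro subprob_spaceI)
  next
    fix A assume A: "A \<in> sets S"
    have "(\<lambda>x. (1 / c x) * ecount (g x \<inter> (B \<inter> A))) \<in> borel_measurable N"
      using cm[of "B \<inter> A"] A B by measurable
    then show "(\<lambda>x. emeasure (L x) A) \<in> borel_measurable N"
      by (rule measurable_cong[THEN iffD1, rotated]) (simp add: em A)
  qed
  have "(\<lambda>x. c x * (\<integral>\<^sup>+y. f x y \<partial>L x)) \<in> borel_measurable N"
    using nn_integral_measurable_subprob_algebra2[OF f Lm] by measurable
  moreover have "c x * (\<integral>\<^sup>+y. f x y \<partial>L x) = (\<integral>\<^sup>+y. f x y \<partial>count_space (g x \<inter> B))" if x: "x \<in> space N" for x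
  proof -
    have fx: "f x \<in> borel_measurable S" using measurable_Pair2[OF f x] by simp
    have "(\<integral>\<^sup>+y. f x y \<partial>L x) = (1 / c x) * (\<integral>\<^sup>+y. f x y \<partial>count_space (g x \<inter> B))"
      unfolding L_def using fx idm[OF x] by (simp add: nn_integral_scale_measure nn_integral_distr)
    moreover have "c x * (1 / c x) = 1"
      using c0[of x] ci[OF x] by (simp add: ennreal_times_divide)
    ultimately show ?thesis by (simp only: mult.assoc[symmetric] mult_1_left)
  qed
  ultimately show ?thesis by (rule measurable_cong[THEN iffD1, rotated]) 
qed

text \<open>Monotone convergence along the exhausting windows \<open>B n\<close> removes the
  finiteness of the whole configuration.\<close>

lemma measurable_nn_integral_config:
  fixes B :: "nat \<Rightarrow> 'b set"
  assumes g: "g \<in> N \<rightarrow>\<^sub>M config_algebra S"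
    and fin: "\<And>x n. x \<in> space N \<Longrightarrow> finite (g x \<inter> B n)"
    and B: "\<And>n. B n \<in> sets S" "incseq B" "\<And>x. x \<in> space N \<Longrightarrow> g x \<subseteq> (\<Union>n. B n)"
    and f: "(\<lambda>(x, y). f x y) \<in> borel_measurable (N \<Otimes>\<^sub>M S)"
  shows "(\<lambda>x. \<integral>\<^sup>+y. f x y \<partial>count_space (g x)) \<in> borel_measurable N"
proof -
  have "(\<integral>\<^sup>+y. f x y \<partial>count_space (g x)) = (SUP n. \<integral>\<^sup>+y. f x y \<partial>count_space (g x \<inter> B n))" if x: "x \<in> space N" for x
  proof -
    have "(SUP n. \<integral>\<^sup>+y. f x y \<partial>count_space (g x \<inter> B n)) =
       (SUP n. \<integral>\<^sup>+y. f x y * indicator (g x \<inter> B n) y \<partial>count_space UNIV)"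
      by (simp add: nn_integral_count_space_indicator)
    also have "\<dots> = (\<integral>\<^sup>+y. (SUP n. f x y * indicator (g x \<inter> B n) y) \<partial>count_space UNIV)"
    proof (rule nn_integral_monotone_convergence_SUP[symmetric])
      show "incseq (\<lambda>n y. f x y * indicator (g x \<inter> B n) y)"
        using B(2) by (auto simp: incseq_def le_fun_def intro!: mult_left_mono split: split_indicator)
    qed auto
    also have "\<dots> = (\<integral>\<^sup>+y. f x y * indicator (g x) y \<partial>count_space UNIV)"
    proof (rule nn_integral_cong)
      fix y
      show "(SUP n. f x y * indicator (g x \<inter> B n) y) = f x y * indicator (g x) y"
      proof (cases "y \<in> g x")
        case True
        then obtain m where m: "y \<in> B m" using B(3)[OF x] by auto
        have "(SUP n. f x y * indicator (g x \<inter> B n) y) = f x y"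
          using True m by (intro antisym SUP_least SUP_upper2[of m]) (auto split: split_indicator)
        then show ?thesis using True by simp
      qed simp
    qed
    finally show ?thesis by (simp add: nn_integral_count_space_indicator)
  qed
  moreover have "(\<lambda>x. SUP n. \<integral>\<^sup>+y. f x y \<partial>count_space (g x \<inter> B n)) \<in> borel_measurable N"
    using measurable_nn_integral_finite_config[OF g fin B(1) f] by measurable
  ultimately show ?thesis by (subst measurable_cong) auto
qed

section \<open>Measurable operations on random compact sets\<close>

lemma space_body: "space body_algebra = {K. compact K}"
  unfolding body_algebra_def by (rule space_measure_of) auto

lemma sets_body_hit: "open G \<Longrightarrow> {K. compact K \<and> K \<inter> G \<noteq> {}} \<in> sets body_algebra"
  unfolding body_algebra_def by (subst sets_measure_of) (auto intro!: sigma_sets.Basic)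

lemma measurable_bodyI:
  assumes "\<And>x. x \<in> space N \<Longrightarrow> compact (g x)"
    and "\<And>G. open G \<Longrightarrow> {x \<in> space N. g x \<inter> G \<noteq> {}} \<in> sets N"
  shows "(g :: _ \<Rightarrow> 'a::euclidean_space set) \<in> N \<rightarrow>\<^sub>M body_algebra"
  unfolding body_algebra_def
proof (rule measurable_measure_of)
  fix Y :: "'a set set" assume "Y \<in> {{K. compact K \<and> K \<inter> G \<noteq> {}} |G. open G}"
  then obtain G where G: "open G" and Y: "Y = {K. compact K \<and> K \<inter> G \<noteq> {}}" by auto
  have "g -` Y \<inter> space N = {x \<in> space N. g x \<inter> G \<noteq> {}}"
    using assms(1) by (auto simp: Y)
  then show "g -` Y \<inter> space N \<in> sets N" using assms(2)[OF G] by simp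
qed (use assms in auto)

lemma pred_hit[measurable (raw)]:
  assumes g: "g \<in> N \<rightarrow>\<^sub>M body_algebra" and "open G"
  shows "Measurable.pred N (\<lambda>x. g x \<inter> G \<noteq> {})"
proof -
  have "{x \<in> space N. g x \<inter> G \<noteq> {}} = g -` {K. compact K \<and> K \<inter> G \<noteq> {}} \<inter> space N"
    using measurable_space[OF g] by (auto simp: space_body)
  then show ?thesis using measurable_sets[OF g sets_body_hit[OF \<open>open G\<close>]]
    by (simp add: pred_def)
qed

lemma pred_bex_countable:
  assumes "countable X" and P: "\<And>i. i \<in> X \<Longrightarrow> Measurable.pred M (P i)"
  shows "Measurable.pred M (\<lambda>x. \<exists>i\<in>X. P i x)"
proof -
  have "{x \<in> space M. \<exists>i\<in>X. P i x} = (\<Union>i\<in>X. {x \<in> space M. P i x})" by auto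
  also have "\<dots> \<in> sets M" using assms by (intro sets.countable_UN') (auto simp: pred_def)
  finally show ?thesis by (simp add: pred_def)
qed

lemma pred_ball_countable:
  assumes "countable X" and "\<And>i. i \<in> X \<Longrightarrow> Measurable.pred M (P i)"
  shows "Measurable.pred M (\<lambda>x. \<forall>i\<in>X. P i x)"
proof -
  have "Measurable.pred M (\<lambda>x. \<not> (\<exists>i\<in>X. \<not> P i x))"
    using assms by (intro pred_intros_logic pred_bex_countable)
  then show ?thesis by simp
qed

text \<open>Rewrites a common point of three compact sets by countably many hitting events: at every
  scale a small ball around a point of the dense set meets all three. Conversely, points taken from
  these balls have a common limit by compactness.\<close>

lemma Int_compact_hits_iff:
  fixes K K' :: "'a::euclidean_space set"
  assumes K: "compact K" "compact K'" "compact C" and D: "\<And>U. open U \<Longrightarrow> U \<noteq> {} \<Longrightarrow> \<exists>q\<in>D. q \<in> U"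
  shows "K \<inter> K' \<inter> C \<noteq> {} \<longleftrightarrow> (\<forall>n::nat. \<exists>q\<in>D. K \<inter> ball q (1 / Suc n) \<noteq> {} \<and> K' \<inter> ball q (1 / Suc n) \<noteq> {} \<and>
            C \<inter> ball q (1 / Suc n) \<noteq> {})" (is "?L \<longleftrightarrow> ?R")
proof
  assume ?L
  then obtain x where x: "x \<in> K" "x \<in> K'" "x \<in> C" by auto
  show ?R
  proof
    fix n :: nat
    obtain q where "q \<in> D" "q \<in> ball x (1 / Suc n)" using D[of "ball x (1 / Suc n)"] by auto
    then show "\<exists>q\<in>D. K \<inter> ball q (1 / Suc n) \<noteq> {} \<and> K' \<inter> ball q (1 / Suc n) \<noteq> {} \<and> C \<inter> ball q (1 / Suc n) \<noteq> {}"
      using x by (intro bexI[of _ q]) (auto simp: dist_commute)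
  qed
next
  assume R: ?R
  have "\<forall>n. \<exists>k k' c. k \<in> K \<and> k' \<in> K' \<and> c \<in> C \<and> dist k k' < 2 / Suc n \<and> dist k c < 2 / Suc n"
  proof
    fix n
    obtain q k k' c where q: "k \<in> K" "k' \<in> K'" "c \<in> C" "dist q k < 1 / Suc n" "dist q k' < 1 / Suc n" "dist q c < 1 / Suc n"
      using R[rule_format, of n] by auto
    have "dist k k' < 1 / Suc n + 1 / Suc n" "dist k c < 1 / Suc n + 1 / Suc n"
      using q dist_triangle3[of k k' q] dist_triangle3[of k c q] by linarith+
    then show "\<exists>k k' c. k \<in> K \<and> k' \<in> K' \<and> c \<in> C \<and> dist k k' < 2 / Suc n \<and> dist k c < 2 / Suc n"
      using q by (intro exI[of _ k] exI[of _ k'] exI[of _ c]) auto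
  qed
  then obtain k k' c where k: "\<And>n. k n \<in> K" "\<And>n. k' n \<in> K'" "\<And>n. c n \<in> C"
    and d: "\<And>n. dist (k n) (k' n) < 2 / Suc n" "\<And>n. dist (k n) (c n) < 2 / Suc n" by metis
  obtain x r where x: "x \<in> K" "strict_mono r" and l: "(k \<circ> r) \<longlonglongrightarrow> x"
    using K(1) k(1) unfolding compact_def by metis
  have z: "(\<lambda>n. 2 / real (Suc (r n))) \<longlonglongrightarrow> 0"
  proof -
    have "(\<lambda>n. 2 / real (Suc n)) \<longlonglongrightarrow> 0" by (rule LIMSEQ_Suc[OF lim_const_over_n])
    from LIMSEQ_subseq_LIMSEQ[OF this x(2)] show ?thesis by (simp add: o_def)
  qed
  \<comment> \<open>Sequences in \<open>K'\<close> and \<open>C\<close> that stay within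
    \<open>2 / Suc n\<close> of \<open>k n\<close> inherit the limit of the subsequence of
    \<open>k\<close>.\<close>
  have "y \<in> S" if y: "y = x" and S: "closed S" and s: "\<And>n. s n \<in> S" and ds: "\<And>n. dist (k n) (s n) < 2 / Suc n" for y S s
  proof -
    have "(\<lambda>n. dist (k (r n)) (s (r n))) \<longlonglongrightarrow> 0"
    proof (rule tendsto_sandwich[OF _ _ tendsto_const z])
      show "\<forall>\<^sub>F n in sequentially. dist (k (r n)) (s (r n)) \<le> 2 / real (Suc (r n))"
        by (rule always_eventually) (rule allI, rule less_imp_le[OF ds])
    qed simp
    then have "(\<lambda>n. k (r n) - s (r n)) \<longlonglongrightarrow> 0"
      by (rule tendsto_norm_zero_cancel[OF iffD1[OF tendsto_cong, rotated]]) (simp add: dist_norm)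
    then have "(\<lambda>n. s (r n)) \<longlonglongrightarrow> x"
      by (rule Lim_transform2[OF l[unfolded o_def]])
    then show ?thesis using S s y by (metis closed_sequentially)
  qed
  from this[OF refl compact_imp_closed[OF K(2)] k(2) d(1)] this[OF refl compact_imp_closed[OF K(3)] k(3) d(2)]
  show ?L using x by auto
qed

text \<open>An open set is a countable union of compact sets, so the event that the intersection
  hits it reduces to the criterion for three compact sets, with the third one fixed.\<close>

lemma measurable_body_Int[measurable (raw)]:
  fixes f g :: "'b \<Rightarrow> 'a::euclidean_space set"
  assumes f[measurable]: "f \<in> N \<rightarrow>\<^sub>M body_algebra" and g[measurable]: "g \<in> N \<rightarrow>\<^sub>M body_algebra"
  shows "(\<lambda>x. f x \<inter> g x) \<in> N \<rightarrow>\<^sub>M body_algebra"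
proof (rule measurable_bodyI)
  have c: "compact (f x)" "compact (g x)" if "x \<in> space N" for x
    using measurable_space[OF f that] measurable_space[OF g that] by (auto simp: space_body)
  then show "compact (f x \<inter> g x)" if "x \<in> space N" for x
    using that compact_Int by blast
  fix G :: "'a set" assume "open G"
  then obtain C :: "nat \<Rightarrow> 'a set" where C: "\<And>n. compact (C n)" "\<And>n. C n \<subseteq> G" "(\<Union>n. C n) = G"
    using open_Union_compact_subsets by metis
  obtain D :: "'a set" where D: "countable D" "\<And>U. open U \<Longrightarrow> U \<noteq> {} \<Longrightarrow> \<exists>q\<in>D. q \<in> U"
    using countable_dense_exists[where 'a='a] by auto
  have "{x \<in> space N. f x \<inter> g x \<inter> G \<noteq> {}} = (\<Union>m. {x \<in> space N. \<forall>n::nat. \<exists>q\<in>D. f x \<inter> ball q (1 / Suc n) \<noteq> {} \<and> g x \<inter> ball q (1 / Suc n) \<noteq> {} \<and>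
            C m \<inter> ball q (1 / Suc n) \<noteq> {}})"
    (is "?A = (\<Union>m. ?B m)")
  proof -
    have "f x \<inter> g x \<inter> G \<noteq> {} \<longleftrightarrow> (\<exists>m. f x \<inter> g x \<inter> C m \<noteq> {})" for x
      using C(3) by blast
    then have "x \<in> ?A \<longleftrightarrow> x \<in> (\<Union>m. ?B m)" for x
      using Int_compact_hits_iff[OF c C(1) D(2)] by (cases "x \<in> space N") auto
    then show ?thesis by blast
  qed
  also have "\<dots> \<in> sets N"
  proof (intro sets.countable_UN image_subsetI)
    fix m
    have "Measurable.pred N (\<lambda>x. \<forall>n::nat. \<exists>q\<in>D. f x \<inter> ball q (1 / Suc n) \<noteq> {} \<and> g x \<inter> ball q (1 / Suc n) \<noteq> {} \<and>
            C m \<inter> ball q (1 / Suc n) \<noteq> {})"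
      by (intro pred_intros_countable(1) pred_bex_countable D(1) pred_intros_logic pred_hit f g open_ball) auto
    then show "?B m \<in> sets N" by (simp add: pred_def)
  qed
  finally show "?A \<in> sets N" .
qed

lemma measurable_body_singleton[measurable (raw)]:
  fixes f :: "'b \<Rightarrow> 'a::euclidean_space"
  assumes [measurable]: "f \<in> N \<rightarrow>\<^sub>M borel"
  shows "(\<lambda>x. {f x}) \<in> N \<rightarrow>\<^sub>M body_algebra"
proof (rule measurable_bodyI)
  fix G :: "'a set" assume [measurable]: "open G"
  have "{x \<in> space N. {f x} \<inter> G \<noteq> {}} = {x \<in> space N. f x \<in> G}" by auto
  also have "\<dots> \<in> sets N" using borel_open[OF \<open>open G\<close>] by measurable
  finally show "{x \<in> space N. {f x} \<inter> G \<noteq> {}} \<in> sets N" .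
qed auto

lemma pred_mem_body[measurable (raw)]:
  fixes f :: "'b \<Rightarrow> 'a::euclidean_space"
  assumes [measurable]: "f \<in> N \<rightarrow>\<^sub>M borel" "g \<in> N \<rightarrow>\<^sub>M body_algebra"
  shows "Measurable.pred N (\<lambda>x. f x \<in> g x)"
proof -
  have "f x \<in> g x \<longleftrightarrow> (g x \<inter> {f x}) \<inter> UNIV \<noteq> {}" for x by auto
  then show ?thesis using pred_hit[OF measurable_body_Int[OF assms(2) measurable_body_singleton[OF assms(1)]] open_UNIV]
    by simp
qed

text \<open>Closed sets are equal once they hit the same members of a countable base.\<close>

lemma pred_eq_body[measurable (raw)]:
  fixes f g :: "'b \<Rightarrow> 'a::euclidean_space set"
  assumes f[measurable]: "f \<in> N \<rightarrow>\<^sub>M body_algebra" and g[measurable]: "g \<in> N \<rightarrow>\<^sub>M body_algebra"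
  shows "Measurable.pred N (\<lambda>x. f x = g x)"
proof -
  obtain B :: "'a set set" where B: "countable B" "\<And>b. b \<in> B \<Longrightarrow> open b"
     "\<And>S x. open S \<Longrightarrow> x \<in> S \<Longrightarrow> \<exists>b\<in>B. x \<in> b \<and> b \<subseteq> S"
    using ex_countable_basis[where 'a='a] topological_basisE topological_basis_open by metis
  have sub: "K \<subseteq> K'" if "\<forall>b\<in>B. (K \<inter> b \<noteq> {}) = (K' \<inter> b \<noteq> {})" "closed K'" for K K' :: "'a set"
  proof
    fix x assume "x \<in> K"
    show "x \<in> K'"
    proof (rule ccontr)
      assume "x \<notin> K'"
      then obtain b where "b \<in> B" "x \<in> b" "b \<subseteq> - K'" using B(3)[of "- K'" x] \<open>closed K'\<close> by auto
      then show False using that(1) \<open>x \<in> K\<close> by blast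
    qed
  qed
  have c: "closed (f x)" "closed (g x)" if "x \<in> space N" for x
    using measurable_space[OF f that] measurable_space[OF g that] by (auto simp: space_body compact_imp_closed)
  have "f x = g x \<longleftrightarrow> (\<forall>b\<in>B. (f x \<inter> b \<noteq> {}) = (g x \<inter> b \<noteq> {}))" if "x \<in> space N" for x
    using sub[of "f x" "g x"] sub[of "g x" "f x"] c[OF that] by auto
  moreover have "Measurable.pred N (\<lambda>x. \<forall>b\<in>B. (f x \<inter> b \<noteq> {}) = (g x \<inter> b \<noteq> {}))"
    by (intro pred_ball_countable B pred_intros_logic pred_hit f g) 
  ultimately show ?thesis by (simp cong: measurable_cong)
qed

lemma sets_If: "A \<in> sets M \<Longrightarrow> B \<in> sets M \<Longrightarrow> (if c then A else B) \<in> sets M"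
  by simp

text \<open>The infimum of a linear functional lies below \<open>c\<close> exactly when the set hits
  an open half-space.\<close>

lemma measurable_body_Inf_inner:
  fixes b :: "'a::euclidean_space"
  shows "(\<lambda>K. Inf ((\<lambda>x. x \<bullet> b) ` K)) \<in> borel_measurable body_algebra"
proof (subst borel_measurable_iff_less, rule)
  fix c :: real
  have id: "(\<lambda>K. K) \<in> (body_algebra :: 'a set measure) \<rightarrow>\<^sub>M body_algebra" by simp
  have o: "open {x. x \<bullet> b < c}" by (rule open_Collect_less) (auto intro!: continuous_intros)
  \<comment> \<open>The empty set is compact too, and there the infimum is the unspecified constant
    \<open>Inf {}\<close>; it gets its own disjunct.\<close>
  have "Inf ((\<lambda>x. x \<bullet> b) ` K) < c \<longleftrightarrow> (K \<inter> {x. x \<bullet> b < c} \<noteq> {} \<or> (\<not> (K \<inter> UNIV \<noteq> {}) \<and> Inf {} < c))"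
    if "compact K" for K
  proof (cases "K = {}")
    case False
    have "bounded ((\<lambda>x. x \<bullet> b) ` K)"
      using that by (intro compact_imp_bounded compact_continuous_image continuous_intros)
    then have "bdd_below ((\<lambda>x. x \<bullet> b) ` K)" by (rule bounded_imp_bdd_below)
    then show ?thesis using False by (subst cInf_less_iff) auto
  qed auto
  then have "{K \<in> space body_algebra. Inf ((\<lambda>x. x \<bullet> b) ` K) < c} =
     {K \<in> space body_algebra. K \<inter> {x. x \<bullet> b < c} \<noteq> {}} \<union>
     (if Inf {} < c then space body_algebra - {K \<in> space body_algebra. K \<inter> UNIV \<noteq> {}} else {})"
    by (auto simp: space_body)
  also have "\<dots> \<in> sets body_algebra"
    by (intro sets.Un sets.Diff sets.top sets.empty_sets sets_If
      pred_hit[OF id o, unfolded pred_def] pred_hit[OF id open_UNIV, unfolded pred_def])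
  finally show "{K \<in> space body_algebra. Inf ((\<lambda>x. x \<bullet> b) ` K) < c} \<in> sets body_algebra" .
qed

text \<open>Stands in for \<open>centroid\<close>, whose thickening has no evident measurability;
  the two agree on bodies with interior points. Volume and first moment are integrals of the
  measurable relation \<open>x \<in> K\<close>.\<close>

lemma measurable_body_mean:
  "(\<lambda>K. (LINT x:K|lborel. x) /\<^sub>R measure lborel K) \<in> (body_algebra :: 'a::euclidean_space set measure) \<rightarrow>\<^sub>M borel"
proof -
  have 1: "(\<lambda>K. (LINT x:K|lborel. x)) \<in> (body_algebra :: 'a set measure) \<rightarrow>\<^sub>M borel"
    unfolding set_lebesgue_integral_def
    by (intro lborel.borel_measurable_lebesgue_integral) measurable
  have "{(K, x). x \<in> K} \<inter> space (body_algebra \<Otimes>\<^sub>M lborel) \<in> sets ((body_algebra :: 'a set measure) \<Otimes>\<^sub>M lborel)"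
  proof -
    have "Measurable.pred ((body_algebra :: 'a set measure) \<Otimes>\<^sub>M lborel) (\<lambda>p. snd p \<in> fst p)"
      by (rule pred_mem_body) auto
    then show ?thesis by (auto simp: pred_def Int_def case_prod_beta conj_commute)
  qed
  from lborel.measurable_emeasure_Pair[OF this]
  have "(\<lambda>K. emeasure lborel (Pair K -` ({(K, x). x \<in> K} \<inter> space (body_algebra \<Otimes>\<^sub>M lborel)))) \<in> borel_measurable (body_algebra :: 'a set measure)" .
  then have "(\<lambda>K. emeasure lborel K) \<in> borel_measurable (body_algebra :: 'a set measure)"
    by (rule measurable_cong[THEN iffD1, rotated])
       (auto simp: space_pair_measure space_body vimage_def)
  then have 2: "(\<lambda>K. measure lborel K) \<in> borel_measurable (body_algebra :: 'a set measure)"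
    unfolding measure_def by measurable
  show ?thesis using 1 2 by measurable
qed

lemma measurable_body_translate:
  fixes x :: "'a::euclidean_space"
  shows "(\<lambda>K. (+) x ` K) \<in> body_algebra \<rightarrow>\<^sub>M body_algebra"
proof (rule measurable_bodyI)
  show "compact ((+) x ` K)" if "K \<in> space body_algebra" for K
    using that compact_translation by (auto simp: space_body)
  fix G :: "'a set" assume "open G"
  then have o: "open ((+) (-x) ` G)" by (rule open_translation)
  have "(+) x ` K \<inter> G \<noteq> {} \<longleftrightarrow> K \<inter> (+) (-x) ` G \<noteq> {}" for K
  proof -
    have "(\<exists>k\<in>K. x + k \<in> G) \<longleftrightarrow> (\<exists>g\<in>G. - x + g \<in> K)"
    proof safe
      fix k assume "k \<in> K" "x + k \<in> G"
      then show "\<exists>g\<in>G. - x + g \<in> K" by (intro bexI[of _ "x + k"]) auto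
    next
      fix g assume "g \<in> G" "- x + g \<in> K"
      then show "\<exists>k\<in>K. x + k \<in> G" by (intro bexI[of _ "- x + g"]) auto
    qed
    then show ?thesis by blast
  qed
  then show "{K \<in> space body_algebra. (+) x ` K \<inter> G \<noteq> {}} \<in> sets body_algebra"
    using pred_hit[of "\<lambda>K. K", OF _ o] by (simp add: pred_def)
qed

subsection \<open>Planar tessellations\<close>

text \<open>The determinant of two plane vectors; its sign tells on which side of the line spanned
  by \<open>a\<close> the vector \<open>b\<close> lies.\<close>

definition cross2 :: "real^2 \<Rightarrow> real^2 \<Rightarrow> real" where
  "cross2 a b = a$1 * b$2 - a$2 * b$1"

lemma cross2_simps [simp]:
  "cross2 (a + b) c = cross2 a c + cross2 b c" "cross2 c (a + b) = cross2 c a + cross2 c b"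
  "cross2 (a - b) c = cross2 a c - cross2 b c" "cross2 c (a - b) = cross2 c a - cross2 c b"
  "cross2 (k *\<^sub>R a) c = k * cross2 a c" "cross2 c (k *\<^sub>R a) = k * cross2 c a"
  "cross2 (- a) c = - cross2 a c" "cross2 c (- a) = - cross2 c a"
  "cross2 a a = 0" "cross2 0 a = 0" "cross2 a 0 = 0"
  by (simp_all add: cross2_def algebra_simps)

lemma cross2_skew: "cross2 a b = - cross2 b a"
  by (simp add: cross2_def)

text \<open>Cramer's rule without division, hence valid for parallel \<open>a\<close> and
  \<open>b\<close> as well.\<close>

lemma cross2_Cramer: "cross2 a b *\<^sub>R x = cross2 x b *\<^sub>R a + cross2 a x *\<^sub>R b"
  by (simp add: vec_eq_iff forall_2 cross2_def algebra_simps)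

lemma continuous_on_cross2[continuous_intros]:
  "continuous_on A f \<Longrightarrow> continuous_on A g \<Longrightarrow> continuous_on A (\<lambda>x. cross2 (f x) (g x))"
  unfolding cross2_def by (intro continuous_intros)

definition perp2 :: "real^2 \<Rightarrow> real^2" where
  "perp2 a = vector [- a$2, a$1]"

lemma cross2_perp2: "cross2 a (perp2 a) = a \<bullet> a"
  by (simp add: cross2_def perp2_def inner_vec_def sum_2)

lemma scaleR_divide_both1:
  fixes x :: "'a::real_vector"
  assumes "d \<noteq> 0" "d *\<^sub>R x = a *\<^sub>R u"
  shows "x = (a / d) *\<^sub>R u"
proof -
  have "x = (1 / d) *\<^sub>R (d *\<^sub>R x)" using assms(1) by simp
  also have "\<dots> = (a / d) *\<^sub>R u" unfolding assms(2) by simp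
  finally show ?thesis .
qed

lemma scaleR_divide_both:
  fixes x :: "'a::real_vector"
  assumes "d \<noteq> 0" "d *\<^sub>R x = a *\<^sub>R u + b *\<^sub>R w"
  shows "x = (a / d) *\<^sub>R u + (b / d) *\<^sub>R w"
proof -
  have "x = (1 / d) *\<^sub>R (d *\<^sub>R x)" using assms(1) by simp
  also have "\<dots> = (a / d) *\<^sub>R u + (b / d) *\<^sub>R w" unfolding assms(2) by (simp add: scaleR_add_right)
  finally show ?thesis .
qed

lemma open_off_line:
  assumes "open U" "x \<in> U" "d \<noteq> 0"
  shows "\<exists>y\<in>U. cross2 d (y - p) \<noteq> 0"
proof (cases "cross2 d (x - p) = 0")
  case True
  have "((\<lambda>k. x + k *\<^sub>R perp2 d) \<longlongrightarrow> x + 0 *\<^sub>R perp2 d) (at_right 0)" by (intro tendsto_intros)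
  then have "\<forall>\<^sub>F k in at_right 0. x + k *\<^sub>R perp2 d \<in> U"
    using assms by (intro topological_tendstoD) auto
  moreover have "\<forall>\<^sub>F k in at_right (0::real). k > 0" by (simp add: eventually_at_right_less)
  ultimately have "\<forall>\<^sub>F k in at_right 0. x + k *\<^sub>R perp2 d \<in> U \<and> k > 0" by eventually_elim auto
  then obtain k where k: "x + k *\<^sub>R perp2 d \<in> U" "k > 0"
    using eventually_happens[of _ "at_right (0::real)"] by auto
  have "cross2 d (x + k *\<^sub>R perp2 d - p) = k * (d \<bullet> d)" using True by (simp add: cross2_perp2)
  then show ?thesis using k assms(3) by (intro bexI[of _ "x + k *\<^sub>R perp2 d"]) auto
qed (use assms in auto)

text \<open>In barycentric coordinates of the triangle \<open>p\<close>, \<open>q\<close>,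
  \<open>r\<close> the point \<open>m\<close> has weights strictly between 0 and 1 at
  \<open>p\<close> and \<open>q\<close>, and weight 0 at \<open>r\<close>. Near \<open>m\<close>
  only the sign of the third weight decides membership in the triangle.\<close>

lemma half_disc:
  assumes z: "convex z" and in_z: "p \<in> z" "q \<in> z" "r \<in> z" and m: "m \<in> open_segment p q"
    and D: "cross2 (q - p) (r - p) \<noteq> 0"
  shows "\<exists>U. open U \<and> m \<in> U \<and> (\<forall>y\<in>U. cross2 (q - p) (y - p) / cross2 (q - p) (r - p) \<ge> 0 \<longrightarrow> y \<in> z)"
proof -
  define D where "D = cross2 (q - p) (r - p)"
  define \<alpha> where "\<alpha> y = cross2 (y - p) (r - p) / D" for y
  define \<beta> where "\<beta> y = cross2 (q - p) (y - p) / D" for y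
  have D0: "D \<noteq> 0" using D by (simp add: D_def)
  obtain s where s: "0 < s" "s < 1" and ms: "m = (1 - s) *\<^sub>R p + s *\<^sub>R q"
    using m by (auto simp: in_segment)
  have mp: "m - p = s *\<^sub>R (q - p)" by (simp add: ms algebra_simps)
  have "cross2 (m - p) (r - p) = s * D" unfolding mp D_def by (rule cross2_simps(5))
  moreover have "cross2 (q - p) (m - p) = 0" unfolding mp by (simp only: cross2_simps(6,9) mult_zero_right)
  ultimately have am: "\<alpha> m = s" "\<beta> m = 0" using D0 by (simp_all add: \<alpha>_def \<beta>_def)
  have conts: "continuous_on UNIV \<alpha>" "continuous_on UNIV \<beta>"
    unfolding \<alpha>_def \<beta>_def using D0 by (auto intro!: continuous_intros)
  let ?U = "{y. 0 < \<alpha> y} \<inter> {y. \<alpha> y + \<beta> y < 1}"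
  have "open ?U" by (intro open_Int open_Collect_less continuous_intros conts)
  moreover have "m \<in> ?U" using am s by auto
  moreover have "y \<in> z" if y: "y \<in> ?U" "\<beta> y \<ge> 0" for y
  proof -
    have "D *\<^sub>R (y - p) = cross2 (y - p) (r - p) *\<^sub>R (q - p) + cross2 (q - p) (y - p) *\<^sub>R (r - p)"
      unfolding D_def by (rule cross2_Cramer)
    then have "y - p = \<alpha> y *\<^sub>R (q - p) + \<beta> y *\<^sub>R (r - p)"
      unfolding \<alpha>_def \<beta>_def by (rule scaleR_divide_both[OF D0])
    then have "y = (1 - \<alpha> y - \<beta> y) *\<^sub>R p + \<alpha> y *\<^sub>R q + \<beta> y *\<^sub>R r" by (simp add: algebra_simps)
    moreover have "\<dots> \<in> z" 
    proof -
      have "(1 - \<alpha> y - \<beta> y) *\<^sub>R p + \<alpha> y *\<^sub>R q + \<beta> y *\<^sub>R r \<in> convex hull {p, q, r}"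
        unfolding convex_hull_3 using y
        by (intro CollectI exI[of _ "1 - \<alpha> y - \<beta> y"] exI[of _ "\<alpha> y"] exI[of _ "\<beta> y"]) auto
      moreover have "convex hull {p, q, r} \<subseteq> z" using z in_z by (intro hull_minimal) auto
      ultimately show ?thesis by blast
    qed
    ultimately show ?thesis by simp
  qed
  ultimately show ?thesis unfolding D_def[symmetric] \<beta>_def[symmetric] by (intro exI[of _ ?U]) auto
qed

text \<open>The set has an interior point \<open>r\<close> off the line through \<open>p\<close> and
  \<open>q\<close>; the half disc around \<open>m\<close> on the side of \<open>r\<close> is the one
  it contains.\<close>

lemma half_disc_interior:
  assumes z: "convex z" "interior z \<noteq> {}" and in_z: "p \<in> z" "q \<in> z" and m: "m \<in> open_segment p q"
  shows "\<exists>\<sigma>\<in>{1, -1}. \<exists>U. open U \<and> m \<in> U \<and> (\<forall>y\<in>U. \<sigma> * cross2 (q - p) (y - p) \<ge> 0 \<longrightarrow> y \<in> z) \<and>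
           (\<forall>y\<in>U. \<sigma> * cross2 (q - p) (y - p) > 0 \<longrightarrow> y \<in> interior z)"
proof -
  have pq: "q - p \<noteq> 0" using m by auto
  obtain r where r: "r \<in> interior z" and D: "cross2 (q - p) (r - p) \<noteq> 0"
    using open_off_line[OF open_interior _ pq] z(2) by blast
  let ?\<sigma> = "sgn (cross2 (q - p) (r - p))"
  obtain U where U: "open U" "m \<in> U" "\<And>y. y \<in> U \<Longrightarrow> cross2 (q - p) (y - p) / cross2 (q - p) (r - p) \<ge> 0 \<Longrightarrow> y \<in> z"
    using half_disc[OF z(1) in_z _ m D] r interior_subset by blast
  have sg: "?\<sigma> * a \<ge> 0 \<Longrightarrow> a / cross2 (q - p) (r - p) \<ge> 0" for a :: real
    using D by (cases "cross2 (q - p) (r - p) > 0") (auto simp: sgn_if zero_le_divide_iff zero_le_mult_iff)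
  have 1: "y \<in> z" if "y \<in> U" "?\<sigma> * cross2 (q - p) (y - p) \<ge> 0" for y
    using U(3)[OF that(1) sg[OF that(2)]] .
  have "y \<in> interior z" if y: "y \<in> U" "?\<sigma> * cross2 (q - p) (y - p) > 0" for y
  proof (rule interiorI)
    show "open (U \<inter> {y. 0 < ?\<sigma> * cross2 (q - p) (y - p)})"
      using U(1) by (intro open_Int open_Collect_less continuous_intros)
  qed (use y 1 in auto)
  then show ?thesis using 1 U(1,2) D by (intro bexI[of _ ?\<sigma>] exI[of _ U]) (auto simp: sgn_if)
qed

text \<open>A convex combination with positive weight at an interior point is interior: first
  combine \<open>v\<close> and \<open>q\<close>, then shrink towards \<open>c\<close>.\<close>

lemma convex_interior_combination:
  fixes z :: "'a::euclidean_space set"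
  assumes "convex z" "c \<in> interior z" "v \<in> z" "q \<in> z" "0 < a" "0 \<le> b" "a + b \<le> 1"
  shows "v + a *\<^sub>R (c - v) + b *\<^sub>R (q - v) \<in> interior z"
proof (cases "a = 1")
  case True
  then show ?thesis using assms by auto
next
  case False
  \<comment> \<open>Shrinking towards \<open>c\<close> by \<open>a\<close> scales the rest by
    \<open>1 - a\<close>, so the weight of \<open>q\<close> is divided by it beforehand.\<close>
  define x where "x = v + (b / (1 - a)) *\<^sub>R (q - v)"
  have a1: "a < 1" using False assms by auto
  have "x = (1 - b / (1 - a)) *\<^sub>R v + (b / (1 - a)) *\<^sub>R q" by (simp add: x_def algebra_simps)
  also have "\<dots> \<in> z" using assms a1 by (intro convexD_alt) (auto simp: field_simps)
  finally have "x \<in> z" .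
  then have "x - a *\<^sub>R (x - c) \<in> interior z"
    using assms a1 by (intro mem_interior_convex_shrink) auto
  moreover have "x - a *\<^sub>R (x - c) = v + a *\<^sub>R (c - v) + ((1 - a) * (b / (1 - a))) *\<^sub>R (q - v)"
  proof -
    have "(v + y *\<^sub>R (q - v)) - a *\<^sub>R ((v + y *\<^sub>R (q - v)) - c) = v + a *\<^sub>R (c - v) + ((1 - a) * y) *\<^sub>R (q - v)" for y
      by (simp add: algebra_simps)
    then show ?thesis unfolding x_def .
  qed
  ultimately show ?thesis using a1 by simp
qed

text \<open>If the directions of \<open>p\<close> and \<open>q\<close>, both on the same side of the
  direction of \<open>c\<close>, were not parallel, one of them would lie strictly inside the cone
  spanned by the other and \<open>c\<close>. A short piece of its segment would then consist of
  combinations with positive weight at \<open>c\<close>, hence enter the interior.\<close>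

lemma boundary_rays_parallel:
  assumes z: "convex z" "c \<in> interior z" and in_z: "v \<in> z" "p \<in> z" "q \<in> z"
    and segs: "closed_segment v p \<inter> interior z = {}" "closed_segment v q \<inter> interior z = {}"
    and side: "\<sigma> * cross2 (c - v) (p - v) > 0" "\<sigma> * cross2 (c - v) (q - v) > 0"
  shows "cross2 (p - v) (q - v) = 0"
proof -
  have key: False if in_z: "p \<in> z" "q \<in> z" and seg: "closed_segment v p \<inter> interior z = {}"
    and side: "\<sigma> * cross2 (c - v) (p - v) > 0" "\<sigma> * cross2 (c - v) (q - v) > 0"
    and pos: "\<sigma> * cross2 (p - v) (q - v) > 0" for p q
  proof -
    define w P Q where "w = c - v" and "P = p - v" and "Q = q - v"
    define A where "A = cross2 P Q / cross2 w Q"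
    define B where "B = cross2 w P / cross2 w Q"
    have w0: "cross2 w Q \<noteq> 0" and s0: "\<sigma> \<noteq> 0" using side by (auto simp: w_def Q_def)
    have "A = (\<sigma> * cross2 P Q) / (\<sigma> * cross2 w Q)" "B = (\<sigma> * cross2 w P) / (\<sigma> * cross2 w Q)"
      using s0 by (simp_all add: A_def B_def)
    then have A: "A > 0" and B: "B > 0"
      using side pos unfolding w_def[symmetric] P_def[symmetric] Q_def[symmetric] by (metis divide_pos_pos)+
    have "cross2 w Q *\<^sub>R P = cross2 P Q *\<^sub>R w + cross2 w P *\<^sub>R Q" by (rule cross2_Cramer)
    then have P: "P = A *\<^sub>R w + B *\<^sub>R Q"
      unfolding A_def B_def by (rule scaleR_divide_both[OF w0])
    \<comment> \<open>Scales the coefficients so that the two weights sum to at most one.\<close>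
    define \<tau> where "\<tau> = 1 / (1 + A + B)"
    have \<tau>: "\<tau> > 0" "\<tau> \<le> 1" using A B by (auto simp: \<tau>_def field_simps)
    have "\<tau> * (1 + A + B) = 1" using A B by (simp add: \<tau>_def)
    then have \<tau>2: "\<tau> * A + \<tau> * B \<le> 1" using \<tau> by (simp add: algebra_simps)
    have "v + (\<tau> * A) *\<^sub>R (c - v) + (\<tau> * B) *\<^sub>R (q - v) \<in> interior z"
      using z \<open>v \<in> z\<close> in_z A B \<tau> \<tau>2 by (intro convex_interior_combination) auto
    moreover have "v + (\<tau> * A) *\<^sub>R (c - v) + (\<tau> * B) *\<^sub>R (q - v) = v + \<tau> *\<^sub>R P"
      unfolding P by (simp add: w_def Q_def scaleR_right_distrib)
    moreover have "v + \<tau> *\<^sub>R P \<in> closed_segment v p"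
      unfolding P_def in_segment using \<tau> by (intro exI[of _ \<tau>]) (auto simp: algebra_simps)
    ultimately show False using seg by auto
  qed
  show ?thesis
  proof (rule ccontr)
    assume n: "cross2 (p - v) (q - v) \<noteq> 0"
    have "\<sigma> \<noteq> 0" using side by auto
    then have "\<sigma> * cross2 (p - v) (q - v) > 0 \<or> \<sigma> * cross2 (q - v) (p - v) > 0"
      using n cross2_skew[of "p - v" "q - v"] by (cases "\<sigma> * cross2 (p - v) (q - v) > 0") (auto simp: not_less order_le_less simp del: cross2_simps)
    then show False using key[OF in_z(2,3) segs(1) side] key[OF in_z(3,2) segs(2) side(2,1)] by auto
  qed
qed

text \<open>A small step from \<open>v\<close> towards \<open>c\<close> ends in the interior, and
  the opposite step ends outside \<open>z\<close>, since otherwise \<open>v\<close> would be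
  interior. Both end points are open conditions, so they may be pushed slightly to the chosen side;
  the segment between the pushed points crosses the frontier.\<close>

lemma frontier_point_on_side:
  assumes z: "convex z" "closed z" "c \<in> interior z" and v: "v \<in> frontier z" and \<sigma>: "\<sigma> \<in> {1, -1}" and e: "e > 0"
  shows "\<exists>p\<in>frontier z. dist v p < e \<and> \<sigma> * cross2 (c - v) (p - v) > 0"
proof -
  define w where "w = c - v"
  have vz: "v \<in> z" "v \<notin> interior z" using v z(2) by (auto simp: frontier_def)
  then have w0: "w \<noteq> 0" using z(3) by (auto simp: w_def)
  define n where "n = \<sigma> *\<^sub>R perp2 w"
  have wn: "\<sigma> * cross2 w n = w \<bullet> w" using \<sigma> by (auto simp: n_def cross2_perp2)
  \<comment> \<open>Keeps the step below \<open>e / 2\<close>; the sideways push uses the other half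
    of \<open>e\<close>.\<close>
  define s where "s = min 1 (e / (4 * norm w))"
  have s: "0 < s" "s \<le> 1" "s * norm w < e / 2"
  proof -
    show "0 < s" "s \<le> 1" using e w0 by (auto simp: s_def)
    have "s * norm w \<le> e / (4 * norm w) * norm w" by (intro mult_right_mono) (auto simp: s_def)
    then show "s * norm w < e / 2" using w0 e by simp
  qed
  define a b where "a = v + s *\<^sub>R w" and "b = v - s *\<^sub>R w"
  have a: "a \<in> interior z"
    using convex_interior_combination[OF z(1,3) vz(1,1), of s 0] s by (simp add: a_def w_def)
  have b: "b \<in> - z"
  proof (rule ComplI)
    assume "b \<in> z"
    then have "b + (1/2) *\<^sub>R (a - b) + 0 *\<^sub>R (b - b) \<in> interior z"
      by (intro convex_interior_combination[OF z(1) a]) auto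
    moreover have "b + (1/2) *\<^sub>R (a - b) + 0 *\<^sub>R (b - b) = v"
      by (simp add: a_def b_def algebra_simps scaleR_2[symmetric])
    ultimately show False using vz by simp
  qed
  have "((\<lambda>k. a + k *\<^sub>R n) \<longlongrightarrow> a + 0 *\<^sub>R n) (at_right 0)" "((\<lambda>k. b + k *\<^sub>R n) \<longlongrightarrow> b + 0 *\<^sub>R n) (at_right 0)"
    by (intro tendsto_intros)+
  then have "\<forall>\<^sub>F k in at_right 0. a + k *\<^sub>R n \<in> interior z" "\<forall>\<^sub>F k in at_right 0. b + k *\<^sub>R n \<in> - z"
    using a b z(2) e by (auto intro!: topological_tendstoD[where S="interior z"] topological_tendstoD[where S="- z"]
      simp del: Compl_iff)
  moreover have "\<forall>\<^sub>F k in at_right 0. k * norm n < e / 2"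
  proof (rule order_tendstoD(2))
    show "((\<lambda>k. k * norm n) \<longlongrightarrow> 0 * norm n) (at_right (0::real))" by (intro tendsto_intros)
  qed (use e in simp)
  moreover have "\<forall>\<^sub>F k in at_right (0::real). k > 0" by (simp add: eventually_at_right_less)
  ultimately have "\<forall>\<^sub>F k in at_right 0. a + k *\<^sub>R n \<in> interior z \<and> b + k *\<^sub>R n \<in> - z \<and> k * norm n < e / 2 \<and> k > 0"
    by eventually_elim auto
  then obtain k where k: "a + k *\<^sub>R n \<in> interior z" "b + k *\<^sub>R n \<in> - z" "k * norm n < e / 2" "k > 0"
    using eventually_happens[of _ "at_right (0::real)"] by auto
  have "closed_segment (a + k *\<^sub>R n) (b + k *\<^sub>R n) \<inter> frontier z \<noteq> {}"
  proof (rule connected_Int_frontier)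
    show "closed_segment (a + k *\<^sub>R n) (b + k *\<^sub>R n) \<inter> z \<noteq> {}" using k(1) interior_subset by blast
    show "closed_segment (a + k *\<^sub>R n) (b + k *\<^sub>R n) - z \<noteq> {}" using k(2) by blast
  qed simp
  then obtain p where p: "p \<in> frontier z" and "p \<in> closed_segment (a + k *\<^sub>R n) (b + k *\<^sub>R n)" by auto
  then obtain u where u: "0 \<le> u" "u \<le> 1" and pu: "p = (1 - u) *\<^sub>R (a + k *\<^sub>R n) + u *\<^sub>R (b + k *\<^sub>R n)"
    unfolding in_segment by auto
  have pv: "p - v = (s * (1 - 2 * u)) *\<^sub>R w + k *\<^sub>R n"
    unfolding pu a_def b_def by (simp add: algebra_simps scaleR_2[symmetric])
  have "\<sigma> * cross2 w (p - v) = k * (w \<bullet> w)"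
    unfolding pv using wn by (simp add: algebra_simps)
  then have "\<sigma> * cross2 w (p - v) > 0" using k w0 by simp
  moreover have "norm (p - v) < e"
  proof -
    have "norm (p - v) \<le> norm ((s * (1 - 2 * u)) *\<^sub>R w) + norm (k *\<^sub>R n)" unfolding pv by (rule norm_triangle_ineq)
    also have "\<dots> = s * \<bar>1 - 2 * u\<bar> * norm w + k * norm n" using s k by (simp add: abs_mult)
    also have "\<dots> \<le> s * 1 * norm w + k * norm n" using u s by (intro add_mono mult_right_mono mult_left_mono) auto
    also have "\<dots> < e" using s k by simp
    finally show ?thesis .
  qed
  ultimately show ?thesis using p unfolding w_def by (intro bexI[of _ p]) (auto simp: dist_norm norm_minus_commute)
qed

text \<open>Two common points exclude contact at a single point. For cells of a planar tessellation
  the common part is then a nondegenerate segment.\<close>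

definition touch :: "'a set \<Rightarrow> 'a set \<Rightarrow> bool" where
  "touch z z' \<longleftrightarrow> z \<noteq> z' \<and> (\<exists>p\<in>z \<inter> z'. \<exists>q\<in>z \<inter> z'. p \<noteq> q)"

lemma touch_sym: "touch z z' \<longleftrightarrow> touch z' z"
  by (auto simp: touch_def)

locale tess =
  fixes t :: "'a::euclidean_space set set"
  assumes t: "tessellation t"
begin

lemma cell:
  assumes "z \<in> t" shows "convex z" "compact z" "closed z" "interior z \<noteq> {}" "z \<noteq> {}"
proof -
  have p: "polytope z" "interior z \<noteq> {}" using t assms by (auto simp: tessellation_def)
  then show "convex z" "compact z" "closed z" "interior z \<noteq> {}" "z \<noteq> {}"
    by (auto simp: polytope_imp_convex polytope_imp_compact polytope_imp_closed)
qed

lemma cover: "\<exists>z\<in>t. x \<in> z" using t by (auto simp: tessellation_def)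

lemma finite_hit: "bounded B \<Longrightarrow> finite {z\<in>t. z \<inter> B \<noteq> {}}"
  using t by (auto simp: tessellation_def)

lemma finite_cells_at: "finite {y\<in>t. v \<in> y}"
  using finite_subset[OF _ finite_hit[of "{v}"], of "{y\<in>t. v \<in> y}"] by auto

text \<open>Upgrades disjointness of interiors to a whole cell against an interior, because a cell
  is contained in the closure of its interior.\<close>

lemma interior_disjoint:
  assumes "z \<in> t" "z' \<in> t" "z \<noteq> z'" shows "z \<inter> interior z' = {}"
proof (rule ccontr)
  assume "z \<inter> interior z' \<noteq> {}"
  then obtain x where x: "x \<in> z" "x \<in> interior z'" by auto
  then have "x \<in> closure (interior z)"
    using convex_closure_interior[OF cell(1,4)[OF assms(1)]] closure_subset by auto
  then have "interior z' \<inter> interior z \<noteq> {}"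
    using x by (metis closure_iff_nhds_not_empty disjoint_iff open_interior order_refl)
  then show False using t assms by (auto simp: tessellation_def)
qed

lemma Int_subset_frontier:
  assumes "z \<in> t" "z' \<in> t" "z \<noteq> z'" shows "z \<inter> z' \<subseteq> frontier z"
  using interior_disjoint[of z' z] assms cell(3)[OF assms(1)] by (auto simp: frontier_def)

text \<open>Only finitely many cells come near \<open>x\<close>, and those that miss
  \<open>x\<close> form a closed set.\<close>

lemma local_cells: "\<exists>e>0. \<forall>z\<in>t. z \<inter> ball x e \<noteq> {} \<longrightarrow> x \<in> z"
proof -
  let ?F = "{z\<in>t. z \<inter> ball x 1 \<noteq> {}}"
  have "closed (\<Union>{z\<in>?F. x \<notin> z})"
    using finite_subset[OF _ finite_hit[of "ball x 1"], of "{z\<in>?F. x \<notin> z}"] cell(3) by (intro closed_Union) auto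
  then have "open (- \<Union>{z\<in>?F. x \<notin> z})" by (rule open_Compl)
  moreover have "x \<in> - \<Union>{z\<in>?F. x \<notin> z}" by auto
  ultimately obtain e where e: "e > 0" "ball x e \<subseteq> - \<Union>{z\<in>?F. x \<notin> z}" by (rule openE)
  show ?thesis
  proof (intro exI[of _ "min e 1"] conjI ballI impI)
    fix z assume "z \<in> t" "z \<inter> ball x (min e 1) \<noteq> {}"
    then obtain y where "y \<in> z" "y \<in> ball x e" "y \<in> ball x 1" by auto
    then show "x \<in> z" using e(2) \<open>z \<in> t\<close> by blast
  qed (use e in auto)
qed

lemma frontier_cover:
  assumes "z \<in> t" "x \<in> frontier z" shows "\<exists>z'\<in>t. z' \<noteq> z \<and> x \<in> z'"
proof -
  obtain e where e: "e > 0" "\<forall>z\<in>t. z \<inter> ball x e \<noteq> {} \<longrightarrow> x \<in> z"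
    using local_cells[of x] by (elim exE conjE) (rule that)
  have "x \<in> closure (- z)" using assms(2) by (simp add: frontier_closures)
  then obtain y where "y \<in> ball x e" "y \<notin> z"
    using e(1) by (auto simp: closure_approachable dist_commute)
  moreover obtain z' where z': "z' \<in> t" "y \<in> z'" using cover by blast
  ultimately have "z' \<inter> ball x e \<noteq> {}" "z' \<noteq> z" by blast+
  then show ?thesis using e(2) z'(1) by blast
qed

end

section \<open>Neighbours and corners of planar cells\<close>

locale planar_tess = tess t for t :: "(real^2) set set"
begin

text \<open>Both cells contain half discs around \<open>m\<close>. These lie on opposite sides, for
  otherwise the interiors would overlap, so together they fill a neighbourhood of \<open>m\<close>
  up to the line. The interior of a third cell at \<open>m\<close> would meet one of them.\<close>

lemma two_cells:
  assumes z: "z \<in> t" "z' \<in> t" "z \<noteq> z'" and pq: "p \<in> z \<inter> z'" "q \<in> z \<inter> z'" and m: "m \<in> open_segment p q"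
    and z'': "z'' \<in> t" "m \<in> z''"
  shows "z'' = z \<or> z'' = z'"
proof (rule ccontr)
  assume n: "\<not> (z'' = z \<or> z'' = z')"
  obtain \<sigma> U where \<sigma>: "\<sigma> \<in> {1, -1}" "open U" "m \<in> U"
    and U: "\<And>y. y \<in> U \<Longrightarrow> \<sigma> * cross2 (q - p) (y - p) > 0 \<Longrightarrow> y \<in> interior z"
    using half_disc_interior[OF cell(1,4)[OF z(1)] _ _ m] pq by blast
  obtain \<sigma>' U' where \<sigma>': "\<sigma>' \<in> {1, -1}" "open U'" "m \<in> U'"
    and U': "\<And>y. y \<in> U' \<Longrightarrow> \<sigma>' * cross2 (q - p) (y - p) > 0 \<Longrightarrow> y \<in> interior z'"
    using half_disc_interior[OF cell(1,4)[OF z(2)] _ _ m] pq by blast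
  have pq0: "q - p \<noteq> 0" using m by auto
  let ?W = "U \<inter> U'"
  have W: "open ?W" "m \<in> ?W" using \<sigma> \<sigma>' by auto
  have disj: "interior z1 \<inter> interior z2 = {}" if "z1 \<in> t" "z2 \<in> t" "z1 \<noteq> z2" for z1 z2
    using interior_disjoint[OF that] interior_subset by blast
  have "\<sigma> \<noteq> \<sigma>'"
  proof
    \<comment> \<open>With equal sides, a small displacement of \<open>m\<close> along the normal
      would lie in both interiors.\<close>
    assume s: "\<sigma> = \<sigma>'"
    obtain k where k: "k > 0" "m + k *\<^sub>R (\<sigma> *\<^sub>R perp2 (q - p)) \<in> ?W"
    proof -
      have "((\<lambda>k. m + k *\<^sub>R (\<sigma> *\<^sub>R perp2 (q - p))) \<longlongrightarrow> m + 0 *\<^sub>R (\<sigma> *\<^sub>R perp2 (q - p))) (at_right 0)"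
        by (intro tendsto_intros)
      then have "\<forall>\<^sub>F k in at_right 0. m + k *\<^sub>R (\<sigma> *\<^sub>R perp2 (q - p)) \<in> ?W"
        using W by (intro topological_tendstoD) auto
      moreover have "\<forall>\<^sub>F k in at_right (0::real). k > 0" by (simp add: eventually_at_right_less)
      ultimately have "\<forall>\<^sub>F k in at_right 0. m + k *\<^sub>R (\<sigma> *\<^sub>R perp2 (q - p)) \<in> ?W \<and> k > 0" by eventually_elim auto
      then show ?thesis using that eventually_happens[of _ "at_right (0::real)"] by auto
    qed
    obtain u where mu: "m = (1 - u) *\<^sub>R p + u *\<^sub>R q" using m by (auto simp: in_segment)
    have "m - p = u *\<^sub>R (q - p)" by (simp add: mu algebra_simps)
    then have "m + k *\<^sub>R (\<sigma> *\<^sub>R perp2 (q - p)) - p = u *\<^sub>R (q - p) + k *\<^sub>R (\<sigma> *\<^sub>R perp2 (q - p))"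
      by (simp add: algebra_simps)
    then have "\<sigma> * cross2 (q - p) (m + k *\<^sub>R (\<sigma> *\<^sub>R perp2 (q - p)) - p) = k * ((q - p) \<bullet> (q - p))"
      using \<sigma>(1) by (simp only: cross2_simps cross2_perp2) auto
    then have "\<sigma> * cross2 (q - p) (m + k *\<^sub>R (\<sigma> *\<^sub>R perp2 (q - p)) - p) > 0" using k pq0 by simp
    then show False using U[of "m + k *\<^sub>R (\<sigma> *\<^sub>R perp2 (q - p))"] U'[of "m + k *\<^sub>R (\<sigma> *\<^sub>R perp2 (q - p))"]
      k(2) s disj[OF z] by auto
  qed
  have "m \<in> closure (interior z'')"
    using convex_closure_interior[OF cell(1,4)[OF z''(1)]] z''(2) closure_subset by auto
  then have "?W \<inter> interior z'' \<noteq> {}"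
    using W by (metis closure_iff_nhds_not_empty inf_commute order_refl)
  then obtain x where "x \<in> ?W \<inter> interior z''" by auto
  \<comment> \<open>The interior of the third cell is open, so it has a point off the line, and such
    a point falls into one of the two open half discs.\<close>
  then obtain y where y: "y \<in> ?W \<inter> interior z''" "cross2 (q - p) (y - p) \<noteq> 0"
    using open_off_line[OF _ _ pq0, of "?W \<inter> interior z''"] W by blast
  have "\<sigma> * cross2 (q - p) (y - p) > 0 \<or> \<sigma>' * cross2 (q - p) (y - p) > 0"
    using \<open>\<sigma> \<noteq> \<sigma>'\<close> \<sigma>(1) \<sigma>'(1) y(2) by auto
  then show False using U[of y] U'[of y] y(1) disj[OF z(1) z''(1)] disj[OF z(2) z''(1)] n by auto
qed

text \<open>A cell with the corner \<open>m\<close> would have to be \<open>z\<close> or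
  \<open>z'\<close>, hence contain \<open>p\<close> and \<open>q\<close>, and \<open>m\<close> would
  not be extreme in it. This is what replaces the side-to-side property.\<close>

lemma corner_not_between:
  assumes z: "z \<in> t" "z' \<in> t" "z \<noteq> z'" and pq: "p \<in> z \<inter> z'" "q \<in> z \<inter> z'" and m: "m \<in> open_segment p q"
  shows "m \<notin> cell_corners t"
proof
  assume "m \<in> cell_corners t"
  then obtain z'' where z'': "z'' \<in> t" "m extreme_point_of z''" by (auto simp: cell_corners_def)
  then have "m \<in> z''" by (simp add: extreme_point_of_def)
  then have "p \<in> z''" "q \<in> z''" using two_cells[OF z pq m z''(1)] pq by auto
  then show False using z''(2) m by (auto simp: extreme_point_of_def)
qed

text \<open>The common part has empty interior, hence affine dimension at most one, and a compact
  convex collinear set is a segment.\<close>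

lemma neighbour_segment:
  assumes z: "z \<in> t" "z' \<in> t" and touch: "touch z z'"
  shows "\<exists>a b. a \<noteq> b \<and> z \<inter> z' = closed_segment a b"
proof -
  have nz: "z \<noteq> z'" and ne: "\<exists>p\<in>z \<inter> z'. \<exists>q\<in>z \<inter> z'. p \<noteq> q" using touch by (auto simp: touch_def)
  have c: "convex (z \<inter> z')" "compact (z \<inter> z')"
    using cell[OF z(1)] cell[OF z(2)] by (auto intro: convex_Int)
  have "interior (z \<inter> z') = {}" using interior_disjoint[OF z nz] interior_subset by auto
  moreover have "aff_dim (z \<inter> z') \<noteq> 2"
  proof
    assume "aff_dim (z \<inter> z') = 2"
    then have "affine hull (z \<inter> z') = UNIV" by (subst aff_dim_eq_full[symmetric]) simp
    then have "rel_interior (z \<inter> z') = interior (z \<inter> z')" by (rule rel_interior_interior)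
    then show False using \<open>interior (z \<inter> z') = {}\<close> rel_interior_eq_empty[OF c(1)] ne by auto
  qed
  ultimately have "aff_dim (z \<inter> z') \<le> 1" using aff_dim_le_DIM[of "z \<inter> z'"] by simp
  then have "collinear (z \<inter> z')" by (simp add: collinear_aff_dim)
  then obtain a b where "z \<inter> z' = closed_segment a b"
    using compact_convex_collinear_segment[of "z \<inter> z'"] c ne by auto
  then show ?thesis using ne by (intro exI[of _ a] exI[of _ b]) auto
qed

text \<open>Take a frontier point on the prescribed side so close to \<open>v\<close> that every
  cell reaching it contains \<open>v\<close>.\<close>

lemma side_neighbour_exists:
  assumes z: "z \<in> t" "c \<in> interior z" "v \<in> frontier z" and \<sigma>: "\<sigma> \<in> {1, -1}"
  shows "\<exists>z'\<in>t. z' \<noteq> z \<and> v \<in> z' \<and> (\<exists>p\<in>z \<inter> z'. \<sigma> * cross2 (c - v) (p - v) > 0)"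
proof -
  obtain e where e: "e > 0" "\<forall>z\<in>t. z \<inter> ball v e \<noteq> {} \<longrightarrow> v \<in> z"
    using local_cells[of v] by (elim exE conjE) (rule that)
  obtain p where p: "p \<in> frontier z" "dist v p < e" "\<sigma> * cross2 (c - v) (p - v) > 0"
    using frontier_point_on_side[OF cell(1,3)[OF z(1)] z(2,3) \<sigma> e(1)] by auto
  obtain z' where "z' \<in> t" "z' \<noteq> z" "p \<in> z'" using frontier_cover[OF z(1) p(1)] by auto
  moreover have "p \<in> z" using p(1) cell(3)[OF z(1)] by (auto simp: frontier_def)
  moreover have "v \<in> z'"
  proof -
    have "z' \<inter> ball v e \<noteq> {}" using \<open>p \<in> z'\<close> p(2) by auto
    then show ?thesis using e(2) \<open>z' \<in> t\<close> by blast
  qed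
  ultimately show ?thesis using p by blast
qed

text \<open>The segments that \<open>z\<close> shares with the two neighbours leave \<open>v\<close>
  in the same direction, hence overlap. A point inside the overlap lies in \<open>z\<close>,
  \<open>z1\<close> and \<open>z2\<close>, which \<open>two_cells\<close> permits only if the
  neighbours coincide.\<close>

lemma side_neighbour_unique:
  assumes z: "z \<in> t" "c \<in> interior z" "v \<in> z"
    and z1: "z1 \<in> t" "z1 \<noteq> z" "v \<in> z1" "p \<in> z \<inter> z1" "\<sigma> * cross2 (c - v) (p - v) > 0"
    and z2: "z2 \<in> t" "z2 \<noteq> z" "v \<in> z2" "q \<in> z \<inter> z2" "\<sigma> * cross2 (c - v) (q - v) > 0"
  shows "z1 = z2"
proof -
  have seg: "closed_segment v p \<subseteq> z \<inter> z1" "closed_segment v q \<subseteq> z \<inter> z2"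
    using z z1 z2 by (intro closed_segment_subset convex_Int cell(1) IntI; simp)+
  have "closed_segment v p \<inter> interior z = {}" "closed_segment v q \<inter> interior z = {}"
    using seg interior_disjoint[OF z1(1) z(1)] interior_disjoint[OF z2(1) z(1)] z1 z2 by blast+
  then have par: "cross2 (p - v) (q - v) = 0"
    using boundary_rays_parallel[OF cell(1)[OF z(1)] z(2,3) _ _ _ _ z1(5) z2(5)] z1 z2 by auto
  \<comment> \<open>The ratio of the two parallel vectors \<open>q - v\<close> and
    \<open>p - v\<close>, read off from their determinants with \<open>c - v\<close>.\<close>
  define \<mu> where "\<mu> = cross2 (c - v) (q - v) / cross2 (c - v) (p - v)"
  have p0: "cross2 (c - v) (p - v) \<noteq> 0" "\<sigma> \<noteq> 0" using z1(5) by auto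
  have "\<mu> = (\<sigma> * cross2 (c - v) (q - v)) / (\<sigma> * cross2 (c - v) (p - v))"
    using p0 by (simp add: \<mu>_def)
  then have \<mu>: "\<mu> > 0" using z1(5) z2(5) by (metis divide_pos_pos)
  have "cross2 (c - v) (p - v) *\<^sub>R (q - v) = cross2 (q - v) (p - v) *\<^sub>R (c - v) + cross2 (c - v) (q - v) *\<^sub>R (p - v)"
    by (rule cross2_Cramer)
  then have "cross2 (c - v) (p - v) *\<^sub>R (q - v) = cross2 (c - v) (q - v) *\<^sub>R (p - v)"
    using par cross2_skew[of "q - v" "p - v"] by simp
  then have q: "q - v = \<mu> *\<^sub>R (p - v)"
    unfolding \<mu>_def by (rule scaleR_divide_both1[OF p0(1)])
  \<comment> \<open>Picks \<open>x\<close> as the nearer of \<open>p\<close> and \<open>q\<close>,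
    so that it lies on both segments.\<close>
  define s where "s = min 1 \<mu>"
  have s: "0 < s" "s \<le> 1" "s / \<mu> \<le> 1" "s / \<mu> > 0" using \<mu> by (auto simp: s_def min_def field_simps)
  define x where "x = v + s *\<^sub>R (p - v)"
  have x1: "x \<in> closed_segment v p" unfolding in_segment x_def using s
    by (intro exI[of _ s]) (auto simp: algebra_simps)
  have "x = v + (s / \<mu>) *\<^sub>R (q - v)" using \<mu> by (simp add: x_def q)
  then have x2: "x \<in> closed_segment v q" unfolding in_segment using s
    by (intro exI[of _ "s / \<mu>"]) (auto simp: algebra_simps)
  have "p \<noteq> v" using p0 by auto
  then have "x \<noteq> v" using s by (auto simp: x_def)
  then have m: "midpoint v x \<in> open_segment v x" by simp
  have xz: "x \<in> z \<inter> z1" "x \<in> z \<inter> z2" using x1 x2 seg by auto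
  have "open_segment v x \<subseteq> z2"
    using closed_segment_subset[OF _ _ cell(1)[OF z2(1)], of v x] xz z2(3) segment_open_subset_closed by blast
  then have "midpoint v x \<in> z2" using m by auto
  then have "z2 = z \<or> z2 = z1"
    using two_cells[OF z(1) z1(1) z1(2)[symmetric] _ _ m z2(1)] z z1 xz by auto
  then show ?thesis using z2 by auto
qed

text \<open>The point may be a corner of another cell only; then it cannot be interior to
  \<open>z\<close> because the other cell contains it.\<close>

lemma corner_in_frontier:
  assumes "z \<in> t" "v \<in> z" "v \<in> cell_corners t" shows "v \<in> frontier z"
proof -
  obtain z' where z': "z' \<in> t" "v extreme_point_of z'" using assms(3) by (auto simp: cell_corners_def)
  then have v: "v \<in> z'" by (simp add: extreme_point_of_def)
  have "v \<notin> interior z"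
  proof (cases "z = z'")
    case True
    then show ?thesis using z'(2) extreme_point_not_in_interior by blast
  next
    case False
    then show ?thesis using interior_disjoint[OF z'(1) assms(1)] v by auto
  qed
  then show ?thesis using assms cell(3)[OF assms(1)] by (auto simp: frontier_def)
qed

lemma extreme_imp_side_touch:
  assumes z: "z \<in> t" "z' \<in> t" "z' \<noteq> z" "v \<in> z" "v \<in> z'" and p: "p \<in> z \<inter> z'" "\<sigma> * cross2 (c - v) (p - v) > 0"
  shows "touch z z'"
proof -
  have "p \<noteq> v" using p by auto
  then show ?thesis using z p unfolding touch_def by (intro conjI bexI[of _ p] bexI[of _ v]) auto
qed

text \<open>The two neighbours of \<open>z\<close> at \<open>v\<close> lie on the two sides of the line through \<open>v\<close> and an
  interior point of \<open>z\<close>.\<close>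

lemma card_neighbours_at_corner:
  assumes z: "z \<in> t" and v: "v \<in> z" "v \<in> cell_corners t"
  shows "card {z'\<in>t. touch z z' \<and> v extreme_point_of (z \<inter> z')} = 2"
proof -
  obtain c where c: "c \<in> interior z" using cell(4)[OF z] by auto
  have vf: "v \<in> frontier z" using corner_in_frontier[OF z v] .
  obtain zl pl where l: "zl \<in> t" "zl \<noteq> z" "v \<in> zl" "pl \<in> z \<inter> zl" "1 * cross2 (c - v) (pl - v) > 0"
    using side_neighbour_exists[OF z c vf, of 1] by auto
  obtain zr pr where r: "zr \<in> t" "zr \<noteq> z" "v \<in> zr" "pr \<in> z \<inter> zr" "-1 * cross2 (c - v) (pr - v) > 0"
    using side_neighbour_exists[OF z c vf, of "-1"] by auto
  \<comment> \<open>A corner never lies strictly between two points common to two cells, so any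
    neighbour containing \<open>v\<close> has it as an end of the shared part, even where
    \<open>z\<close> is straight at \<open>v\<close>.\<close>
  have ext: "v extreme_point_of (z \<inter> z')" if "z' \<in> t" "z' \<noteq> z" "v \<in> z'" for z'
    unfolding extreme_point_of_def using corner_not_between[OF z that(1) that(2)[symmetric]] v that by blast
  \<comment> \<open>A single neighbour on both sides would share with \<open>z\<close> a segment
    that starts at \<open>v\<close> and has points on both sides of the line through
    \<open>v\<close> and \<open>c\<close>.\<close>
  have "zl \<noteq> zr"
  proof
    assume e: "zl = zr"
    have "touch z zl" using extreme_imp_side_touch[OF z l(1,2) v(1) l(3,4,5)] .
    then obtain a b where ab: "a \<noteq> b" "z \<inter> zl = closed_segment a b"
      using neighbour_segment[OF z l(1)] by auto
    have "v extreme_point_of (closed_segment a b)" using ext[OF l(1,2,3)] ab by simp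
    then have "v = a \<or> v = b" by (simp add: extreme_point_of_segment)
    then obtain b' where s: "z \<inter> zl = closed_segment v b'" using ab closed_segment_commute by metis
    have "pl \<in> closed_segment v b'" "pr \<in> closed_segment v b'" using l r s e by auto
    then obtain x y where x: "0 \<le> x" "pl = (1 - x) *\<^sub>R v + x *\<^sub>R b'" and y: "0 \<le> y" "pr = (1 - y) *\<^sub>R v + y *\<^sub>R b'"
      by (auto simp: in_segment)
    have "pl - v = x *\<^sub>R (b' - v)" "pr - v = y *\<^sub>R (b' - v)" by (simp_all add: x y algebra_simps)
    then have "x * cross2 (c - v) (b' - v) > 0" "y * cross2 (c - v) (b' - v) < 0"
      using l(5) r(5) by (simp_all only: cross2_simps)
    then show False using x(1) y(1) by (auto simp: zero_less_mult_iff mult_less_0_iff)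
  qed
  moreover have "{z'\<in>t. touch z z' \<and> v extreme_point_of (z \<inter> z')} = {zl, zr}"
  proof (intro set_eqI iffI)
    fix z' assume "z' \<in> {zl, zr}"
    then show "z' \<in> {z'\<in>t. touch z z' \<and> v extreme_point_of (z \<inter> z')}"
      using ext[OF l(1-3)] ext[OF r(1-3)] l(1) r(1)
        extreme_imp_side_touch[OF z l(1,2) v(1) l(3,4,5)] extreme_imp_side_touch[OF z r(1,2) v(1) r(3,4,5)] by auto
  next
    fix z' assume z': "z' \<in> {z'\<in>t. touch z z' \<and> v extreme_point_of (z \<inter> z')}"
    then have z': "z' \<in> t" "touch z z'" "v extreme_point_of (z \<inter> z')" "z' \<noteq> z" "v \<in> z'"
      by (auto simp: touch_def extreme_point_of_def)
    obtain x where x: "x \<in> z \<inter> z'" "x \<noteq> v" using z'(2) unfolding touch_def by metis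
    \<comment> \<open>A shared point \<open>x\<close> on the line through \<open>v\<close> and
      \<open>c\<close> is impossible. With \<open>x - v\<close> equal to \<open>k\<close> times
      \<open>c - v\<close>, the point \<open>x\<close> is interior to \<open>z\<close> for
      \<open>0 < k \<le> 1\<close>, the neighbour contains \<open>c\<close> for
      \<open>k > 1\<close>, and \<open>v\<close> lies between \<open>x\<close> and \<open>c\<close>
      for \<open>k < 0\<close>.\<close>
    have "cross2 (c - v) (x - v) \<noteq> 0"
    proof
      assume 0: "cross2 (c - v) (x - v) = 0"
      have cv: "c - v \<noteq> 0" using vf c by (auto simp: frontier_def)
      have "cross2 (c - v) (perp2 (c - v)) *\<^sub>R (x - v) = cross2 (x - v) (perp2 (c - v)) *\<^sub>R (c - v) + cross2 (c - v) (x - v) *\<^sub>R perp2 (c - v)"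
        by (rule cross2_Cramer)
      then have 1: "((c - v) \<bullet> (c - v)) *\<^sub>R (x - v) = cross2 (x - v) (perp2 (c - v)) *\<^sub>R (c - v)"
        by (simp only: 0 cross2_perp2) simp
      define k where "k = cross2 (x - v) (perp2 (c - v)) / ((c - v) \<bullet> (c - v))"
      have xk: "x - v = k *\<^sub>R (c - v)"
        unfolding k_def using 1 cv by (intro scaleR_divide_both1) auto
      have nx: "x \<notin> interior z" using interior_disjoint[OF z'(1) z z'(4)] x by auto
      have k0: "k \<noteq> 0" using xk x(2) by auto
      have vz: "v \<in> z" "x \<in> z" using v x by auto
      show False
      proof (cases "k > 0")
        case True
        show False
        proof (cases "k \<le> 1")
          case True
          then have "v + k *\<^sub>R (c - v) + 0 *\<^sub>R (v - v) \<in> interior z"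
            using \<open>k > 0\<close> by (intro convex_interior_combination[OF cell(1)[OF z] c vz(1,1)]) auto
          moreover have "v + k *\<^sub>R (c - v) = x" using xk by (simp add: algebra_simps)
          ultimately show False using nx by simp
        next
          case False
          then have "closed_segment v x \<inter> interior z \<noteq> {}"
          proof -
            have "c = v + (1 / k) *\<^sub>R (x - v)" using xk k0 by simp
            then have "c \<in> closed_segment v x" unfolding in_segment using False
              by (intro exI[of _ "1 / k"]) (auto simp: algebra_simps)
            then show ?thesis using c by auto
          qed
          moreover have "closed_segment v x \<subseteq> z'"
            using closed_segment_subset[OF _ _ cell(1)[OF z'(1)]] z'(5) x by auto
          ultimately show False using interior_disjoint[OF z'(1) z z'(4)] by auto
        qed
      next
        case False
        then have k: "k < 0" using k0 by auto
        \<comment> \<open>The fraction of the way from \<open>x\<close> to \<open>c\<close> at which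
          \<open>v\<close> is met; it is positive, so \<open>v\<close> would be interior.\<close>
        let ?a = "- k / (1 - k)"
        have "x + ?a *\<^sub>R (c - x) + 0 *\<^sub>R (x - x) \<in> interior z"
          using k by (intro convex_interior_combination[OF cell(1)[OF z] c vz(2,2)]) (auto simp: field_simps)
        moreover have "x + ?a *\<^sub>R (c - x) = v"
        proof -
          have xe: "x = v + k *\<^sub>R (c - v)" using xk by (simp add: algebra_simps)
          have "c - x = (1 - k) *\<^sub>R (c - v)" unfolding xe by (simp add: algebra_simps)
          then have "?a *\<^sub>R (c - x) = (- k) *\<^sub>R (c - v)" using k by simp
          then have "x + ?a *\<^sub>R (c - x) = v + k *\<^sub>R (c - v) + (- k) *\<^sub>R (c - v)" using xe by simp
          then show ?thesis by simp
        qed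
        ultimately show False using vf by (simp add: frontier_def)
      qed
    qed
    then have "1 * cross2 (c - v) (x - v) > 0 \<or> -1 * cross2 (c - v) (x - v) > 0" by auto
    then show "z' \<in> {zl, zr}"
      using side_neighbour_unique[OF z c v(1) z'(1,4,5) x(1) _ l] side_neighbour_unique[OF z c v(1) z'(1,4,5) x(1) _ r]
      by blast
  qed
  ultimately show ?thesis by simp
qed

lemma frontier_cover_touch:
  assumes z: "z \<in> t" and v: "v \<in> frontier z"
  shows "\<exists>z'\<in>t. touch z z' \<and> v \<in> z'"
proof -
  obtain c where c: "c \<in> interior z" using cell(4)[OF z] by auto
  obtain z' p where l: "z' \<in> t" "z' \<noteq> z" "v \<in> z'" "p \<in> z \<inter> z'" "1 * cross2 (c - v) (p - v) > 0"
    using side_neighbour_exists[OF z c v, of 1] by auto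
  have "v \<in> z" using v cell(3)[OF z] by (auto simp: frontier_def)
  then show ?thesis using extreme_imp_side_touch[OF z l(1,2) _ l(3,4,5)] l by auto
qed

text \<open>If \<open>v\<close> were extreme in neither cell, each cell would contain an open
  segment through \<open>v\<close>. Parallel segments place \<open>v\<close> between two common
  points of the cells. Otherwise the segment of \<open>z'\<close> crosses the one of
  \<open>z\<close> and enters the half disc that \<open>z\<close> contains at \<open>v\<close>, so
  it meets the interior of \<open>z\<close>.\<close>

lemma extreme_of_side_is_corner:
  assumes z: "z \<in> t" "z' \<in> t" "z \<noteq> z'" and v: "v extreme_point_of (z \<inter> z')"
  shows "v \<in> cell_corners t"
proof (rule ccontr)
  assume n: "v \<notin> cell_corners t"
  have vz: "v \<in> z" "v \<in> z'" using v by (auto simp: extreme_point_of_def)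
  have "\<not> v extreme_point_of z" "\<not> v extreme_point_of z'" using n z by (auto simp: cell_corners_def)
  then obtain p q p' q' where pq: "p \<in> z" "q \<in> z" "v \<in> open_segment p q" and pq': "p' \<in> z'" "q' \<in> z'" "v \<in> open_segment p' q'"
    using vz unfolding extreme_point_of_def by blast
  define d where "d = q - p"
  have d0: "d \<noteq> 0" using pq by (auto simp: d_def)
  obtain s where s: "0 < s" "s < 1" "v = (1 - s) *\<^sub>R p + s *\<^sub>R q" using pq(3) by (auto simp: in_segment)
  obtain s' where s': "0 < s'" "s' < 1" "v = (1 - s') *\<^sub>R p' + s' *\<^sub>R q'" using pq'(3) by (auto simp: in_segment)
  have vp: "v - p = s *\<^sub>R d" by (simp add: s(3) d_def algebra_simps)
  have vz'mem: "v + k *\<^sub>R (q' - p') \<in> z'" if "\<bar>k\<bar> \<le> min s' (1 - s')" for k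
  proof -
    have "(1 - (s' + k)) *\<^sub>R p' + (s' + k) *\<^sub>R q' \<in> z'"
      using that pq' s' by (intro convexD_alt[OF cell(1)[OF z(2)]]) auto
    then show ?thesis by (simp add: s'(3) algebra_simps)
  qed
  have vzmem: "v + k *\<^sub>R d \<in> z" if "\<bar>k\<bar> \<le> min s (1 - s)" for k
  proof -
    have "(1 - (s + k)) *\<^sub>R p + (s + k) *\<^sub>R q \<in> z"
      using that pq s by (intro convexD_alt[OF cell(1)[OF z(1)]]) auto
    then show ?thesis by (simp add: s(3) d_def algebra_simps)
  qed
  show False
  proof (cases "cross2 d (q' - p') = 0")
    case True
    define d' where "d' = q' - p'"
    have d'0: "d' \<noteq> 0" using pq' by (auto simp: d'_def)
    define k where "k = cross2 d' (perp2 d) / (d \<bullet> d)"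
    have "cross2 d (perp2 d) *\<^sub>R d' = cross2 d' (perp2 d) *\<^sub>R d + cross2 d d' *\<^sub>R perp2 d" by (rule cross2_Cramer)
    then have "(d \<bullet> d) *\<^sub>R d' = cross2 d' (perp2 d) *\<^sub>R d" using True by (simp add: cross2_perp2 d'_def)
    then have k: "d' = k *\<^sub>R d"
      unfolding k_def using d0 by (intro scaleR_divide_both1) auto
    have k0: "k \<noteq> 0" using k d'0 by auto
    \<comment> \<open>A step along \<open>d\<close> short enough for both segments; the factor
      \<open>k\<close> converts between their direction vectors.\<close>
    define \<epsilon> where "\<epsilon> = min (min s (1 - s)) (\<bar>k\<bar> * min s' (1 - s'))"
    have \<epsilon>: "\<epsilon> > 0" using s s' k0 by (auto simp: \<epsilon>_def)
    have mem: "v + h *\<^sub>R d \<in> z \<inter> z'" if "\<bar>h\<bar> = \<epsilon>" for h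
    proof
      show "v + h *\<^sub>R d \<in> z" using that by (intro vzmem) (auto simp: \<epsilon>_def)
      have "v + (h / k) *\<^sub>R (q' - p') \<in> z'"
      proof (rule vz'mem)
        have "\<bar>h / k\<bar> = \<epsilon> / \<bar>k\<bar>" using that by (simp add: abs_divide)
        also have "\<dots> \<le> min s' (1 - s')" using k0 by (subst pos_divide_le_eq) (simp_all only: \<epsilon>_def mult.commute zero_less_abs_iff min.cobounded2 not_False_eq_True)
        finally show "\<bar>h / k\<bar> \<le> min s' (1 - s')" .
      qed
      then show "v + h *\<^sub>R d \<in> z'" using k k0 by (simp add: d'_def[symmetric])
    qed
    have "v \<in> open_segment (v + (- \<epsilon>) *\<^sub>R d) (v + \<epsilon> *\<^sub>R d)"
      unfolding in_segment using \<epsilon> d0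
      by (intro conjI exI[of _ "1/2"]) (auto simp: algebra_simps scaleR_2[symmetric] eq_neg_iff_add_eq_0)
    then show False using v mem[of \<epsilon>] mem[of "- \<epsilon>"] \<epsilon> unfolding extreme_point_of_def by auto
  next
    case False
    obtain \<sigma> U where \<sigma>: "\<sigma> \<in> {1, -1}" "open U" "v \<in> U"
      and U: "\<And>y. y \<in> U \<Longrightarrow> \<sigma> * cross2 (q - p) (y - p) > 0 \<Longrightarrow> y \<in> interior z"
      using half_disc_interior[OF cell(1,4)[OF z(1)] pq] by blast
    \<comment> \<open>The direction of the segment of \<open>z'\<close>, oriented towards the side
      on which \<open>z\<close> contains a half disc.\<close>
    define n where "n = (\<sigma> * sgn (cross2 d (q' - p'))) *\<^sub>R (q' - p')"
    have "((\<lambda>k. v + k *\<^sub>R n) \<longlongrightarrow> v + 0 *\<^sub>R n) (at_right 0)" by (intro tendsto_intros)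
    then have "\<forall>\<^sub>F k in at_right 0. v + k *\<^sub>R n \<in> U" using \<sigma> by (intro topological_tendstoD) auto
    moreover have "\<forall>\<^sub>F k in at_right (0::real). k > 0" by (simp add: eventually_at_right_less)
    moreover have "\<forall>\<^sub>F k in at_right (0::real). k < min s' (1 - s')"
      using s' by (intro order_tendstoD(2)[OF tendsto_ident_at]) auto
    ultimately have "\<forall>\<^sub>F k in at_right 0. v + k *\<^sub>R n \<in> U \<and> k > 0 \<and> k < min s' (1 - s')" by eventually_elim auto
    then obtain k where k: "v + k *\<^sub>R n \<in> U" "k > 0" "k < min s' (1 - s')"
      using eventually_happens[of _ "at_right (0::real)"] by auto
    have "v + (k * (\<sigma> * sgn (cross2 d (q' - p')))) *\<^sub>R (q' - p') \<in> z'"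
      using k \<sigma>(1) False by (intro vz'mem) (auto simp: abs_mult)
    then have "v + k *\<^sub>R n \<in> z'" by (simp add: n_def)
    moreover have "v + k *\<^sub>R n \<in> interior z"
    proof (rule U[OF k(1)])
      have "v + k *\<^sub>R n - p = s *\<^sub>R d + k *\<^sub>R n" using vp by (simp add: algebra_simps)
      then have "\<sigma> * cross2 d (v + k *\<^sub>R n - p) = k * (\<sigma> * \<sigma>) * (sgn (cross2 d (q' - p')) * cross2 d (q' - p'))"
        by (simp only: n_def cross2_simps) simp
      also have "\<dots> > 0" using k \<sigma>(1) False by (auto simp: sgn_if)
      finally show "\<sigma> * cross2 (q - p) (v + k *\<^sub>R n - p) > 0" by (simp add: d_def)
    qed
    ultimately show False using interior_disjoint[OF z(2,1)] z(3) by auto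
  qed
qed

lemma corner_iff:
  "v \<in> cell_corners t \<longleftrightarrow> (\<exists>z\<in>t. \<exists>z'\<in>t. touch z z' \<and> v extreme_point_of (z \<inter> z'))"
proof
  assume v: "v \<in> cell_corners t"
  then obtain z where z: "z \<in> t" "v extreme_point_of z" by (auto simp: cell_corners_def)
  then have "v \<in> z" by (simp add: extreme_point_of_def)
  from card_neighbours_at_corner[OF z(1) this v] have "{z'\<in>t. touch z z' \<and> v extreme_point_of (z \<inter> z')} \<noteq> {}"
    by (intro notI) simp
  then show "\<exists>z\<in>t. \<exists>z'\<in>t. touch z z' \<and> v extreme_point_of (z \<inter> z')" using z(1) by blast
next
  assume "\<exists>z\<in>t. \<exists>z'\<in>t. touch z z' \<and> v extreme_point_of (z \<inter> z')"
  then show "v \<in> cell_corners t" using extreme_of_side_is_corner by (auto simp: touch_def)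
qed

end

section \<open>Products of convex sets, and components of partitions\<close>

lemma affine_hull_Times:
  fixes S :: "'a::euclidean_space set" and T :: "'b::euclidean_space set"
  shows "affine hull (S \<times> T) = (affine hull S) \<times> (affine hull T)"
proof
  have "affine ((affine hull S) \<times> (affine hull T))"
    unfolding affine_def[of "_ \<times> _"] by (auto intro: mem_affine[OF affine_affine_hull])
  then show "affine hull (S \<times> T) \<subseteq> (affine hull S) \<times> (affine hull T)"
    by (intro hull_minimal) (auto intro: hull_inc)
next
  let ?H = "affine hull (S \<times> T)"
  have H: "affine ?H" by simp
  \<comment> \<open>The slices of the hull in either coordinate are affine, so the hull can be taken
    in one coordinate at a time.\<close>
  have 1: "affine {x. (x, b) \<in> ?H}" for b
    unfolding affine_def[of "{x. (x, b) \<in> ?H}"]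
  proof (intro ballI allI impI CollectI)
    fix x y and u v :: real assume "x \<in> {x. (x, b) \<in> ?H}" "y \<in> {x. (x, b) \<in> ?H}" and uv: "u + v = 1"
    then have "u *\<^sub>R (x, b) + v *\<^sub>R (y, b) \<in> ?H" by (intro mem_affine[OF H]) auto
    also have "u *\<^sub>R (x, b) + v *\<^sub>R (y, b) = (u *\<^sub>R x + v *\<^sub>R y, (u + v) *\<^sub>R b)" by (simp add: scaleR_left_distrib)
    finally show "(u *\<^sub>R x + v *\<^sub>R y, b) \<in> ?H" using uv by simp
  qed
  have 2: "affine {y. (a, y) \<in> ?H}" for a
    unfolding affine_def[of "{y. (a, y) \<in> ?H}"]
  proof (intro ballI allI impI CollectI)
    fix x y and u v :: real assume "x \<in> {y. (a, y) \<in> ?H}" "y \<in> {y. (a, y) \<in> ?H}" and uv: "u + v = 1"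
    then have "u *\<^sub>R (a, x) + v *\<^sub>R (a, y) \<in> ?H" by (intro mem_affine[OF H]) auto
    also have "u *\<^sub>R (a, x) + v *\<^sub>R (a, y) = ((u + v) *\<^sub>R a, u *\<^sub>R x + v *\<^sub>R y)" by (simp add: scaleR_left_distrib)
    finally show "(a, u *\<^sub>R x + v *\<^sub>R y) \<in> ?H" using uv by simp
  qed
  have s1: "(x, b) \<in> ?H" if "x \<in> affine hull S" "b \<in> T" for x b
  proof -
    have "affine hull S \<subseteq> {x. (x, b) \<in> ?H}" using 1 that(2) by (intro hull_minimal) (auto intro: hull_inc)
    then show ?thesis using that by auto
  qed
  have s2: "(x, y) \<in> ?H" if "x \<in> affine hull S" "y \<in> affine hull T" for x y
  proof -
    have "affine hull T \<subseteq> {y. (x, y) \<in> ?H}" using 2 that(1) s1 by (intro hull_minimal) auto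
    then show ?thesis using that by auto
  qed
  then show "(affine hull S) \<times> (affine hull T) \<subseteq> ?H" by auto
qed

lemma aff_dim_Times:
  fixes S :: "'a::euclidean_space set" and T :: "'b::euclidean_space set"
  assumes "S \<noteq> {}" "T \<noteq> {}"
  shows "aff_dim (S \<times> T) = aff_dim S + aff_dim T"
proof -
  obtain a b where ab: "a \<in> affine hull S" "b \<in> affine hull T"
    using assms hull_subset[of S affine] hull_subset[of T affine] by blast
  let ?U = "(+) (-a) ` (affine hull S)" and ?W = "(+) (-b) ` (affine hull T)"
  have U: "subspace ?U" "subspace ?W"
    using ab affine_diffs_subspace by (metis affine_affine_hull uminus_add_conv_diff image_cong)+
  have "aff_dim (S \<times> T) = aff_dim ((affine hull S) \<times> (affine hull T))"
    by (metis aff_dim_affine_hull affine_hull_Times)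
  also have "\<dots> = aff_dim ((+) (-(a, b)) ` ((affine hull S) \<times> (affine hull T)))"
    by (rule aff_dim_translation_eq[symmetric])
  also have "(+) (-(a, b)) ` ((affine hull S) \<times> (affine hull T)) = ?U \<times> ?W"
    by (auto simp: image_iff)
  also have "aff_dim (?U \<times> ?W) = dim (?U \<times> ?W)"
    using U by (intro aff_dim_subspace subspace_Times)
  also have "\<dots> = dim ?U + dim ?W" using dim_Times[OF U] by simp
  also have "\<dots> = aff_dim ?U + aff_dim ?W" using U by (simp add: aff_dim_subspace)
  also have "\<dots> = aff_dim S + aff_dim T" by (simp only: aff_dim_translation_eq aff_dim_affine_hull)
  finally show ?thesis .
qed

lemma aff_dim_interval:
  fixes a b :: real
  shows "aff_dim {a..b} = (if a < b then 1 else if a = b then 0 else -1)"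
proof -
  have "aff_dim {a..b} \<le> 1" using aff_dim_le_DIM[of "{a..b}"] by simp
  moreover have "aff_dim {a..b} \<noteq> -1" if "a < b"
    using that by (simp add: aff_dim_empty[symmetric])
  moreover have "aff_dim {a..b} \<noteq> 0" if "a < b"
  proof -
    show "aff_dim {a..b} \<noteq> 0"
    proof
      assume "aff_dim {a..b} = 0"
      then obtain c where "{a..b} = {c}" by (auto simp: aff_dim_eq_0)
      then have "a \<in> {c}" "b \<in> {c}" using that by auto
      then show False using that by simp
    qed
  qed
  moreover have "aff_dim {a..b} \<ge> -1" by (rule aff_dim_geq)
  ultimately show ?thesis by auto
qed

lemma extreme_point_of_Times:
  fixes S :: "'a::euclidean_space set" and T :: "'b::euclidean_space set"
  shows "(v, h) extreme_point_of (S \<times> T) \<longleftrightarrow> v extreme_point_of S \<and> h extreme_point_of T"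
proof -
  have "{(v, h)} = {v} \<times> {h}" by auto
  then show ?thesis
    using face_of_Times_eq[of "{v}" "{h}" S T] by (metis face_of_singleton insert_not_empty)
qed

text \<open>A piece is open in the union, and so is the union of the other pieces; a component that
  meets a piece therefore cannot leave it.\<close>

lemma components_open_partition:
  assumes disj: "\<And>X Y. X \<in> \<F> \<Longrightarrow> Y \<in> \<F> \<Longrightarrow> X \<noteq> Y \<Longrightarrow> X \<inter> Y = {}"
    and conn: "\<And>X. X \<in> \<F> \<Longrightarrow> connected X" "\<And>X. X \<in> \<F> \<Longrightarrow> X \<noteq> {}"
    and op: "\<And>X. X \<in> \<F> \<Longrightarrow> openin (top_of_set (\<Union>\<F>)) X"
  shows "components (\<Union>\<F>) = \<F>"
proof -
  have cc: "connected_component_set (\<Union>\<F>) x = X" if X: "X \<in> \<F>" "x \<in> X" for X x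
  proof
    show "X \<subseteq> connected_component_set (\<Union>\<F>) x"
      using X conn by (intro connected_component_maximal) auto
    let ?C = "connected_component_set (\<Union>\<F>) x"
    have sub: "?C \<subseteq> \<Union>\<F>" by (rule connected_component_subset)
    have o: "openin (top_of_set ?C) (?C \<inter> Y)" if Y: "openin (top_of_set (\<Union>\<F>)) Y" for Y
    proof -
      obtain W where "open W" "Y = \<Union>\<F> \<inter> W" using Y by (auto simp: openin_open)
      then have "?C \<inter> Y = ?C \<inter> W" using sub by blast
      then show ?thesis using \<open>open W\<close> by (auto simp: openin_open)
    qed
    have o1: "openin (top_of_set ?C) (?C \<inter> X)" by (rule o[OF op[OF X(1)]])
    have "openin (top_of_set (\<Union>\<F>)) (\<Union>(\<F> - {X}))" using op by (intro openin_Union) auto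
    then have o2: "openin (top_of_set ?C) (?C \<inter> \<Union>(\<F> - {X}))" by (rule o)
    have "?C - ?C \<inter> X = ?C \<inter> \<Union>(\<F> - {X})" using sub disj X(1) by blast
    then have "closedin (top_of_set ?C) (?C \<inter> X)"
      using o2 by (auto simp: closedin_def)
    then have "?C \<inter> X = {} \<or> ?C \<inter> X = ?C"
      using o1 connected_connected_component[of "\<Union>\<F>" x] unfolding connected_clopen by blast
    moreover have "x \<in> ?C" using X by auto
    ultimately show "?C \<subseteq> X" using X(2) by blast
  qed
  have "components (\<Union>\<F>) = connected_component_set (\<Union>\<F>) ` (\<Union>\<F>)"
    by (auto simp: components_def)
  also have "\<dots> = \<F>"
  proof (intro set_eqI iffI)
    fix C assume "C \<in> connected_component_set (\<Union>\<F>) ` (\<Union>\<F>)"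
    then obtain x X where "X \<in> \<F>" "x \<in> X" "C = connected_component_set (\<Union>\<F>) x" by auto
    then show "C \<in> \<F>" using cc by auto
  next
    fix X assume X: "X \<in> \<F>"
    then obtain x where "x \<in> X" using conn by auto
    then show "X \<in> connected_component_set (\<Union>\<F>) ` (\<Union>\<F>)" using cc[OF X] X by force
  qed
  finally show ?thesis .
qed

text \<open>Relative openness follows from closedness and local finiteness: finitely many other
  pieces come near a point of \<open>X\<close>, and none of their closures contains it.\<close>

lemma components_locally_finite_partition:
  fixes \<F> :: "'a::metric_space set set"
  assumes disj: "\<And>X Y. X \<in> \<F> \<Longrightarrow> Y \<in> \<F> \<Longrightarrow> X \<noteq> Y \<Longrightarrow> X \<inter> Y = {}"
    and conn: "\<And>X. X \<in> \<F> \<Longrightarrow> connected X" "\<And>X. X \<in> \<F> \<Longrightarrow> X \<noteq> {}"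
    and cl: "\<And>X x. X \<in> \<F> \<Longrightarrow> x \<in> closure X \<Longrightarrow> x \<in> \<Union>\<F> \<Longrightarrow> x \<in> X"
    and fin: "\<And>x. finite {X\<in>\<F>. X \<inter> ball x 1 \<noteq> {}}"
  shows "components (\<Union>\<F>) = \<F>"
proof (rule components_open_partition[OF disj conn])
  fix X assume X: "X \<in> \<F>"
  show "openin (top_of_set (\<Union>\<F>)) X"
    unfolding openin_contains_ball
  proof (intro conjI ballI)
    fix x assume x: "x \<in> X"
    let ?K = "{Y\<in>\<F>. Y \<inter> ball x 1 \<noteq> {} \<and> Y \<noteq> X}"
    have "finite ?K" by (rule finite_subset[OF _ fin[of x]]) auto
    then have "closed (\<Union>(closure ` ?K))" by (intro closed_Union) auto
    then have "open (- \<Union>(closure ` ?K))" by (rule open_Compl)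
    moreover have "x \<in> - \<Union>(closure ` ?K)"
    proof
      assume "x \<in> \<Union>(closure ` ?K)"
      then obtain Y where Y: "Y \<in> \<F>" "Y \<noteq> X" "x \<in> closure Y" by auto
      then have "x \<in> Y" using cl X x by blast
      then show False using disj[OF X Y(1)] Y(2) x by auto
    qed
    ultimately obtain e where e: "e > 0" "ball x e \<subseteq> - \<Union>(closure ` ?K)" by (rule openE)
    have "ball x (min e 1) \<inter> \<Union>\<F> \<subseteq> X"
    proof
      fix y assume y: "y \<in> ball x (min e 1) \<inter> \<Union>\<F>"
      then obtain Y where Y: "Y \<in> \<F>" "y \<in> Y" by auto
      have yb: "y \<in> ball x e" "y \<in> ball x 1" using y by auto
      show "y \<in> X"
      proof (rule ccontr)
        assume "y \<notin> X"
        then have "Y \<in> ?K" using Y yb by auto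
        moreover have "y \<in> closure Y" using Y closure_subset by blast
        ultimately show False using e(2) yb by blast
      qed
    qed
    then show "\<exists>e>0. ball x e \<inter> \<Union>\<F> \<subseteq> X" using e(1) by (intro exI[of _ "min e 1"]) auto
  qed (use X in auto)
qed auto

subsection \<open>Discrete subsets of the line\<close>

text \<open>Heights for which a column is cut into bounded cells, locally finitely many.\<close>

definition bilat :: "real set \<Rightarrow> bool" where
  "bilat D \<longleftrightarrow> (\<forall>a b. finite (D \<inter> {a..b})) \<and> (\<forall>x. \<exists>h\<in>D. x < h) \<and> (\<forall>x. \<exists>h\<in>D. h < x)"

text \<open>The argument \<open>h\<close> need not belong to \<open>D\<close>: a height of one
  column is also compared with the next height of a neighbouring column.\<close>

definition succ :: "real set \<Rightarrow> real \<Rightarrow> real" where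
  "succ D h = Inf (D \<inter> {h<..})"

lemma bilat_succ_aux:
  assumes D: "bilat D"
  shows "succ D h \<in> D \<and> h < succ D h \<and> (\<forall>x\<in>D. h < x \<longrightarrow> succ D h \<le> x)"
proof -
  obtain u where u: "u \<in> D" "h < u" using D unfolding bilat_def by blast
  have "finite (D \<inter> {h..u})" using D by (auto simp: bilat_def)
  then have fin: "finite (D \<inter> {h<..u})" by (rule rev_finite_subset) auto
  have ne: "D \<inter> {h<..u} \<noteq> {}" using u by auto
  define m where "m = Min (D \<inter> {h<..u})"
  have m: "m \<in> D" "h < m" "m \<le> u" using Min_in[OF fin ne] by (auto simp: m_def)
  have le: "m \<le> x" if "x \<in> D" "h < x" for x
  proof (cases "x \<le> u")
    case True
    then show ?thesis using that fin unfolding m_def by (intro Min_le) auto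
  qed (use m in auto)
  have "succ D h = m" unfolding succ_def by (rule cInf_eq_minimum) (use m le in auto)
  then show ?thesis using m le by auto
qed

lemma bilat_succ:
  assumes "bilat D"
  shows "succ D h \<in> D" "h < succ D h" "x \<in> D \<Longrightarrow> h < x \<Longrightarrow> succ D h \<le> x"
  using bilat_succ_aux[OF assms, of h] by auto

lemma succ_eqI:
  assumes "h' \<in> D" "h < h'" "\<And>x. x \<in> D \<Longrightarrow> h < x \<Longrightarrow> h' \<le> x"
  shows "succ D h = h'"
  unfolding succ_def by (rule cInf_eq_minimum) (use assms in auto)

lemma bilat_floor:
  assumes D: "bilat D"
  shows "\<exists>h\<in>D. h \<le> x \<and> x < succ D h"
proof -
  obtain l where l: "l \<in> D" "l < x" using D unfolding bilat_def by blast
  have fin: "finite (D \<inter> {l..x})" using D by (auto simp: bilat_def)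
  have ne: "D \<inter> {l..x} \<noteq> {}" using l by auto
  define m where "m = Max (D \<inter> {l..x})"
  have m: "m \<in> D" "l \<le> m" "m \<le> x" using Max_in[OF fin ne] by (auto simp: m_def)
  have "x < succ D m"
  proof (rule ccontr)
    assume "\<not> x < succ D m"
    then have "succ D m \<in> D \<inter> {l..x}" using bilat_succ[OF D, of m] m by auto
    then have "succ D m \<le> m" unfolding m_def using fin by (intro Max_ge) (auto simp: m_def)
    then show False using bilat_succ(2)[OF D, of m] by simp
  qed
  then show ?thesis using m by auto
qed

lemma bilat_pred:
  assumes D: "bilat D" and h: "h \<in> D"
  shows "\<exists>h0\<in>D. succ D h0 = h"
proof -
  obtain l where l: "l \<in> D" "l < h" using D unfolding bilat_def by blast
  have "finite (D \<inter> {l..h})" using D by (auto simp: bilat_def)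
  then have fin: "finite (D \<inter> {l..<h})" by (rule rev_finite_subset) auto
  have ne: "D \<inter> {l..<h} \<noteq> {}" using l by auto
  define m where "m = Max (D \<inter> {l..<h})"
  have m: "m \<in> D" "l \<le> m" "m < h" using Max_in[OF fin ne] by (auto simp: m_def)
  have "succ D m = h"
  proof (rule succ_eqI[OF h m(3)])
    fix x assume x: "x \<in> D" "m < x"
    show "h \<le> x"
    proof (rule ccontr)
      assume "\<not> h \<le> x"
      then have "x \<le> m" unfolding m_def using fin x m by (intro Max_ge) auto
      then show False using x by simp
    qed
  qed
  then show ?thesis using m by auto
qed

lemma bilat_interval_unique:
  assumes D: "bilat D" and h: "h \<in> D" "h' \<in> D" "h \<le> x" "x < succ D h" "h' \<le> x" "x < succ D h'"
  shows "h = h'"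
  using bilat_succ(3)[OF D h(1), of h'] bilat_succ(3)[OF D h(2), of h] h by force

text \<open>A gap reaching above \<open>a\<close> cannot start before a point of \<open>D\<close>
  below \<open>a\<close>, since it would have ended there.\<close>

lemma bilat_finite_intervals:
  assumes D: "bilat D"
  shows "finite {h\<in>D. h \<le> b \<and> a < succ D h}"
proof -
  obtain l where l: "l \<in> D" "l < a" using D unfolding bilat_def by blast
  have "{h\<in>D. h \<le> b \<and> a < succ D h} \<subseteq> D \<inter> {l..b}"
  proof
    fix h assume h: "h \<in> {h\<in>D. h \<le> b \<and> a < succ D h}"
    have "\<not> h < l" using bilat_succ(3)[OF D l(1), of h] l(2) h by auto
    then show "h \<in> D \<inter> {l..b}" using h by auto
  qed
  then show ?thesis using D finite_subset unfolding bilat_def by blast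
qed

lemma components_Compl_bilat:
  assumes D: "bilat D"
  shows "components (- D) = (\<lambda>h. {h<..<succ D h}) ` D"
proof -
  have U: "- D = \<Union>((\<lambda>h. {h<..<succ D h}) ` D)"
  proof (intro set_eqI iffI)
    fix x assume x: "x \<in> - D"
    obtain h where "h \<in> D" "h \<le> x" "x < succ D h" using bilat_floor[OF D] by blast
    moreover have "h \<noteq> x" using x calculation by auto
    ultimately show "x \<in> \<Union>((\<lambda>h. {h<..<succ D h}) ` D)" by force
  next
    fix x assume "x \<in> \<Union>((\<lambda>h. {h<..<succ D h}) ` D)"
    then obtain h where "h < x" "x < succ D h" by auto
    then show "x \<in> - D" using bilat_succ(3)[OF D, of x h] by auto
  qed
  show ?thesis unfolding U
  proof (rule components_open_partition)
    fix X Y assume "X \<in> (\<lambda>h. {h<..<succ D h}) ` D" "Y \<in> (\<lambda>h. {h<..<succ D h}) ` D" "X \<noteq> Y"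
    then obtain h h' where h: "h \<in> D" "h' \<in> D" "X = {h<..<succ D h}" "Y = {h'<..<succ D h'}" "h \<noteq> h'" by auto
    show "X \<inter> Y = {}"
    proof (rule ccontr)
      assume "X \<inter> Y \<noteq> {}"
      then obtain x where "x \<in> X" "x \<in> Y" by blast
      then have "h < x" "x < succ D h" "h' < x" "x < succ D h'" using h by auto
      then have "h = h'" by (intro bilat_interval_unique[OF D h(1,2), of x]) auto
      then show False using h(5) by simp
    qed
  next
    fix X assume "X \<in> (\<lambda>h. {h<..<succ D h}) ` D"
    then obtain h where h: "h \<in> D" "X = {h<..<succ D h}" by auto
    show "connected X" using h by (simp add: convex_connected)
    show "X \<noteq> {}" using h bilat_succ(2)[OF D, of h] dense by auto
    show "openin (top_of_set (\<Union>((\<lambda>h. {h<..<succ D h}) ` D))) X"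
      using h by (intro open_subset) auto
  qed
qed

lemma bilat_UN:
  assumes "finite I" "I \<noteq> {}" "\<And>i. i \<in> I \<Longrightarrow> bilat (D i)"
  shows "bilat (\<Union>i\<in>I. D i)"
proof -
  have "finite ((\<Union>i\<in>I. D i) \<inter> {a..b})" for a b
  proof -
    have "(\<Union>i\<in>I. D i) \<inter> {a..b} = (\<Union>i\<in>I. D i \<inter> {a..b})" by auto
    also have "finite \<dots>" using assms(1,3) by (intro finite_UN_I) (auto simp: bilat_def)
    finally show ?thesis .
  qed
  moreover obtain i where i: "i \<in> I" using assms by auto
  have sub: "D i \<subseteq> (\<Union>i\<in>I. D i)" using i by blast
  have "\<exists>h\<in>\<Union>i\<in>I. D i. x < h" "\<exists>h\<in>\<Union>i\<in>I. D i. h < x" for x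
  proof -
    have "\<exists>h\<in>D i. x < h" "\<exists>h\<in>D i. h < x" using assms(3)[OF i] by (simp_all add: bilat_def)
    then show "\<exists>h\<in>\<Union>i\<in>I. D i. x < h" "\<exists>h\<in>\<Union>i\<in>I. D i. h < x" using sub by (meson subsetD)+
  qed
  ultimately show ?thesis unfolding bilat_def by simp
qed

lemma succ_Un:
  assumes "bilat D" "bilat D'"
  shows "succ (D \<union> D') h = min (succ D h) (succ D' h)"
proof (rule succ_eqI)
  show "min (succ D h) (succ D' h) \<in> D \<union> D'"
    using bilat_succ(1)[OF assms(1), of h] bilat_succ(1)[OF assms(2), of h] by (auto simp: min_def)
  show "h < min (succ D h) (succ D' h)"
    using bilat_succ(2)[OF assms(1), of h] bilat_succ(2)[OF assms(2), of h] by simp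
  fix x assume "x \<in> D \<union> D'" "h < x"
  then show "min (succ D h) (succ D' h) \<le> x"
    using bilat_succ(3)[OF assms(1), of x h] bilat_succ(3)[OF assms(2), of x h] by auto
qed

text \<open>For a set with successors this says that the midpoint of \<open>h\<close> and its
  successor lies below \<open>c\<close>. The existential form avoids the infimum and is visibly
  measurable in a random configuration.\<close>

definition before_midpoint :: "real set \<Rightarrow> real \<Rightarrow> real \<Rightarrow> bool" where
  "before_midpoint D h c \<longleftrightarrow> (\<exists>x\<in>D. h < x \<and> h + x < 2 * c)"

lemma before_midpoint_iff:
  assumes "bilat D"
  shows "before_midpoint D h c \<longleftrightarrow> (h + succ D h) / 2 < c"
proof
  assume "before_midpoint D h c"
  then obtain x where x: "x \<in> D" "h < x" "h + x < 2 * c" by (auto simp: before_midpoint_def)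
  from bilat_succ(3)[OF assms x(1,2)] x(3) show "(h + succ D h) / 2 < c" by simp
next
  assume "(h + succ D h) / 2 < c"
  then show "before_midpoint D h c"
    unfolding before_midpoint_def using bilat_succ(1,2)[OF assms, of h] by (intro bexI[of _ "succ D h"]) auto
qed

lemma platesI:
  assumes "c \<in> Y" "c' \<in> Y" "c \<noteq> c'" "p = c \<inter> c'" "aff_dim p = 2"
  shows "p \<in> plates Y"
  unfolding plates_def by (rule CollectI, rule bexI[OF _ assms(1)], rule bexI[OF _ assms(2)]) (use assms in simp)

subsection \<open>Primitive elements of a column tessellation\<close>

text \<open>One realization outside the exceptional null set; the geometry proved here is
  deterministic.\<close>

locale column_tess = planar_tess t for t +
  fixes \<psi> :: "((real^2) set \<times> real) set"
  assumes sub: "\<psi> \<subseteq> t \<times> UNIV"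
    and bi: "z \<in> t \<Longrightarrow> bilat (\<psi> `` {z})"
    and nc: "(z, h) \<in> \<psi> \<Longrightarrow> (z', h) \<in> \<psi> \<Longrightarrow> z = z'"
begin

abbreviation heights :: "(real^2) set set \<Rightarrow> real set" where
  "heights A \<equiv> \<psi> `` A"

lemma in_t: "(z, h) \<in> \<psi> \<Longrightarrow> z \<in> t"
  using sub by auto

lemma bilat_heights:
  assumes "finite A" "A \<noteq> {}" "A \<subseteq> t"
  shows "bilat (heights A)"
proof -
  have "heights A = (\<Union>z\<in>A. heights {z})" by auto
  moreover have "bilat (\<Union>z\<in>A. heights {z})"
    using assms(3) bi by (intro bilat_UN assms(1,2)) (rule bi, blast)
  ultimately show ?thesis by (simp only:)
qed

lemma bilat_pair: "z \<in> t \<Longrightarrow> z' \<in> t \<Longrightarrow> bilat (heights {z, z'})"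
  by (intro bilat_heights) auto

abbreviation heights_at :: "real^2 \<Rightarrow> real set" where
  "heights_at v \<equiv> heights {y. v \<in> y}"

lemma heights_at_eq: "heights_at v = heights {y\<in>t. v \<in> y}"
  using in_t by auto

lemma bilat_at: "bilat (heights_at v)"
proof -
  have "{y\<in>t. v \<in> y} \<noteq> {}" using cover[of v] by auto
  then show ?thesis unfolding heights_at_eq using finite_cells_at by (intro bilat_heights) auto
qed

text \<open>Every gap of the heights has a lower end, so a prism is named by the plate at its
  bottom.\<close>

lemma column_cells_eq: "column_cells t \<psi> = (\<lambda>(z, h). z \<times> {h..succ (heights {z}) h}) ` \<psi>"
proof -
  have cl: "closure {h<..<succ (heights {z}) h} = {h..succ (heights {z}) h}" if "z \<in> t" for z h
    using bilat_succ(2)[OF bi[OF that], of h] by (simp add: closure_greaterThanLessThan)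
  show ?thesis
  proof (intro set_eqI iffI)
    fix c assume "c \<in> column_cells t \<psi>"
    then obtain z I where z: "z \<in> t" and I: "I \<in> components (- (\<psi> `` {z}))" and c: "c = z \<times> closure I"
      unfolding column_cells_def by blast
    obtain h where h: "h \<in> \<psi> `` {z}" "I = {h<..<succ (heights {z}) h}"
      using I unfolding components_Compl_bilat[OF bi[OF z]] by blast
    then show "c \<in> (\<lambda>(z, h). z \<times> {h..succ (heights {z}) h}) ` \<psi>"
      using c cl[OF z] by (intro image_eqI[of _ _ "(z, h)"]) auto
  next
    fix c assume "c \<in> (\<lambda>(z, h). z \<times> {h..succ (heights {z}) h}) ` \<psi>"
    then obtain z h where h: "(z, h) \<in> \<psi>" and c: "c = z \<times> {h..succ (heights {z}) h}" by auto
    have z: "z \<in> t" using in_t[OF h] .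
    have "{h<..<succ (heights {z}) h} \<in> components (- (\<psi> `` {z}))"
      unfolding components_Compl_bilat[OF bi[OF z]] using h by auto
    then show "c \<in> column_cells t \<psi>" unfolding column_cells_def
      using z c cl[OF z, of h] by blast
  qed
qed

lemma Times_interval_eq:
  fixes a b a' b' :: real
  assumes "A \<times> {a..b} = A' \<times> {a'..b'}" "A \<noteq> {}" "a \<le> b"
  shows "A = A'" "a = a'" "b = b'"
  using assms by (auto simp: times_eq_iff Icc_eq_Icc)

lemma inj_cells: "inj_on (\<lambda>(z, h). z \<times> {h..succ (heights {z}) h}) \<psi>"
proof (rule inj_onI, clarify)
  fix z h z' h' assume z: "(z, h) \<in> \<psi>" and e: "z \<times> {h..succ (heights {z}) h} = z' \<times> {h'..succ (heights {z'}) h'}"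
  show "z = z' \<and> h = h'"
    using Times_interval_eq[OF e cell(5)[OF in_t[OF z]]] bilat_succ(2)[OF bi[OF in_t[OF z]], of h] by auto
qed

text \<open>The pair of cells is ordered: the height belongs to the column of the first. Both orders
  give the same segment but different heights, which is why flags index each element once.\<close>

definition flags :: "((real^2) set \<times> (real^2) set \<times> real) set" where
  "flags = {(z, z', h). z' \<in> t \<and> touch z z' \<and> (z, h) \<in> \<psi>}"

definition hplate :: "(real^2) set \<times> real \<Rightarrow> ((real^2) \<times> real) set" where
  "hplate = (\<lambda>(z, h). z \<times> {h})"

definition vplate :: "(real^2) set \<times> (real^2) set \<times> real \<Rightarrow> ((real^2) \<times> real) set" where
  "vplate = (\<lambda>(z, z', h). (z \<inter> z') \<times> {h..succ (heights {z, z'}) h})"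

lemma flagsD:
  assumes "(z, z', h) \<in> flags"
  shows "z \<in> t" "z' \<in> t" "z \<noteq> z'" "touch z z'" "(z, h) \<in> \<psi>"
  using assms in_t by (auto simp: flags_def touch_def)

lemma aff_dim_cell: "z \<in> t \<Longrightarrow> aff_dim z = 2"
  using aff_dim_nonempty_interior[OF cell(4)] by simp

lemma aff_dim_side:
  assumes "z \<in> t" "z' \<in> t" "touch z z'" shows "aff_dim (z \<inter> z') = 1"
proof -
  obtain a b where ab: "a \<noteq> b" "z \<inter> z' = closed_segment a b" using neighbour_segment[OF assms] by auto
  have "aff_dim (closed_segment a b) = aff_dim {a, b}"
    by (metis aff_dim_convex_hull segment_convex_hull)
  then show ?thesis using ab by simp
qed

text \<open>Two prisms meet in the product of the common part of their bases and a height interval,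
  and the affine dimensions of the factors must add up to 2. Equal bases leave a single height;
  different bases have a common part of dimension at most one, so both factors are nondegenerate
  segments.\<close>

lemma plates_eq: "plates (column_cells t \<psi>) = hplate ` \<psi> \<union> vplate ` flags"
proof (intro set_eqI iffI)
  fix p assume "p \<in> plates (column_cells t \<psi>)"
  then obtain c c' where cc: "c \<in> column_cells t \<psi>" "c' \<in> column_cells t \<psi>" "c \<noteq> c'" and p: "p = c \<inter> c'" and dim: "aff_dim p = 2"
    by (auto simp: plates_def)
  obtain z h where h: "(z, h) \<in> \<psi>" and c: "c = z \<times> {h..succ (heights {z}) h}"
    using cc(1) unfolding column_cells_eq by auto
  obtain z' h' where h': "(z', h') \<in> \<psi>" and c': "c' = z' \<times> {h'..succ (heights {z'}) h'}"
    using cc(2) unfolding column_cells_eq by auto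
  note zt = in_t[OF h] in_t[OF h']
  define J where "J = {max h h'..min (succ (heights {z}) h) (succ (heights {z'}) h')}"
  have pJ: "p = (z \<inter> z') \<times> J" unfolding p c c' J_def by auto
  have ne: "p \<noteq> {}" using dim by auto
  then have ne': "z \<inter> z' \<noteq> {}" "J \<noteq> {}" using pJ by auto
  have dimp: "aff_dim (z \<inter> z') + aff_dim J = 2" using dim aff_dim_Times[OF ne'] pJ by simp
  show "p \<in> hplate ` \<psi> \<union> vplate ` flags"
  proof (cases "z = z'")
    case True
    then have "h \<noteq> h'" using cc(3) c c' by auto
    have "aff_dim J = 0" using dimp True aff_dim_cell[OF zt(1)] by simp
    then have mm: "max h h' = min (succ (heights {z}) h) (succ (heights {z'}) h')"
      unfolding J_def aff_dim_interval by (simp split: if_splits)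
    then have "p = z \<times> {max h h'}" unfolding pJ J_def using True by simp
    moreover have "(z, max h h') \<in> \<psi>" using h h' True by (auto simp: max_def)
    ultimately show ?thesis unfolding hplate_def by force
  next
    case False
    have J1: "aff_dim J \<le> 1" using aff_dim_le_DIM[of J] by simp
    have "aff_dim (z \<inter> z') \<noteq> 0" using dimp J1 by auto
    then have "\<not> (\<exists>a. z \<inter> z' = {a})" by (simp add: aff_dim_eq_0)
    then have touch: "touch z z'" using ne'(1) False unfolding touch_def by blast
    have "aff_dim J = 1" using dimp aff_dim_side[OF zt touch] by simp
    then have lt: "max h h' < min (succ (heights {z}) h) (succ (heights {z'}) h')"
      unfolding J_def aff_dim_interval by (simp split: if_splits)
    have hz: "heights {z, z'} = heights {z} \<union> heights {z'}" by auto
    \<comment> \<open>Neither prism is cut inside its own height range, so no height of either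
      column lies strictly inside the common interval.\<close>
    have s: "succ (heights {z, z'}) (max h h') = min (succ (heights {z}) h) (succ (heights {z'}) h')"
    proof (rule succ_eqI[OF _ lt])
      show "min (succ (heights {z}) h) (succ (heights {z'}) h') \<in> heights {z, z'}"
        using bilat_succ(1)[OF bi[OF zt(1)], of h] bilat_succ(1)[OF bi[OF zt(2)], of h'] by (auto simp: min_def)
      fix x assume x: "x \<in> heights {z, z'}" "max h h' < x"
      show "min (succ (heights {z}) h) (succ (heights {z'}) h') \<le> x"
      proof (cases "x \<in> heights {z}")
        case True
        then show ?thesis using bilat_succ(3)[OF bi[OF zt(1)], of x h] x by auto
      next
        case False
        then have "x \<in> heights {z'}" using x hz by auto
        then show ?thesis using bilat_succ(3)[OF bi[OF zt(2)], of x h'] x by auto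
      qed
    qed
    \<comment> \<open>The plate in both orientations; the flag is the one whose first column
      contains the lower height \<open>max h h'\<close>.\<close>
    have p1: "p = vplate (z, z', max h h')" unfolding pJ J_def vplate_def by (simp only: prod.case s)
    have p2: "p = vplate (z', z, max h h')" unfolding p1 vplate_def by (simp add: Int_commute insert_commute)
    show ?thesis
    proof (cases "h' \<le> h")
      case True
      then have "(z, z', max h h') \<in> flags" using h zt touch by (auto simp: flags_def max_def)
      then show ?thesis using p1 by blast
    next
      case False
      then have "(z', z, max h h') \<in> flags" using h' zt touch touch_sym by (auto simp: flags_def max_def)
      then show ?thesis using p2 by blast
    qed
  qed
next
  fix p assume p: "p \<in> hplate ` \<psi> \<union> vplate ` flags"
  show "p \<in> plates (column_cells t \<psi>)"
  proof (cases "p \<in> hplate ` \<psi>")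
    case True
    then obtain z h where h: "(z, h) \<in> \<psi>" and p: "p = z \<times> {h}" by (auto simp: hplate_def)
    have z: "z \<in> t" using in_t[OF h] .
    \<comment> \<open>A horizontal plate separates the prism ending at its height from the prism
      starting there; the former is found through the preceding height.\<close>
    obtain h0 where h0: "h0 \<in> heights {z}" "succ (heights {z}) h0 = h"
      using bilat_pred[OF bi[OF z], of h] h by auto
    let ?c = "z \<times> {h0..h}" and ?c' = "z \<times> {h..succ (heights {z}) h}"
    have lt: "h0 < h" "h < succ (heights {z}) h" using bilat_succ(2)[OF bi[OF z]] h0(2) by auto
    have "?c \<in> column_cells t \<psi>" "?c' \<in> column_cells t \<psi>"
      unfolding column_cells_eq using h0 h by force+
    moreover have "?c \<noteq> ?c'"
      using Times_interval_eq(2)[of z h0 h z h "succ (heights {z}) h"] lt cell(5)[OF z] by auto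
    moreover have "p = ?c \<inter> ?c'" unfolding p using lt by auto
    moreover have "aff_dim p = 2" unfolding p using aff_dim_Times[OF cell(5)[OF z], of "{h}"] aff_dim_cell[OF z] by simp
    ultimately show ?thesis by (rule platesI)
  next
    case False
    then obtain z z' h where f: "(z, z', h) \<in> flags" and p: "p = (z \<inter> z') \<times> {h..succ (heights {z, z'}) h}"
      using p by (auto simp: vplate_def)
    note fz = flagsD[OF f]
    \<comment> \<open>The prism over the neighbour that stands beside the plate: the one whose
      half-open height range contains \<open>h\<close>.\<close>
    obtain h' where h': "h' \<in> heights {z'}" "h' \<le> h" "h < succ (heights {z'}) h'"
      using bilat_floor[OF bi[OF fz(2)]] by blast
    have "succ (heights {z'}) h = succ (heights {z'}) h'"
    proof (rule succ_eqI)
      show "succ (heights {z'}) h' \<in> heights {z'}" by (rule bilat_succ(1)[OF bi[OF fz(2)]])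
      show "h < succ (heights {z'}) h'" by (rule h'(3))
      fix x assume x: "x \<in> heights {z'}" "h < x"
      show "succ (heights {z'}) h' \<le> x" by (rule bilat_succ(3)[OF bi[OF fz(2)] x(1)]) (use x h' in simp)
    qed
    moreover have "heights {z, z'} = heights {z} \<union> heights {z'}" by auto
    ultimately have s: "succ (heights {z, z'}) h = min (succ (heights {z}) h) (succ (heights {z'}) h')"
      using succ_Un[OF bi[OF fz(1)] bi[OF fz(2)], of h] by simp
    let ?c = "z \<times> {h..succ (heights {z}) h}" and ?c' = "z' \<times> {h'..succ (heights {z'}) h'}"
    have "?c \<in> column_cells t \<psi>" "?c' \<in> column_cells t \<psi>"
      unfolding column_cells_eq using h' fz by force+
    moreover have "?c \<noteq> ?c'"
      using Times_interval_eq(1)[of z h "succ (heights {z}) h" z' h' "succ (heights {z'}) h'"] cell(5)[OF fz(1)] fz(3)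
        bilat_succ(2)[OF bi[OF fz(1)], of h] by auto
    moreover have "p = ?c \<inter> ?c'" unfolding p s using h'(2) by auto
    moreover have "aff_dim p = 2"
    proof -
      have "h < succ (heights {z, z'}) h" using bilat_succ(2)[OF bilat_pair[OF fz(1,2)]] .
      moreover have "z \<inter> z' \<noteq> {}" using fz(4) by (auto simp: touch_def)
      ultimately show ?thesis unfolding p using aff_dim_side[OF fz(1,2,4)]
        by (subst aff_dim_Times) (auto simp: aff_dim_interval)
    qed
    ultimately show ?thesis by (rule platesI)
  qed
qed

lemma inj_hplate: "inj_on hplate \<psi>"
proof (rule inj_onI, clarify)
  fix z h z' h' assume z: "(z, h) \<in> \<psi>" and e: "hplate (z, h) = hplate (z', h')"
  then show "z = z' \<and> h = h'" using cell(5)[OF in_t[OF z]] by (auto simp: hplate_def times_eq_iff)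
qed

text \<open>A relative interior point of a side lies in no third cell.\<close>

lemma side_determines:
  assumes z: "z \<in> t" "z' \<in> t" "touch z z'" and y: "y \<in> t" "y' \<in> t" "touch y y'"
    and m: "m \<in> rel_interior (z \<inter> z')" "m \<in> y" "m \<in> y'"
  shows "y = z \<and> y' = z' \<or> y = z' \<and> y' = z"
proof -
  obtain a b where ab: "a \<noteq> b" "z \<inter> z' = closed_segment a b" using neighbour_segment[OF z] by auto
  then have o: "m \<in> open_segment a b" using m(1) by (simp add: rel_interior_closed_segment)
  have e: "a \<in> z \<inter> z'" "b \<in> z \<inter> z'" unfolding ab by auto
  have n: "z \<noteq> z'" "y \<noteq> y'" using z(3) y(3) by (auto simp: touch_def)
  from two_cells[OF z(1,2) n(1) e o y(1) m(2)] two_cells[OF z(1,2) n(1) e o y(2) m(3)] n(2)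
  show ?thesis by auto
qed

lemma side_rel_interior:
  assumes "z \<in> t" "z' \<in> t" "touch z z'"
  shows "rel_interior (z \<inter> z') \<noteq> {}" "rel_interior (z \<inter> z') \<subseteq> z \<inter> z'" "convex (z \<inter> z')" "compact (z \<inter> z')"
    "z \<inter> z' \<noteq> {}" "connected (rel_interior (z \<inter> z'))" "closure (rel_interior (z \<inter> z')) = z \<inter> z'"
proof -
  show c: "convex (z \<inter> z')" and k: "compact (z \<inter> z')"
    using cell(1,2)[OF assms(1)] cell(1,2)[OF assms(2)] by (auto intro: convex_Int)
  show ne: "z \<inter> z' \<noteq> {}" using assms(3) by (auto simp: touch_def)
  show "rel_interior (z \<inter> z') \<noteq> {}" using rel_interior_eq_empty[OF c] ne by simp
  show "rel_interior (z \<inter> z') \<subseteq> z \<inter> z'" by (rule rel_interior_subset)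
  show "connected (rel_interior (z \<inter> z'))" using c by (intro convex_connected convex_rel_interior)
  show "closure (rel_interior (z \<inter> z')) = z \<inter> z'"
    using convex_closure_rel_interior[OF c] compact_imp_closed[OF k] by simp
qed

lemma side_eq_imp:
  assumes "z \<in> t" "z' \<in> t" "touch z z'" "y \<in> t" "y' \<in> t" "touch y y'" "z \<inter> z' = y \<inter> y'"
  shows "y = z \<and> y' = z' \<or> y = z' \<and> y' = z"
proof -
  obtain m where m: "m \<in> rel_interior (z \<inter> z')" using side_rel_interior(1)[OF assms(1-3)] by auto
  then have "m \<in> y \<inter> y'" using side_rel_interior(2)[OF assms(1-3)] assms(7) by blast
  then show ?thesis using side_determines[OF assms(1-6) m] by auto
qed

text \<open>The shared segment determines the two cells up to order, and the lower height determines
  the order because no two columns share a height.\<close>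

lemma inj_vplate: "inj_on vplate flags"
proof (rule inj_onI)
  fix a b assume ab: "a \<in> flags" "b \<in> flags" "vplate a = vplate b"
  obtain z z' h y y' k where abe: "a = (z, z', h)" "b = (y, y', k)" by (cases a, cases b) auto
  note f = ab(1,2)[unfolded abe] and e = ab(3)[unfolded abe]
  note fz = flagsD[OF f(1)] and fy = flagsD[OF f(2)]
  have eq: "z \<inter> z' = y \<inter> y'" "h = k"
    using Times_interval_eq[OF e[unfolded vplate_def prod.case]] side_rel_interior(5)[OF fz(1,2,4)]
      bilat_succ(2)[OF bilat_pair[OF fz(1,2)], of h] by auto
  have "z = y" using nc[of z h y] fz(5) fy(5) eq(2) by simp
  moreover have "y = z \<and> y' = z' \<or> y = z' \<and> y' = z"
    using side_eq_imp[OF fz(1,2,4) fy(1,2,4) eq(1)] .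
  ultimately show "a = b" unfolding abe using eq(2) fz(3) by auto
qed

lemma extreme_interval:
  fixes a b :: real assumes "a < b"
  shows "h extreme_point_of {a..b} \<longleftrightarrow> h = a \<or> h = b"
proof -
  have "{a..b} = closed_segment a b" using assms by (simp add: closed_segment_eq_real_ivl)
  then show ?thesis by (simp add: extreme_point_of_segment)
qed

text \<open>Extreme points of a product are pairs of extreme points. Every height of every cell
  containing the corner occurs: also where the corner lies inside a straight side of a cell, a
  segment shared with a neighbour ends there.\<close>

lemma vertices_eq: "vertices (column_cells t \<psi>) = {(v, h). v \<in> cell_corners t \<and> h \<in> heights_at v}"
proof (intro set_eqI iffI)
  fix x assume "x \<in> vertices (column_cells t \<psi>)"
  then obtain p where p: "p \<in> plates (column_cells t \<psi>)" "x extreme_point_of p" by (auto simp: vertices_def)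
  obtain v k where x: "x = (v, k)" by (cases x)
  consider (h) z h where "(z, h) \<in> \<psi>" "p = z \<times> {h}"
    | (v) z z' h where "(z, z', h) \<in> flags" "p = (z \<inter> z') \<times> {h..succ (heights {z, z'}) h}"
    using p(1) unfolding plates_eq hplate_def vplate_def by auto
  then show "x \<in> {(v, h). v \<in> cell_corners t \<and> h \<in> heights_at v}"
  proof cases
    case h
    then have "v extreme_point_of z" "k = h" using p(2) x by (auto simp: extreme_point_of_Times)
    then show ?thesis using h in_t[OF h(1)] x unfolding cell_corners_def by (auto simp: extreme_point_of_def)
  next
    case v
    note fz = flagsD[OF v(1)]
    have lt: "h < succ (heights {z, z'}) h" using bilat_succ(2)[OF bilat_pair[OF fz(1,2)]] .
    have e: "v extreme_point_of (z \<inter> z')" "k = h \<or> k = succ (heights {z, z'}) h"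
      using p(2) x v(2) extreme_interval[OF lt] by (auto simp: extreme_point_of_Times)
    have "k \<in> heights {z, z'}" using e(2) bilat_succ(1)[OF bilat_pair[OF fz(1,2)], of h] fz(5) by auto
    moreover have "v \<in> z" "v \<in> z'" using e(1) by (auto simp: extreme_point_of_def)
    ultimately have "k \<in> heights_at v" by auto
    then show ?thesis using extreme_of_side_is_corner[OF fz(1-3) e(1)] x by auto
  qed
next
  fix x assume "x \<in> {(v, h). v \<in> cell_corners t \<and> h \<in> heights_at v}"
  then obtain v h y where x: "x = (v, h)" "v \<in> cell_corners t" "v \<in> y" "(y, h) \<in> \<psi>" by auto
  have y: "y \<in> t" using in_t[OF x(4)] .
  \<comment> \<open>A neighbour whose shared segment ends at \<open>v\<close>; the vertical plate
    over that segment, starting at \<open>h\<close>, has the required extreme point.\<close>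
  have "{z'\<in>t. touch y z' \<and> v extreme_point_of (y \<inter> z')} \<noteq> {}"
    using card_neighbours_at_corner[OF y x(3,2)] by (intro notI) simp
  then obtain z' where z': "z' \<in> t" "touch y z'" "v extreme_point_of (y \<inter> z')" by auto
  have "(y, z', h) \<in> flags" using z' x by (auto simp: flags_def)
  then have "vplate (y, z', h) \<in> plates (column_cells t \<psi>)" unfolding plates_eq by auto
  moreover have "x extreme_point_of vplate (y, z', h)"
    unfolding vplate_def x(1) using z'(3) extreme_interval[OF bilat_succ(2)[OF bilat_pair[OF y z'(1)], of h]]
    by (auto simp: extreme_point_of_Times)
  ultimately show "x \<in> vertices (column_cells t \<psi>)" by (auto simp: vertices_def)
qed

end

lemma finite_extreme_points_polytope:
  assumes "polytope S" shows "finite {x. x extreme_point_of S}"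
proof -
  obtain v where v: "finite v" "S = convex hull v" using assms by (auto simp: polytope_def)
  have "{x. x extreme_point_of S} \<subseteq> v" unfolding v(2) using extreme_point_of_convex_hull by blast
  then show ?thesis using v(1) finite_subset by blast
qed

lemma (in tess) finite_corners:
  assumes "bounded B" shows "finite (cell_corners t \<inter> B)"
proof (rule finite_subset)
  show "cell_corners t \<inter> B \<subseteq> (\<Union>z\<in>{z\<in>t. z \<inter> B \<noteq> {}}. {x. x extreme_point_of z})"
  proof
    fix v assume v: "v \<in> cell_corners t \<inter> B"
    then obtain z where "z \<in> t" "v extreme_point_of z" by (auto simp: cell_corners_def)
    moreover have "v \<in> z" using calculation(2) by (simp add: extreme_point_of_def)
    ultimately show "v \<in> (\<Union>z\<in>{z\<in>t. z \<inter> B \<noteq> {}}. {x. x extreme_point_of z})" using v by blast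
  qed
  show "finite (\<Union>z\<in>{z\<in>t. z \<inter> B \<noteq> {}}. {x. x extreme_point_of z})"
    using finite_hit[OF assms] t by (intro finite_UN_I finite_extreme_points_polytope) (auto simp: tessellation_def)
qed

section \<open>Orientation of product sets\<close>

lemma horizontal_Times: "horizontal (A \<times> {h})"
  by (auto simp: horizontal_def)

lemma not_vertical_Times:
  assumes "A \<noteq> {}" shows "\<not> vertical (A \<times> {h})"
proof
  assume v: "vertical (A \<times> {h})"
  obtain a where a: "a \<in> A" using assms by auto
  have m: "(a, h) \<in> affine hull (A \<times> {h})" using a by (intro hull_inc) auto
  have "(a, h) + (0, 1) \<in> affine hull (A \<times> {h})" using v m unfolding vertical_def by blast
  then show False by (simp add: affine_hull_Times)
qed

lemma vertical_Times:
  assumes "(a::real) < b" shows "vertical (A \<times> {a..b})"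
proof -
  have "affine hull {a..b} = UNIV"
    using aff_dim_interval[of a b] assms by (subst aff_dim_eq_full[symmetric]) simp
  then show ?thesis by (auto simp: vertical_def affine_hull_Times)
qed

lemma not_horizontal_Times:
  assumes "(a::real) < b" "A \<noteq> {}" shows "\<not> horizontal (A \<times> {a..b})"
proof
  assume h: "horizontal (A \<times> {a..b})"
  obtain x where x: "x \<in> A" using assms by auto
  have "(x, a) \<in> A \<times> {a..b}" "(x, b) \<in> A \<times> {a..b}" using x assms by auto
  then have "snd (x, a) = snd (x, b)" using h unfolding horizontal_def by blast
  then show False using assms by simp
qed

context column_tess
begin

text \<open>By \<open>vertices_eq\<close> these are the vertices; each is also the lower end of one
  vertical edge.\<close>

abbreviation spots :: "((real^2) \<times> real) set" where
  "spots \<equiv> {(v, h). v \<in> cell_corners t \<and> h \<in> heights_at v}"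

text \<open>Horizontal edges without their end points: pieces of the skeleton that remain when the
  vertices are removed.\<close>

definition hopen :: "(real^2) set \<times> (real^2) set \<times> real \<Rightarrow> ((real^2) \<times> real) set" where
  "hopen = (\<lambda>(z, z', h). rel_interior (z \<inter> z') \<times> {h})"

definition vopen :: "(real^2) \<times> real \<Rightarrow> ((real^2) \<times> real) set" where
  "vopen = (\<lambda>(v, h). {v} \<times> {h<..<succ (heights_at v) h})"

definition hedge :: "(real^2) set \<times> (real^2) set \<times> real \<Rightarrow> ((real^2) \<times> real) set" where
  "hedge = (\<lambda>(z, z', h). (z \<inter> z') \<times> {h})"

definition vedge :: "(real^2) \<times> real \<Rightarrow> ((real^2) \<times> real) set" where
  "vedge = (\<lambda>(v, h). {v} \<times> {h..succ (heights_at v) h})"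

lemma side_point_cases:
  assumes "z \<in> t" "z' \<in> t" "touch z z'" "u \<in> z \<inter> z'"
  shows "u \<in> rel_interior (z \<inter> z') \<or> u extreme_point_of (z \<inter> z')"
proof -
  obtain a b where ab: "a \<noteq> b" "z \<inter> z' = closed_segment a b" using neighbour_segment[OF assms(1-3)] by auto
  then show ?thesis using assms(4) by (auto simp: extreme_point_of_segment rel_interior_closed_segment open_segment_def)
qed

lemma extreme_not_rel_interior:
  assumes "z \<in> t" "z' \<in> t" "touch z z'" "u extreme_point_of (z \<inter> z')"
  shows "u \<notin> rel_interior (z \<inter> z')"
proof -
  obtain a b where ab: "a \<noteq> b" "z \<inter> z' = closed_segment a b" using neighbour_segment[OF assms(1-3)] by auto
  then show ?thesis using assms(4) by (auto simp: extreme_point_of_segment rel_interior_closed_segment open_segment_def)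
qed

lemma side_interior_not_corner:
  assumes "z \<in> t" "z' \<in> t" "touch z z'" "u \<in> rel_interior (z \<inter> z')"
  shows "u \<notin> cell_corners t"
proof -
  obtain a b where ab: "a \<noteq> b" "z \<inter> z' = closed_segment a b" using neighbour_segment[OF assms(1-3)] by auto
  then have o: "u \<in> open_segment a b" using assms(4) by (simp add: rel_interior_closed_segment)
  have e: "a \<in> z \<inter> z'" "b \<in> z \<inter> z'" unfolding ab by auto
  have n: "z \<noteq> z'" using assms(3) by (auto simp: touch_def)
  show ?thesis by (rule corner_not_between[OF assms(1,2) n e o])
qed

lemma rel_frontier_hplate:
  assumes "z \<in> t" shows "rel_frontier (z \<times> {h}) = frontier z \<times> {h::real}"
proof -
  have "rel_interior (z \<times> {h}) = interior z \<times> {h}"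
    using cell[OF assms] by (simp add: rel_interior_Times rel_interior_nonempty_interior)
  then show ?thesis
    using cell(3)[OF assms] by (auto simp: rel_frontier_def frontier_def closure_Times)
qed

lemma rel_frontier_vplate:
  assumes "z \<in> t" "z' \<in> t" "touch z z'" "(a::real) < b"
  shows "rel_frontier ((z \<inter> z') \<times> {a..b}) = (z \<inter> z') \<times> {a..b} - rel_interior (z \<inter> z') \<times> {a<..<b}"
proof -
  have "rel_interior {a..b} = {a<..<b}"
    using assms(4) by (subst rel_interior_nonempty_interior) (auto simp: interior_atLeastAtMost_real)
  moreover have "closed (z \<inter> z')" using cell(3)[OF assms(1)] cell(3)[OF assms(2)] by (rule closed_Int)
  ultimately show ?thesis
    using side_rel_interior(3)[OF assms(1-3)] by (simp add: rel_frontier_def closure_Times rel_interior_Times)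
qed

lemma not_spot_between:
  assumes "h < y" "y < succ (heights_at v) h" shows "(v, y) \<notin> spots"
  using bilat_succ(3)[OF bilat_at, of y v h] assms by auto

text \<open>Boundaries of horizontal plates consist of sides at plate heights. A vertical plate
  contributes its side at the two bounding heights and two vertical segments over the ends of the
  side. Without the vertices, what remains is either inside a side at a height of one of its two
  columns, or over a corner strictly between consecutive heights there.\<close>

lemma skeleton_eq:
  "(\<Union>p\<in>hplate ` \<psi> \<union> vplate ` flags. rel_frontier p) - spots = \<Union>(hopen ` flags \<union> vopen ` spots)"
proof (intro set_eqI iffI)
  fix x assume x: "x \<in> (\<Union>p\<in>hplate ` \<psi> \<union> vplate ` flags. rel_frontier p) - spots"
  obtain u y where xu: "x = (u, y)" by (cases x)
  have ns: "(u, y) \<notin> spots" using x xu by auto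
  obtain p where p: "p \<in> hplate ` \<psi> \<union> vplate ` flags" "(u, y) \<in> rel_frontier p" using x xu by auto
  \<comment> \<open>The flag is oriented so that the column owning the height \<open>y\<close> comes
    first.\<close>
  have key: "(u, y) \<in> \<Union>(hopen ` flags \<union> vopen ` spots)"
    if z: "z \<in> t" "z' \<in> t" "touch z z'" "u \<in> rel_interior (z \<inter> z')" "y \<in> heights {z, z'}" for z z'
  proof (cases "y \<in> heights {z}")
    case True
    then have "(z, z', y) \<in> flags" using z by (auto simp: flags_def)
    moreover have "(u, y) \<in> hopen (z, z', y)" using z by (auto simp: hopen_def)
    ultimately show ?thesis by blast
  next
    case False
    then have "(z', z, y) \<in> flags" using z touch_sym by (auto simp: flags_def)
    moreover have "(u, y) \<in> hopen (z', z, y)" using z by (auto simp: hopen_def Int_commute)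
    ultimately show ?thesis by blast
  qed
  consider (h) z h where "(z, h) \<in> \<psi>" "p = z \<times> {h}"
    | (v) z z' h where "(z, z', h) \<in> flags" "p = (z \<inter> z') \<times> {h..succ (heights {z, z'}) h}"
    using p(1) unfolding hplate_def vplate_def by auto
  then show "x \<in> \<Union>(hopen ` flags \<union> vopen ` spots)"
  proof cases
    case h
    have z: "z \<in> t" using in_t[OF h(1)] .
    have u: "u \<in> frontier z" "y = h" using p(2) unfolding h(2) rel_frontier_hplate[OF z] by auto
    obtain z' where z': "z' \<in> t" "touch z z'" "u \<in> z'" using frontier_cover_touch[OF z u(1)] by auto
    have uz: "u \<in> z \<inter> z'" using u z' cell(3)[OF z] by (auto simp: frontier_def)
    from side_point_cases[OF z z'(1,2) uz] show ?thesis
    proof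
      assume "u \<in> rel_interior (z \<inter> z')"
      then show ?thesis unfolding xu using h u by (intro key[OF z z'(1,2)]) auto
    next
      assume e: "u extreme_point_of (z \<inter> z')"
      have "z \<noteq> z'" using z' by (auto simp: touch_def)
      then have "u \<in> cell_corners t" using extreme_of_side_is_corner[OF z z'(1) _ e] by simp
      then have "(u, y) \<in> spots" using h u uz by auto
      then show ?thesis using ns by simp
    qed
  next
    case v
    note fz = flagsD[OF v(1)]
    have lt: "h < succ (heights {z, z'}) h" using bilat_succ(2)[OF bilat_pair[OF fz(1,2)]] .
    have uz: "u \<in> z \<inter> z'" "h \<le> y" "y \<le> succ (heights {z, z'}) h"
      and ni: "\<not> (u \<in> rel_interior (z \<inter> z') \<and> h < y \<and> y < succ (heights {z, z'}) h)"
      using p(2) unfolding v(2) rel_frontier_vplate[OF fz(1,2,4) lt] by auto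
    from side_point_cases[OF fz(1,2,4) uz(1)] show ?thesis
    proof
      assume u: "u \<in> rel_interior (z \<inter> z')"
      then have "y = h \<or> y = succ (heights {z, z'}) h" using uz ni by auto
      then have "y \<in> heights {z, z'}" using bilat_succ(1)[OF bilat_pair[OF fz(1,2)], of h] fz(5) by auto
      then show ?thesis unfolding xu by (intro key[OF fz(1,2,4) u])
    next
      assume e: "u extreme_point_of (z \<inter> z')"
      have c: "u \<in> cell_corners t" using extreme_of_side_is_corner[OF fz(1-3) e] .
      \<comment> \<open>The edge through the point starts at the last height below it among all
        columns around the corner, not only the two columns of this plate.\<close>
      obtain k where k: "k \<in> heights_at u" "k \<le> y" "y < succ (heights_at u) k" using bilat_floor[OF bilat_at] by blast
      have "k \<noteq> y" using ns c k by auto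
      then have "(u, y) \<in> vopen (u, k)" using k by (auto simp: vopen_def)
      moreover have "(u, k) \<in> spots" using c k by auto
      ultimately show ?thesis unfolding xu by blast
    qed
  qed
next
  fix x assume x: "x \<in> \<Union>(hopen ` flags \<union> vopen ` spots)"
  then consider (h) f where "f \<in> flags" "x \<in> hopen f" | (v) s where "s \<in> spots" "x \<in> vopen s" by blast
  then show "x \<in> (\<Union>p\<in>hplate ` \<psi> \<union> vplate ` flags. rel_frontier p) - spots"
  proof cases
    case h
    obtain z z' h where f: "f = (z, z', h)" by (cases f) auto
    note fz = flagsD[OF h(1)[unfolded f]]
    obtain u where u: "x = (u, h)" "u \<in> rel_interior (z \<inter> z')" using h(2) f by (auto simp: hopen_def)
    have "u \<notin> cell_corners t" by (rule side_interior_not_corner[OF fz(1,2,4) u(2)])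
    then have "x \<notin> spots" using u by auto
    moreover have "u \<in> frontier z"
      using u(2) side_rel_interior(2)[OF fz(1,2,4)] Int_subset_frontier[OF fz(1-3)] by blast
    then have "x \<in> rel_frontier (hplate (z, h))" unfolding hplate_def u(1) by (simp add: rel_frontier_hplate[OF fz(1)])
    ultimately show ?thesis using fz(5) by blast
  next
    case v
    obtain w k where s: "s = (w, k)" by (cases s)
    have w: "w \<in> cell_corners t" "k \<in> heights_at w" using v(1) s by auto
    obtain y where y: "x = (w, y)" "k < y" "y < succ (heights_at w) k" using v(2) s by (auto simp: vopen_def)
    obtain z z' where z: "z \<in> t" "z' \<in> t" "touch z z'" "w extreme_point_of (z \<inter> z')" using w(1) unfolding corner_iff by blast
    have wz: "w \<in> z \<inter> z'" using z(4) by (simp add: extreme_point_of_def)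
    have nr: "w \<notin> rel_interior (z \<inter> z')" using extreme_not_rel_interior[OF z] .
    \<comment> \<open>Over an end of a side, the whole closed height range of a vertical plate
      belongs to its relative boundary.\<close>
    have key: "x \<in> (\<Union>p\<in>hplate ` \<psi> \<union> vplate ` flags. rel_frontier p)"
      if z: "z \<in> t" "z' \<in> t" "touch z z'" "w \<in> z \<inter> z'" "w \<notin> rel_interior (z \<inter> z')"
        and a: "(z, a) \<in> \<psi>" "a \<le> y" "y < succ (heights {z, z'}) a" for z z' a
    proof -
      have f: "(z, z', a) \<in> flags" using z a by (auto simp: flags_def)
      have lt: "a < succ (heights {z, z'}) a" using a by simp
      have "x \<in> rel_frontier (vplate (z, z', a))"
        unfolding vplate_def y(1) prod.case rel_frontier_vplate[OF z(1-3) lt] using z a by auto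
      then show ?thesis using f by blast
    qed
    obtain a where a: "a \<in> heights {z, z'}" "a \<le> y" "y < succ (heights {z, z'}) a"
      using bilat_floor[OF bilat_pair[OF z(1,2)]] by blast
    have "x \<in> (\<Union>p\<in>hplate ` \<psi> \<union> vplate ` flags. rel_frontier p)"
    proof (cases "(z, a) \<in> \<psi>")
      case True
      then show ?thesis using key[OF z(1-3) wz nr] a by blast
    next
      case False
      then have b: "(z', a) \<in> \<psi>" using a(1) by auto
      have c: "heights {z, z'} = heights {z', z}" by (simp add: insert_commute)
      have tz: "touch z' z" using z(3) touch_sym by blast
      have "w \<in> z' \<inter> z" "w \<notin> rel_interior (z' \<inter> z)" using wz nr by (auto simp: Int_commute)
      from key[OF z(2,1) tz this b a(2)] a(3) show ?thesis unfolding c by blast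
    qed
    moreover have "x \<notin> spots" unfolding y(1) by (rule not_spot_between[OF y(2,3)])
    ultimately show ?thesis by blast
  qed
qed

lemma closure_hopen:
  assumes "(z, z', h) \<in> flags" shows "closure (hopen (z, z', h)) = hedge (z, z', h)"
  using side_rel_interior(7)[OF flagsD(1,2,4)[OF assms]] by (simp add: hopen_def hedge_def closure_Times)

lemma closure_vopen: "closure (vopen (v, h)) = vedge (v, h)"
  using bilat_succ(2)[OF bilat_at, of h v] by (simp add: vopen_def vedge_def closure_Times closure_greaterThanLessThan)

text \<open>The open edges are disjoint, connected and locally finite, and closing one of them adds
  only vertices, which have been removed.\<close>

lemma components_skeleton:
  "components (\<Union>(hopen ` flags \<union> vopen ` spots)) = hopen ` flags \<union> vopen ` spots"
proof (rule components_locally_finite_partition)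
  fix X Y assume X: "X \<in> hopen ` flags \<union> vopen ` spots" and Y: "Y \<in> hopen ` flags \<union> vopen ` spots" and ne: "X \<noteq> Y"
  have hv: "hopen f \<inter> vopen s = {}" if f: "f \<in> flags" and s: "s \<in> spots" for f s
  proof (rule ccontr)
    assume "hopen f \<inter> vopen s \<noteq> {}"
    then obtain x where x: "x \<in> hopen f" "x \<in> vopen s" by blast
    obtain z z' h where fe: "f = (z, z', h)" by (cases f) auto
    note fz = flagsD[OF f[unfolded fe]]
    have "fst x \<in> rel_interior (z \<inter> z')" using x(1) fe by (auto simp: hopen_def)
    moreover have "fst x \<in> cell_corners t" using x(2) s by (auto simp: vopen_def)
    ultimately show False using side_interior_not_corner[OF fz(1,2,4)] by blast
  qed
  have hh: "hopen f = hopen g" if f: "f \<in> flags" "g \<in> flags" and x: "x \<in> hopen f" "x \<in> hopen g" for f g x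
  proof -
    obtain z z' h where fe: "f = (z, z', h)" by (cases f) auto
    obtain y y' k where ge: "g = (y, y', k)" by (cases g) auto
    note fz = flagsD[OF f(1)[unfolded fe]] and gz = flagsD[OF f(2)[unfolded ge]]
    have 1: "fst x \<in> rel_interior (z \<inter> z')" "snd x = h" using x(1) fe by (auto simp: hopen_def)
    have 2: "fst x \<in> rel_interior (y \<inter> y')" "snd x = k" using x(2) ge by (auto simp: hopen_def)
    have "fst x \<in> y" "fst x \<in> y'" using 2 side_rel_interior(2)[OF gz(1,2,4)] by auto
    from side_determines[OF fz(1,2,4) gz(1,2,4) 1(1) this]
    have "z \<inter> z' = y \<inter> y'" by auto
    then show ?thesis using 1 2 unfolding fe ge hopen_def by simp
  qed
  have vv: "vopen s = vopen r" if s: "s \<in> spots" "r \<in> spots" and x: "x \<in> vopen s" "x \<in> vopen r" for s r x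
  proof -
    obtain v h w k where se: "s = (v, h)" "r = (w, k)" by (cases s, cases r)
    have 1: "fst x = v" "h < snd x" "snd x < succ (heights_at v) h" using x(1) se by (auto simp: vopen_def)
    have 2: "fst x = w" "k < snd x" "snd x < succ (heights_at w) k" using x(2) se by (auto simp: vopen_def)
    have "h \<in> heights_at v" "k \<in> heights_at v" using s 1 2 se by auto
    then have "h = k" using 1 2 by (intro bilat_interval_unique[OF bilat_at, of h v k "snd x"]) auto
    then show ?thesis using 1 2 se by simp
  qed
  show "X \<inter> Y = {}"
  proof (rule ccontr)
    assume "X \<inter> Y \<noteq> {}"
    then obtain x where x: "x \<in> X" "x \<in> Y" by blast
    from X Y show False
    proof (elim UnE imageE)
      fix f g assume "X = hopen f" "f \<in> flags" "Y = hopen g" "g \<in> flags"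
      then show False using hh[of f g x] x ne by simp
    next
      fix f s assume "X = hopen f" "f \<in> flags" "Y = vopen s" "s \<in> spots"
      then show False using hv[of f s] x by blast
    next
      fix s f assume "X = vopen s" "s \<in> spots" "Y = hopen f" "f \<in> flags"
      then show False using hv[of f s] x by blast
    next
      fix s r assume "X = vopen s" "s \<in> spots" "Y = vopen r" "r \<in> spots"
      then show False using vv[of s r x] x ne by simp
    qed
  qed
next
  fix X assume X: "X \<in> hopen ` flags \<union> vopen ` spots"
  then show "connected X"
  proof (elim UnE imageE)
    fix f assume f: "X = hopen f" "f \<in> flags"
    obtain z z' h where fe: "f = (z, z', h)" by (cases f) auto
    show "connected X" using side_rel_interior(6)[OF flagsD(1,2,4)[OF f(2)[unfolded fe]]]
      unfolding f(1) fe hopen_def by (auto intro: connected_Times)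
  next
    fix s assume s: "X = vopen s"
    show "connected X" unfolding s vopen_def by (cases s) (auto intro!: connected_Times convex_connected)
  qed
  from X show "X \<noteq> {}"
  proof (elim UnE imageE)
    fix f assume f: "X = hopen f" "f \<in> flags"
    obtain z z' h where fe: "f = (z, z', h)" by (cases f) auto
    show "X \<noteq> {}" using side_rel_interior(1)[OF flagsD(1,2,4)[OF f(2)[unfolded fe]]]
      unfolding f(1) fe hopen_def by auto
  next
    fix s assume s: "X = vopen s"
    obtain v h where se: "s = (v, h)" by (cases s)
    have "closure X \<noteq> {}" unfolding s se closure_vopen vedge_def using bilat_succ(2)[OF bilat_at, of h v] by auto
    then show "X \<noteq> {}" by auto
  qed
  fix x assume x: "x \<in> closure X" "x \<in> \<Union>(hopen ` flags \<union> vopen ` spots)"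
  have ns: "x \<notin> spots" using x(2) unfolding skeleton_eq[symmetric] by simp
  from X show "x \<in> X"
  proof (elim UnE imageE)
    fix f assume f: "X = hopen f" "f \<in> flags"
    obtain z z' h where fe: "f = (z, z', h)" by (cases f) auto
    note fz = flagsD[OF f(2)[unfolded fe]]
    have "x \<in> hedge (z, z', h)" using x(1) closure_hopen f fe by simp
    then obtain u where u: "x = (u, h)" "u \<in> z \<inter> z'" by (auto simp: hedge_def)
    from side_point_cases[OF fz(1,2,4) u(2)] show "x \<in> X"
    proof
      assume "u extreme_point_of (z \<inter> z')"
      then have "u \<in> cell_corners t" using extreme_of_side_is_corner[OF fz(1-3)] by blast
      then have "x \<in> spots" using u fz(5) by auto
      then show ?thesis using ns by simp
    qed (use f fe u in \<open>auto simp: hopen_def\<close>)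
  next
    fix s assume s: "X = vopen s" "s \<in> spots"
    obtain v h where se: "s = (v, h)" by (cases s)
    have v: "v \<in> cell_corners t" "h \<in> heights_at v" using s se by auto
    have "x \<in> vedge (v, h)" using x(1) closure_vopen s se by simp
    then obtain y where y: "x = (v, y)" "h \<le> y" "y \<le> succ (heights_at v) h" by (auto simp: vedge_def)
    have "y \<noteq> h" "y \<noteq> succ (heights_at v) h"
      using ns y(1) v bilat_succ(1)[OF bilat_at, of v h] by auto
    then show "x \<in> X" unfolding s se vopen_def using y by auto
  qed
next
  fix x :: "(real^2) \<times> real"
  obtain a y where x: "x = (a, y)" by (cases x)
  let ?C = "{z\<in>t. z \<inter> ball a 1 \<noteq> {}}"
  let ?K = "cell_corners t \<inter> ball a 1"
  \<comment> \<open>Open horizontal edges near \<open>x\<close> come from cells near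
    \<open>a\<close> and heights within 1 of \<open>y\<close>; vertical ones from corners near
    \<open>a\<close> and gaps that overlap this height window.\<close>
  let ?A = "?C \<times> ?C \<times> (\<Union>z\<in>?C. heights {z} \<inter> {y - 1..y + 1})"
  let ?B = "Sigma ?K (\<lambda>v. {h\<in>heights_at v. h \<le> y + 1 \<and> y - 1 < succ (heights_at v) h})"
  have fC: "finite ?C" and fK: "finite ?K" by (auto intro!: finite_hit finite_corners)
  have fh: "finite (heights {z} \<inter> {y - 1..y + 1})" if "z \<in> ?C" for z
    using bi[of z] that by (auto simp: bilat_def)
  have fA: "finite ?A" by (intro finite_cartesian_product finite_UN_I fC fh)
  have fB: "finite ?B" by (intro finite_SigmaI fK bilat_finite_intervals[OF bilat_at])
  have b: "dist a u < 1 \<and> \<bar>y - k\<bar> < 1" if "(u, k) \<in> ball x 1" for u k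
  proof -
    have "dist x (u, k) < 1" using that by simp
    then show ?thesis using dist_fst_le[of x "(u, k)"] dist_snd_le[of x "(u, k)"] x by (auto simp: dist_real_def)
  qed
  have "{X \<in> hopen ` flags \<union> vopen ` spots. X \<inter> ball x 1 \<noteq> {}} \<subseteq> hopen ` ?A \<union> vopen ` ?B"
  proof clarify
    fix X assume X: "X \<in> hopen ` flags \<union> vopen ` spots" and h: "X \<inter> ball x 1 \<noteq> {}" and nB: "X \<notin> vopen ` ?B"
    obtain u k where uk: "(u, k) \<in> X" "(u, k) \<in> ball x 1" using h by auto
    note bb = b[OF uk(2)]
    from X show "X \<in> hopen ` ?A"
    proof (elim UnE imageE)
      fix f assume f: "X = hopen f" "f \<in> flags"
      obtain z z' h where fe: "f = (z, z', h)" by (cases f) auto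
      note fz = flagsD[OF f(2)[unfolded fe]]
      have "u \<in> z \<inter> z'" "k = h" using uk(1) side_rel_interior(2)[OF fz(1,2,4)] unfolding f fe hopen_def by auto
      then have "z \<in> ?C" "z' \<in> ?C" "h \<in> heights {z} \<inter> {y - 1..y + 1}" using fz bb by auto
      then have "f \<in> ?A" unfolding fe by blast
      then show ?thesis using f(1) by blast
    next
      fix s assume s: "X = vopen s" "s \<in> spots"
      obtain v h where se: "s = (v, h)" by (cases s)
      have "v \<in> cell_corners t" "h \<in> heights_at v" using s se by auto
      moreover have "u = v" "h < k" "k < succ (heights_at v) h" using uk(1) unfolding s se vopen_def by auto
      ultimately have "s \<in> ?B" unfolding se using bb by auto
      then show ?thesis using nB s(1) by blast
    qed
  qed
  then show "finite {X \<in> hopen ` flags \<union> vopen ` spots. X \<inter> ball x 1 \<noteq> {}}"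
    by (rule finite_subset) (intro finite_UnI finite_imageI fA fB)
qed

lemma edges_eq: "edges (column_cells t \<psi>) = hedge ` flags \<union> vedge ` spots"
proof -
  have "edges (column_cells t \<psi>) = closure ` (hopen ` flags \<union> vopen ` spots)"
    unfolding edges_def plates_eq vertices_eq skeleton_eq components_skeleton ..
  also have "\<dots> = hedge ` flags \<union> vedge ` spots"
    unfolding image_Un image_image using closure_hopen closure_vopen
    by (intro arg_cong2[where f="(\<union>)"] image_cong) auto
  finally show ?thesis .
qed

lemma inj_hedge: "inj_on hedge flags"
proof (rule inj_onI)
  fix a b assume ab: "a \<in> flags" "b \<in> flags" "hedge a = hedge b"
  obtain z z' h y y' k where abe: "a = (z, z', h)" "b = (y, y', k)" by (cases a, cases b) auto
  note fz = flagsD[OF ab(1)[unfolded abe]] and fy = flagsD[OF ab(2)[unfolded abe]]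
  have eq: "z \<inter> z' = y \<inter> y'" "h = k"
    using ab(3) side_rel_interior(5)[OF fz(1,2,4)] unfolding abe hedge_def by (auto simp: times_eq_iff)
  have "z = y" using nc[of z h y] fz(5) fy(5) eq(2) by simp
  moreover have "y = z \<and> y' = z' \<or> y = z' \<and> y' = z"
    using side_eq_imp[OF fz(1,2,4) fy(1,2,4) eq(1)] .
  ultimately show "a = b" unfolding abe using eq(2) fz(3) by auto
qed

lemma inj_vedge: "inj_on vedge spots"
proof (rule inj_onI)
  fix a b assume ab: "a \<in> spots" "b \<in> spots" "vedge a = vedge b"
  obtain v h w k where abe: "a = (v, h)" "b = (w, k)" by (cases a, cases b)
  have "h \<le> succ (heights_at v) h" using bilat_succ(2)[OF bilat_at, of h v] by simp
  from Times_interval_eq[OF ab(3)[unfolded abe vedge_def prod.case] _ this]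
  show "a = b" unfolding abe by auto
qed

lemma orientations:
  "f \<in> flags \<Longrightarrow> horizontal (hedge f) \<and> \<not> vertical (hedge f)"
  "s \<in> spots \<Longrightarrow> vertical (vedge s) \<and> \<not> horizontal (vedge s)"
  "p \<in> \<psi> \<Longrightarrow> horizontal (hplate p) \<and> \<not> vertical (hplate p)"
  "f \<in> flags \<Longrightarrow> vertical (vplate f) \<and> \<not> horizontal (vplate f)"
proof -
  show "horizontal (hedge f) \<and> \<not> vertical (hedge f)" if f: "f \<in> flags"
  proof -
    obtain z z' h where fe: "f = (z, z', h)" by (cases f) auto
    note fz = flagsD[OF f[unfolded fe]]
    show ?thesis unfolding fe hedge_def prod.case
      using horizontal_Times not_vertical_Times[OF side_rel_interior(5)[OF fz(1,2,4)]] by simp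
  qed
  show "vertical (vplate f) \<and> \<not> horizontal (vplate f)" if f: "f \<in> flags"
  proof -
    obtain z z' h where fe: "f = (z, z', h)" by (cases f) auto
    note fz = flagsD[OF f[unfolded fe]]
    have lt: "h < succ (heights {z, z'}) h" using bilat_succ(2)[OF bilat_pair[OF fz(1,2)]] .
    show ?thesis unfolding fe vplate_def prod.case
      using vertical_Times[OF lt] not_horizontal_Times[OF lt side_rel_interior(5)[OF fz(1,2,4)]] by simp
  qed
  show "vertical (vedge s) \<and> \<not> horizontal (vedge s)" if "s \<in> spots"
  proof -
    obtain v h where se: "s = (v, h)" by (cases s)
    have lt: "h < succ (heights_at v) h" using bilat_succ(2)[OF bilat_at] .
    show ?thesis unfolding se vedge_def prod.case
      using vertical_Times[OF lt] not_horizontal_Times[OF lt, of "{v}"] by simp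
  qed
  show "horizontal (hplate p) \<and> \<not> vertical (hplate p)" if "p \<in> \<psi>"
  proof -
    obtain z h where pe: "p = (z, h)" by (cases p)
    have "z \<noteq> {}" using cell(5) in_t that pe by blast
    then show ?thesis unfolding pe hplate_def prod.case
      using horizontal_Times not_vertical_Times by simp
  qed
qed

end

subsection \<open>Centroids\<close>

text \<open>The body \<open>C\<close> in the definition of \<open>centroid\<close>.\<close>

definition thicken :: "'a::euclidean_space set \<Rightarrow> 'a set" where
  "thicken K = {x + u | x u. x \<in> K \<and> norm u \<le> 1 \<and> (\<forall>y\<in>K. \<forall>y'\<in>K. u \<bullet> (y - y') = 0)}"

lemma centroid_thicken: "centroid K = (LINT x:thicken K|lborel. x) /\<^sub>R measure lborel (thicken K)"
  by (simp add: centroid_def thicken_def Let_def)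

lemma compact_thicken:
  assumes "compact K" shows "compact (thicken K)"
proof -
  let ?W = "cball 0 1 \<inter> (\<Inter>y\<in>K. \<Inter>y'\<in>K. {u. u \<bullet> (y - y') = 0})"
  have "closed (\<Inter>y\<in>K. \<Inter>y'\<in>K. {u. u \<bullet> (y - y') = 0})"
    by (intro closed_INT ballI closed_Collect_eq continuous_intros)
  then have "compact ?W" by (intro compact_Int_closed) auto
  then have "compact ((\<lambda>p. fst p + snd p) ` (K \<times> ?W))"
    using assms by (intro compact_continuous_image compact_Times continuous_intros)
  moreover have "(\<lambda>p. fst p + snd p) ` (K \<times> ?W) = thicken K"
  proof (intro set_eqI iffI)
    fix x assume "x \<in> (\<lambda>p. fst p + snd p) ` (K \<times> ?W)"
    then show "x \<in> thicken K" unfolding thicken_def by fastforce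
  next
    fix x assume "x \<in> thicken K"
    then obtain k u where "x = k + u" "k \<in> K" "norm u \<le> 1" "\<forall>y\<in>K. \<forall>y'\<in>K. u \<bullet> (y - y') = 0"
      unfolding thicken_def by blast
    then show "x \<in> (\<lambda>p. fst p + snd p) ` (K \<times> ?W)" by (intro image_eqI[of _ _ "(k, u)"]) auto
  qed
  ultimately show ?thesis by simp
qed

lemma thicken_interior:
  fixes K :: "'a::euclidean_space set"
  assumes "convex K" "K \<noteq> {}" shows "\<exists>x e. e > 0 \<and> ball x e \<subseteq> thicken K"
proof -
  obtain x0 where x0: "x0 \<in> rel_interior K" using rel_interior_eq_empty[OF assms(1)] assms(2) by auto
  then obtain e where e: "e > 0" "ball x0 e \<inter> affine hull K \<subseteq> K" and x0K: "x0 \<in> K"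
    unfolding mem_rel_interior_ball by auto
  define V where "V = span ((\<lambda>y. y - x0) ` K)"
  have "ball x0 (min e 1) \<subseteq> thicken K"
  proof
    fix p assume p: "p \<in> ball x0 (min e 1)"
    obtain d u where d: "d \<in> V" and u: "\<And>w. w \<in> V \<Longrightarrow> orthogonal u w" and pd: "p - x0 = d + u"
      using orthogonal_subspace_decomp_exists[of "(\<lambda>y. y - x0) ` K" "p - x0"] unfolding V_def by metis
    have "orthogonal d u" using u[OF d] by (simp add: orthogonal_commute)
    then have n: "(norm (p - x0))\<^sup>2 = (norm d)\<^sup>2 + (norm u)\<^sup>2"
      unfolding pd by (rule norm_add_Pythagorean)
    have np: "norm (p - x0) < min e 1" using p by (simp add: dist_norm norm_minus_commute)
    have "(norm d)\<^sup>2 \<le> (norm (p - x0))\<^sup>2" "(norm u)\<^sup>2 \<le> (norm (p - x0))\<^sup>2" using n by simp_all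
    then have "norm d \<le> norm (p - x0)" "norm u \<le> norm (p - x0)"
      by (simp_all only: power2_le_imp_le norm_ge_zero)
    then have nd: "norm d < e" "norm u \<le> 1" using np by auto
    have "x0 + d \<in> affine hull K"
    proof -
      have "affine hull K = (\<lambda>v. x0 + v) ` span ((\<lambda>y. y - x0) ` K)"
      proof -
        have "affine hull K = (+) x0 ` span ((\<lambda>x. - x0 + x) ` K)"
          using x0K by (intro affine_hull_span_gen hull_inc)
        then show ?thesis by simp
      qed
      then show ?thesis using d unfolding V_def by blast
    qed
    then have "x0 + d \<in> K" using e(2) nd by (auto simp: dist_norm)
    moreover have "u \<bullet> (y - y') = 0" if "y \<in> K" "y' \<in> K" for y y'
    proof -
      have "y - x0 \<in> V" "y' - x0 \<in> V" using that by (auto simp: V_def intro: span_base)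
      then have "u \<bullet> (y - x0) = 0" "u \<bullet> (y' - x0) = 0" using u by (auto simp: orthogonal_def)
      then show ?thesis by (simp add: inner_diff_right)
    qed
    moreover have "p = (x0 + d) + u" using pd by (simp add: algebra_simps)
    ultimately show "p \<in> thicken K" unfolding thicken_def using nd by blast
  qed
  then show ?thesis using e(1) by (intro exI[of _ x0] exI[of _ "min e 1"]) auto
qed

lemma measure_thicken_pos:
  fixes K :: "'a::euclidean_space set"
  assumes "convex K" "compact K" "K \<noteq> {}" shows "measure lborel (thicken K) > 0"
proof -
  obtain x :: 'a and e where e: "e > 0" "ball x e \<subseteq> thicken K" using thicken_interior[OF assms(1,3)] by auto
  have "0 < measure lborel (ball x e)" using content_ball_pos[OF e(1)] by simp
  also have "\<dots> \<le> measure lborel (thicken K)"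
  proof (rule measure_mono_fmeasurable[OF e(2)])
    show "thicken K \<in> fmeasurable lborel" using compact_thicken[OF assms(2)] by (rule fmeasurable_compact)
  qed simp
  finally show ?thesis .
qed

lemma set_integrable_compact_id:
  fixes C :: "'a::euclidean_space set"
  assumes "compact C" shows "integrable lborel (\<lambda>x. indicator C x *\<^sub>R x)"
  by (rule borel_integrable_compact[OF assms]) (rule continuous_on_id)

text \<open>The thickened set inherits the point symmetry, and the reflection preserves Lebesgue
  measure, so the first moment equals its mirror image.\<close>

lemma centroid_symmetric:
  fixes K :: "'a::euclidean_space set"
  assumes K: "convex K" "compact K" "K \<noteq> {}" and sym: "\<And>x. x \<in> K \<Longrightarrow> 2 *\<^sub>R m - x \<in> K"
  shows "centroid K = m"
proof -
  let ?C = "thicken K"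
  have c: "compact ?C" using compact_thicken[OF K(2)] .
  have s: "2 *\<^sub>R m - x \<in> ?C" if x: "x \<in> ?C" for x
  proof -
    obtain k u where k: "x = k + u" "k \<in> K" "norm u \<le> 1" "\<forall>y\<in>K. \<forall>y'\<in>K. u \<bullet> (y - y') = 0"
      using x by (auto simp: thicken_def)
    have "2 *\<^sub>R m - x = (2 *\<^sub>R m - k) + (- u)" by (simp add: k(1))
    then show ?thesis unfolding thicken_def using sym[OF k(2)] k(3,4) by fastforce
  qed
  have s2: "2 *\<^sub>R m - x \<in> ?C \<longleftrightarrow> x \<in> ?C" for x
    using s[of x] s[of "2 *\<^sub>R m - x"] by auto
  have i1: "integrable lborel (\<lambda>x. indicator ?C x *\<^sub>R x)" using set_integrable_compact_id[OF c] .
  have em: "emeasure lborel ?C < \<infinity>" using compact_imp_bounded[OF c] by (rule emeasure_bounded_finite) 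
  have i2: "integrable lborel (\<lambda>x. indicator ?C x *\<^sub>R (2 *\<^sub>R m))"
    using em compact_imp_closed[OF c] by (intro integrable_scaleR_left integrable_real_indicator) auto
  have "(LINT x:?C|lborel. x) = (\<integral>x. indicator ?C x *\<^sub>R x \<partial>distr lborel borel (\<lambda>x. 2 *\<^sub>R m - x))"
  proof -
    have "(lborel :: 'a measure) = distr lborel borel (\<lambda>x. 2 *\<^sub>R m - x)"
      using lborel_affine[of "-1" "2 *\<^sub>R m"] by (simp add: density_1)
    then show ?thesis unfolding set_lebesgue_integral_def by simp
  qed
  also have "\<dots> = (\<integral>x. indicator ?C (2 *\<^sub>R m - x) *\<^sub>R (2 *\<^sub>R m - x) \<partial>lborel)"
    using compact_imp_closed[OF c] by (subst integral_distr) auto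
  also have "\<dots> = (\<integral>x. indicator ?C x *\<^sub>R (2 *\<^sub>R m) - indicator ?C x *\<^sub>R x \<partial>lborel)"
    by (intro Bochner_Integration.integral_cong) (auto simp: indicator_def s2 algebra_simps)
  also have "\<dots> = (\<integral>x. indicator ?C x *\<^sub>R (2 *\<^sub>R m) \<partial>lborel) - (LINT x:?C|lborel. x)"
    unfolding set_lebesgue_integral_def using i1 i2 by (rule Bochner_Integration.integral_diff[rotated])
  also have "(\<integral>x. indicator ?C x *\<^sub>R (2 *\<^sub>R m) \<partial>lborel) = measure lborel ?C *\<^sub>R (2 *\<^sub>R m)"
    using em compact_imp_closed[OF c] by (subst integral_scaleR_left) auto
  finally have e: "(LINT x:?C|lborel. x) = measure lborel ?C *\<^sub>R (2 *\<^sub>R m) - (LINT x:?C|lborel. x)" .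
  have "2 *\<^sub>R (LINT x:?C|lborel. x) = measure lborel ?C *\<^sub>R (2 *\<^sub>R m)"
    unfolding scaleR_2[of "LINT x:?C|lborel. x"] using e[unfolded eq_diff_eq] .
  also have "\<dots> = 2 *\<^sub>R (measure lborel ?C *\<^sub>R m)" by (simp only: scaleR_scaleR mult.commute)
  finally have "(LINT x:?C|lborel. x) = measure lborel ?C *\<^sub>R m" by (simp only: scaleR_cancel_left) simp
  then show ?thesis unfolding centroid_thicken using measure_thicken_pos[OF K] by simp
qed

lemma orthogonal_to_body:
  fixes K :: "'a::euclidean_space set"
  assumes "interior K \<noteq> {}" "\<forall>y\<in>K. \<forall>y'\<in>K. u \<bullet> (y - y') = 0" shows "u = 0"
proof -
  obtain x e where e: "e > 0" "ball x e \<subseteq> K" using assms(1) by (auto simp: mem_interior)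
  define k where "k = e / (2 * (norm u + 1))"
  have k: "k > 0" using e by (auto simp: k_def add_nonneg_pos)
  have "k * norm u < e"
  proof -
    have "k * norm u \<le> k * (norm u + 1)" using k by (intro mult_left_mono) auto
    also have "\<dots> = e / 2" by (simp add: k_def add_nonneg_eq_0_iff field_simps)
    finally show ?thesis using e by simp
  qed
  then have "x + k *\<^sub>R u \<in> K" "x \<in> K" using e k by (auto simp: dist_norm)
  then have "u \<bullet> (x + k *\<^sub>R u - x) = 0" using assms(2) by blast
  then show ?thesis using k by simp
qed

lemma thicken_body:
  assumes "interior K \<noteq> {}" shows "thicken K = K"
proof (intro set_eqI iffI)
  fix x assume "x \<in> thicken K"
  then obtain k u where "x = k + u" "k \<in> K" "\<forall>y\<in>K. \<forall>y'\<in>K. u \<bullet> (y - y') = 0"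
    unfolding thicken_def by blast
  then show "x \<in> K" using orthogonal_to_body[OF assms, of u] by simp
next
  fix x assume "x \<in> K"
  then show "x \<in> thicken K" unfolding thicken_def
    by (intro CollectI exI[of _ x] exI[of _ "0::'a"]) auto
qed

text \<open>The vectors orthogonal to a full-dimensional horizontal set are vertical, so thickening
  turns the plate into a prism of height 2.\<close>

lemma thicken_body_Times_singleton:
  fixes K :: "'a::euclidean_space set" and h :: real
  assumes "interior K \<noteq> {}" shows "thicken (K \<times> {h}) = K \<times> {h - 1..h + 1}"
proof -
  have o: "(\<forall>y\<in>K \<times> {h}. \<forall>y'\<in>K \<times> {h}. u \<bullet> (y - y') = 0) \<longleftrightarrow> fst u = 0" for u :: "'a \<times> real"
  proof
    assume a: "\<forall>y\<in>K \<times> {h}. \<forall>y'\<in>K \<times> {h}. u \<bullet> (y - y') = 0"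
    have "fst u \<bullet> (y - y') = 0" if "y \<in> K" "y' \<in> K" for y y'
    proof -
      have "u \<bullet> ((y, h) - (y', h)) = 0" using a that by blast
      then show ?thesis by (simp add: inner_prod_def)
    qed
    then show "fst u = 0" using orthogonal_to_body[OF assms] by blast
  qed (auto simp: inner_prod_def)
  show ?thesis
  proof (intro set_eqI iffI)
    fix p assume "p \<in> thicken (K \<times> {h})"
    then obtain k u where "p = (k, h) + u" "k \<in> K" "norm u \<le> 1" "fst u = 0"
      unfolding thicken_def o by auto
    then show "p \<in> K \<times> {h - 1..h + 1}" by (cases u, cases p) (auto simp: norm_Pair)
  next
    fix p assume p: "p \<in> K \<times> {h - 1..h + 1}"
    have "p = (fst p, h) + (0, snd p - h)" by (cases p) simp
    moreover have "norm (0::'a, snd p - h) \<le> 1" using p by (auto simp: norm_Pair)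
    moreover have "(fst p, h) \<in> K \<times> {h}" using p by auto
    moreover have "fst (0::'a, snd p - h) = 0" by simp
    ultimately show "p \<in> thicken (K \<times> {h})" unfolding thicken_def o by blast
  qed
qed

lemma mean_Times_interval:
  fixes K :: "'a::euclidean_space set" and a b :: real
  assumes K: "compact K" "measure lborel K > 0" and ab: "a < b"
  shows "(LINT x:K \<times> {a..b}|lborel. x) /\<^sub>R measure lborel (K \<times> {a..b}) =
    ((LINT x:K|lborel. x) /\<^sub>R measure lborel K, (a + b) / 2)"
proof -
  let ?P = "K \<times> {a..b}"
  have cP: "compact ?P" using K by (intro compact_Times) auto
  have b1[measurable]: "K \<in> sets borel" using K by (simp add: compact_imp_closed)
  have m: "measure lborel ?P = measure lborel K * (b - a)"
  proof -
    have "emeasure lborel ?P = emeasure lborel K * emeasure lborel {a..b}"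
      unfolding lborel_prod[symmetric] by (rule lborel.emeasure_pair_measure_Times) auto
    then show ?thesis using ab by (simp add: measure_def enn2real_mult)
  qed
  have i: "integrable lborel (\<lambda>x. indicator ?P x *\<^sub>R x)" using set_integrable_compact_id[OF cP] .
  have i1: "integrable (lborel \<Otimes>\<^sub>M lborel) (\<lambda>x. indicator ?P x *\<^sub>R fst x)"
    using integrable_fst[OF i] by (simp add: lborel_prod)
  have i2: "integrable (lborel \<Otimes>\<^sub>M lborel) (\<lambda>x. indicator ?P x *\<^sub>R snd x)"
    using integrable_snd[OF i] by (simp add: lborel_prod)
  have "fst (LINT x:?P|lborel. x) = (\<integral>x. indicator ?P x *\<^sub>R fst x \<partial>(lborel \<Otimes>\<^sub>M lborel))"
    unfolding set_lebesgue_integral_def using integral_fst[OF i] by (simp add: lborel_prod)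
  also have "\<dots> = (\<integral>x. \<integral>y. indicator ?P (x, y) *\<^sub>R x \<partial>lborel \<partial>lborel)"
    using lborel_pair.integral_fst'[OF i1] by simp
  also have "\<dots> = (\<integral>x. (b - a) *\<^sub>R (indicator K x *\<^sub>R x) \<partial>lborel)"
  proof (intro Bochner_Integration.integral_cong refl)
    fix x
    have "(\<integral>y. indicator ?P (x, y) *\<^sub>R x \<partial>lborel) = (\<integral>y. indicator {a..b} y *\<^sub>R (indicator K x *\<^sub>R x) \<partial>lborel)"
      by (intro Bochner_Integration.integral_cong) (auto simp: indicator_def)
    also have "\<dots> = (\<integral>y. indicator {a..b} y \<partial>lborel) *\<^sub>R (indicator K x *\<^sub>R x)"
      by (rule integral_scaleR_left) (use ab in \<open>auto intro!: integrable_real_indicator\<close>)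
    finally show "(\<integral>y. indicator ?P (x, y) *\<^sub>R x \<partial>lborel) = (b - a) *\<^sub>R (indicator K x *\<^sub>R x)" using ab by simp
  qed
  also have "\<dots> = (b - a) *\<^sub>R (LINT x:K|lborel. x)" unfolding set_lebesgue_integral_def by (rule integral_scaleR_right)
  finally have f: "fst (LINT x:?P|lborel. x) = (b - a) *\<^sub>R (LINT x:K|lborel. x)" .
  have "snd (LINT x:?P|lborel. x) = (\<integral>x. indicator ?P x *\<^sub>R snd x \<partial>(lborel \<Otimes>\<^sub>M lborel))"
    unfolding set_lebesgue_integral_def using integral_snd[OF i] by (simp add: lborel_prod)
  also have "\<dots> = (\<integral>x. \<integral>y. indicator ?P (x, y) *\<^sub>R y \<partial>lborel \<partial>lborel)"
    using lborel_pair.integral_fst'[OF i2] by simp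
  also have "\<dots> = (\<integral>x. indicator K x * ((b\<^sup>2 - a\<^sup>2) / 2) \<partial>lborel)"
  proof (intro Bochner_Integration.integral_cong refl)
    fix x
    have "(\<integral>y. indicator ?P (x, y) *\<^sub>R y \<partial>lborel) = (\<integral>y. indicator K x * (y ^ 1 * indicator {a..b} y) \<partial>lborel)"
      by (intro Bochner_Integration.integral_cong) (auto simp: indicator_def)
    also have "\<dots> = indicator K x * (\<integral>y. y ^ 1 * indicator {a..b} y \<partial>lborel)" by simp
    also have "(\<integral>y. y ^ 1 * indicator {a..b} y \<partial>lborel) = (b\<^sup>2 - a\<^sup>2) / 2"
      using ab by (subst integral_power) (auto simp: power2_eq_square)
    finally show "(\<integral>y. indicator ?P (x, y) *\<^sub>R y \<partial>lborel) = indicator K x * ((b\<^sup>2 - a\<^sup>2) / 2)" .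
  qed
  also have "\<dots> = measure lborel K * ((b\<^sup>2 - a\<^sup>2) / 2)" by simp
  finally have s: "snd (LINT x:?P|lborel. x) = measure lborel K * ((b\<^sup>2 - a\<^sup>2) / 2)" .
  have sq: "b\<^sup>2 - a\<^sup>2 = (b - a) * (a + b)" by (simp add: power2_eq_square algebra_simps)
  show ?thesis
    using K(2) ab by (intro prod_eqI) (simp add: f m, simp add: s m sq field_simps)
qed

lemma measure_body_pos:
  fixes K :: "'a::euclidean_space set"
  assumes "compact K" "interior K \<noteq> {}" shows "measure lborel K > 0"
proof -
  obtain x e where e: "e > 0" "ball x e \<subseteq> K" using assms(2) by (auto simp: mem_interior)
  have "0 < measure lborel (ball x e)" using content_ball_pos[OF e(1)] by simp
  also have "\<dots> \<le> measure lborel K"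
    by (rule measure_mono_fmeasurable[OF e(2)]) (use assms fmeasurable_compact in auto)
  finally show ?thesis .
qed

lemma centroid_body:
  fixes K :: "'a::euclidean_space set"
  assumes "interior K \<noteq> {}"
  shows "centroid K = (LINT x:K|lborel. x) /\<^sub>R measure lborel K"
  unfolding centroid_thicken thicken_body[OF assms] ..

lemma centroid_prism:
  fixes K :: "'a::euclidean_space set" and a b :: real
  assumes K: "compact K" "interior K \<noteq> {}" and ab: "a < b"
  shows "centroid (K \<times> {a..b}) = (centroid K, (a + b) / 2)"
proof -
  have "interior (K \<times> {a..b}) \<noteq> {}" using K ab by (simp add: interior_Times interior_atLeastAtMost_real)
  then show ?thesis
    unfolding centroid_body[OF K(2)] using mean_Times_interval[OF K(1) measure_body_pos[OF K] ab] by (simp add: centroid_body)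
qed

lemma centroid_horizontal_body:
  fixes K :: "'a::euclidean_space set" and h :: real
  assumes K: "compact K" "interior K \<noteq> {}"
  shows "centroid (K \<times> {h}) = (centroid K, h)"
  unfolding centroid_thicken[of "K \<times> {h}"] thicken_body_Times_singleton[OF K(2)] centroid_body[OF K(2)]
  using mean_Times_interval[OF K(1) measure_body_pos[OF K], of "h - 1" "h + 1"] by simp

text \<open>Such a product is symmetric about the claimed point. The degenerate cases
  \<open>a = b\<close> and \<open>p = q\<close> cover horizontal and vertical edges, the general one
  vertical plates.\<close>

lemma centroid_segment_Times:
  fixes p q :: "'a::euclidean_space" and a b :: real
  assumes "a \<le> b"
  shows "centroid (closed_segment p q \<times> {a..b}) = (midpoint p q, (a + b) / 2)"
proof (rule centroid_symmetric)
  fix x assume x: "x \<in> closed_segment p q \<times> {a..b}"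
  then obtain u where u: "0 \<le> u" "u \<le> 1" "fst x = (1 - u) *\<^sub>R p + u *\<^sub>R q" by (auto simp: in_segment)
  have "2 *\<^sub>R midpoint p q - fst x = (1 - (1 - u)) *\<^sub>R p + (1 - u) *\<^sub>R q"
    by (simp add: u(3) midpoint_def algebra_simps)
  then have "2 *\<^sub>R midpoint p q - fst x \<in> closed_segment p q"
    unfolding in_segment using u by (intro exI[of _ "1 - u"]) auto
  then show "2 *\<^sub>R (midpoint p q, (a + b) / 2) - x \<in> closed_segment p q \<times> {a..b}"
    using x assms by (cases x) (auto simp: field_simps)
qed (use assms in \<open>auto intro!: convex_Times compact_Times\<close>)

lemma mem_unit_cube_Pair:
  "(x, y) \<in> (unit_cube :: ('a::euclidean_space \<times> real) set) \<longleftrightarrow> x \<in> unit_cube \<and> 0 \<le> y \<and> y < 1"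
  by (auto simp: unit_cube_def Basis_prod_def)

lemma unit_cube_real: "(unit_cube :: real set) = {0..<1}"
  by (auto simp: unit_cube_def)

subsection \<open>End points of sides\<close>

definition vec2 :: "real \<Rightarrow> real \<Rightarrow> real^2" where
  "vec2 x y = x *\<^sub>R axis 1 1 + y *\<^sub>R axis 2 1"

lemma vec2_nth[simp]: "vec2 x y $ 1 = x" "vec2 x y $ 2 = y"
  by (simp_all add: vec2_def axis_def)

lemma vec2_eq_iff: "v = vec2 x y \<longleftrightarrow> v $ 1 = x \<and> v $ 2 = y"
  by (simp add: vec_eq_iff forall_2)

lemma vec2_add: "x + vec2 a b = vec2 (x $ 1 + a) (x $ 2 + b)"
  by (simp add: vec_eq_iff forall_2)

lemma measurable_vec2[measurable (raw)]:
  "f \<in> borel_measurable N \<Longrightarrow> g \<in> borel_measurable N \<Longrightarrow> (\<lambda>x. vec2 (f x) (g x)) \<in> borel_measurable N"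
  unfolding vec2_def by (intro borel_measurable_add borel_measurable_scaleR measurable_const) auto

definition lo :: "2 \<Rightarrow> (real^2) set \<Rightarrow> real" where
  "lo i K = Inf ((\<lambda>x. x \<bullet> axis i 1) ` K)"

text \<open>The maximum is written as a negated infimum, so the measurability of infima of linear
  functionals serves for all sides of the bounding box.\<close>

definition hi :: "2 \<Rightarrow> (real^2) set \<Rightarrow> real" where
  "hi i K = - Inf ((\<lambda>x. x \<bullet> (- axis i 1)) ` K)"

text \<open>A segment is spanned by two opposite corners of its bounding box; which diagonal it is
  can be read off from the lower left corner. This makes the endpoints measurable functions.\<close>

definition end1 :: "(real^2) set \<Rightarrow> real^2" where
  "end1 K = (if vec2 (lo 1 K) (lo 2 K) \<in> K then vec2 (lo 1 K) (lo 2 K) else vec2 (lo 1 K) (hi 2 K))"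

definition end2 :: "(real^2) set \<Rightarrow> real^2" where
  "end2 K = (if vec2 (lo 1 K) (lo 2 K) \<in> K then vec2 (hi 1 K) (hi 2 K) else vec2 (hi 1 K) (lo 2 K))"

lemma Inf_inner_segment:
  fixes a b u :: "'a::euclidean_space"
  shows "Inf ((\<lambda>x. x \<bullet> u) ` closed_segment a b) = min (a \<bullet> u) (b \<bullet> u)"
proof (rule cInf_eq_minimum)
  have "a \<in> closed_segment a b" "b \<in> closed_segment a b" by auto
  then show "min (a \<bullet> u) (b \<bullet> u) \<in> (\<lambda>x. x \<bullet> u) ` closed_segment a b"
    unfolding min_def by (auto intro: image_eqI[of _ _ a] image_eqI[of _ _ b])
  fix y assume "y \<in> (\<lambda>x. x \<bullet> u) ` closed_segment a b"
  then obtain s where s: "0 \<le> s" "s \<le> 1" "y = (1 - s) * (a \<bullet> u) + s * (b \<bullet> u)"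
    by (auto simp: in_segment inner_add_left)
  have "(1 - s) * min (a \<bullet> u) (b \<bullet> u) + s * min (a \<bullet> u) (b \<bullet> u) \<le> y"
    unfolding s(3) using s by (intro add_mono mult_left_mono) auto
  then show "min (a \<bullet> u) (b \<bullet> u) \<le> y" by (simp add: algebra_simps)
qed

lemma lo_segment: "lo i (closed_segment a b) = min (a $ i) (b $ i)"
  unfolding lo_def Inf_inner_segment by (simp add: inner_axis)

lemma hi_segment: "hi i (closed_segment a b) = max (a $ i) (b $ i)"
  unfolding hi_def Inf_inner_segment by (simp add: inner_axis max_def min_def)

lemma ends_segment: "{end1 (closed_segment a b), end2 (closed_segment a b)} = {a, b}"
proof -
  have ordered: "{end1 (closed_segment a b), end2 (closed_segment a b)} = {a, b}" if le: "a $ 1 \<le> b $ 1" for a b :: "real^2"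
  proof (cases "a $ 2 \<le> b $ 2")
    case True
    have "vec2 (lo 1 (closed_segment a b)) (lo 2 (closed_segment a b)) = a"
      using le True by (simp add: lo_segment eq_commute[of _ a] vec2_eq_iff)
    moreover have "vec2 (hi 1 (closed_segment a b)) (hi 2 (closed_segment a b)) = b"
      using le True by (simp add: hi_segment eq_commute[of _ b] vec2_eq_iff)
    ultimately show ?thesis by (simp add: end1_def end2_def)
  next
    case False
    have 1: "vec2 (lo 1 (closed_segment a b)) (lo 2 (closed_segment a b)) = vec2 (a $ 1) (b $ 2)"
      using le False by (simp add: lo_segment)
    have 2: "vec2 (lo 1 (closed_segment a b)) (hi 2 (closed_segment a b)) = a"
      using le False by (simp add: lo_segment hi_segment eq_commute[of _ a] vec2_eq_iff)
    have 3: "vec2 (hi 1 (closed_segment a b)) (lo 2 (closed_segment a b)) = b"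
      using le False by (simp add: lo_segment hi_segment eq_commute[of _ b] vec2_eq_iff)
    show ?thesis
    \<comment> \<open>A segment descending from \<open>a\<close> to \<open>b\<close> contains the
      lower left corner of its box only if it is vertical; the box then degenerates and either
      diagonal gives the right ends.\<close>
    proof (cases "vec2 (a $ 1) (b $ 2) \<in> closed_segment a b")
      case True
      then obtain s where s: "vec2 (a $ 1) (b $ 2) = (1 - s) *\<^sub>R a + s *\<^sub>R b" by (auto simp: in_segment)
      have "b $ 2 = (1 - s) * a $ 2 + s * b $ 2" using arg_cong[OF s, of "\<lambda>v. v $ 2"] by simp
      then have "(1 - s) * (a $ 2 - b $ 2) = 0" by (simp add: algebra_simps)
      then have "s = 1" using False by simp
      then have ab1: "a $ 1 = b $ 1" using arg_cong[OF s, of "\<lambda>v. v $ 1"] by simp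
      have "vec2 (a $ 1) (b $ 2) = b" using ab1 by (simp add: eq_commute[of _ b] vec2_eq_iff)
      moreover have "vec2 (hi 1 (closed_segment a b)) (hi 2 (closed_segment a b)) = a"
        using ab1 False by (simp add: hi_segment eq_commute[of _ a] vec2_eq_iff)
      ultimately show ?thesis using True 1 by (auto simp: end1_def end2_def)
    next
      case nin: False
      then show ?thesis using 1 2 3 by (simp add: end1_def end2_def)
    qed
  qed
  show ?thesis
  proof (cases "a $ 1 \<le> b $ 1")
    case True then show ?thesis by (rule ordered)
  next
    case False
    then show ?thesis using ordered[of b a] by (simp add: closed_segment_commute insert_commute)
  qed
qed

lemma ends_segment_cases:
  "end1 (closed_segment a b) = a \<and> end2 (closed_segment a b) = b \<or> end1 (closed_segment a b) = b \<and> end2 (closed_segment a b) = a"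
  using ends_segment[of a b] by (metis doubleton_eq_iff)

lemma ends_translate:
  assumes "K = closed_segment a b"
  shows "end1 ((+) x ` K) = x + end1 K" "end2 ((+) x ` K) = x + end2 K"
proof -
  have K': "(+) x ` K = closed_segment (x + a) (x + b)"
    unfolding assms by (rule closed_segment_translation[symmetric])
  have l: "lo i ((+) x ` K) = x $ i + lo i K" "hi i ((+) x ` K) = x $ i + hi i K" for i
    unfolding K' unfolding assms by (auto simp: lo_segment hi_segment min_def max_def)
  have "vec2 (lo 1 ((+) x ` K)) (lo 2 ((+) x ` K)) \<in> (+) x ` K \<longleftrightarrow> vec2 (lo 1 K) (lo 2 K) \<in> K"
    unfolding l vec2_add[symmetric] by auto
  then show "end1 ((+) x ` K) = x + end1 K" "end2 ((+) x ` K) = x + end2 K"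
    unfolding end1_def end2_def l vec2_add[symmetric] by simp_all
qed

lemma measurable_lo_hi[measurable]:
  "lo i \<in> borel_measurable body_algebra" "hi i \<in> borel_measurable body_algebra"
proof -
  show "lo i \<in> borel_measurable body_algebra"
    unfolding lo_def[abs_def] by (rule measurable_body_Inf_inner)
  show "hi i \<in> borel_measurable body_algebra"
    unfolding hi_def[abs_def] by (intro borel_measurable_uminus measurable_body_Inf_inner)
qed

lemma measurable_ends[measurable]:
  "end1 \<in> body_algebra \<rightarrow>\<^sub>M borel" "end2 \<in> body_algebra \<rightarrow>\<^sub>M borel"
  unfolding end1_def[abs_def] end2_def[abs_def] by measurable

text \<open>The measurable form of \<open>touch\<close>, with which it agrees on cells: nonemptiness
  as a hitting event, nondegeneracy as distinct ends.\<close>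

definition sides :: "(real^2) set \<Rightarrow> (real^2) set \<Rightarrow> bool" where
  "sides z z' \<longleftrightarrow> z \<noteq> z' \<and> (z \<inter> z') \<inter> UNIV \<noteq> {} \<and> end1 (z \<inter> z') \<noteq> end2 (z \<inter> z')"

lemma pred_sides[measurable (raw)]:
  assumes [measurable]: "f \<in> N \<rightarrow>\<^sub>M body_algebra" "g \<in> N \<rightarrow>\<^sub>M body_algebra"
  shows "Measurable.pred N (\<lambda>x. sides (f x) (g x))"
  unfolding sides_def
  by (intro pred_intros_logic pred_eq_body pred_hit measurable_body_Int assms open_UNIV)
     (auto intro!: borel_measurable_eq measurable_compose[OF measurable_body_Int measurable_ends(1)] measurable_compose[OF measurable_body_Int measurable_ends(2)] assms simp: pred_def)

context planar_tess
begin

lemma sides_iff_touch: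
  assumes "z \<in> t" "z' \<in> t" shows "sides z z' \<longleftrightarrow> touch z z'"
proof
  assume s: "sides z z'"
  then obtain p where p: "p \<in> z \<inter> z'" by (auto simp: sides_def)
  have "z \<inter> z' \<noteq> closed_segment p p" using s ends_segment_cases[of p p] unfolding sides_def by metis
  then have "\<exists>q\<in>z \<inter> z'. q \<noteq> p" using p by auto
  then show "touch z z'" using s p unfolding touch_def sides_def by blast
next
  assume t: "touch z z'"
  obtain a b where ab: "a \<noteq> b" "z \<inter> z' = closed_segment a b" using neighbour_segment[OF assms t] by auto
  show "sides z z'" unfolding sides_def ab(2)
    using ab(1) t ends_segment_cases[of a b] by (auto simp: touch_def)
qed

lemma ends_of_side:
  assumes "z \<in> t" "z' \<in> t" "touch z z'"
  shows "z \<inter> z' = closed_segment (end1 (z \<inter> z')) (end2 (z \<inter> z'))" "end1 (z \<inter> z') \<noteq> end2 (z \<inter> z')"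
    "v extreme_point_of (z \<inter> z') \<longleftrightarrow> v = end1 (z \<inter> z') \<or> v = end2 (z \<inter> z')"
proof -
  obtain a b where ab: "a \<noteq> b" "z \<inter> z' = closed_segment a b" using neighbour_segment[OF assms] by auto
  show "z \<inter> z' = closed_segment (end1 (z \<inter> z')) (end2 (z \<inter> z'))" "end1 (z \<inter> z') \<noteq> end2 (z \<inter> z')"
    "v extreme_point_of (z \<inter> z') \<longleftrightarrow> v = end1 (z \<inter> z') \<or> v = end2 (z \<inter> z')"
    unfolding ab(2) using ends_segment_cases[of a b] ab(1)
    by (auto simp: extreme_point_of_segment closed_segment_commute)
qed

end

subsection \<open>Locally finite configurations\<close>

text \<open>Sums over a random configuration are measurable only if it is locally finite, which is known
  almost surely. Cleaning removes the exceptional configurations measurably.\<close>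

definition clean :: "(nat \<Rightarrow> 'b set) \<Rightarrow> 'b set \<Rightarrow> 'b set" where
  "clean B X = (if (\<forall>n. finite (X \<inter> B n)) \<and> X \<subseteq> (\<Union>n. B n) then X else {})"

lemma clean_finite: "finite (clean B X \<inter> B n)"
  and clean_subset_UN: "clean B X \<subseteq> (\<Union>n. B n)"
  and clean_subset: "clean B X \<subseteq> X"
  by (auto simp: clean_def)

lemma ecount_finite_iff: "ecount X < \<infinity> \<longleftrightarrow> finite X"
  by (simp add: emeasure_count_space of_nat_less_top)

lemma clean_eq_iff: "clean B X = X \<longleftrightarrow> (\<forall>n. finite (X \<inter> B n)) \<and> X \<subseteq> (\<Union>n. B n)"
  by (auto simp: clean_def)

text \<open>Both conditions concern counts: finite in every \<open>B n\<close>, and zero outside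
  their union.\<close>

lemma pred_clean:
  assumes g: "g \<in> N \<rightarrow>\<^sub>M config_algebra S" and B: "\<And>n. B n \<in> sets S"
  shows "Measurable.pred N (\<lambda>x. clean B (g x) = g x)"
proof -
  have m: "(\<lambda>x. ecount (g x \<inter> A)) \<in> borel_measurable N" if "A \<in> sets S" for A
    using measurable_compose[OF g measurable_ecount_Int[OF that]] .
  have 1: "Measurable.pred N (\<lambda>x. finite (g x \<inter> B n))" for n
    unfolding ecount_finite_iff[symmetric] using m[OF B] by measurable
  have U: "space S - (\<Union>n. B n) \<in> sets S" using B by auto
  have 2: "Measurable.pred N (\<lambda>x. ecount (g x \<inter> (space S - (\<Union>n. B n))) = 0)"
    using m[OF U] by measurable
  have "Measurable.pred N (\<lambda>x. (\<forall>n. finite (g x \<inter> B n)) \<and> ecount (g x \<inter> (space S - (\<Union>n. B n))) = 0)"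
    by (intro pred_intros_logic pred_intros_countable(1) 1 2)
  moreover have "clean B (g x) = g x \<longleftrightarrow> (\<forall>n. finite (g x \<inter> B n)) \<and> ecount (g x \<inter> (space S - (\<Union>n. B n))) = 0"
    if "x \<in> space N" for x
  proof -
    have "g x \<subseteq> space S" using measurable_space[OF g that] by (simp add: space_config)
    moreover have "ecount Y = 0 \<longleftrightarrow> Y = {}" for Y :: "'b set"
      by (auto simp: emeasure_count_space_eq_0)
    ultimately show ?thesis unfolding clean_eq_iff by auto
  qed
  ultimately show ?thesis by (subst measurable_cong) auto
qed

lemma measurable_clean:
  assumes g: "g \<in> N \<rightarrow>\<^sub>M config_algebra S" and B: "\<And>n. B n \<in> sets S"
  shows "(\<lambda>x. clean B (g x)) \<in> N \<rightarrow>\<^sub>M config_algebra S"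
proof -
  have "(\<lambda>x. if clean B (g x) = g x then g x else {}) \<in> N \<rightarrow>\<^sub>M config_algebra S"
    by (intro measurable_If g measurable_const predE pred_clean[OF g B]) (auto simp: space_config)
  moreover have "clean B X = (if clean B X = X then X else {})" for X by (simp add: clean_def)
  ultimately show ?thesis by simp
qed

lemma measurable_sum_clean:
  assumes g: "g \<in> N \<rightarrow>\<^sub>M config_algebra S" and B: "\<And>n. B n \<in> sets S" "incseq B"
    and f: "(\<lambda>(x, y). f x y) \<in> borel_measurable (N \<Otimes>\<^sub>M S)"
  shows "(\<lambda>x. \<integral>\<^sup>+y. f x y \<partial>count_space (clean B (g x))) \<in> borel_measurable N"
  using measurable_nn_integral_config[OF measurable_clean[OF g B(1)] clean_finite B clean_subset_UN f] .

lemma nn_integral_indicator_count_space_eq_0: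
  "(\<integral>\<^sup>+y. indicator {y. P y} y \<partial>count_space X) = (0::ennreal) \<longleftrightarrow> (\<forall>y\<in>X. \<not> P y)"
  by (subst nn_integral_0_iff_AE) (auto simp: AE_count_space)

text \<open>A point with the property exists exactly when the sum of its indicators is nonzero, and
  such sums are measurable. This makes quantifiers over random configurations available.\<close>

lemma pred_ex_clean:
  assumes g: "g \<in> N \<rightarrow>\<^sub>M config_algebra S" and B: "\<And>n. B n \<in> sets S" "incseq B"
    and P: "Measurable.pred (N \<Otimes>\<^sub>M S) (\<lambda>p. P (fst p) (snd p))"
  shows "Measurable.pred N (\<lambda>x. \<exists>y\<in>clean B (g x). P x y)"
proof -
  have "(\<lambda>(x, y). indicator {y. P x y} y :: ennreal) \<in> borel_measurable (N \<Otimes>\<^sub>M S)"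
  proof -
    have "(\<lambda>p. if P (fst p) (snd p) then 1 else 0 :: ennreal) \<in> borel_measurable (N \<Otimes>\<^sub>M S)"
      using P by measurable
    also have "(\<lambda>p. if P (fst p) (snd p) then 1 else 0 :: ennreal) = (\<lambda>(x, y). indicator {y. P x y} y)"
      by (auto simp: fun_eq_iff indicator_def)
    finally show ?thesis .
  qed
  from measurable_sum_clean[OF g B this]
  have "Measurable.pred N (\<lambda>x. \<not> (\<integral>\<^sup>+y. indicator {y. P x y} y \<partial>count_space (clean B (g x))) = (0::ennreal))"
    by measurable
  then show ?thesis unfolding nn_integral_indicator_count_space_eq_0 by simp
qed

section \<open>Windows exhausting cells, plates and heights\<close>

definition hitting :: "nat \<Rightarrow> 'a::euclidean_space set set" where
  "hitting n = {K. compact K \<and> K \<inter> ball 0 (real n) \<noteq> {}}"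

lemma sets_hitting: "hitting n \<in> sets body_algebra"
  unfolding hitting_def by (rule sets_body_hit) simp

lemma incseq_hitting: "incseq (hitting :: nat \<Rightarrow> 'a::euclidean_space set set)"
  unfolding incseq_def
proof (intro allI impI)
  fix m n :: nat assume "m \<le> n"
  then have "ball (0::'a) (real m) \<subseteq> ball 0 (real n)" by (intro subset_ball) simp
  then show "(hitting m :: 'a set set) \<subseteq> hitting n" unfolding hitting_def by blast
qed

lemma UN_hitting: "(\<Union>n. hitting n) = {K. compact K \<and> K \<noteq> {}}"
proof (intro set_eqI iffI)
  fix K :: "'a set" assume "K \<in> {K. compact K \<and> K \<noteq> {}}"
  then obtain x where x: "compact K" "x \<in> K" by auto
  obtain n :: nat where "norm x < n" using reals_Archimedean2 by blast
  then have "K \<in> hitting n" using x by (auto simp: hitting_def)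
  then show "K \<in> (\<Union>n. hitting n)" by auto
qed (auto simp: hitting_def)

lemma tessellation_cell:
  assumes "tessellation t" "z \<in> t" shows "compact z" "z \<noteq> {}" "interior z \<noteq> {}" "convex z"
proof -
  have "polytope z" "interior z \<noteq> {}" using assms by (auto simp: tessellation_def)
  then show "compact z" "z \<noteq> {}" "interior z \<noteq> {}" "convex z"
    by (auto simp: polytope_imp_compact polytope_imp_convex)
qed

lemma clean_tessellation:
  assumes "tessellation t" shows "clean hitting t = t"
proof -
  have "finite (t \<inter> hitting n)" for n
  proof (rule finite_subset)
    show "t \<inter> hitting n \<subseteq> {z\<in>t. z \<inter> ball 0 (real n) \<noteq> {}}" by (auto simp: hitting_def)
    show "finite {z\<in>t. z \<inter> ball 0 (real n) \<noteq> {}}" using assms by (auto simp: tessellation_def)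
  qed
  moreover have "t \<subseteq> (\<Union>n. hitting n)" unfolding UN_hitting using tessellation_cell[OF assms] by auto
  ultimately show ?thesis by (simp add: clean_def)
qed

lemma space_tess: "space (tess_algebra :: 'a::euclidean_space set set measure) = {t. tessellation t}"
  unfolding tess_algebra_def using tessellation_cell(1)
  by (auto simp: space_restrict_space space_config space_body)

lemma tess_to_config: "(\<lambda>t. t) \<in> tess_algebra \<rightarrow>\<^sub>M config_algebra body_algebra"
  unfolding tess_algebra_def by (rule measurable_restrict_space1) simp

lemma measurable_sum_tess:
  assumes g: "g \<in> N \<rightarrow>\<^sub>M tess_algebra" and f: "(\<lambda>(x, y). f x y) \<in> borel_measurable (N \<Otimes>\<^sub>M body_algebra)"
  shows "(\<lambda>x. \<integral>\<^sup>+y. f x y \<partial>count_space (g x)) \<in> borel_measurable N"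
proof -
  have "(\<lambda>x. \<integral>\<^sup>+y. f x y \<partial>count_space (clean hitting (g x))) \<in> borel_measurable N"
    using measurable_compose[OF g tess_to_config] sets_hitting incseq_hitting f by (intro measurable_sum_clean) auto
  moreover have "clean hitting (g x) = g x" if "x \<in> space N" for x
    using measurable_space[OF g that] by (simp add: space_tess clean_tessellation)
  ultimately show ?thesis by (subst measurable_cong) auto
qed

lemma pred_ex_tess:
  assumes g: "g \<in> N \<rightarrow>\<^sub>M tess_algebra" and P: "Measurable.pred (N \<Otimes>\<^sub>M body_algebra) (\<lambda>p. P (fst p) (snd p))"
  shows "Measurable.pred N (\<lambda>x. \<exists>y\<in>g x. P x y)"
proof -
  have "Measurable.pred N (\<lambda>x. \<exists>y\<in>clean hitting (g x). P x y)"
    using measurable_compose[OF g tess_to_config] sets_hitting incseq_hitting P by (intro pred_ex_clean) auto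
  moreover have "clean hitting (g x) = g x" if "x \<in> space N" for x
    using measurable_space[OF g that] by (simp add: space_tess clean_tessellation)
  ultimately show ?thesis by (subst measurable_cong) auto
qed

definition plate_box :: "nat \<Rightarrow> ('a::euclidean_space set \<times> real) set" where
  "plate_box n = hitting n \<times> {- real n..real n}"

lemma sets_plate_box: "plate_box n \<in> sets (body_algebra \<Otimes>\<^sub>M borel)"
  unfolding plate_box_def by (intro pair_measureI sets_hitting) simp

lemma incseq_plate_box: "incseq plate_box"
  unfolding incseq_def plate_box_def
  by (intro allI impI Sigma_mono incseqD[OF incseq_hitting]) auto

definition line_box :: "nat \<Rightarrow> real set" where
  "line_box n = {- real n..real n}"

lemma sets_line_box: "line_box n \<in> sets borel"
  by (simp add: line_box_def)

lemma incseq_line_box: "incseq line_box"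
  by (auto simp: incseq_def line_box_def)

lemma UN_line_box: "(\<Union>n. line_box n) = UNIV"
proof -
  have "x \<in> (\<Union>n. line_box n)" for x :: real
  proof -
    obtain n :: nat where "\<bar>x\<bar> < n" using reals_Archimedean2 by blast
    then have "x \<in> line_box n" by (auto simp: line_box_def)
    then show ?thesis by auto
  qed
  then show ?thesis by auto
qed

lemma clean_line_box: "clean line_box X = (if \<forall>a b. finite (X \<inter> {a..b}) then X else {})"
proof -
  have "(\<forall>n. finite (X \<inter> line_box n)) \<longleftrightarrow> (\<forall>a b. finite (X \<inter> {a..b}))"
  proof (intro iffI allI)
    fix a b :: real assume f: "\<forall>n. finite (X \<inter> line_box n)"
    obtain n :: nat where n: "max \<bar>a\<bar> \<bar>b\<bar> < real n" using reals_Archimedean2[of "max \<bar>a\<bar> \<bar>b\<bar>"] by (elim exE) (rule that)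
    have "- real n \<le> a" "b \<le> real n" using n by linarith+
    then have "{a..b} \<subseteq> line_box n" by (auto simp: line_box_def)
    then have "X \<inter> {a..b} \<subseteq> X \<inter> line_box n" by (rule Int_mono[OF order_refl])
    then show "finite (X \<inter> {a..b})" by (rule finite_subset) (use f in simp)
  next
    fix n :: nat assume "\<forall>a b. finite (X \<inter> {a..b})"
    then show "finite (X \<inter> line_box n)" unfolding line_box_def by (elim allE)
  qed
  then show ?thesis by (simp only: clean_def UN_line_box subset_UNIV simp_thms)
qed

text \<open>The joint law of \<open>T\<close> and \<open>X\<close> and the law composed from that of
  \<open>T\<close> and the kernel agree on rectangles by definition; these generate the product
  algebra and are stable under intersection.\<close>

lemma nn_integral_disintegration:
  assumes M: "prob_space M" and cd: "conditional_distribution M N T S X \<kappa>"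
    and f: "f \<in> borel_measurable (N \<Otimes>\<^sub>M S)"
  shows "(\<integral>\<^sup>+w. f (T w, X w) \<partial>M) = (\<integral>\<^sup>+t. \<integral>\<^sup>+\<psi>. f (t, \<psi>) \<partial>\<kappa> t \<partial>distr M N T)"
proof -
  interpret prob_space M by (rule M)
  have T[measurable]: "T \<in> M \<rightarrow>\<^sub>M N" and X[measurable]: "X \<in> M \<rightarrow>\<^sub>M S" and \<kappa>: "\<kappa> \<in> N \<rightarrow>\<^sub>M prob_algebra S"
    and eq: "\<And>A B. A \<in> sets N \<Longrightarrow> B \<in> sets S \<Longrightarrow>
        emeasure M {w \<in> space M. T w \<in> A \<and> X w \<in> B} = (\<integral>\<^sup>+t\<in>A. emeasure (\<kappa> t) B \<partial>distr M N T)"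
    using cd by (auto simp: conditional_distribution_def)
  have \<kappa>': "\<kappa> \<in> N \<rightarrow>\<^sub>M subprob_algebra S" using \<kappa> by (rule measurable_prob_algebraD)
  have sk: "sets (\<kappa> t) = sets S" if "t \<in> space N" for t
    using measurable_space[OF \<kappa>' that] by (simp add: space_subprob_algebra)
  \<comment> \<open>The kernel with the parameter kept as first coordinate, so that binding it
    yields a joint law.\<close>
  define D where "D t = distr (\<kappa> t) (N \<Otimes>\<^sub>M S) (Pair t)" for t
  have D: "D \<in> N \<rightarrow>\<^sub>M subprob_algebra (N \<Otimes>\<^sub>M S)"
    unfolding D_def by (rule measurable_distr2[OF _ \<kappa>']) simp
  have D': "D \<in> distr M N T \<rightarrow>\<^sub>M subprob_algebra (N \<Otimes>\<^sub>M S)" using D by simp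
  have Pm: "Pair t \<in> \<kappa> t \<rightarrow>\<^sub>M N \<Otimes>\<^sub>M S" if "t \<in> space N" for t
    using that sk[OF that] by (simp cong: measurable_cong_sets)
  have ne: "space (distr M N T) \<noteq> {}" using not_empty measurable_space[OF T] by auto
  have \<mu>: "distr M (N \<Otimes>\<^sub>M S) (\<lambda>w. (T w, X w)) = distr M N T \<bind> D" (is "?\<mu> = ?\<nu>")
  proof (rule measure_eqI_generator_eq[OF Int_stable_pair_measure_generator[of N S], of "space N \<times> space S" _ _ "\<lambda>_. space N \<times> space S"])
    show "{a \<times> b |a b. a \<in> sets N \<and> b \<in> sets S} \<subseteq> Pow (space N \<times> space S)"
      by (rule pair_measure_closed)
    show "sets ?\<mu> = sigma_sets (space N \<times> space S) {a \<times> b |a b. a \<in> sets N \<and> b \<in> sets S}"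
      by (simp add: sets_pair_measure)
    show "sets ?\<nu> = sigma_sets (space N \<times> space S) {a \<times> b |a b. a \<in> sets N \<and> b \<in> sets S}"
    proof -
      have "sets (D t) = sets (N \<Otimes>\<^sub>M S)" if "t \<in> space (distr M N T)" for t
        by (simp add: D_def)
      from sets_bind[OF this ne] show ?thesis by (simp add: sets_pair_measure)
    qed
    fix Y assume "Y \<in> {a \<times> b |a b. a \<in> sets N \<and> b \<in> sets S}"
    then obtain A B where AB: "A \<in> sets N" "B \<in> sets S" and Y: "Y = A \<times> B" by auto
    have "emeasure ?\<mu> Y = emeasure M {w \<in> space M. T w \<in> A \<and> X w \<in> B}"
      using AB unfolding Y by (subst emeasure_distr) (auto intro!: arg_cong[where f="emeasure M"])
    also have "\<dots> = (\<integral>\<^sup>+t\<in>A. emeasure (\<kappa> t) B \<partial>distr M N T)" by (rule eq[OF AB])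
    also have "\<dots> = (\<integral>\<^sup>+t. emeasure (D t) Y \<partial>distr M N T)"
    proof (rule nn_integral_cong)
      fix t assume "t \<in> space (distr M N T)"
      then have t: "t \<in> space N" by simp
      have "emeasure (D t) Y = emeasure (\<kappa> t) (Pair t -` Y \<inter> space (\<kappa> t))"
        unfolding D_def Y using AB Pm[OF t] by (subst emeasure_distr) auto
      also have "Pair t -` Y \<inter> space (\<kappa> t) = (if t \<in> A then B else {})"
        using sets.sets_into_space[OF AB(2)] sets_eq_imp_space_eq[OF sk[OF t]] unfolding Y by auto
      finally show "emeasure (\<kappa> t) B * indicator A t = emeasure (D t) Y" by (simp add: indicator_def)
    qed
    also have "\<dots> = emeasure ?\<nu> Y"
      using AB unfolding Y by (subst emeasure_bind[OF ne D']) auto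
    finally show "emeasure ?\<mu> Y = emeasure ?\<nu> Y" .
  next
    show "range (\<lambda>_. space N \<times> space S) \<subseteq> {a \<times> b |a b. a \<in> sets N \<and> b \<in> sets S}" by auto
    show "(\<Union>i. space N \<times> space S) = space N \<times> space S" by simp
    fix i :: nat
    have "(\<lambda>w. (T w, X w)) \<in> M \<rightarrow>\<^sub>M N \<Otimes>\<^sub>M S" by measurable
    then have "prob_space ?\<mu>" by (rule prob_space_distr)
    then show "emeasure ?\<mu> (space N \<times> space S) \<noteq> \<infinity>"
      using prob_space.emeasure_space_1[of ?\<mu>] by (simp add: space_pair_measure)
  qed
  have "(\<integral>\<^sup>+w. f (T w, X w) \<partial>M) = (\<integral>\<^sup>+p. f p \<partial>?\<mu>)" using f by (subst nn_integral_distr) auto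
  also have "\<dots> = (\<integral>\<^sup>+t. \<integral>\<^sup>+p. f p \<partial>D t \<partial>distr M N T)" unfolding \<mu> by (rule nn_integral_bind[OF f D'])
  also have "\<dots> = (\<integral>\<^sup>+t. \<integral>\<^sup>+\<psi>. f (t, \<psi>) \<partial>\<kappa> t \<partial>distr M N T)"
    unfolding D_def using f Pm by (intro nn_integral_cong nn_integral_distr) auto
  finally show ?thesis .
qed

lemma measurable_tess_sections:
  assumes f: "f \<in> borel_measurable (N \<Otimes>\<^sub>M S)" and k: "\<kappa> \<in> N \<rightarrow>\<^sub>M prob_algebra S"
  shows "(\<lambda>t. \<integral>\<^sup>+\<psi>. f (t, \<psi>) \<partial>\<kappa> t) \<in> borel_measurable N"
  using nn_integral_measurable_subprob_algebra2[of "\<lambda>t \<psi>. f (t, \<psi>)" N S \<kappa>] f measurable_prob_algebraD[OF k] by simp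

text \<open>The disintegrated integral of the indicator of failure vanishes on one side exactly when
  it vanishes on the other. Both directions are used later.\<close>

lemma AE_disintegration:
  assumes M: "prob_space M" and cd: "conditional_distribution M N T S X \<kappa>"
    and P: "Measurable.pred (N \<Otimes>\<^sub>M S) (\<lambda>p. P (fst p) (snd p))"
  shows "(AE w in M. P (T w) (X w)) \<longleftrightarrow> (AE t in distr M N T. AE \<psi> in \<kappa> t. P t \<psi>)"
proof -
  have T: "T \<in> M \<rightarrow>\<^sub>M N" and X: "X \<in> M \<rightarrow>\<^sub>M S" and \<kappa>: "\<kappa> \<in> N \<rightarrow>\<^sub>M prob_algebra S"
    using cd by (auto simp: conditional_distribution_def)
  have sk: "sets (\<kappa> t) = sets S" if "t \<in> space N" for t
    using measurable_space[OF measurable_prob_algebraD[OF \<kappa>] that] by (simp add: space_subprob_algebra)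
  define f :: "'b \<times> 'c \<Rightarrow> ennreal" where "f p = (if P (fst p) (snd p) then 0 else 1)" for p
  have f: "f \<in> borel_measurable (N \<Otimes>\<^sub>M S)" unfolding f_def using P by measurable
  have TX: "(\<lambda>w. (T w, X w)) \<in> M \<rightarrow>\<^sub>M N \<Otimes>\<^sub>M S" using T X by measurable
  have fp: "f (t, \<psi>) = 0 \<longleftrightarrow> P t \<psi>" for t \<psi> by (simp add: f_def)
  have "(AE w in M. P (T w) (X w)) \<longleftrightarrow> (\<integral>\<^sup>+w. f (T w, X w) \<partial>M) = 0"
    using measurable_compose[OF TX f] by (subst nn_integral_0_iff_AE) (auto simp: fp)
  also have "\<dots> \<longleftrightarrow> (AE t in distr M N T. (\<integral>\<^sup>+\<psi>. f (t, \<psi>) \<partial>\<kappa> t) = 0)"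
    unfolding nn_integral_disintegration[OF M cd f] using measurable_tess_sections[OF f \<kappa>]
    by (subst nn_integral_0_iff_AE) auto
  also have "\<dots> \<longleftrightarrow> (AE t in distr M N T. AE \<psi> in \<kappa> t. P t \<psi>)"
  proof (rule AE_cong)
    fix t assume "t \<in> space (distr M N T)"
    then have t: "t \<in> space N" by simp
    have "(\<lambda>\<psi>. f (t, \<psi>)) \<in> borel_measurable (\<kappa> t)"
      using measurable_Pair2[OF f t] sk[OF t] by (simp cong: measurable_cong_sets)
    then show "(\<integral>\<^sup>+\<psi>. f (t, \<psi>) \<partial>\<kappa> t) = 0 \<longleftrightarrow> (AE \<psi> in \<kappa> t. P t \<psi>)"
      by (subst nn_integral_0_iff_AE) (auto simp: fp)
  qed
  finally show ?thesis .
qed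

subsection \<open>Stationary line processes\<close>

lemma ecount_image: "inj_on f X \<Longrightarrow> ecount (f ` X) = ecount X"
  by (simp add: emeasure_count_space finite_image_iff card_image)

lemma nn_integral_one_count_space: "(\<integral>\<^sup>+x. indicator A x \<partial>count_space X) = ecount (X \<inter> A)"
proof -
  have "(\<integral>\<^sup>+x. indicator A x \<partial>count_space X) = (\<integral>\<^sup>+x. indicator A x * indicator X x \<partial>count_space UNIV)"
    by (rule nn_integral_count_space_indicator) simp
  also have "\<dots> = (\<integral>\<^sup>+x. indicator (X \<inter> A) x \<partial>count_space UNIV)"
    by (intro nn_integral_cong) (auto split: split_indicator)
  also have "\<dots> = ecount (X \<inter> A)" by (rule nn_integral_indicator) simp
  finally show ?thesis .
qed

lemma measurable_shift_config: "(\<lambda>X. (+) s ` X) \<in> config_algebra borel \<rightarrow>\<^sub>M config_algebra (borel :: real measure)"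
proof (rule measurable_config_algebraI)
  fix A :: "real set" assume A: "A \<in> sets borel"
  have B: "(\<lambda>x. s + x) -` A \<in> sets borel"
    using measurable_sets[of "\<lambda>x. s + x" borel borel A] A by simp
  have "(+) s ` X \<inter> A = (+) s ` (X \<inter> (\<lambda>x. s + x) -` A)" for X by auto
  then have "ecount ((+) s ` X \<inter> A) = ecount (X \<inter> (\<lambda>x. s + x) -` A)" for X
    by (simp add: ecount_image)
  then show "(\<lambda>X. ecount ((+) s ` X \<inter> A)) \<in> borel_measurable (config_algebra borel)"
    using measurable_ecount_Int[OF B] by simp
qed simp

lemma clean_line_shift: "clean line_box ((+) s ` X) = (+) s ` clean line_box X"
proof -
  have "(+) s ` X \<inter> {a..b} = (+) s ` (X \<inter> {a - s..b - s})" for a b by (auto simp: image_iff)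
  then have 1: "finite ((+) s ` X \<inter> {a..b}) \<longleftrightarrow> finite (X \<inter> {a - s..b - s})" for a b
    by (simp add: finite_image_iff)
  have "(\<forall>a b. finite ((+) s ` X \<inter> {a..b})) \<longleftrightarrow> (\<forall>a b. finite (X \<inter> {a..b}))"
  proof (intro iffI allI)
    fix a b assume "\<forall>a b. finite ((+) s ` X \<inter> {a..b})"
    then have "finite ((+) s ` X \<inter> {a + s..b + s})" by (elim allE)
    then show "finite (X \<inter> {a..b})" unfolding 1 by simp
  next
    fix a b assume "\<forall>a b. finite (X \<inter> {a..b})"
    then show "finite ((+) s ` X \<inter> {a..b})" unfolding 1 by (elim allE)
  qed
  then show ?thesis unfolding clean_line_box by simp
qed

lemma before_midpoint_shift: "before_midpoint ((+) s ` D) (s + h) c \<longleftrightarrow> before_midpoint D h (c - s)"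
  unfolding before_midpoint_def by (auto simp: algebra_simps)

lemma before_midpoint_mono: "before_midpoint D h c \<Longrightarrow> c \<le> c' \<Longrightarrow> before_midpoint D h c'"
  unfolding before_midpoint_def by force

lemma int_jump:
  fixes P :: "int \<Rightarrow> bool"
  assumes mono: "\<And>m n. P m \<Longrightarrow> m \<le> n \<Longrightarrow> P n" and a: "P a" and b: "\<not> P b"
  shows "\<exists>!m. P m \<and> \<not> P (m - 1)"
proof -
  have ab: "b < a" using mono[of a b] a b by (cases "a \<le> b") auto
  define n where "n = (LEAST n. P (b + int n))"
  have ex: "P (b + int (nat (a - b)))" using ab a by simp
  have n: "P (b + int n)" unfolding n_def by (rule LeastI[of _ "nat (a - b)"]) (rule ex)
  have n0: "n \<noteq> 0" using n b by (intro notI) simp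
  have "\<not> P (b + int (n - 1))" unfolding n_def by (rule not_less_Least) (use n0 in \<open>simp add: n_def\<close>)
  then have n': "\<not> P (b + int n - 1)" using n0 by (simp add: of_nat_diff algebra_simps)
  show ?thesis
  proof (rule ex1I[of _ "b + int n"])
    fix m assume m: "P m \<and> \<not> P (m - 1)"
    show "m = b + int n"
      using mono[of m "b + int n - 1"] mono[of "b + int n" "m - 1"] m n n' by force
  qed (use n n' in simp)
qed

text \<open>The condition is monotone in \<open>c\<close>; it fails for integers up to
  \<open>h\<close> and holds beyond some point above \<open>h\<close>. Hence exactly one integer
  translate of the unit window contains the midpoint.\<close>

lemma midpoint_jump:
  assumes "\<exists>y\<in>D. h < y"
  shows "\<exists>!k::int. before_midpoint D h (1 - of_int k) \<and> \<not> before_midpoint D h (0 - of_int k)"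
proof -
  obtain y where y: "y \<in> D" "h < y" using assms by auto
  define P where "P m = before_midpoint D h (of_int m)" for m :: int
  have "\<exists>!m. P m \<and> \<not> P (m - 1)"
  proof (rule int_jump)
    show "P n" if "P m" "m \<le> n" for m n using that unfolding P_def by (auto intro: before_midpoint_mono)
    have "y < of_int (\<lfloor>y\<rfloor> + 1)" by linarith
    then have "h + y < 2 * of_int (\<lfloor>y\<rfloor> + 1)"
      using add_strict_mono[OF less_trans[OF y(2)]] by (metis mult_2)
    then show "P (\<lfloor>y\<rfloor> + 1)" unfolding P_def before_midpoint_def using y by blast
    have "of_int \<lfloor>h\<rfloor> \<le> h" by simp
    then show "\<not> P \<lfloor>h\<rfloor>" unfolding P_def before_midpoint_def by (intro notI) (elim bexE conjE, linarith)
  qed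
  then obtain m where m: "P m" "\<not> P (m - 1)" and u: "\<And>m'. P m' \<Longrightarrow> \<not> P (m' - 1) \<Longrightarrow> m' = m" by blast
  show ?thesis
  proof (rule ex1I[of _ "1 - m"])
    show "before_midpoint D h (1 - of_int (1 - m)) \<and> \<not> before_midpoint D h (0 - of_int (1 - m))"
      using m by (simp add: P_def)
    fix k assume "before_midpoint D h (1 - of_int k) \<and> \<not> before_midpoint D h (0 - of_int k)"
    then have "P (1 - k)" "\<not> P (1 - k - 1)" by (simp_all add: P_def)
    then show "k = 1 - m" using u[of "1 - k"] by simp
  qed
qed

lemma nn_integral_indicator_unique:
  assumes "\<exists>!k. P k"
  shows "(\<integral>\<^sup>+k. indicator {k. P k} k \<partial>count_space UNIV) = 1"
proof -
  obtain k where "{k. P k} = {k}" using assms by auto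
  then show ?thesis by (simp add: emeasure_count_space)
qed

lemma unit_interval_translates: "\<exists>!k::int. of_int k \<le> x \<and> x < of_int k + (1::real)"
proof (rule ex1I[of _ "\<lfloor>x\<rfloor>"])
  show "k = \<lfloor>x\<rfloor>" if "of_int k \<le> x \<and> x < of_int k + 1" for k using floor_unique[of k x] that by simp
qed linarith

locale indep_lines = prob_space Q for Q :: "'b measure" +
  fixes I :: "'i set" and X :: "'i \<Rightarrow> 'b \<Rightarrow> real set" and r :: "'i \<Rightarrow> real"
  assumes ind: "indep_vars (\<lambda>_. config_algebra borel) X I"
    and slp: "\<And>i. i \<in> I \<Longrightarrow> stationary_line_process Q (X i) (r i)"
    and r_pos: "\<And>i. i \<in> I \<Longrightarrow> r i > 0"
begin

lemma rv[measurable]: "i \<in> I \<Longrightarrow> X i \<in> Q \<rightarrow>\<^sub>M config_algebra borel"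
  using ind by (auto simp: indep_vars_def)

lemma rv_count[measurable]: "i \<in> I \<Longrightarrow> A \<in> sets borel \<Longrightarrow> (\<lambda>\<omega>. ecount (X i \<omega> \<inter> A)) \<in> borel_measurable Q"
  using measurable_compose[OF rv measurable_ecount_Int] .

lemma mean_count_unit: "i \<in> I \<Longrightarrow> (\<integral>\<^sup>+\<omega>. ecount (X i \<omega> \<inter> {0..<1}) \<partial>Q) = ennreal (r i)"
proof -
  assume "i \<in> I"
  then have "intensity Q id (X i) = ennreal (r i)" using slp by (simp add: stationary_line_process_def)
  moreover have "{x \<in> X i \<omega>. id x \<in> unit_cube} = X i \<omega> \<inter> {0..<1}" for \<omega> by (auto simp: unit_cube_real)
  moreover have "emeasure (count_space A) A = ecount A" for A :: "real set" by (simp add: emeasure_count_space)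
  ultimately show ?thesis by (simp add: intensity_def mean_sum_def)
qed

lemma AE_clean: "i \<in> I \<Longrightarrow> AE \<omega> in Q. clean line_box (X i \<omega>) = X i \<omega>"
  using slp[of i] unfolding stationary_line_process_def clean_line_box by auto

lemma shift_one:
  assumes i: "i \<in> I" and f: "f \<in> borel_measurable (config_algebra borel)"
  shows "(\<integral>\<^sup>+\<omega>. f ((+) s ` X i \<omega>) \<partial>Q) = (\<integral>\<^sup>+\<omega>. f (X i \<omega>) \<partial>Q)"
proof -
  have m: "(\<lambda>\<omega>. (+) s ` X i \<omega>) \<in> Q \<rightarrow>\<^sub>M config_algebra borel"
    using measurable_compose[OF rv[OF i] measurable_shift_config] .
  have "distr Q (config_algebra borel) (\<lambda>\<omega>. (+) s ` X i \<omega>) = distr Q (config_algebra borel) (X i)"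
    using slp[OF i] by (simp add: stationary_line_process_def)
  then show ?thesis using nn_integral_distr[OF m, of f] nn_integral_distr[OF rv[OF i], of f] f by simp
qed

text \<open>By independence the joint law is the product of the individual laws, each of which is
  shift invariant; hence a common shift preserves it.\<close>

lemma shift_family:
  assumes A: "A \<subseteq> I" "A \<noteq> {}" and f: "f \<in> borel_measurable (PiM A (\<lambda>_. config_algebra borel))"
  shows "(\<integral>\<^sup>+\<omega>. f (\<lambda>i\<in>A. (+) s ` X i \<omega>) \<partial>Q) = (\<integral>\<^sup>+\<omega>. f (\<lambda>i\<in>A. X i \<omega>) \<partial>Q)"
proof -
  have i1: "indep_vars (\<lambda>_. config_algebra borel) X A" using indep_vars_subset[OF ind A(1)] .
  have "indep_vars (\<lambda>_. config_algebra borel) (\<lambda>i. (\<lambda>X. (+) s ` X) \<circ> X i) A"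
    by (rule indep_vars_compose[OF i1]) (rule measurable_shift_config)
  then have i2: "indep_vars (\<lambda>_. config_algebra borel) (\<lambda>i \<omega>. (+) s ` X i \<omega>) A" by (simp add: o_def)
  have rv1: "X i \<in> Q \<rightarrow>\<^sub>M config_algebra borel" if "i \<in> A" for i using that A rv by auto
  have rv2: "(\<lambda>\<omega>. (+) s ` X i \<omega>) \<in> Q \<rightarrow>\<^sub>M config_algebra borel" if "i \<in> A" for i
    using measurable_compose[OF rv1[OF that] measurable_shift_config] .
  have d1: "distr Q (PiM A (\<lambda>_. config_algebra borel)) (\<lambda>\<omega>. \<lambda>i\<in>A. X i \<omega>) = PiM A (\<lambda>i. distr Q (config_algebra borel) (X i))"
    using i1 indep_vars_iff_distr_eq_PiM'[OF A(2), of X "\<lambda>_. config_algebra borel"] rv1 by blast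
  have d2: "distr Q (PiM A (\<lambda>_. config_algebra borel)) (\<lambda>\<omega>. \<lambda>i\<in>A. (+) s ` X i \<omega>) = PiM A (\<lambda>i. distr Q (config_algebra borel) (\<lambda>\<omega>. (+) s ` X i \<omega>))"
    using i2 indep_vars_iff_distr_eq_PiM'[OF A(2), of "\<lambda>i \<omega>. (+) s ` X i \<omega>" "\<lambda>_. config_algebra borel"] rv2 by blast
  have "distr Q (config_algebra borel) (\<lambda>\<omega>. (+) s ` X i \<omega>) = distr Q (config_algebra borel) (X i)" if "i \<in> A" for i
    using slp[of i] that A by (auto simp: stationary_line_process_def)
  then have e: "distr Q (PiM A (\<lambda>_. config_algebra borel)) (\<lambda>\<omega>. \<lambda>i\<in>A. (+) s ` X i \<omega>) = distr Q (PiM A (\<lambda>_. config_algebra borel)) (\<lambda>\<omega>. \<lambda>i\<in>A. X i \<omega>)"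
    unfolding d1 d2 by (intro PiM_cong) auto
  have m1: "(\<lambda>\<omega>. \<lambda>i\<in>A. X i \<omega>) \<in> Q \<rightarrow>\<^sub>M PiM A (\<lambda>_. config_algebra borel)"
    using rv1 by (intro measurable_restrict)
  have m2: "(\<lambda>\<omega>. \<lambda>i\<in>A. (+) s ` X i \<omega>) \<in> Q \<rightarrow>\<^sub>M PiM A (\<lambda>_. config_algebra borel)"
    using rv2 by (intro measurable_restrict)
  show ?thesis using nn_integral_distr[OF m1, of f] nn_integral_distr[OF m2, of f] e f by simp
qed

text \<open>The unit interval consists of \<open>n\<close> translates of an interval of length
  \<open>1 / n\<close>, which have equal mean counts by stationarity.\<close>

lemma mean_count_fraction:
  assumes i: "i \<in> I" and n: "n > (0::nat)"
  shows "(\<integral>\<^sup>+\<omega>. ecount (X i \<omega> \<inter> {a..<a + 1 / n}) \<partial>Q) = ennreal (r i / n)"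
proof -
  define c where "c = (\<integral>\<^sup>+\<omega>. ecount (X i \<omega> \<inter> {0..<1 / n}) \<partial>Q)"
  have sh: "(\<integral>\<^sup>+\<omega>. ecount (X i \<omega> \<inter> {a..<a + 1 / n}) \<partial>Q) = c" for a :: real
  proof -
    have "ecount ((+) a ` Y \<inter> {a..<a + 1 / n}) = ecount (Y \<inter> {0..<1 / n})" for Y
    proof -
      have "(+) a ` Y \<inter> {a..<a + 1 / n} = (+) a ` (Y \<inter> {0..<1 / n})" by auto
      then show ?thesis by (simp add: ecount_image)
    qed
    then show ?thesis
      unfolding c_def using shift_one[OF i measurable_ecount_Int[of "{a..<a + 1 / n}"], of a] by simp
  qed
  have U: "{0..<1::real} = (\<Union>l<n. {real l / n..<real l / n + 1 / n})"
  proof (intro set_eqI iffI)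
    fix x :: real assume x: "x \<in> {0..<1}"
    \<comment> \<open>The index of the subinterval containing \<open>x\<close>.\<close>
    define l where "l = nat \<lfloor>x * n\<rfloor>"
    have l: "real l \<le> x * n" "x * n < real l + 1" using x by (auto simp: l_def)
    have "x * n < 1 * real n" using x n by (intro mult_strict_right_mono) auto
    then have "l < n" using l by simp
    moreover have "real l / n \<le> x" "x < real l / n + 1 / n" using l n by (auto simp: field_simps)
    ultimately show "x \<in> (\<Union>l<n. {real l / n..<real l / n + 1 / n})" by auto
  next
    fix x assume "x \<in> (\<Union>l<n. {real l / n..<real l / n + 1 / n})"
    then obtain l where l: "l < n" "real l / n \<le> x" "x < real l / n + 1 / n" by auto
    have "real l / n + 1 / n \<le> 1" using l n by (simp add: add_divide_distrib[symmetric])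
    moreover have "0 \<le> real l / n" by simp
    ultimately show "x \<in> {0..<1}" using l by (auto simp del: of_nat_0_le_iff divide_nonneg_nonneg)
  qed
  have disj: "disjoint_family_on (\<lambda>l. Y \<inter> {real l / n..<real l / n + 1 / n}) {..<n}" for Y :: "real set"
  proof -
    have key: "k = l" if "real k / n \<le> x" "x < real k / n + 1 / n" "real l / n \<le> x" "x < real l / n + 1 / n" for k l x
    proof -
      have "real k \<le> x * n" "x * n < real k + 1" "real l \<le> x * n" "x * n < real l + 1"
        using that n by (auto simp: field_simps)
      then have "real k < real l + 1" "real l < real k + 1" by linarith+
      then show ?thesis by linarith
    qed
    show ?thesis unfolding disjoint_family_on_def using key by fastforce
  qed
  have "ennreal (r i) = (\<integral>\<^sup>+\<omega>. (\<Sum>l<n. ecount (X i \<omega> \<inter> {real l / n..<real l / n + 1 / n})) \<partial>Q)"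
  proof -
    have "ecount (Y \<inter> {0..<1}) = (\<Sum>l<n. ecount (Y \<inter> {real l / n..<real l / n + 1 / n}))" for Y :: "real set"
    proof -
      have "(\<Sum>l<n. ecount (Y \<inter> {real l / n..<real l / n + 1 / n})) = ecount (\<Union>l<n. Y \<inter> {real l / n..<real l / n + 1 / n})"
        using disj[of Y] by (intro sum_emeasure) auto
      moreover have "(\<Union>l<n. Y \<inter> {real l / n..<real l / n + 1 / n}) = Y \<inter> {0..<1}" unfolding U by blast
      ultimately show ?thesis by (simp only:)
    qed
    then show ?thesis using mean_count_unit[OF i] by simp
  qed
  also have "\<dots> = (\<Sum>l<n. (\<integral>\<^sup>+\<omega>. ecount (X i \<omega> \<inter> {real l / n..<real l / n + 1 / n}) \<partial>Q))"
    using i by (intro nn_integral_sum) auto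
  also have "\<dots> = of_nat n * c" by (simp add: sh)
  finally have e: "ennreal (r i) = of_nat n * c" .
  have "c = ennreal (r i / n)"
  proof -
    have "ennreal (r i / n) = ennreal (r i) / ennreal n" using n r_pos[OF i] by (simp add: divide_ennreal)
    also have "\<dots> = (c * of_nat n) / of_nat n" unfolding e by (simp add: ennreal_of_nat_eq_real_of_nat mult.commute)
    also have "\<dots> = c" using n by (intro ennreal_mult_divide_eq) auto
    finally show ?thesis by simp
  qed
  then show ?thesis by (simp add: sh)
qed

definition hits :: "'i \<Rightarrow> real set \<Rightarrow> 'b set" where
  "hits i A = {\<omega> \<in> space Q. ecount (X i \<omega> \<inter> A) \<noteq> 0}"

lemma sets_hits: assumes "i \<in> I" "A \<in> sets borel" shows "hits i A \<in> sets Q"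
  unfolding hits_def using rv_count[OF assms] by measurable

lemma hits_iff: "\<omega> \<in> hits i A \<longleftrightarrow> \<omega> \<in> space Q \<and> X i \<omega> \<inter> A \<noteq> {}"
  by (simp add: hits_def emeasure_count_space_eq_0)

text \<open>Markov's inequality at level one.\<close>

lemma emeasure_hits_le:
  assumes "i \<in> I" "A \<in> sets borel" shows "emeasure Q (hits i A) \<le> (\<integral>\<^sup>+\<omega>. ecount (X i \<omega> \<inter> A) \<partial>Q)"
proof -
  have "emeasure Q (hits i A) = (\<integral>\<^sup>+\<omega>. indicator (hits i A) \<omega> \<partial>Q)" using sets_hits[OF assms] by simp
  also have "\<dots> \<le> (\<integral>\<^sup>+\<omega>. ecount (X i \<omega> \<inter> A) \<partial>Q)"
  proof (intro nn_integral_mono)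
    fix \<omega>
    have "1 \<le> ecount Y" if ne: "Y \<noteq> {}" for Y :: "real set"
    proof -
      obtain y where "y \<in> Y" using ne by blast
      then have "ecount {y} \<le> ecount Y" by (intro emeasure_mono) auto
      then show ?thesis by (simp add: emeasure_count_space)
    qed
    then show "indicator (hits i A) \<omega> \<le> ecount (X i \<omega> \<inter> A)" by (auto simp: hits_iff split: split_indicator)
  qed
  finally show ?thesis .
qed

lemma indep_hits:
  assumes ij: "i \<in> I" "j \<in> I" "i \<noteq> j" and A: "A \<in> sets borel"
  shows "emeasure Q (hits i A \<inter> hits j A) = emeasure Q (hits i A) * emeasure Q (hits j A)"
proof -
  let ?H = "{Y \<in> space (config_algebra borel). ecount (Y \<inter> A) \<noteq> 0}"
  have H: "?H \<in> sets (config_algebra borel)" using measurable_ecount_Int[OF A] by measurable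
  have e: "X k -` ?H \<inter> space Q = hits k A" if "k \<in> I" for k
    using measurable_space[OF rv[OF that]] by (auto simp: hits_def)
  have "prob (\<Inter>k\<in>{i, j}. X k -` ?H \<inter> space Q) = (\<Prod>k\<in>{i, j}. prob (X k -` ?H \<inter> space Q))"
    using ij H by (intro indep_varsD[OF ind]) auto
  then have "prob (hits i A \<inter> hits j A) = prob (hits i A) * prob (hits j A)"
    using ij e[OF ij(1)] e[OF ij(2)] by simp
  then show ?thesis by (simp add: emeasure_eq_measure ennreal_mult)
qed

text \<open>A common point lies in one of \<open>n\<close> windows of length \<open>1/n\<close>, each of which is hit by both independent
  processes with probability of order \<open>1/n\<^sup>2\<close>.\<close>

lemma AE_no_common_point_window:
  fixes a :: real
  assumes ij: "i \<in> I" "j \<in> I" "i \<noteq> j"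
  shows "AE \<omega> in Q. X i \<omega> \<inter> X j \<omega> \<inter> {a..<a + 1} = {}"
proof -
  define J where "J n l = {a + real l / real n..<a + real l / real n + 1 / real n}" for n l :: nat
  define W where "W n = (\<Union>l<n. hits i (J n l) \<inter> hits j (J n l))" for n
  have J[measurable]: "J n l \<in> sets borel" for n l by (simp add: J_def)
  have Wm: "W n \<in> sets Q" for n unfolding W_def using ij sets_hits[OF _ J] by auto
  \<comment> \<open>There are \<open>n\<close> windows, and in each of them independence bounds the
    probability of a double hit by the product of the mean counts.\<close>
  have bound: "emeasure Q (W n) \<le> ennreal (r i * r j / n)" if n: "n > 0" for n
  proof -
    have "emeasure Q (W n) \<le> (\<Sum>l<n. emeasure Q (hits i (J n l) \<inter> hits j (J n l)))"
      unfolding W_def using ij sets_hits[OF _ J] by (intro emeasure_subadditive_finite) auto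
    also have "\<dots> \<le> (\<Sum>l<n. ennreal (r i / n) * ennreal (r j / n))"
    proof (intro sum_mono)
      fix l assume "l \<in> {..<n}"
      have "emeasure Q (hits k (J n l)) \<le> ennreal (r k / n)" if "k \<in> I" for k
        using emeasure_hits_le[OF that J[of n l]] mean_count_fraction[OF that n, of "a + real l / real n"] unfolding J_def by simp
      then show "emeasure Q (hits i (J n l) \<inter> hits j (J n l)) \<le> ennreal (r i / n) * ennreal (r j / n)"
        unfolding indep_hits[OF ij J] using ij by (intro mult_mono) auto
    qed
    also have "\<dots> = of_nat n * (ennreal (r i / n) * ennreal (r j / n))" by simp
    also have "\<dots> = ennreal (real n * (r i / n * (r j / n)))"
      using r_pos[OF ij(1)] r_pos[OF ij(2)] by (simp only: ennreal_of_nat_eq_real_of_nat) (subst ennreal_mult, simp_all add: ennreal_mult[symmetric])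
    also have "real n * (r i / n * (r j / n)) = r i * r j / n" using n by (simp add: field_simps)
    finally show ?thesis .
  qed
  have N: "(\<Inter>n\<in>{0<..}. W n) \<in> sets Q" by (intro sets.countable_INT') (use Wm in auto)
  \<comment> \<open>The bound by \<open>r i * r j / n\<close> for every \<open>n\<close> excludes a
    positive probability \<open>p\<close>.\<close>
  have "emeasure Q (\<Inter>n\<in>{0<..}. W n) = 0"
  proof (rule ccontr)
    assume n0: "emeasure Q (\<Inter>n\<in>{0<..}. W n) \<noteq> 0"
    define p where "p = prob (\<Inter>n\<in>{0<..}. W n)"
    have p: "p > 0" using n0 by (simp add: p_def emeasure_eq_measure zero_less_measure_iff ennreal_eq_0_iff not_le)
    have pn: "p \<le> r i * r j / n" if n: "n > 0" for n :: nat
    proof -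
      have "ennreal p \<le> emeasure Q (W n)"
        unfolding p_def emeasure_eq_measure[symmetric] using n Wm by (intro emeasure_mono) auto
      also have "\<dots> \<le> ennreal (r i * r j / n)" by (rule bound[OF n])
      finally show ?thesis using r_pos[OF ij(1)] r_pos[OF ij(2)] by (simp add: ennreal_le_iff)
    qed
    obtain n :: nat where n: "r i * r j / p < n" using reals_Archimedean2 by blast
    have "0 \<le> r i * r j / p" using p r_pos[OF ij(1)] r_pos[OF ij(2)] by simp
    then have "0 < real n" using n by linarith
    then have n0: "n > 0" by simp
    have "r i * r j < n * p" using n p by (simp add: divide_less_eq)
    then show False using pn[OF n0] n0 by (simp add: le_divide_eq mult.commute)
  qed
  then have "(\<Inter>n\<in>{0<..}. W n) \<in> null_sets Q" using N by auto
  then show ?thesis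
  proof (rule AE_I')
    show "{\<omega> \<in> space Q. X i \<omega> \<inter> X j \<omega> \<inter> {a..<a + 1} \<noteq> {}} \<subseteq> (\<Inter>n\<in>{0<..}. W n)"
    proof
      fix \<omega> assume w: "\<omega> \<in> {\<omega> \<in> space Q. X i \<omega> \<inter> X j \<omega> \<inter> {a..<a + 1} \<noteq> {}}"
      then obtain x where x: "x \<in> X i \<omega>" "x \<in> X j \<omega>" "a \<le> x" "x < a + 1" by auto
      show "\<omega> \<in> (\<Inter>n\<in>{0<..}. W n)"
      proof
        fix n :: nat assume n: "n \<in> {0<..}"
        define l where "l = nat \<lfloor>(x - a) * n\<rfloor>"
        have l: "real l \<le> (x - a) * n" "(x - a) * n < real l + 1" using x by (auto simp: l_def)
        have "(x - a) * n < 1 * real n" using x n by (intro mult_strict_right_mono) auto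
        then have "l < n" using l by simp
        moreover have "x \<in> J n l" using l n by (auto simp: J_def field_simps)
        ultimately show "\<omega> \<in> W n" unfolding W_def using x w by (auto simp: hits_iff)
      qed
    qed
  qed
qed

lemma AE_no_common_point:
  assumes ij: "i \<in> I" "j \<in> I" "i \<noteq> j"
  shows "AE \<omega> in Q. X i \<omega> \<inter> X j \<omega> = {}"
proof -
  have "AE \<omega> in Q. \<forall>k::int. X i \<omega> \<inter> X j \<omega> \<inter> {of_int k..<of_int k + 1} = {}"
    using AE_no_common_point_window[OF ij] by (subst AE_all_countable) auto
  then show ?thesis
  proof eventually_elim
    fix \<omega> assume h: "\<forall>k::int. X i \<omega> \<inter> X j \<omega> \<inter> {of_int k..<of_int k + 1} = {}"
    show "X i \<omega> \<inter> X j \<omega> = {}"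
    proof (rule ccontr)
      assume "X i \<omega> \<inter> X j \<omega> \<noteq> {}"
      then obtain x where x: "x \<in> X i \<omega> \<inter> X j \<omega>" by blast
      have "x \<in> {of_int \<lfloor>x\<rfloor>..<of_int \<lfloor>x\<rfloor> + 1}" by auto
      then show False using h x by blast
    qed
  qed
qed

text \<open>The points of the superposition and their successors split the line into intervals; assign to each
  point of \<open>X i\<close> the midpoint of the interval above it. The unit interval is recovered by summing over
  its integer translates, so by stationarity this displacement does not change the intensity.\<close>

lemma mean_midpoint_count:
  assumes i: "i \<in> A" and A: "A \<subseteq> I" "finite A"
    and unb: "AE \<omega> in Q. \<forall>x. \<exists>h\<in>X i \<omega>. x < h"
  shows "(\<integral>\<^sup>+\<omega>. ecount {h \<in> X i \<omega>. before_midpoint (\<Union>j\<in>A. X j \<omega>) h 1 \<and> \<not> before_midpoint (\<Union>j\<in>A. X j \<omega>) h 0} \<partial>Q) = ennreal (r i)"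
proof -
  let ?P = "PiM A (\<lambda>_. config_algebra borel)"
  define D where "D x = (\<Union>j\<in>A. clean line_box (x j))" for x :: "'i \<Rightarrow> real set"
  \<comment> \<open>The point lies in the unit interval starting at \<open>a + k\<close>, its
    midpoint in the interval from \<open>c\<close> to \<open>b\<close>. Two instances occur: point
    in the unit interval starting at \<open>k\<close> with midpoint in the unit window, and the same
    picture shifted down by \<open>k\<close>.\<close>
  define E where "E a b c k x h \<longleftrightarrow> (a + of_int k \<le> h \<and> h < a + of_int k + 1) \<and> before_midpoint (D x) h b \<and> \<not> before_midpoint (D x) h c"
    for a b c and k :: int and x h
  define F where "F a b c k x = (\<integral>\<^sup>+h. indicator {h. E a b c k x h} h \<partial>count_space (clean line_box (x i)))"
    for a b c :: real and k and x :: "'i \<Rightarrow> real set"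
  have iI: "i \<in> I" and Ane: "A \<noteq> {}" using i A by auto
  have comp: "(\<lambda>x. x j) \<in> ?P \<rightarrow>\<^sub>M config_algebra borel" if "j \<in> A" for j
    using that by (rule measurable_component_singleton)
  have bm: "Measurable.pred (?P \<Otimes>\<^sub>M borel) (\<lambda>p. before_midpoint (D (fst p)) (snd p) c)" for c
  proof -
    have "before_midpoint (D (fst p)) (snd p) c \<longleftrightarrow> (\<exists>j\<in>A. \<exists>y\<in>clean line_box (fst p j). snd p < y \<and> snd p + y < 2 * c)" for p
      unfolding before_midpoint_def D_def by blast
    moreover have "Measurable.pred (?P \<Otimes>\<^sub>M borel) (\<lambda>p. \<exists>j\<in>A. \<exists>y\<in>clean line_box (fst p j). snd p < y \<and> snd p + y < 2 * c)"
    proof (intro pred_bex_countable countable_finite A(2) pred_ex_clean[OF _ sets_line_box incseq_line_box])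
      fix j assume "j \<in> A"
      then show "(\<lambda>p. fst p j) \<in> ?P \<Otimes>\<^sub>M borel \<rightarrow>\<^sub>M config_algebra borel"
        using measurable_compose[OF measurable_fst comp] by blast
    qed measurable
    ultimately show ?thesis by simp
  qed
  have Fm: "F a b c k \<in> borel_measurable ?P" for a b c k
    unfolding F_def
  proof (rule measurable_sum_clean[OF comp[OF i] sets_line_box incseq_line_box])
    have "Measurable.pred (?P \<Otimes>\<^sub>M borel) (\<lambda>p. E a b c k (fst p) (snd p))"
      unfolding E_def using bm[of b] bm[of c] by measurable
    then have "(\<lambda>p. if E a b c k (fst p) (snd p) then 1 else 0 :: ennreal) \<in> borel_measurable (?P \<Otimes>\<^sub>M borel)" by measurable
    also have "(\<lambda>p. if E a b c k (fst p) (snd p) then 1 else 0 :: ennreal) = (\<lambda>(x, h). indicator {h. E a b c k x h} h)"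
      by (auto simp: fun_eq_iff indicator_def)
    finally show "(\<lambda>(x, h). indicator {h. E a b c k x h} h :: ennreal) \<in> borel_measurable (?P \<Otimes>\<^sub>M borel)" .
  qed
  have FXm: "(\<lambda>\<omega>. F a b c k (\<lambda>j\<in>A. X j \<omega>)) \<in> borel_measurable Q" for a b c k
    using A rv by (intro measurable_compose[OF _ Fm] measurable_restrict) auto
  \<comment> \<open>Shifting all columns up by \<open>k\<close> moves points of the unit window into
    the interval starting at \<open>k\<close>, and their midpoints accordingly.\<close>
  have shiftF: "F 0 1 0 k (\<lambda>j\<in>A. (+) (of_int k) ` X j \<omega>) = F (- of_int k) (1 - of_int k) (0 - of_int k) k (\<lambda>j\<in>A. X j \<omega>)" for k \<omega>
  proof -
    let ?s = "real_of_int k"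
    have Ds: "D (\<lambda>j\<in>A. (+) ?s ` X j \<omega>) = (+) ?s ` D (\<lambda>j\<in>A. X j \<omega>)"
      unfolding D_def by (auto simp: clean_line_shift)
    have Es: "E 0 1 0 k (\<lambda>j\<in>A. (+) ?s ` X j \<omega>) (?s + h) \<longleftrightarrow> E (- ?s) (1 - ?s) (0 - ?s) k (\<lambda>j\<in>A. X j \<omega>) h" for h
      unfolding E_def Ds before_midpoint_shift by auto
    have "F 0 1 0 k (\<lambda>j\<in>A. (+) ?s ` X j \<omega>) =
        (\<integral>\<^sup>+h. indicator {h. E 0 1 0 k (\<lambda>j\<in>A. (+) ?s ` X j \<omega>) h} h \<partial>count_space ((+) ?s ` clean line_box (X i \<omega>)))"
      unfolding F_def using i by (simp add: clean_line_shift)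
    also have "\<dots> = (\<integral>\<^sup>+h. indicator {h. E 0 1 0 k (\<lambda>j\<in>A. (+) ?s ` X j \<omega>) h} (?s + h) \<partial>count_space (clean line_box (X i \<omega>)))"
      by (rule nn_integral_bij_count_space[symmetric]) (auto simp: bij_betw_def)
    also have "\<dots> = F (- ?s) (1 - ?s) (0 - ?s) k (\<lambda>j\<in>A. X j \<omega>)"
      unfolding F_def restrict_apply'[OF i] by (intro nn_integral_cong) (simp add: indicator_def Es)
    finally show ?thesis .
  qed
  have clean: "AE \<omega> in Q. \<forall>j\<in>A. clean line_box (X j \<omega>) = X j \<omega>"
    using A AE_clean by (intro AE_finite_allI) auto
  have fin: "countable (clean line_box Y)" for Y
  proof -
    have "clean line_box Y \<subseteq> (\<Union>n. clean line_box Y \<inter> line_box n)" using clean_subset_UN[of line_box Y] by auto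
    moreover have "countable (\<Union>n. clean line_box Y \<inter> line_box n)"
      by (intro countable_UN countableI_type countable_finite clean_finite)
    ultimately show ?thesis by (rule countable_subset)
  qed
  have "(\<integral>\<^sup>+\<omega>. ecount {h \<in> X i \<omega>. before_midpoint (\<Union>j\<in>A. X j \<omega>) h 1 \<and> \<not> before_midpoint (\<Union>j\<in>A. X j \<omega>) h 0} \<partial>Q)
     = (\<integral>\<^sup>+\<omega>. (\<integral>\<^sup>+k. F 0 1 0 k (\<lambda>j\<in>A. X j \<omega>) \<partial>count_space UNIV) \<partial>Q)"
  \<comment> \<open>Points with midpoint in the unit window are sorted by the unit interval in which
    they lie themselves.\<close>
  proof (rule nn_integral_cong_AE, use clean in eventually_elim)
    fix \<omega> assume c: "\<forall>j\<in>A. clean line_box (X j \<omega>) = X j \<omega>"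
    let ?x = "\<lambda>j\<in>A. X j \<omega>" and ?D = "\<Union>j\<in>A. X j \<omega>"
    have D: "D ?x = ?D" unfolding D_def using c by simp
    have ct: "countable (X i \<omega>)" using fin[of "X i \<omega>"] c i by simp
    have "(\<integral>\<^sup>+k. F 0 1 0 k ?x \<partial>count_space UNIV) = (\<integral>\<^sup>+k. \<integral>\<^sup>+h. indicator {h. E 0 1 0 k ?x h} h \<partial>count_space (X i \<omega>) \<partial>count_space UNIV)"
      unfolding F_def using c i by simp
    also have "\<dots> = (\<integral>\<^sup>+h. \<integral>\<^sup>+k. indicator {h. E 0 1 0 k ?x h} h \<partial>count_space UNIV \<partial>count_space (X i \<omega>))"
      by (rule nn_integral_count_space_nn_integral) (auto simp: ct)
    also have "\<dots> = (\<integral>\<^sup>+h. indicator {h. before_midpoint ?D h 1 \<and> \<not> before_midpoint ?D h 0} h \<partial>count_space (X i \<omega>))"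
    proof (rule nn_integral_cong)
      fix h
      have "(\<integral>\<^sup>+k. indicator {h. E 0 1 0 k ?x h} h \<partial>count_space UNIV) =
        (\<integral>\<^sup>+k. indicator {h. before_midpoint ?D h 1 \<and> \<not> before_midpoint ?D h 0} h * indicator {k::int. of_int k \<le> h \<and> h < of_int k + 1} k \<partial>count_space UNIV)"
        by (rule nn_integral_cong) (auto simp: E_def D indicator_def)
      also have "\<dots> = indicator {h. before_midpoint ?D h 1 \<and> \<not> before_midpoint ?D h 0} h * (1::ennreal)"
        by (subst nn_integral_cmult) (simp_all add: nn_integral_indicator_unique[OF unit_interval_translates] del: nn_integral_indicator)
      finally show "(\<integral>\<^sup>+k. indicator {h. E 0 1 0 k ?x h} h \<partial>count_space UNIV) = (indicator {h. before_midpoint ?D h 1 \<and> \<not> before_midpoint ?D h 0} h :: ennreal)" by simp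
    qed
    also have "\<dots> = ecount {h \<in> X i \<omega>. before_midpoint ?D h 1 \<and> \<not> before_midpoint ?D h 0}"
      unfolding nn_integral_one_count_space by (simp add: Int_def)
    finally show "ecount {h \<in> X i \<omega>. before_midpoint ?D h 1 \<and> \<not> before_midpoint ?D h 0} = (\<integral>\<^sup>+k. F 0 1 0 k ?x \<partial>count_space UNIV)" by simp
  qed
  also have "\<dots> = (\<integral>\<^sup>+k. (\<integral>\<^sup>+\<omega>. F 0 1 0 k (\<lambda>j\<in>A. X j \<omega>) \<partial>Q) \<partial>count_space UNIV)"
    by (intro nn_integral_count_space_nn_integral FXm) auto
  also have "\<dots> = (\<integral>\<^sup>+k. (\<integral>\<^sup>+\<omega>. F (- of_int k) (1 - of_int k) (0 - of_int k) k (\<lambda>j\<in>A. X j \<omega>) \<partial>Q) \<partial>count_space UNIV)"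
  proof (rule nn_integral_cong)
    fix k :: int
    have "(\<integral>\<^sup>+\<omega>. F 0 1 0 k (\<lambda>j\<in>A. X j \<omega>) \<partial>Q) = (\<integral>\<^sup>+\<omega>. F 0 1 0 k (\<lambda>j\<in>A. (+) (of_int k) ` X j \<omega>) \<partial>Q)"
      by (rule shift_family[OF A(1) Ane Fm, symmetric])
    then show "(\<integral>\<^sup>+\<omega>. F 0 1 0 k (\<lambda>j\<in>A. X j \<omega>) \<partial>Q) = (\<integral>\<^sup>+\<omega>. F (- of_int k) (1 - of_int k) (0 - of_int k) k (\<lambda>j\<in>A. X j \<omega>) \<partial>Q)"
      by (simp only: shiftF)
  qed
  also have "\<dots> = (\<integral>\<^sup>+\<omega>. (\<integral>\<^sup>+k. F (- of_int k) (1 - of_int k) (0 - of_int k) k (\<lambda>j\<in>A. X j \<omega>) \<partial>count_space UNIV) \<partial>Q)"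
    by (intro nn_integral_count_space_nn_integral[symmetric] FXm) auto
  also have "\<dots> = (\<integral>\<^sup>+\<omega>. ecount (X i \<omega> \<inter> {0..<1}) \<partial>Q)"
  \<comment> \<open>After the shift, the summands are points of the unit interval sorted by the unit
    interval of their midpoint, so each such point is counted once.\<close>
  proof (rule nn_integral_cong_AE, use clean unb in eventually_elim)
    fix \<omega> assume c: "\<forall>j\<in>A. clean line_box (X j \<omega>) = X j \<omega>" and u: "\<forall>x. \<exists>h\<in>X i \<omega>. x < h"
    let ?x = "\<lambda>j\<in>A. X j \<omega>" and ?D = "\<Union>j\<in>A. X j \<omega>"
    let ?G = "\<lambda>k h. E (- of_int k) (1 - of_int k) (0 - of_int k) k ?x h"
    have D: "D ?x = ?D" unfolding D_def using c by simp
    have ct: "countable (X i \<omega>)" using fin[of "X i \<omega>"] c i by simp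
    have "(\<integral>\<^sup>+k. F (- of_int k) (1 - of_int k) (0 - of_int k) k ?x \<partial>count_space UNIV) = (\<integral>\<^sup>+k. \<integral>\<^sup>+h. indicator {h. ?G k h} h \<partial>count_space (X i \<omega>) \<partial>count_space UNIV)"
      unfolding F_def using c i by simp
    also have "\<dots> = (\<integral>\<^sup>+h. \<integral>\<^sup>+k. indicator {h. ?G k h} h \<partial>count_space UNIV \<partial>count_space (X i \<omega>))"
      by (rule nn_integral_count_space_nn_integral) (auto simp: ct)
    also have "\<dots> = (\<integral>\<^sup>+h. indicator {0..<1} h \<partial>count_space (X i \<omega>))"
    proof (rule nn_integral_cong)
      fix h
      have ex: "\<exists>y\<in>?D. h < y" using u i by blast
      have "(\<integral>\<^sup>+k. indicator {h. ?G k h} h \<partial>count_space UNIV) =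
        (\<integral>\<^sup>+k. indicator {0..<1} h * indicator {k::int. before_midpoint ?D h (1 - of_int k) \<and> \<not> before_midpoint ?D h (0 - of_int k)} k \<partial>count_space UNIV)"
        by (rule nn_integral_cong) (auto simp: E_def D indicator_def)
      also have "\<dots> = indicator {0..<1} h * (1::ennreal)"
        by (subst nn_integral_cmult) (simp, simp only: nn_integral_indicator_unique[OF midpoint_jump[OF ex]])
      finally show "(\<integral>\<^sup>+k. indicator {h. ?G k h} h \<partial>count_space UNIV) = (indicator {0..<1} h :: ennreal)" by simp
    qed
    also have "\<dots> = ecount (X i \<omega> \<inter> {0..<1})" by (rule nn_integral_one_count_space)
    finally show "(\<integral>\<^sup>+k. F (- of_int k) (1 - of_int k) (0 - of_int k) k ?x \<partial>count_space UNIV) = ecount (X i \<omega> \<inter> {0..<1})" .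
  qed
  also have "\<dots> = ennreal (r i)" by (rule mean_count_unit[OF iI])
  finally show ?thesis .
qed

end

subsection \<open>Mass transport in the plane\<close>

lemma tessellation_translate:
  assumes t: "tessellation (t :: 'a::euclidean_space set set)" shows "tessellation (translate_tess x t)"
  unfolding tessellation_def translate_tess_def
proof (intro conjI ballI impI allI)
  fix z assume "z \<in> (`) ((+) x) ` t"
  then obtain y where "y \<in> t" "z = (+) x ` y" by auto
  then show "polytope z" "interior z \<noteq> {}"
    using t by (auto simp: tessellation_def polytope_translation_eq interior_translation)
next
  fix z z' assume "z \<in> (`) ((+) x) ` t" "z' \<in> (`) ((+) x) ` t" "z \<noteq> z'"
  then obtain y y' where y: "y \<in> t" "z = (+) x ` y" "y' \<in> t" "z' = (+) x ` y'" "y \<noteq> y'" by auto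
  have "interior y \<inter> interior y' = {}" using t y by (auto simp: tessellation_def)
  then show "interior z \<inter> interior z' = {}" unfolding y interior_translation by auto
next
  have "y \<in> \<Union>((`) ((+) x) ` t)" for y
  proof -
    have "y - x \<in> \<Union>t" using t by (simp add: tessellation_def)
    then obtain z where "z \<in> t" "y - x \<in> z" by auto
    then show ?thesis by (auto intro!: bexI[of _ z] image_eqI[of _ _ "y - x"])
  qed
  then show "\<Union>((`) ((+) x) ` t) = UNIV" by auto
next
  fix B :: "'a set" assume "bounded B"
  then have "bounded ((+) (- x) ` B)" by (rule bounded_translation)
  then have "finite {z\<in>t. z \<inter> (+) (- x) ` B \<noteq> {}}" using t by (simp add: tessellation_def)
  moreover have "{z \<in> (`) ((+) x) ` t. z \<inter> B \<noteq> {}} \<subseteq> (`) ((+) x) ` {z\<in>t. z \<inter> (+) (- x) ` B \<noteq> {}}"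
  proof
    fix z assume "z \<in> {z \<in> (`) ((+) x) ` t. z \<inter> B \<noteq> {}}"
    then obtain y b where y: "y \<in> t" "z = (+) x ` y" "b \<in> y" "x + b \<in> B" by auto
    then have "b \<in> (+) (- x) ` B" by (intro image_eqI[of _ _ "x + b"]) auto
    then have "y \<in> {z\<in>t. z \<inter> (+) (- x) ` B \<noteq> {}}" using y by auto
    then show "z \<in> (`) ((+) x) ` {z\<in>t. z \<inter> (+) (- x) ` B \<noteq> {}}" using y by auto
  qed
  ultimately show "finite {z \<in> (`) ((+) x) ` t. z \<inter> B \<noteq> {}}" using finite_subset by blast
qed

lemma inj_translate_set: "inj ((`) ((+) (x::'a::ab_group_add)))"
  by (intro inj_onI) (simp add: inj_image_eq_iff)

lemma measurable_tessI:
  assumes "g \<in> N \<rightarrow>\<^sub>M config_algebra body_algebra" "\<And>x. x \<in> space N \<Longrightarrow> tessellation (g x)"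
  shows "g \<in> N \<rightarrow>\<^sub>M tess_algebra"
  unfolding tess_algebra_def using assms by (intro measurable_restrict_space2) auto

lemma measurable_translate_tess:
  "translate_tess x \<in> tess_algebra \<rightarrow>\<^sub>M (tess_algebra :: 'a::euclidean_space set set measure)"
proof -
  have "translate_tess x \<in> tess_algebra \<rightarrow>\<^sub>M config_algebra (body_algebra :: 'a set measure)"
  proof (rule measurable_config_algebraI)
    fix t :: "'a set set" assume "t \<in> space tess_algebra"
    then have t: "tessellation t" by (simp add: space_tess)
    show "translate_tess x t \<subseteq> space body_algebra"
      using tessellation_cell(1)[OF tessellation_translate[OF t]] by (auto simp: space_body)
  next
    fix A :: "'a set set" assume A: "A \<in> sets body_algebra"
    let ?B = "(`) ((+) x) -` A \<inter> space body_algebra"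
    have B: "?B \<in> sets body_algebra" using measurable_sets[OF measurable_body_translate A] .
    have "ecount (translate_tess x t \<inter> A) = ecount (t \<inter> ?B)" if t: "tessellation t" for t
    proof -
      have "translate_tess x t \<inter> A = (`) ((+) x) ` (t \<inter> ?B)"
        using tessellation_cell(1)[OF t] by (auto simp: translate_tess_def space_body)
      then show ?thesis by (simp add: ecount_image inj_on_subset[OF inj_translate_set])
    qed
    moreover have "(\<lambda>t. ecount (t \<inter> ?B)) \<in> borel_measurable tess_algebra"
      using measurable_compose[OF tess_to_config measurable_ecount_Int[OF B]] .
    ultimately show "(\<lambda>t. ecount (translate_tess x t \<inter> A)) \<in> borel_measurable tess_algebra"
      by (subst measurable_cong) (auto simp: space_tess)
  qed
  then show ?thesis
    by (rule measurable_tessI) (simp add: space_tess tessellation_translate)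
qed

lemma nn_integral_translate:
  assumes T: "stationary_tessellation M T" and f: "f \<in> borel_measurable tess_algebra"
  shows "(\<integral>\<^sup>+w. f (translate_tess x (T w)) \<partial>M) = (\<integral>\<^sup>+w. f (T w) \<partial>M)"
proof -
  have Tm: "T \<in> M \<rightarrow>\<^sub>M tess_algebra" and e: "distr M tess_algebra (\<lambda>w. translate_tess x (T w)) = distr M tess_algebra T"
    using T by (auto simp: stationary_tessellation_def)
  have m: "(\<lambda>w. translate_tess x (T w)) \<in> M \<rightarrow>\<^sub>M tess_algebra"
    using measurable_compose[OF Tm measurable_translate_tess] .
  show ?thesis using nn_integral_distr[OF m, of f] nn_integral_distr[OF Tm, of f] e f by simp
qed

lemma nn_integral_translate_tess:
  "(\<integral>\<^sup>+z. f z \<partial>count_space (translate_tess x t)) = (\<integral>\<^sup>+z. f ((+) x ` z) \<partial>count_space t)"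
proof -
  have "bij_betw ((`) ((+) x)) t (translate_tess x t)"
    using inj_on_subset[OF inj_translate_set] by (auto simp: bij_betw_def translate_tess_def)
  from nn_integral_bij_count_space[OF this] show ?thesis by simp
qed

lemma touch_translate: "touch ((+) x ` z) ((+) x ` z') \<longleftrightarrow> touch z (z' :: 'a::ab_group_add set)"
proof -
  have "(+) x ` z \<inter> (+) x ` z' = (+) x ` (z \<inter> z')" by (simp add: image_Int)
  moreover have "(+) x ` z = (+) x ` z' \<longleftrightarrow> z = z'" by (simp add: inj_image_eq_iff)
  ultimately show ?thesis unfolding touch_def by auto
qed

lemma measurable_tess_pair_sum:
  assumes g: "g \<in> N \<rightarrow>\<^sub>M tess_algebra"
    and f: "(\<lambda>p. f (fst (fst p)) (snd (fst p)) (snd p)) \<in> borel_measurable ((N \<Otimes>\<^sub>M body_algebra) \<Otimes>\<^sub>M body_algebra)"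
  shows "(\<lambda>x. \<integral>\<^sup>+z. \<integral>\<^sup>+z'. f x z z' \<partial>count_space (g x) \<partial>count_space (g x)) \<in> borel_measurable N"
proof (rule measurable_sum_tess[OF g])
  have "(\<lambda>q. \<integral>\<^sup>+z'. f (fst q) (snd q) z' \<partial>count_space (g (fst q))) \<in> borel_measurable (N \<Otimes>\<^sub>M body_algebra)"
  proof (rule measurable_sum_tess)
    show "(\<lambda>q. g (fst q)) \<in> N \<Otimes>\<^sub>M body_algebra \<rightarrow>\<^sub>M tess_algebra" using g by measurable
  qed (use f in \<open>simp add: case_prod_beta\<close>)
  then show "(\<lambda>(x, z). \<integral>\<^sup>+z'. f x z z' \<partial>count_space (g x)) \<in> borel_measurable (N \<Otimes>\<^sub>M body_algebra)"
    by (simp add: case_prod_beta)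
qed

definition lattice_vec :: "int \<times> int \<Rightarrow> real^2" where
  "lattice_vec k = vec2 (of_int (fst k)) (of_int (snd k))"

lemma unit_cube_plane: "(x :: real^2) \<in> unit_cube \<longleftrightarrow> (\<forall>i. 0 \<le> x $ i \<and> x $ i < 1)"
proof -
  have "(\<forall>b\<in>Basis. 0 \<le> x \<bullet> b \<and> x \<bullet> b < 1) \<longleftrightarrow> (\<forall>i. 0 \<le> x $ i \<and> x $ i < 1)"
    unfolding Basis_vec_def by (auto simp: inner_axis)
  then show ?thesis by (simp add: unit_cube_def)
qed

lemma sets_unit_cube_plane[measurable]: "(unit_cube :: (real^2) set) \<in> sets borel"
proof -
  have "(unit_cube :: (real^2) set) = {x. 0 \<le> x \<bullet> axis 1 1 \<and> x \<bullet> axis 1 1 < 1 \<and> 0 \<le> x \<bullet> axis 2 1 \<and> x \<bullet> axis 2 1 < 1}"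
    by (auto simp: unit_cube_plane forall_2 inner_axis)
  also have "\<dots> \<in> sets borel" by measurable
  finally show ?thesis .
qed

lemma cube_translates_minus: "\<exists>!k. x - lattice_vec k \<in> unit_cube"
proof (rule ex1I[of _ "(\<lfloor>x $ 1\<rfloor>, \<lfloor>x $ 2\<rfloor>)"])
  show "x - lattice_vec (\<lfloor>x $ 1\<rfloor>, \<lfloor>x $ 2\<rfloor>) \<in> unit_cube"
    unfolding unit_cube_plane forall_2 lattice_vec_def by (simp, linarith)
  fix k assume k: "x - lattice_vec k \<in> unit_cube"
  have "\<lfloor>x $ 1\<rfloor> = fst k" "\<lfloor>x $ 2\<rfloor> = snd k"
    using k unfolding unit_cube_plane forall_2 lattice_vec_def by (auto intro!: floor_unique)
  then show "k = (\<lfloor>x $ 1\<rfloor>, \<lfloor>x $ 2\<rfloor>)" by (simp add: prod_eq_iff)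
qed

lemma cube_translates_plus: "\<exists>!k. x + lattice_vec k \<in> unit_cube"
proof -
  have neg: "x + lattice_vec (- fst k, - snd k) = x - lattice_vec k" for k
    by (simp add: lattice_vec_def vec_eq_iff forall_2)
  obtain k where k: "x - lattice_vec k \<in> unit_cube" "\<forall>k'. x - lattice_vec k' \<in> unit_cube \<longrightarrow> k' = k"
    using cube_translates_minus[of x] unfolding Ex1_def by (elim exE conjE) (rule that)
  show ?thesis
  proof (rule ex1I[of _ "(- fst k, - snd k)"])
    show "x + lattice_vec (- fst k, - snd k) \<in> unit_cube" using k(1) by (simp add: neg)
    fix l assume "x + lattice_vec l \<in> unit_cube"
    then have "x - lattice_vec (- fst l, - snd l) \<in> unit_cube" using neg[of "(- fst l, - snd l)"] by simp
    then have "(- fst l, - snd l) = k" by (rule k(2)[rule_format])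
    then show "l = (- fst k, - snd k)" by (cases l) auto
  qed
qed

lemma nn_integral_unique_if:
  assumes "\<exists>!k. P k"
  shows "(\<integral>\<^sup>+k. (if P k then c else 0) \<partial>count_space UNIV) = (c::ennreal)"
proof -
  have "(\<integral>\<^sup>+k. (if P k then c else 0) \<partial>count_space UNIV) = (\<integral>\<^sup>+k. c * indicator {k. P k} k \<partial>count_space UNIV)"
    by (rule nn_integral_cong) (simp add: indicator_def)
  also have "\<dots> = c * (\<integral>\<^sup>+k. indicator {k. P k} k \<partial>count_space UNIV)" by (rule nn_integral_cmult) simp
  finally show ?thesis by (simp only: nn_integral_indicator_unique[OF assms] mult_1_right)
qed

text \<open>Mass transport: in a stationary tessellation the marked oriented sides can be localized by
  any of their translation covariant reference points.\<close>

lemma side_mass_transport: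
  fixes a b :: "(real^2) set \<Rightarrow> (real^2) set \<Rightarrow> real^2"
  assumes T: "stationary_tessellation M T" and \<rho>: "cell_mark \<rho>"
    and am: "(\<lambda>p. a (fst p) (snd p)) \<in> body_algebra \<Otimes>\<^sub>M body_algebra \<rightarrow>\<^sub>M borel"
    and bm: "(\<lambda>p. b (fst p) (snd p)) \<in> body_algebra \<Otimes>\<^sub>M body_algebra \<rightarrow>\<^sub>M borel"
    and cov: "\<And>t x z z'. tessellation t \<Longrightarrow> z \<in> t \<Longrightarrow> z' \<in> t \<Longrightarrow> touch z z' \<Longrightarrow>
       a ((+) x ` z) ((+) x ` z') = x + a z z' \<and> b ((+) x ` z) ((+) x ` z') = x + b z z'"
  shows "(\<integral>\<^sup>+w. (\<integral>\<^sup>+z. \<integral>\<^sup>+z'. (if sides z z' \<and> a z z' \<in> unit_cube then ennreal (\<rho> (T w) z) else 0) \<partial>count_space (T w) \<partial>count_space (T w)) \<partial>M) =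
    (\<integral>\<^sup>+w. (\<integral>\<^sup>+z. \<integral>\<^sup>+z'. (if sides z z' \<and> b z z' \<in> unit_cube then ennreal (\<rho> (T w) z) else 0) \<partial>count_space (T w) \<partial>count_space (T w)) \<partial>M)"
proof -
  \<comment> \<open>Both reference points are tested, each with its own displacement; the sum over
    displacements of one of them by lattice vectors drops the test on it.\<close>
  define f where "f v u t z z' = (if sides z z' \<and> a z z' + v \<in> unit_cube \<and> b z z' + u \<in> unit_cube then ennreal (\<rho> t z) else 0)"
    for v u :: "real^2" and t z z'
  define H where "H v u t = (\<integral>\<^sup>+z. \<integral>\<^sup>+z'. f v u t z z' \<partial>count_space t \<partial>count_space t)" for v u t
  have tm: "T \<in> M \<rightarrow>\<^sub>M tess_algebra" using T by (simp add: stationary_tessellation_def)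
  have tT: "tessellation (T w)" if "w \<in> space M" for w using measurable_space[OF tm that] by (simp add: space_tess)
  have \<rho>m: "(\<lambda>p. \<rho> (fst p) (snd p)) \<in> borel_measurable (tess_algebra \<Otimes>\<^sub>M body_algebra)"
  proof -
    have "(\<lambda>(T, z). \<rho> T z) = (\<lambda>p. \<rho> (fst p) (snd p))" by auto
    then show ?thesis using \<rho> unfolding cell_mark_def by (simp only:)
  qed
  have Hm: "H v u \<in> borel_measurable tess_algebra" for v u
    unfolding H_def
  proof (rule measurable_tess_pair_sum)
    let ?N = "(tess_algebra \<Otimes>\<^sub>M body_algebra) \<Otimes>\<^sub>M body_algebra :: (((real^2) set set \<times> (real^2) set) \<times> (real^2) set) measure"
    have 1: "(\<lambda>p. (snd (fst p), snd p)) \<in> ?N \<rightarrow>\<^sub>M body_algebra \<Otimes>\<^sub>M body_algebra" by measurable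
    have [measurable]: "(\<lambda>p. a (snd (fst p)) (snd p)) \<in> ?N \<rightarrow>\<^sub>M borel" "(\<lambda>p. b (snd (fst p)) (snd p)) \<in> ?N \<rightarrow>\<^sub>M borel"
      using measurable_compose[OF 1 am] measurable_compose[OF 1 bm] by simp_all
    have [measurable]: "(\<lambda>p. \<rho> (fst (fst p)) (snd (fst p))) \<in> borel_measurable ?N"
      using measurable_compose[OF measurable_fst \<rho>m] .
    show "(\<lambda>p. f v u (fst (fst p)) (snd (fst p)) (snd p)) \<in> borel_measurable ?N"
      unfolding f_def by measurable
  qed simp
  have HT: "(\<lambda>w. H v u (T w)) \<in> borel_measurable M" for v u
    using measurable_compose[OF tm Hm] .
  have shift: "H v u (translate_tess x t) = H (v + x) (u + x) t" if t: "tessellation t" for v u x t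
  proof -
    interpret planar_tess t by unfold_locales (rule t)
    interpret tr: planar_tess "translate_tess x t" by unfold_locales (rule tessellation_translate[OF t])
    have "f v u (translate_tess x t) ((+) x ` z) ((+) x ` z') = f (v + x) (u + x) t z z'" if z: "z \<in> t" "z' \<in> t" for z z'
    proof -
      have "(+) x ` z \<in> translate_tess x t" "(+) x ` z' \<in> translate_tess x t" using z by (auto simp: translate_tess_def)
      then have s: "sides ((+) x ` z) ((+) x ` z') \<longleftrightarrow> sides z z'"
        by (simp add: tr.sides_iff_touch sides_iff_touch[OF z] touch_translate)
      have r: "\<rho> (translate_tess x t) ((+) x ` z) = \<rho> t z" using \<rho> t z by (auto simp: cell_mark_def)
      show ?thesis
      proof (cases "sides z z'")
        case True
        then show ?thesis using cov[OF t z, of x] s r by (simp add: f_def sides_iff_touch[OF z] ac_simps)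
      next
        case False
        then show ?thesis using s by (simp add: f_def)
      qed
    qed
    then show ?thesis unfolding H_def nn_integral_translate_tess by (intro nn_integral_cong) simp
  qed
  \<comment> \<open>Exactly one lattice translate of the cube contains the reference point
    \<open>b\<close>, so only the condition on \<open>a\<close> survives; \<open>sumb\<close>
    exchanges the roles.\<close>
  have suma: "(\<integral>\<^sup>+k. H 0 (- lattice_vec k) t \<partial>count_space UNIV) =
      (\<integral>\<^sup>+z. \<integral>\<^sup>+z'. (if sides z z' \<and> a z z' \<in> unit_cube then ennreal (\<rho> t z) else 0) \<partial>count_space t \<partial>count_space t)" for t
  proof -
    have "(\<integral>\<^sup>+k. H 0 (- lattice_vec k) t \<partial>count_space UNIV) =
       (\<integral>\<^sup>+z. \<integral>\<^sup>+k. \<integral>\<^sup>+z'. f 0 (- lattice_vec k) t z z' \<partial>count_space t \<partial>count_space UNIV \<partial>count_space t)"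
      unfolding H_def by (rule nn_integral_count_space_nn_integral[symmetric]) auto
    also have "\<dots> = (\<integral>\<^sup>+z. \<integral>\<^sup>+z'. \<integral>\<^sup>+k. f 0 (- lattice_vec k) t z z' \<partial>count_space UNIV \<partial>count_space t \<partial>count_space t)"
      by (intro nn_integral_cong nn_integral_count_space_nn_integral[symmetric]) auto
    also have "\<dots> = (\<integral>\<^sup>+z. \<integral>\<^sup>+z'. (if sides z z' \<and> a z z' \<in> unit_cube then ennreal (\<rho> t z) else 0) \<partial>count_space t \<partial>count_space t)"
    proof (intro nn_integral_cong)
      fix z z'
      let ?c = "if sides z z' \<and> a z z' \<in> unit_cube then ennreal (\<rho> t z) else 0"
      have "(\<integral>\<^sup>+k. f 0 (- lattice_vec k) t z z' \<partial>count_space UNIV) = (\<integral>\<^sup>+k. (if b z z' - lattice_vec k \<in> unit_cube then ?c else 0) \<partial>count_space UNIV)"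
        by (rule nn_integral_cong) (simp add: f_def)
      then show "(\<integral>\<^sup>+k. f 0 (- lattice_vec k) t z z' \<partial>count_space UNIV) = ?c"
        by (simp only: nn_integral_unique_if[OF cube_translates_minus])
    qed
    finally show ?thesis .
  qed
  have sumb: "(\<integral>\<^sup>+k. H (lattice_vec k) 0 t \<partial>count_space UNIV) =
      (\<integral>\<^sup>+z. \<integral>\<^sup>+z'. (if sides z z' \<and> b z z' \<in> unit_cube then ennreal (\<rho> t z) else 0) \<partial>count_space t \<partial>count_space t)" for t
  proof -
    have "(\<integral>\<^sup>+k. H (lattice_vec k) 0 t \<partial>count_space UNIV) =
       (\<integral>\<^sup>+z. \<integral>\<^sup>+k. \<integral>\<^sup>+z'. f (lattice_vec k) 0 t z z' \<partial>count_space t \<partial>count_space UNIV \<partial>count_space t)"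
      unfolding H_def by (rule nn_integral_count_space_nn_integral[symmetric]) auto
    also have "\<dots> = (\<integral>\<^sup>+z. \<integral>\<^sup>+z'. \<integral>\<^sup>+k. f (lattice_vec k) 0 t z z' \<partial>count_space UNIV \<partial>count_space t \<partial>count_space t)"
      by (intro nn_integral_cong nn_integral_count_space_nn_integral[symmetric]) auto
    also have "\<dots> = (\<integral>\<^sup>+z. \<integral>\<^sup>+z'. (if sides z z' \<and> b z z' \<in> unit_cube then ennreal (\<rho> t z) else 0) \<partial>count_space t \<partial>count_space t)"
    proof (intro nn_integral_cong)
      fix z z'
      let ?c = "if sides z z' \<and> b z z' \<in> unit_cube then ennreal (\<rho> t z) else 0"
      have "(\<integral>\<^sup>+k. f (lattice_vec k) 0 t z z' \<partial>count_space UNIV) = (\<integral>\<^sup>+k. (if a z z' + lattice_vec k \<in> unit_cube then ?c else 0) \<partial>count_space UNIV)"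
        by (rule nn_integral_cong) (simp add: f_def)
      then show "(\<integral>\<^sup>+k. f (lattice_vec k) 0 t z z' \<partial>count_space UNIV) = ?c"
        by (simp only: nn_integral_unique_if[OF cube_translates_plus])
    qed
    finally show ?thesis .
  qed
  have "(\<integral>\<^sup>+w. (\<integral>\<^sup>+k. H 0 (- lattice_vec k) (T w) \<partial>count_space UNIV) \<partial>M) = (\<integral>\<^sup>+k. (\<integral>\<^sup>+w. H 0 (- lattice_vec k) (T w) \<partial>M) \<partial>count_space UNIV)"
    by (rule nn_integral_count_space_nn_integral) (auto intro: HT)
  also have "\<dots> = (\<integral>\<^sup>+k. (\<integral>\<^sup>+w. H (lattice_vec k) 0 (T w) \<partial>M) \<partial>count_space UNIV)"
  proof (rule nn_integral_cong)
    \<comment> \<open>Translating the tessellation by the lattice vector cancels the displacement of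
      \<open>b\<close> and creates the opposite displacement of \<open>a\<close>.\<close>
    fix k
    have "(\<integral>\<^sup>+w. H 0 (- lattice_vec k) (T w) \<partial>M) = (\<integral>\<^sup>+w. H 0 (- lattice_vec k) (translate_tess (lattice_vec k) (T w)) \<partial>M)"
      by (rule nn_integral_translate[OF T Hm, symmetric])
    also have "\<dots> = (\<integral>\<^sup>+w. H (lattice_vec k) 0 (T w) \<partial>M)"
      using shift[OF tT, of _ 0 "- lattice_vec k" "lattice_vec k"] by (intro nn_integral_cong) simp
    finally show "(\<integral>\<^sup>+w. H 0 (- lattice_vec k) (T w) \<partial>M) = (\<integral>\<^sup>+w. H (lattice_vec k) 0 (T w) \<partial>M)" .
  qed
  also have "\<dots> = (\<integral>\<^sup>+w. (\<integral>\<^sup>+k. H (lattice_vec k) 0 (T w) \<partial>count_space UNIV) \<partial>M)"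
    by (rule nn_integral_count_space_nn_integral[symmetric]) (auto intro: HT)
  finally show ?thesis unfolding suma sumb .
qed

subsection \<open>Conditioning on the planar tessellation\<close>

lemma closure_minus_connected_real:
  fixes I :: "real set"
  assumes I: "connected I" and y: "y \<in> closure I" "y \<notin> I"
  shows "y = Sup (closure I) \<or> y = Inf (closure I)"
proof -
  have "(\<forall>u\<in>I. u \<le> y) \<or> (\<forall>u\<in>I. y \<le> u)"
  proof (rule ccontr)
    assume "\<not> ?thesis"
    then obtain u v where uv: "u \<in> I" "v \<in> I" "y < u" "v < y" by (auto simp: not_le)
    then have "y \<in> I" using connectedD_interval[OF I, of v u y] by auto
    then show False using y by simp
  qed
  then show ?thesis
  proof
    assume "\<forall>u\<in>I. u \<le> y"
    then have "closure I \<subseteq> {..y}" by (intro closure_minimal) auto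
    then have "Sup (closure I) = y" using y(1) by (intro cSup_eq_maximum) auto
    then show ?thesis by simp
  next
    assume "\<forall>u\<in>I. y \<le> u"
    then have "closure I \<subseteq> {y..}" by (intro closure_minimal) auto
    then have "Inf (closure I) = y" using y(1) by (intro cInf_eq_minimum) auto
    then show ?thesis by simp
  qed
qed

text \<open>An unbounded gap would produce an unbounded cell, which is no polytope. Heights in a
  bounded range are ends of cells that meet a vertical segment over an interior point of
  \<open>z\<close>, and only finitely many cells do.\<close>

lemma column_process_bilat:
  assumes t: "tessellation t" and sub: "\<psi> \<subseteq> t \<times> UNIV" and Y: "tessellation (column_cells t \<psi>)" and z: "z \<in> t"
  shows "bilat (\<psi> `` {z})"
proof -
  interpret tess t by unfold_locales (rule t)
  let ?D = "\<psi> `` {z}"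
  obtain p where p: "p \<in> interior z" using cell(4)[OF z] by auto
  have pz: "p \<in> z" using p interior_subset by auto
  have col: "z \<times> closure I \<in> column_cells t \<psi>" if "I \<in> components (- ?D)" for I
    using that z unfolding column_cells_def by blast
  have bI: "bounded I" if I: "I \<in> components (- ?D)" for I
  proof -
    have "polytope (z \<times> closure I)" using Y col[OF I] by (simp add: tessellation_def)
    then have "bounded (z \<times> closure I)" by (rule polytope_imp_bounded)
    then have "bounded (snd ` (z \<times> closure I))" by (rule bounded_snd)
    moreover have "I \<subseteq> snd ` (z \<times> closure I)" using pz closure_subset by force
    ultimately show ?thesis by (rule bounded_subset)
  qed
  have no_ray: "\<not> S \<subseteq> - ?D" if S: "connected S" "\<not> bounded S" for S :: "real set"
  proof
    assume sub: "S \<subseteq> - ?D"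
    have ne: "S \<noteq> {}" using S by auto
    obtain I where "I \<in> components (- ?D)" "S \<subseteq> I"
      using exists_component_superset[OF sub _ S(1)] ne sub by auto
    then show False using bI S(2) bounded_subset by blast
  qed
  have up: "\<exists>h\<in>?D. x < h" for x
  proof (rule ccontr)
    assume n: "\<not> ?thesis"
    have "{x<..} \<subseteq> - ?D" using n by auto
    moreover have "\<not> bounded {x<..}"
    proof
      assume "bounded {x<..}"
      then obtain u where "\<forall>y\<in>{x<..}. y \<le> u" using bounded_imp_bdd_above unfolding bdd_above_def by blast
      then show False by (auto dest!: bspec[of _ _ "max x u + 1"])
    qed
    ultimately show False using no_ray[of "{x<..}"] by (simp add: convex_connected)
  qed
  have down: "\<exists>h\<in>?D. h < x" for x
  proof (rule ccontr)
    assume n: "\<not> ?thesis"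
    have "{..<x} \<subseteq> - ?D" using n by auto
    moreover have "\<not> bounded {..<x}"
    proof
      assume "bounded {..<x}"
      then obtain u where "\<forall>y\<in>{..<x}. u \<le> y" using bounded_imp_bdd_below unfolding bdd_below_def by blast
      then show False by (auto dest!: bspec[of _ _ "min x u - 1"])
    qed
    ultimately show False using no_ray[of "{..<x}"] by (simp add: convex_connected)
  qed
  have "finite (?D \<inter> {a..b})" for a b
  proof (rule finite_subset)
    let ?F = "{c \<in> column_cells t \<psi>. c \<inter> {p} \<times> {a..b} \<noteq> {}}"
    show "?D \<inter> {a..b} \<subseteq> (\<Union>c\<in>?F. {Sup (snd ` c), Inf (snd ` c)})"
    proof
      fix y assume y: "y \<in> ?D \<inter> {a..b}"
      \<comment> \<open>The cell covering the point stands over \<open>z\<close> because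
        \<open>p\<close> is interior to \<open>z\<close>. The height \<open>y\<close> is removed
        from its open gap but lies in the closure, so it is an end.\<close>
      have "(p, y) \<in> \<Union>(column_cells t \<psi>)" using Y by (simp add: tessellation_def)
      then obtain c where c: "c \<in> column_cells t \<psi>" "(p, y) \<in> c" by auto
      then obtain z' I where zI: "z' \<in> t" "I \<in> components (- (\<psi> `` {z'}))" "c = z' \<times> closure I"
        unfolding column_cells_def by blast
      have "z' = z" using interior_disjoint[OF zI(1) z] p c(2) zI(3) by auto
      have yI: "y \<in> closure I" using c zI by auto
      have "I \<subseteq> - ?D" using zI(2) \<open>z' = z\<close> in_components_subset by blast
      then have "y \<notin> I" using y by auto
      moreover have "connected I" using zI(2) in_components_connected by blast
      ultimately have "y = Sup (closure I) \<or> y = Inf (closure I)" using closure_minus_connected_real[OF _ yI] by blast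
      moreover have "snd ` c = closure I" using zI(3) pz \<open>z' = z\<close> by force
      moreover have "c \<in> ?F" using c y by auto
      ultimately have "y \<in> {Sup (snd ` c), Inf (snd ` c)}" "c \<in> ?F" by simp_all
      then show "y \<in> (\<Union>c\<in>?F. {Sup (snd ` c), Inf (snd ` c)})" by (rule UN_I[rotated])
    qed
    have "bounded ({p} \<times> {a..b})" by (intro bounded_Times) auto
    then have "finite ?F" using Y by (simp add: tessellation_def)
    then show "finite (\<Union>c\<in>?F. {Sup (snd ` c), Inf (snd ` c)})" by simp
  qed
  then show ?thesis unfolding bilat_def using up down by blast
qed

text \<open>Finitely many cells hit a bounded window, each with finitely many heights in a bounded
  range.\<close>

lemma clean_plate_box:
  assumes t: "tessellation t" and sub: "\<psi> \<subseteq> t \<times> UNIV" and b: "\<And>z. z \<in> t \<Longrightarrow> bilat (\<psi> `` {z})"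
  shows "clean plate_box \<psi> = \<psi>"
  unfolding clean_eq_iff
proof (intro conjI allI)
  have clt: "\<forall>n. finite (t \<inter> hitting n)" "t \<subseteq> (\<Union>n. hitting n)"
    using clean_tessellation[OF t] unfolding clean_eq_iff by auto
  show "finite (\<psi> \<inter> plate_box n)" for n
  proof (rule finite_subset)
    show "\<psi> \<inter> plate_box n \<subseteq> (SIGMA z:t \<inter> hitting n. \<psi> `` {z} \<inter> {- real n..real n})"
      using sub by (auto simp: plate_box_def)
    show "finite (SIGMA z:t \<inter> hitting n. \<psi> `` {z} \<inter> {- real n..real n})"
      using clt b by (intro finite_SigmaI) (auto simp: bilat_def)
  qed
  show "\<psi> \<subseteq> (\<Union>n. plate_box n)"
  proof
    fix q assume q: "q \<in> \<psi>"
    then obtain m where m: "fst q \<in> hitting m" using clt(2) sub by fastforce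
    obtain k :: nat where k: "\<bar>snd q\<bar> < real k" using reals_Archimedean2[of "\<bar>snd q\<bar>"] by (elim exE) (rule that)
    have "fst q \<in> hitting (max m k)" using incseqD[OF incseq_hitting, of m "max m k"] m by auto
    moreover have "snd q \<in> {- real (max m k)..real (max m k)}" using k by auto
    ultimately have "q \<in> plate_box (max m k)" unfolding plate_box_def by (cases q) auto
    then show "q \<in> (\<Union>n. plate_box n)" by blast
  qed
qed

text \<open>Phrased with cleaned configurations, quantifiers over cells and plates, and integer
  bounds, so that measurability can be read off. It keeps what the kernels need: local finiteness,
  plates over cells, and heights unbounded above.\<close>

definition admissible :: "(real^2) set set \<Rightarrow> ((real^2) set \<times> real) set \<Rightarrow> bool" where
  "admissible t \<psi> \<longleftrightarrow> clean plate_box \<psi> = \<psi> \<and> \<not> (\<exists>p\<in>clean plate_box \<psi>. \<not> (\<exists>z\<in>t. z = fst p)) \<and>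
     \<not> (\<exists>z\<in>t. \<exists>m::nat. \<not> (\<exists>p\<in>clean plate_box \<psi>. fst p = z \<and> real m < snd p))"

definition no_common_height :: "((real^2) set \<times> real) set \<Rightarrow> bool" where
  "no_common_height \<psi> \<longleftrightarrow> \<not> (\<exists>p\<in>clean plate_box \<psi>. \<exists>q\<in>clean plate_box \<psi>. snd p = snd q \<and> fst p \<noteq> fst q)"

abbreviation plate_config :: "((real^2) set \<times> real) set measure" where
  "plate_config \<equiv> config_algebra (body_algebra \<Otimes>\<^sub>M borel)"

lemma pred_ex_plate:
  assumes g: "g \<in> N \<rightarrow>\<^sub>M plate_config"
    and P: "Measurable.pred (N \<Otimes>\<^sub>M (body_algebra \<Otimes>\<^sub>M borel)) (\<lambda>p. P (fst p) (snd p))"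
  shows "Measurable.pred N (\<lambda>x. \<exists>y\<in>clean plate_box (g x). P x y)"
  by (rule pred_ex_clean[OF g sets_plate_box incseq_plate_box P])

lemma pred_admissible: "Measurable.pred (tess_algebra \<Otimes>\<^sub>M plate_config) (\<lambda>p. admissible (fst p) (snd p))"
  unfolding admissible_def
proof (intro pred_intros_logic)
  show "Measurable.pred (tess_algebra \<Otimes>\<^sub>M plate_config) (\<lambda>x. clean plate_box (snd x) = snd x)"
    by (rule pred_clean[OF measurable_snd sets_plate_box])
  show "Measurable.pred (tess_algebra \<Otimes>\<^sub>M plate_config) (\<lambda>x. \<exists>p\<in>clean plate_box (snd x). \<not> (\<exists>z\<in>fst x. z = fst p))"
    by (intro pred_ex_plate pred_ex_tess pred_intros_logic pred_eq_body) measurable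
  show "Measurable.pred (tess_algebra \<Otimes>\<^sub>M plate_config) (\<lambda>x. \<exists>z\<in>fst x. \<exists>m::nat. \<not> (\<exists>p\<in>clean plate_box (snd x). fst p = z \<and> real m < snd p))"
    by (intro pred_ex_plate pred_ex_tess pred_intros_logic pred_intros_countable(2) pred_eq_body) measurable
qed

lemma pred_no_common_height: "Measurable.pred (tess_algebra \<Otimes>\<^sub>M plate_config) (\<lambda>p. no_common_height (snd p))"
  unfolding no_common_height_def
  by (intro pred_ex_plate pred_intros_logic pred_eq_body borel_measurable_eq) measurable

lemma countable_tess: "tessellation (t :: 'a::euclidean_space set set) \<Longrightarrow> countable t"
proof -
  assume "tessellation t"
  then have f: "\<forall>n. finite (t \<inter> hitting n)" "t \<subseteq> (\<Union>n. hitting n)"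
    using clean_tessellation[of t] unfolding clean_eq_iff by auto
  have "countable (t \<inter> hitting n)" for n using f(1) by (simp add: countable_finite)
  then have "countable (\<Union>n. t \<inter> hitting n)" by (rule countable_UN[rotated]) simp
  moreover have "(\<Union>n. t \<inter> hitting n) = t" using f(2) unfolding Int_UN_distrib[symmetric] by (rule Int_absorb2)
  ultimately show "countable t" by (simp only:)
qed

section \<open>From conditional laws to planar mean sums\<close>

locale column_model = prob_space M for M :: "'w measure" +
  fixes T :: "'w \<Rightarrow> (real^2) set set" and \<rho> :: "(real^2) set set \<Rightarrow> (real^2) set \<Rightarrow> real"
    and \<Psi> :: "'w \<Rightarrow> ((real^2) set \<times> real) set" and \<kappa> :: "(real^2) set set \<Rightarrow> ((real^2) set \<times> real) set measure"
  assumes stat: "stationary_tessellation M T" and mark: "cell_mark \<rho>"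
    and sub: "\<And>w. w \<in> space M \<Longrightarrow> \<Psi> w \<subseteq> T w \<times> UNIV"
    and cd: "conditional_distribution M tess_algebra T plate_config \<Psi> \<kappa>"
    and ker: "AE t in distr M tess_algebra T.
             prob_space.indep_vars (\<kappa> t) (\<lambda>z. config_algebra borel) (\<lambda>z \<psi>. \<psi> `` {z}) t \<and>
             (\<forall>z\<in>t. stationary_line_process (\<kappa> t) (\<lambda>\<psi>. \<psi> `` {z}) (\<rho> t z))"
    and tessY: "AE w in M. tessellation (column_cells (T w) (\<Psi> w))"
begin

lemma Tm: "T \<in> M \<rightarrow>\<^sub>M tess_algebra" and \<Psi>m: "\<Psi> \<in> M \<rightarrow>\<^sub>M plate_config" and \<kappa>m: "\<kappa> \<in> tess_algebra \<rightarrow>\<^sub>M prob_algebra plate_config"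
  using cd by (auto simp: conditional_distribution_def)

lemma tT: "w \<in> space M \<Longrightarrow> tessellation (T w)"
  using measurable_space[OF Tm] by (simp add: space_tess)

lemma \<rho>m: "(\<lambda>p. \<rho> (fst p) (snd p)) \<in> borel_measurable (tess_algebra \<Otimes>\<^sub>M body_algebra)"
proof -
  have "(\<lambda>(T, z). \<rho> T z) = (\<lambda>p. \<rho> (fst p) (snd p))" by auto
  then show ?thesis using mark unfolding cell_mark_def by (simp only:)
qed

lemma prob_\<kappa>: "tessellation t \<Longrightarrow> prob_space (\<kappa> t)"
  and sets_\<kappa>: "tessellation t \<Longrightarrow> sets (\<kappa> t) = sets plate_config"
  using measurable_space[OF \<kappa>m, of t] by (auto simp: space_tess space_prob_algebra)

lemma AE_bilat: "AE w in M. \<forall>z\<in>T w. bilat (\<Psi> w `` {z})"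
  using tessY AE_space
  by eventually_elim (use column_process_bilat[OF tT sub] in blast)

lemma admissibleI:
  assumes "tessellation t" "\<psi> \<subseteq> t \<times> UNIV" "\<And>z. z \<in> t \<Longrightarrow> bilat (\<psi> `` {z})"
  shows "admissible t \<psi>"
proof -
  have c: "clean plate_box \<psi> = \<psi>" using clean_plate_box[OF assms] .
  have "\<exists>p\<in>\<psi>. fst p = z \<and> real m < snd p" if zt: "z \<in> t" for z m
  proof -
    obtain h where "h \<in> \<psi> `` {z}" "real m < h" using assms(3)[OF zt] unfolding bilat_def by blast
    then show ?thesis by (intro bexI[of _ "(z, h)"]) auto
  qed
  then show ?thesis unfolding admissible_def c using assms(2) by auto
qed

lemma AE_admissible: "AE w in M. admissible (T w) (\<Psi> w)"
  using AE_bilat AE_space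
  by eventually_elim (use admissibleI[OF tT sub] in blast)

text \<open>That the columns form a tessellation is known for realizations under \<open>M\<close>;
  the disintegration carries its consequences to almost every kernel, where the expected counts are
  computed.\<close>

lemma AE_admissible_kernel: "AE t in distr M tess_algebra T. AE \<psi> in \<kappa> t. admissible t \<psi>"
  using AE_admissible AE_disintegration[OF prob_space_axioms cd pred_admissible] by simp

lemma admissibleD:
  assumes "admissible t \<psi>"
  shows "clean plate_box \<psi> = \<psi>" "\<psi> \<subseteq> t \<times> UNIV" "z \<in> t \<Longrightarrow> \<exists>h\<in>\<psi> `` {z}. x < h"
proof -
  show c: "clean plate_box \<psi> = \<psi>" using assms by (simp add: admissible_def)
  show "\<psi> \<subseteq> t \<times> UNIV" using assms unfolding admissible_def c by fastforce
  assume z: "z \<in> t"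
  obtain m :: nat where m: "x < real m" using reals_Archimedean2[of x] by (elim exE) (rule that)
  have "\<exists>p\<in>\<psi>. fst p = z \<and> real m < snd p" using assms z unfolding admissible_def c by blast
  then show "\<exists>h\<in>\<psi> `` {z}. x < h" using m by (auto intro: less_trans)
qed

lemma kernel_lines: "AE t in distr M tess_algebra T. tessellation t \<and> indep_lines (\<kappa> t) t (\<lambda>z \<psi>. \<psi> `` {z}) (\<rho> t) \<and> (AE \<psi> in \<kappa> t. admissible t \<psi>)"
  using ker AE_admissible_kernel AE_space
proof eventually_elim
  fix t assume k: "prob_space.indep_vars (\<kappa> t) (\<lambda>z. config_algebra borel) (\<lambda>z \<psi>. \<psi> `` {z}) t \<and>
             (\<forall>z\<in>t. stationary_line_process (\<kappa> t) (\<lambda>\<psi>. \<psi> `` {z}) (\<rho> t z))"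
    and a: "AE \<psi> in \<kappa> t. admissible t \<psi>" and "t \<in> space (distr M tess_algebra T)"
  then have t: "tessellation t" by (simp add: space_tess)
  have "indep_lines (\<kappa> t) t (\<lambda>z \<psi>. \<psi> `` {z}) (\<rho> t)"
    unfolding indep_lines_def indep_lines_axioms_def using prob_\<kappa>[OF t] k mark t by (auto simp: cell_mark_def)
  then show "tessellation t \<and> indep_lines (\<kappa> t) t (\<lambda>z \<psi>. \<psi> `` {z}) (\<rho> t) \<and> (AE \<psi> in \<kappa> t. admissible t \<psi>)"
    using t a by blast
qed

text \<open>Under a kernel the columns are independent and there are countably many pairs of cells,
  so the statement for two processes suffices; the disintegration then carries it back to
  \<open>M\<close>.\<close>

lemma AE_no_common_height: "AE w in M. no_common_height (\<Psi> w)"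
proof -
  have "AE t in distr M tess_algebra T. AE \<psi> in \<kappa> t. no_common_height \<psi>"
    using kernel_lines
  proof eventually_elim
    fix t assume k: "tessellation t \<and> indep_lines (\<kappa> t) t (\<lambda>z \<psi>. \<psi> `` {z}) (\<rho> t) \<and> (AE \<psi> in \<kappa> t. admissible t \<psi>)"
    then interpret L: indep_lines "\<kappa> t" t "\<lambda>z \<psi>. \<psi> `` {z}" "\<rho> t" by simp
    have c: "countable t" using countable_tess k by blast
    have "AE \<psi> in \<kappa> t. z \<noteq> z' \<longrightarrow> \<psi> `` {z} \<inter> \<psi> `` {z'} = {}" if "z \<in> t" "z' \<in> t" for z z'
      using L.AE_no_common_point[OF that] by (cases "z = z'") auto
    then have "AE \<psi> in \<kappa> t. \<forall>z\<in>t. \<forall>z'\<in>t. z \<noteq> z' \<longrightarrow> \<psi> `` {z} \<inter> \<psi> `` {z'} = {}"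
      using c by (simp add: AE_ball_countable)
    moreover have "AE \<psi> in \<kappa> t. admissible t \<psi>" using k by simp
    ultimately show "AE \<psi> in \<kappa> t. no_common_height \<psi>"
    proof eventually_elim
      fix \<psi> assume d: "\<forall>z\<in>t. \<forall>z'\<in>t. z \<noteq> z' \<longrightarrow> \<psi> `` {z} \<inter> \<psi> `` {z'} = {}" and a: "admissible t \<psi>"
      note ad = admissibleD(1,2)[OF a]
      show "no_common_height \<psi>" unfolding no_common_height_def ad(1)
      proof (intro notI, elim bexE conjE)
        fix p q assume pq: "p \<in> \<psi>" "q \<in> \<psi>" "snd p = snd q" "fst p \<noteq> fst q"
        obtain z z' h where e: "p = (z, h)" "q = (z', h)" "z \<noteq> z'" using pq(3,4) by (cases p, cases q) simp
        then have "z \<in> t" "z' \<in> t" using ad(2) pq by auto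
        then have "\<psi> `` {z} \<inter> \<psi> `` {z'} = {}" using d e(3) by blast
        moreover have "h \<in> \<psi> `` {z}" "h \<in> \<psi> `` {z'}" using pq e by auto
        ultimately show False by blast
      qed
    qed
  qed
  then show ?thesis using AE_disintegration[OF prob_space_axioms cd pred_no_common_height] by simp
qed

lemma AE_column_tess: "AE w in M. column_tess (T w) (\<Psi> w)"
  using AE_bilat AE_admissible AE_no_common_height AE_space
proof eventually_elim
  fix w assume b: "\<forall>z\<in>T w. bilat (\<Psi> w `` {z})" and a: "admissible (T w) (\<Psi> w)" and n: "no_common_height (\<Psi> w)" and w: "w \<in> space M"
  show "column_tess (T w) (\<Psi> w)"
  proof unfold_locales
    show "tessellation (T w)" using tT[OF w] .
    show "\<Psi> w \<subseteq> T w \<times> UNIV" using sub[OF w] .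
    show "bilat (\<Psi> w `` {z})" if "z \<in> T w" for z using b that by blast
    show "z = z'" if "(z, h) \<in> \<Psi> w" "(z', h) \<in> \<Psi> w" for z h z'
      using n that unfolding no_common_height_def admissibleD(1)[OF a] by force
  qed
qed

lemma sum_over_plates:
  assumes sub: "\<psi> \<subseteq> t \<times> UNIV"
  shows "(\<integral>\<^sup>+p. f (fst p) (snd p) \<partial>count_space \<psi>) = (\<integral>\<^sup>+z. \<integral>\<^sup>+h. f z h \<partial>count_space (\<psi> `` {z}) \<partial>count_space t)"
proof -
  have "(\<integral>\<^sup>+p. f (fst p) (snd p) \<partial>count_space \<psi>) = (\<integral>\<^sup>+p. f (fst p) (snd p) * indicator \<psi> p \<partial>count_space UNIV)"
    by (rule nn_integral_count_space_indicator) simp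
  also have "\<dots> = (\<integral>\<^sup>+z. \<integral>\<^sup>+h. f z h * indicator \<psi> (z, h) \<partial>count_space UNIV \<partial>count_space UNIV)"
    using nn_integral_fst_count_space[of "\<lambda>p. f (fst p) (snd p) * indicator \<psi> p"] by simp
  also have "\<dots> = (\<integral>\<^sup>+z. (\<integral>\<^sup>+h. f z h * indicator (\<psi> `` {z}) h \<partial>count_space UNIV) * indicator t z \<partial>count_space UNIV)"
  proof (rule nn_integral_cong)
    fix z
    show "(\<integral>\<^sup>+h. f z h * indicator \<psi> (z, h) \<partial>count_space UNIV) = (\<integral>\<^sup>+h. f z h * indicator (\<psi> `` {z}) h \<partial>count_space UNIV) * indicator t z"
    proof (cases "z \<in> t")
      case True
      then show ?thesis by (auto intro!: nn_integral_cong simp: indicator_def)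
    next
      case False
      then have "(z, h) \<notin> \<psi>" for h using sub by auto
      then show ?thesis using False by simp
    qed
  qed
  also have "\<dots> = (\<integral>\<^sup>+z. \<integral>\<^sup>+h. f z h \<partial>count_space (\<psi> `` {z}) \<partial>count_space t)"
    by (simp add: nn_integral_count_space_indicator)
  finally show ?thesis .
qed

text \<open>Counts of primitive elements equal measurable functions almost surely, but need not be
  measurable themselves, as \<open>M\<close> need not be complete. This weaker property still gives
  additivity of the integral.\<close>

definition ae_measurable :: "('w \<Rightarrow> ennreal) \<Rightarrow> bool" where
  "ae_measurable f \<longleftrightarrow> (\<exists>g\<in>borel_measurable M. AE w in M. f w = g w)"

lemma nn_integral_add_ae:
  assumes "ae_measurable f" "ae_measurable g"
  shows "(\<integral>\<^sup>+w. f w + g w \<partial>M) = (\<integral>\<^sup>+w. f w \<partial>M) + (\<integral>\<^sup>+w. g w \<partial>M)"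
proof -
  obtain f' g' where f: "f' \<in> borel_measurable M" "AE w in M. f w = f' w" and g: "g' \<in> borel_measurable M" "AE w in M. g w = g' w"
    using assms unfolding ae_measurable_def by blast
  have "(\<integral>\<^sup>+w. f w + g w \<partial>M) = (\<integral>\<^sup>+w. f' w + g' w \<partial>M)"
    using f(2) g(2) by (intro nn_integral_cong_AE) auto
  also have "\<dots> = (\<integral>\<^sup>+w. f' w \<partial>M) + (\<integral>\<^sup>+w. g' w \<partial>M)" by (rule nn_integral_add[OF f(1) g(1)])
  also have "(\<integral>\<^sup>+w. f' w \<partial>M) = (\<integral>\<^sup>+w. f w \<partial>M)" using f(2) by (intro nn_integral_cong_AE) auto
  also have "(\<integral>\<^sup>+w. g' w \<partial>M) = (\<integral>\<^sup>+w. g w \<partial>M)" using g(2) by (intro nn_integral_cong_AE) auto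
  finally show ?thesis .
qed

lemma marked_sum_tess:
  assumes Wm: "Measurable.pred (body_algebra \<Otimes>\<^sub>M body_algebra) (\<lambda>p. W (fst p) (snd p))"
  shows "(\<lambda>t. \<integral>\<^sup>+z. \<integral>\<^sup>+z'. (if W z z' then ennreal (\<rho> t z) else 0) \<partial>count_space t \<partial>count_space t) \<in> borel_measurable tess_algebra"
proof (rule measurable_tess_pair_sum)
  let ?N = "(tess_algebra \<Otimes>\<^sub>M body_algebra) \<Otimes>\<^sub>M body_algebra :: (((real^2) set set \<times> (real^2) set) \<times> (real^2) set) measure"
  have "(\<lambda>p. (snd (fst p), snd p)) \<in> ?N \<rightarrow>\<^sub>M body_algebra \<Otimes>\<^sub>M body_algebra" by measurable
  from measurable_compose[OF this Wm] have 1: "Measurable.pred ?N (\<lambda>p. W (snd (fst p)) (snd p))" by simp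
  have 2: "(\<lambda>p. \<rho> (fst (fst p)) (snd (fst p))) \<in> borel_measurable ?N"
    using measurable_compose[OF measurable_fst \<rho>m] .
  show "(\<lambda>p. if W (snd (fst p)) (snd p) then ennreal (\<rho> (fst (fst p)) (snd (fst p))) else 0) \<in> borel_measurable ?N"
    using 1 2 by measurable
qed simp

text \<open>After disintegration the sums over the countably many cells move outside the kernel
  mean, and there \<open>Rv\<close> replaces the selected heights of a column by its mark.
  \<open>W\<close> selects pairs of cells, \<open>R\<close> selects heights and may depend on the
  whole configuration. Its measurability is assumed for two sample spaces because an assumption is
  not polymorphic.\<close>

lemma mean_transfer:
  fixes W :: "(real^2) set \<Rightarrow> (real^2) set \<Rightarrow> bool" and R :: "((real^2) set \<times> real) set \<Rightarrow> (real^2) set \<Rightarrow> (real^2) set \<Rightarrow> real \<Rightarrow> bool"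
  assumes Wm: "Measurable.pred (body_algebra \<Otimes>\<^sub>M body_algebra) (\<lambda>p. W (fst p) (snd p))"
    and Rm: "\<And>N (g :: ((((real^2) set set \<times> ((real^2) set \<times> real) set) \<times> ((real^2) set \<times> real)) \<times> (real^2) set) \<Rightarrow> _) z z' h. g \<in> N \<rightarrow>\<^sub>M plate_config \<Longrightarrow> z \<in> N \<rightarrow>\<^sub>M body_algebra \<Longrightarrow> z' \<in> N \<rightarrow>\<^sub>M body_algebra \<Longrightarrow> h \<in> N \<rightarrow>\<^sub>M borel \<Longrightarrow>
        Measurable.pred N (\<lambda>x. R (clean plate_box (g x)) (z x) (z' x) (h x))"
    and Rm2: "\<And>N (g :: (((real^2) set \<times> real) set \<times> ((real^2) set \<times> real)) \<Rightarrow> _) z z' h. g \<in> N \<rightarrow>\<^sub>M plate_config \<Longrightarrow> z \<in> N \<rightarrow>\<^sub>M body_algebra \<Longrightarrow> z' \<in> N \<rightarrow>\<^sub>M body_algebra \<Longrightarrow> h \<in> N \<rightarrow>\<^sub>M borel \<Longrightarrow>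
        Measurable.pred N (\<lambda>x. R (clean plate_box (g x)) (z x) (z' x) (h x))"
    and Rv: "AE t in distr M tess_algebra T. \<forall>z\<in>t. \<forall>z'\<in>t. W z z' \<longrightarrow> (\<integral>\<^sup>+\<psi>. ecount {h \<in> \<psi> `` {z}. R \<psi> z z' h} \<partial>\<kappa> t) = ennreal (\<rho> t z)"
  shows "(\<integral>\<^sup>+w. (\<integral>\<^sup>+p. \<integral>\<^sup>+z'. (if W (fst p) z' \<and> R (\<Psi> w) (fst p) z' (snd p) then 1 else 0) \<partial>count_space (T w) \<partial>count_space (\<Psi> w)) \<partial>M) =
    (\<integral>\<^sup>+w. (\<integral>\<^sup>+z. \<integral>\<^sup>+z'. (if W z z' then ennreal (\<rho> (T w) z) else 0) \<partial>count_space (T w) \<partial>count_space (T w)) \<partial>M) \<and>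
    ae_measurable (\<lambda>w. \<integral>\<^sup>+p. \<integral>\<^sup>+z'. (if W (fst p) z' \<and> R (\<Psi> w) (fst p) z' (snd p) then 1 else 0) \<partial>count_space (T w) \<partial>count_space (\<Psi> w))" (is "?A = ?B \<and> ae_measurable ?f")
proof -
  let ?N0 = "(tess_algebra :: (real^2) set set measure) \<Otimes>\<^sub>M plate_config" and ?S = "body_algebra \<Otimes>\<^sub>M borel :: ((real^2) set \<times> real) measure"
  define f where "f \<psi> z z' h = (if W z z' \<and> R (clean plate_box \<psi>) z z' h then 1 else 0 :: ennreal)" for \<psi> z z' h
  define \<Phi> where "\<Phi> q = (\<integral>\<^sup>+p. \<integral>\<^sup>+z'. f (snd q) (fst p) z' (snd p) \<partial>count_space (fst q) \<partial>count_space (clean plate_box (snd q)))" for q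
  have \<Phi>m: "\<Phi> \<in> borel_measurable ?N0"
    unfolding \<Phi>_def
  proof (rule measurable_sum_clean[OF measurable_snd sets_plate_box incseq_plate_box])
    have "(\<lambda>x. \<integral>\<^sup>+z'. f (snd (fst x)) (fst (snd x)) z' (snd (snd x)) \<partial>count_space (fst (fst x))) \<in> borel_measurable (?N0 \<Otimes>\<^sub>M ?S)"
    proof (rule measurable_sum_tess)
      show "(\<lambda>x. fst (fst x)) \<in> ?N0 \<Otimes>\<^sub>M ?S \<rightarrow>\<^sub>M tess_algebra" by measurable
      let ?N2 = "(?N0 \<Otimes>\<^sub>M ?S) \<Otimes>\<^sub>M (body_algebra :: (real^2) set measure)"
      have 1: "Measurable.pred ?N2 (\<lambda>x. R (clean plate_box (snd (fst (fst x)))) (fst (snd (fst x))) (snd x) (snd (snd (fst x))))"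
        by (rule Rm[of "\<lambda>x. snd (fst (fst x))" ?N2 "\<lambda>x. fst (snd (fst x))" "\<lambda>x. snd x" "\<lambda>x. snd (snd (fst x))"]) measurable
      have "(\<lambda>x. (fst (snd (fst x)), snd x)) \<in> ?N2 \<rightarrow>\<^sub>M body_algebra \<Otimes>\<^sub>M body_algebra" by measurable
      from measurable_compose[OF this Wm]
      have 2: "Measurable.pred ?N2 (\<lambda>x. W (fst (snd (fst x))) (snd x))" by simp
      have "(\<lambda>x. f (snd (fst (fst x))) (fst (snd (fst x))) (snd x) (snd (snd (fst x)))) \<in> borel_measurable ?N2"
        unfolding f_def using 1 2 by measurable
      then show "(\<lambda>(x, z'). f (snd (fst x)) (fst (snd x)) z' (snd (snd x))) \<in> borel_measurable ?N2"
        by (simp add: case_prod_beta)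
    qed
    then show "(\<lambda>(q, p). \<integral>\<^sup>+z'. f (snd q) (fst p) z' (snd p) \<partial>count_space (fst q)) \<in> borel_measurable (?N0 \<Otimes>\<^sub>M ?S)"
      by (simp add: case_prod_beta)
  qed
  have ae: "AE w in M. ?f w = \<Phi> (T w, \<Psi> w)"
    using AE_admissible by eventually_elim (simp add: \<Phi>_def f_def admissibleD(1))
  have "(\<lambda>w. (T w, \<Psi> w)) \<in> M \<rightarrow>\<^sub>M ?N0" using Tm \<Psi>m by measurable
  then have phm: "(\<lambda>w. \<Phi> (T w, \<Psi> w)) \<in> borel_measurable M" using \<Phi>m by (rule measurable_compose)
  have aem: "ae_measurable ?f" unfolding ae_measurable_def
    by (rule bexI[where x="\<lambda>w. \<Phi> (T w, \<Psi> w)"]) (rule ae, rule phm)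
  have "?A = (\<integral>\<^sup>+w. \<Phi> (T w, \<Psi> w) \<partial>M)" by (rule nn_integral_cong_AE) (rule ae)
  also have "\<dots> = (\<integral>\<^sup>+t. \<integral>\<^sup>+\<psi>. \<Phi> (t, \<psi>) \<partial>\<kappa> t \<partial>distr M tess_algebra T)"
    by (rule nn_integral_disintegration[OF prob_space_axioms cd \<Phi>m])
  also have "\<dots> = (\<integral>\<^sup>+t. (\<integral>\<^sup>+z. \<integral>\<^sup>+z'. (if W z z' then ennreal (\<rho> t z) else 0) \<partial>count_space t \<partial>count_space t) \<partial>distr M tess_algebra T)"
  proof (rule nn_integral_cong_AE, use kernel_lines Rv in eventually_elim)
    fix t assume k: "tessellation t \<and> indep_lines (\<kappa> t) t (\<lambda>z \<psi>. \<psi> `` {z}) (\<rho> t) \<and> (AE \<psi> in \<kappa> t. admissible t \<psi>)"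
      and rv: "\<forall>z\<in>t. \<forall>z'\<in>t. W z z' \<longrightarrow> (\<integral>\<^sup>+\<psi>. ecount {h \<in> \<psi> `` {z}. R \<psi> z z' h} \<partial>\<kappa> t) = ennreal (\<rho> t z)"
    have t: "tessellation t" and ad: "AE \<psi> in \<kappa> t. admissible t \<psi>" using k by auto
    have ct: "countable t" by (rule countable_tess[OF t])
    have tb: "z \<in> space body_algebra" if "z \<in> t" for z using tessellation_cell(1)[OF t that] by (simp add: space_body)
    \<comment> \<open>The number of selected heights of one column, written as a sum over all plates
      because such sums are known to be measurable.\<close>
    define G where "G z z' \<psi> = (\<integral>\<^sup>+p. (if fst p = z \<and> R (clean plate_box \<psi>) z z' (snd p) then 1 else 0 :: ennreal) \<partial>count_space (clean plate_box \<psi>))" for z z' \<psi>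
    have Gm: "G z z' \<in> borel_measurable (\<kappa> t)" if z: "z \<in> t" "z' \<in> t" for z z'
    proof -
      have "G z z' \<in> borel_measurable plate_config"
        unfolding G_def[abs_def]
      proof (rule measurable_sum_clean[OF _ sets_plate_box incseq_plate_box, of "\<lambda>\<psi>. \<psi>"])
        show "(\<lambda>\<psi>. \<psi>) \<in> plate_config \<rightarrow>\<^sub>M plate_config" by (rule measurable_ident_sets[OF refl, unfolded id_def])
        have 1: "Measurable.pred (plate_config \<Otimes>\<^sub>M ?S) (\<lambda>x. R (clean plate_box (fst x)) z z' (snd (snd x)))"
          using tb[OF z(1)] tb[OF z(2)] by (intro Rm2) auto
        have 2: "Measurable.pred (plate_config \<Otimes>\<^sub>M ?S) (\<lambda>x. fst (snd x) = z)"
          using tb[OF z(1)] by (intro pred_eq_body) auto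
        have "(\<lambda>x. if fst (snd x) = z \<and> R (clean plate_box (fst x)) z z' (snd (snd x)) then 1 else 0 :: ennreal) \<in> borel_measurable (plate_config \<Otimes>\<^sub>M ?S)"
          using 1 2 by measurable
        then show "(\<lambda>(\<psi>, p). if fst p = z \<and> R (clean plate_box \<psi>) z z' (snd p) then 1 else 0 :: ennreal) \<in> borel_measurable (plate_config \<Otimes>\<^sub>M ?S)"
          by (simp add: case_prod_beta)
      qed
      then show ?thesis using sets_\<kappa>[OF t] by (simp cong: measurable_cong_sets)
    qed
    have G: "G z z' \<psi> = ecount {h \<in> \<psi> `` {z}. R \<psi> z z' h}" if a: "admissible t \<psi>" and z: "z \<in> t" for z z' \<psi>
    proof -
      note ad = admissibleD(1,2)[OF a]
      have "G z z' \<psi> = (\<integral>\<^sup>+y. \<integral>\<^sup>+h. (if y = z \<and> R \<psi> z z' h then 1 else 0) \<partial>count_space (\<psi> `` {y}) \<partial>count_space t)"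
        unfolding G_def ad(1) by (rule sum_over_plates[OF ad(2), of "\<lambda>y h. if y = z \<and> R \<psi> z z' h then 1 else 0"])
      also have "\<dots> = (\<integral>\<^sup>+y. (\<integral>\<^sup>+h. (if R \<psi> z z' h then 1 else 0) \<partial>count_space (\<psi> `` {z})) * indicator {z} y \<partial>count_space t)"
        by (rule nn_integral_cong) (simp split: split_indicator)
      also have "\<dots> = (\<integral>\<^sup>+h. (if R \<psi> z z' h then 1 else 0) \<partial>count_space (\<psi> `` {z}))"
        using z by (subst nn_integral_indicator_singleton) (auto simp: emeasure_count_space)
      also have "\<dots> = (\<integral>\<^sup>+h. indicator {h. R \<psi> z z' h} h \<partial>count_space (\<psi> `` {z}))"
        by (rule nn_integral_cong) simp
      also have "\<dots> = ecount {h \<in> \<psi> `` {z}. R \<psi> z z' h}"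
        unfolding nn_integral_one_count_space by (simp add: Int_def)
      finally show ?thesis .
    qed
    have "(\<integral>\<^sup>+\<psi>. \<Phi> (t, \<psi>) \<partial>\<kappa> t) = (\<integral>\<^sup>+\<psi>. (\<integral>\<^sup>+z. \<integral>\<^sup>+z'. (if W z z' then G z z' \<psi> else 0) \<partial>count_space t \<partial>count_space t) \<partial>\<kappa> t)"
    proof (rule nn_integral_cong_AE, use ad in eventually_elim)
      fix \<psi> assume a: "admissible t \<psi>"
      note ad = admissibleD(1,2)[OF a]
      have "\<Phi> (t, \<psi>) = (\<integral>\<^sup>+z. \<integral>\<^sup>+h. \<integral>\<^sup>+z'. f \<psi> z z' h \<partial>count_space t \<partial>count_space (\<psi> `` {z}) \<partial>count_space t)"
        unfolding \<Phi>_def fst_conv snd_conv ad(1) by (rule sum_over_plates[OF ad(2), of "\<lambda>z h. \<integral>\<^sup>+z'. f \<psi> z z' h \<partial>count_space t"])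
      also have "\<dots> = (\<integral>\<^sup>+z. \<integral>\<^sup>+z'. \<integral>\<^sup>+h. f \<psi> z z' h \<partial>count_space (\<psi> `` {z}) \<partial>count_space t \<partial>count_space t)"
        using ct by (intro nn_integral_cong nn_integral_count_space_nn_integral) auto
      also have "\<dots> = (\<integral>\<^sup>+z. \<integral>\<^sup>+z'. (if W z z' then G z z' \<psi> else 0) \<partial>count_space t \<partial>count_space t)"
      proof (intro nn_integral_cong)
        fix z z' assume z: "z \<in> space (count_space t)"
        have "(\<integral>\<^sup>+h. f \<psi> z z' h \<partial>count_space (\<psi> `` {z})) = (if W z z' then (\<integral>\<^sup>+h. indicator {h. R \<psi> z z' h} h \<partial>count_space (\<psi> `` {z})) else 0)"
          unfolding f_def ad(1) by (auto intro!: nn_integral_cong simp: indicator_def)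
        also have "\<dots> = (if W z z' then ecount {h \<in> \<psi> `` {z}. R \<psi> z z' h} else 0)"
          unfolding nn_integral_one_count_space by (simp add: Int_def)
        finally show "(\<integral>\<^sup>+h. f \<psi> z z' h \<partial>count_space (\<psi> `` {z})) = (if W z z' then G z z' \<psi> else 0)"
          using G[OF a] z by simp
      qed
      finally show "\<Phi> (t, \<psi>) = (\<integral>\<^sup>+z. \<integral>\<^sup>+z'. (if W z z' then G z z' \<psi> else 0) \<partial>count_space t \<partial>count_space t)" .
    qed
    also have "\<dots> = (\<integral>\<^sup>+z. (\<integral>\<^sup>+\<psi>. (\<integral>\<^sup>+z'. (if W z z' then G z z' \<psi> else 0) \<partial>count_space t) \<partial>\<kappa> t) \<partial>count_space t)"
    \<comment> \<open>Exchanging the sum over cells with the kernel mean uses that a tessellation is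
      countable; the inner sum over neighbours must be measurable first.\<close>
    proof (rule nn_integral_count_space_nn_integral[OF ct])
      fix z assume z: "z \<in> t"
      interpret C: sigma_finite_measure "count_space t" by (rule sigma_finite_measure_count_space_countable[OF ct])
      have "(\<lambda>q. if W z (snd q) then G z (snd q) (fst q) else 0) \<in> borel_measurable (\<kappa> t \<Otimes>\<^sub>M count_space t)"
      proof (rule measurable_compose_countable'[where f="\<lambda>z' q. if W z z' then G z z' (fst q) else 0", OF _ measurable_snd ct])
        fix z' assume z': "z' \<in> t"
        have "(\<lambda>q. G z z' (fst q)) \<in> borel_measurable (\<kappa> t \<Otimes>\<^sub>M count_space t)"
          by (rule measurable_compose[OF measurable_fst Gm[OF z z']])
        then show "(\<lambda>q. if W z z' then G z z' (fst q) else 0) \<in> borel_measurable (\<kappa> t \<Otimes>\<^sub>M count_space t)"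
          by (cases "W z z'") simp_all
      qed
      then show "(\<lambda>\<psi>. \<integral>\<^sup>+z'. (if W z z' then G z z' \<psi> else 0) \<partial>count_space t) \<in> borel_measurable (\<kappa> t)"
        by (intro C.borel_measurable_nn_integral) (simp add: case_prod_beta)
    qed
    also have "\<dots> = (\<integral>\<^sup>+z. \<integral>\<^sup>+z'. (\<integral>\<^sup>+\<psi>. (if W z z' then G z z' \<psi> else 0) \<partial>\<kappa> t) \<partial>count_space t \<partial>count_space t)"
      using Gm ct by (intro nn_integral_cong nn_integral_count_space_nn_integral) auto
    also have "\<dots> = (\<integral>\<^sup>+z. \<integral>\<^sup>+z'. (if W z z' then ennreal (\<rho> t z) else 0) \<partial>count_space t \<partial>count_space t)"
    proof (intro nn_integral_cong)
      fix z z' assume z: "z \<in> space (count_space t)" "z' \<in> space (count_space t)"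
      have "(\<integral>\<^sup>+\<psi>. G z z' \<psi> \<partial>\<kappa> t) = (\<integral>\<^sup>+\<psi>. ecount {h \<in> \<psi> `` {z}. R \<psi> z z' h} \<partial>\<kappa> t)"
        by (rule nn_integral_cong_AE, use ad in eventually_elim) (use G z in auto)
      then show "(\<integral>\<^sup>+\<psi>. (if W z z' then G z z' \<psi> else 0) \<partial>\<kappa> t) = (if W z z' then ennreal (\<rho> t z) else 0)"
        using rv z by auto
    qed
    finally show "(\<integral>\<^sup>+\<psi>. \<Phi> (t, \<psi>) \<partial>\<kappa> t) = (\<integral>\<^sup>+z. \<integral>\<^sup>+z'. (if W z z' then ennreal (\<rho> t z) else 0) \<partial>count_space t \<partial>count_space t)" .
  qed
  also have "\<dots> = ?B" using marked_sum_tess[OF Wm] by (intro nn_integral_distr[OF Tm]) simp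
  finally show ?thesis using aem by (rule conjI)
qed

lemma mean_height_count:
  assumes Wm: "Measurable.pred (body_algebra \<Otimes>\<^sub>M body_algebra) (\<lambda>p. W (fst p) (snd p))"
  shows "(\<integral>\<^sup>+w. (\<integral>\<^sup>+p. \<integral>\<^sup>+z'. (if W (fst p) z' \<and> (0 \<le> snd p \<and> snd p < 1) then 1 else 0) \<partial>count_space (T w) \<partial>count_space (\<Psi> w)) \<partial>M) =
    (\<integral>\<^sup>+w. (\<integral>\<^sup>+z. \<integral>\<^sup>+z'. (if W z z' then ennreal (\<rho> (T w) z) else 0) \<partial>count_space (T w) \<partial>count_space (T w)) \<partial>M) \<and>
    ae_measurable (\<lambda>w. \<integral>\<^sup>+p. \<integral>\<^sup>+z'. (if W (fst p) z' \<and> (0 \<le> snd p \<and> snd p < 1) then 1 else 0) \<partial>count_space (T w) \<partial>count_space (\<Psi> w))"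
proof (rule mean_transfer[OF Wm, of "\<lambda>\<psi> z z' h. 0 \<le> h \<and> h < 1"])
  show "AE t in distr M tess_algebra T. \<forall>z\<in>t. \<forall>z'\<in>t. W z z' \<longrightarrow> (\<integral>\<^sup>+\<psi>. ecount {h \<in> \<psi> `` {z}. 0 \<le> h \<and> h < 1} \<partial>\<kappa> t) = ennreal (\<rho> t z)"
    using kernel_lines
  proof eventually_elim
    fix t assume k: "tessellation t \<and> indep_lines (\<kappa> t) t (\<lambda>z \<psi>. \<psi> `` {z}) (\<rho> t) \<and> (AE \<psi> in \<kappa> t. admissible t \<psi>)"
    then interpret L: indep_lines "\<kappa> t" t "\<lambda>z \<psi>. \<psi> `` {z}" "\<rho> t" by simp
    have "{h \<in> \<psi> `` {z}. 0 \<le> h \<and> h < 1} = \<psi> `` {z} \<inter> {0..<1}" for \<psi> :: "((real^2) set \<times> real) set" and z by auto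
    then show "\<forall>z\<in>t. \<forall>z'\<in>t. W z z' \<longrightarrow> (\<integral>\<^sup>+\<psi>. ecount {h \<in> \<psi> `` {z}. 0 \<le> h \<and> h < 1} \<partial>\<kappa> t) = ennreal (\<rho> t z)"
      using L.mean_count_unit by simp
  qed
  show "Measurable.pred N (\<lambda>x. 0 \<le> h x \<and> h x < 1)" if [measurable]: "h \<in> N \<rightarrow>\<^sub>M borel"
    for N and h :: "((((real^2) set set \<times> ((real^2) set \<times> real) set) \<times> ((real^2) set \<times> real)) \<times> (real^2) set) \<Rightarrow> real" by measurable
  show "Measurable.pred N (\<lambda>x. 0 \<le> h x \<and> h x < 1)" if [measurable]: "h \<in> N \<rightarrow>\<^sub>M borel"
    for N and h :: "(((real^2) set \<times> real) set \<times> ((real^2) set \<times> real)) \<Rightarrow> real" by measurable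
qed

text \<open>\<open>P z z' y\<close> tells which columns \<open>y\<close> cut the element above a
  plate of \<open>z\<close>: that of \<open>z\<close> alone for cells, of \<open>z\<close> and
  \<open>z'\<close> for vertical plates, and of all cells around a corner for vertical edges.
  Finitely many columns including \<open>z\<close> suffice for the midpoint count.\<close>

lemma mean_midpoint_plate_count:
  assumes Wm: "Measurable.pred (body_algebra \<Otimes>\<^sub>M body_algebra) (\<lambda>p. W (fst p) (snd p))"
    and Pm: "Measurable.pred (body_algebra \<Otimes>\<^sub>M (body_algebra \<Otimes>\<^sub>M body_algebra)) (\<lambda>q. P (fst q) (fst (snd q)) (snd (snd q)))"
    and Pz: "\<And>t z z'. tessellation t \<Longrightarrow> z \<in> t \<Longrightarrow> z' \<in> t \<Longrightarrow> W z z' \<Longrightarrow> P z z' z \<and> finite {y\<in>t. P z z' y}"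
  shows "(\<integral>\<^sup>+w. (\<integral>\<^sup>+p. \<integral>\<^sup>+z'. (if W (fst p) z' \<and> (before_midpoint (\<Psi> w `` {y. P (fst p) z' y}) (snd p) 1 \<and> \<not> before_midpoint (\<Psi> w `` {y. P (fst p) z' y}) (snd p) 0) then 1 else 0) \<partial>count_space (T w) \<partial>count_space (\<Psi> w)) \<partial>M) =
    (\<integral>\<^sup>+w. (\<integral>\<^sup>+z. \<integral>\<^sup>+z'. (if W z z' then ennreal (\<rho> (T w) z) else 0) \<partial>count_space (T w) \<partial>count_space (T w)) \<partial>M) \<and>
    ae_measurable (\<lambda>w. \<integral>\<^sup>+p. \<integral>\<^sup>+z'. (if W (fst p) z' \<and> (before_midpoint (\<Psi> w `` {y. P (fst p) z' y}) (snd p) 1 \<and> \<not> before_midpoint (\<Psi> w `` {y. P (fst p) z' y}) (snd p) 0) then 1 else 0) \<partial>count_space (T w) \<partial>count_space (\<Psi> w))"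
proof (rule mean_transfer[OF Wm, of "\<lambda>\<psi> z z' h. before_midpoint (\<psi> `` {y. P z z' y}) h 1 \<and> \<not> before_midpoint (\<psi> `` {y. P z z' y}) h 0"])
  have bm: "Measurable.pred N (\<lambda>x. before_midpoint (clean plate_box (g x) `` {y. P (z x) (z' x) y}) (h x) c)"
    if g: "g \<in> N \<rightarrow>\<^sub>M plate_config" and z: "z \<in> N \<rightarrow>\<^sub>M body_algebra" "z' \<in> N \<rightarrow>\<^sub>M body_algebra" and h: "h \<in> N \<rightarrow>\<^sub>M borel"
    for N and g :: "'c \<Rightarrow> _" and z z' h c
  proof -
    have "Measurable.pred N (\<lambda>x. \<exists>q\<in>clean plate_box (g x). P (z x) (z' x) (fst q) \<and> h x < snd q \<and> h x + snd q < 2 * c)"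
    proof (rule pred_ex_plate[OF g])
      have [measurable]: "z \<in> N \<rightarrow>\<^sub>M body_algebra" "z' \<in> N \<rightarrow>\<^sub>M body_algebra" "h \<in> N \<rightarrow>\<^sub>M borel" using z h by auto
      let ?N = "N \<Otimes>\<^sub>M (body_algebra \<Otimes>\<^sub>M borel :: ((real^2) set \<times> real) measure)"
      have "(\<lambda>p. (z (fst p), z' (fst p), fst (snd p))) \<in> ?N \<rightarrow>\<^sub>M body_algebra \<Otimes>\<^sub>M (body_algebra \<Otimes>\<^sub>M body_algebra)" by measurable
      from measurable_compose[OF this Pm] have 1: "Measurable.pred ?N (\<lambda>p. P (z (fst p)) (z' (fst p)) (fst (snd p)))" by simp
      then show "Measurable.pred ?N (\<lambda>p. P (z (fst p)) (z' (fst p)) (fst (snd p)) \<and> h (fst p) < snd (snd p) \<and> h (fst p) + snd (snd p) < 2 * c)"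
        by measurable
    qed
    moreover have "before_midpoint (\<psi> `` {y. P u u' y}) k c \<longleftrightarrow> (\<exists>q\<in>\<psi>. P u u' (fst q) \<and> k < snd q \<and> k + snd q < 2 * c)" for \<psi> u u' k
      unfolding before_midpoint_def by force
    ultimately show ?thesis by simp
  qed
  show "Measurable.pred N (\<lambda>x. before_midpoint (clean plate_box (g x) `` {y. P (z x) (z' x) y}) (h x) 1 \<and> \<not> before_midpoint (clean plate_box (g x) `` {y. P (z x) (z' x) y}) (h x) 0)"
    if "g \<in> N \<rightarrow>\<^sub>M plate_config" "z \<in> N \<rightarrow>\<^sub>M body_algebra" "z' \<in> N \<rightarrow>\<^sub>M body_algebra" "h \<in> N \<rightarrow>\<^sub>M borel"
    for N and g :: "((((real^2) set set \<times> ((real^2) set \<times> real) set) \<times> ((real^2) set \<times> real)) \<times> (real^2) set) \<Rightarrow> _" and z z' h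
    using that by (intro pred_intros_logic bm)
  show "Measurable.pred N (\<lambda>x. before_midpoint (clean plate_box (g x) `` {y. P (z x) (z' x) y}) (h x) 1 \<and> \<not> before_midpoint (clean plate_box (g x) `` {y. P (z x) (z' x) y}) (h x) 0)"
    if "g \<in> N \<rightarrow>\<^sub>M plate_config" "z \<in> N \<rightarrow>\<^sub>M body_algebra" "z' \<in> N \<rightarrow>\<^sub>M body_algebra" "h \<in> N \<rightarrow>\<^sub>M borel"
    for N and g :: "(((real^2) set \<times> real) set \<times> ((real^2) set \<times> real)) \<Rightarrow> _" and z z' h
    using that by (intro pred_intros_logic bm)
  show "AE t in distr M tess_algebra T. \<forall>z\<in>t. \<forall>z'\<in>t. W z z' \<longrightarrow>
      (\<integral>\<^sup>+\<psi>. ecount {h \<in> \<psi> `` {z}. before_midpoint (\<psi> `` {y. P z z' y}) h 1 \<and> \<not> before_midpoint (\<psi> `` {y. P z z' y}) h 0} \<partial>\<kappa> t) = ennreal (\<rho> t z)"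
    using kernel_lines
  proof eventually_elim
    fix t assume k: "tessellation t \<and> indep_lines (\<kappa> t) t (\<lambda>z \<psi>. \<psi> `` {z}) (\<rho> t) \<and> (AE \<psi> in \<kappa> t. admissible t \<psi>)"
    then interpret L: indep_lines "\<kappa> t" t "\<lambda>z \<psi>. \<psi> `` {z}" "\<rho> t" by simp
    have ad: "AE \<psi> in \<kappa> t. admissible t \<psi>" and t: "tessellation t" using k by auto
    show "\<forall>z\<in>t. \<forall>z'\<in>t. W z z' \<longrightarrow>
      (\<integral>\<^sup>+\<psi>. ecount {h \<in> \<psi> `` {z}. before_midpoint (\<psi> `` {y. P z z' y}) h 1 \<and> \<not> before_midpoint (\<psi> `` {y. P z z' y}) h 0} \<partial>\<kappa> t) = ennreal (\<rho> t z)"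
    proof (intro ballI impI)
      fix z z' assume z: "z \<in> t" "z' \<in> t" "W z z'"
      let ?A = "{y\<in>t. P z z' y}"
      have A: "z \<in> ?A" "finite ?A" "?A \<subseteq> t" using Pz[OF t z] z by auto
      have unb: "AE \<psi> in \<kappa> t. \<forall>x. \<exists>h\<in>\<psi> `` {z}. x < h"
        using ad by eventually_elim (use admissibleD(3) z(1) in blast)
      have "(\<integral>\<^sup>+\<psi>. ecount {h \<in> \<psi> `` {z}. before_midpoint (\<psi> `` {y. P z z' y}) h 1 \<and> \<not> before_midpoint (\<psi> `` {y. P z z' y}) h 0} \<partial>\<kappa> t) =
         (\<integral>\<^sup>+\<psi>. ecount {h \<in> \<psi> `` {z}. before_midpoint (\<Union>y\<in>?A. \<psi> `` {y}) h 1 \<and> \<not> before_midpoint (\<Union>y\<in>?A. \<psi> `` {y}) h 0} \<partial>\<kappa> t)"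
      proof (rule nn_integral_cong_AE, use ad in eventually_elim)
        fix \<psi> assume "admissible t \<psi>"
        then have "\<psi> `` {y. P z z' y} = (\<Union>y\<in>?A. \<psi> `` {y})" using admissibleD(2) by blast
        then show "ecount {h \<in> \<psi> `` {z}. before_midpoint (\<psi> `` {y. P z z' y}) h 1 \<and> \<not> before_midpoint (\<psi> `` {y. P z z' y}) h 0} =
          ecount {h \<in> \<psi> `` {z}. before_midpoint (\<Union>y\<in>?A. \<psi> `` {y}) h 1 \<and> \<not> before_midpoint (\<Union>y\<in>?A. \<psi> `` {y}) h 0}" by simp
      qed
      also have "\<dots> = ennreal (\<rho> t z)" by (rule L.mean_midpoint_count[OF A(1,3,2) unb])
      finally show "(\<integral>\<^sup>+\<psi>. ecount {h \<in> \<psi> `` {z}. before_midpoint (\<psi> `` {y. P z z' y}) h 1 \<and> \<not> before_midpoint (\<psi> `` {y. P z z' y}) h 0} \<partial>\<kappa> t) = ennreal (\<rho> t z)" .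
    qed
  qed
qed

end

subsection \<open>Counting primitive elements\<close>

lemma ecount_image_filter:
  assumes "inj_on f A" shows "ecount {x \<in> f ` A. Q x} = ecount {a \<in> A. Q (f a)}"
proof -
  have "{x \<in> f ` A. Q x} = f ` {a \<in> A. Q (f a)}" by auto
  moreover have "inj_on f {a \<in> A. Q (f a)}" using assms by (rule inj_on_subset) auto
  ultimately show ?thesis by (simp add: ecount_image)
qed

lemma ecount_filter: "ecount {a \<in> A. Q a} = (\<integral>\<^sup>+a. (if Q a then 1 else 0) \<partial>count_space A)"
proof -
  have "(\<integral>\<^sup>+a. (if Q a then 1 else 0) \<partial>count_space A) = (\<integral>\<^sup>+a. indicator {a. Q a} a \<partial>count_space A)"
    by (rule nn_integral_cong) simp
  then show ?thesis unfolding nn_integral_one_count_space by (simp add: Int_def)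
qed

lemma ecount_Times:
  "ecount {(a, b). a \<in> A \<and> b \<in> B \<and> Q a b} = (\<integral>\<^sup>+a. \<integral>\<^sup>+b. (if Q a b then 1 else 0) \<partial>count_space B \<partial>count_space A)"
proof -
  let ?S = "{(a, b). a \<in> A \<and> b \<in> B \<and> Q a b}"
  have "ecount ?S = (\<integral>\<^sup>+p. indicator ?S p \<partial>count_space UNIV)" by simp
  also have "\<dots> = (\<integral>\<^sup>+a. \<integral>\<^sup>+b. indicator ?S (a, b) \<partial>count_space UNIV \<partial>count_space UNIV)"
    by (rule nn_integral_fst_count_space[symmetric])
  also have "\<dots> = (\<integral>\<^sup>+a. (\<integral>\<^sup>+b. (if Q a b then 1 else 0) * indicator B b \<partial>count_space UNIV) * indicator A a \<partial>count_space UNIV)"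
  proof (rule nn_integral_cong)
    fix a
    show "(\<integral>\<^sup>+b. indicator ?S (a, b) \<partial>count_space UNIV) = (\<integral>\<^sup>+b. (if Q a b then 1 else 0) * indicator B b \<partial>count_space UNIV) * (indicator A a :: ennreal)"
      by (cases "a \<in> A") (auto intro!: nn_integral_cong simp: indicator_def)
  qed
  also have "\<dots> = (\<integral>\<^sup>+a. \<integral>\<^sup>+b. (if Q a b then 1 else 0) \<partial>count_space B \<partial>count_space A)"
    by (simp add: nn_integral_count_space_indicator)
  finally show ?thesis .
qed

lemma intensity_eq: "intensity M c X = (\<integral>\<^sup>+w. ecount {x \<in> X w. c x \<in> unit_cube} \<partial>M)"
proof -
  have "(\<integral>\<^sup>+x. 1 \<partial>count_space A) = ecount A" for A :: "'b set" by (simp add: emeasure_count_space)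
  then show ?thesis unfolding intensity_def mean_sum_def by simp
qed

lemma half_window:
  assumes "bilat D"
  shows "(0 \<le> (h + succ D h) / 2 \<and> (h + succ D h) / 2 < 1) \<longleftrightarrow> before_midpoint D h 1 \<and> \<not> before_midpoint D h 0"
  unfolding before_midpoint_iff[OF assms] by (auto simp: not_less)

abbreviation side_mid :: "(real^2) set \<Rightarrow> (real^2) set \<Rightarrow> real^2" where
  "side_mid z z' \<equiv> midpoint (end1 (z \<inter> z')) (end2 (z \<inter> z'))"

abbreviation window :: "real set \<Rightarrow> real \<Rightarrow> bool" where
  "window D h \<equiv> before_midpoint D h 1 \<and> \<not> before_midpoint D h 0"

context planar_tess
begin

text \<open>The ends of a side are distinct, so no neighbour is counted in both sums, and together
  they count the neighbours whose shared segment ends at \<open>v\<close>.\<close>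

lemma neighbours_at_point:
  assumes z: "z \<in> t"
  shows "ecount {z' \<in> t. sides z z' \<and> v = end1 (z \<inter> z')} + ecount {z' \<in> t. sides z z' \<and> v = end2 (z \<inter> z')} =
    (if v \<in> cell_corners t \<and> v \<in> z then 2 else 0)"
proof -
  let ?E1 = "{z' \<in> t. sides z z' \<and> v = end1 (z \<inter> z')}" and ?E2 = "{z' \<in> t. sides z z' \<and> v = end2 (z \<inter> z')}"
  have d: "?E1 \<inter> ?E2 = {}" using ends_of_side(2)[OF z] sides_iff_touch[OF z] by auto
  have "ecount ?E1 + ecount ?E2 = ecount (?E1 \<union> ?E2)" using d by (intro plus_emeasure) auto
  also have "?E1 \<union> ?E2 = {z'\<in>t. touch z z' \<and> v extreme_point_of (z \<inter> z')}"
    using ends_of_side(3)[OF z] sides_iff_touch[OF z] by auto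
  also have "ecount \<dots> = (if v \<in> cell_corners t \<and> v \<in> z then 2 else 0)"
  proof (cases "v \<in> cell_corners t \<and> v \<in> z")
    case True
    then have c: "card {z'\<in>t. touch z z' \<and> v extreme_point_of (z \<inter> z')} = 2"
      using card_neighbours_at_corner[OF z] by blast
    then have "finite {z'\<in>t. touch z z' \<and> v extreme_point_of (z \<inter> z')}" by (intro card_ge_0_finite) simp
    then show ?thesis using True c by (simp add: emeasure_count_space)
  next
    case False
    then have "{z'\<in>t. touch z z' \<and> v extreme_point_of (z \<inter> z')} = {}"
      using extreme_of_side_is_corner[OF z] by (auto simp: touch_def extreme_point_of_def)
    then show ?thesis by (simp only: if_not_P[OF False] emeasure_empty)
  qed
  finally show ?thesis .
qed

text \<open>Double counting of corners in \<open>z\<close> against ends of shared segments; which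
  end is \<open>end1\<close> is irrelevant for the sum of both.\<close>

lemma corners_as_side_ends:
  assumes z: "z \<in> t"
  shows "2 * ecount {v \<in> cell_corners t. v \<in> z \<and> A v} =
    (\<integral>\<^sup>+z'. (if sides z z' \<and> A (end1 (z \<inter> z')) then 1 else 0) \<partial>count_space t) +
    (\<integral>\<^sup>+z'. (if sides z z' \<and> A (end2 (z \<inter> z')) then 1 else 0) \<partial>count_space t)"
proof -
  have e: "(\<integral>\<^sup>+z'. (if sides z z' \<and> A (en (z \<inter> z')) then 1 else 0) \<partial>count_space t) =
     (\<integral>\<^sup>+v. (if A v then ecount {z' \<in> t. sides z z' \<and> v = en (z \<inter> z')} else 0) \<partial>count_space UNIV)" for en :: "(real^2) set \<Rightarrow> real^2"
  proof -
    have "(\<integral>\<^sup>+z'. (if sides z z' \<and> A (en (z \<inter> z')) then 1 else 0) \<partial>count_space t) =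
      (\<integral>\<^sup>+z'. \<integral>\<^sup>+v. (if v = en (z \<inter> z') then (if A v \<and> sides z z' then 1 else 0) else 0) \<partial>count_space UNIV \<partial>count_space t)"
    proof (rule nn_integral_cong)
      fix z'
      have "(\<integral>\<^sup>+v. (if v = en (z \<inter> z') then (if A v \<and> sides z z' then 1 else 0) else 0) \<partial>count_space UNIV) =
         (\<integral>\<^sup>+v. (if v = en (z \<inter> z') then (if sides z z' \<and> A (en (z \<inter> z')) then 1 else 0) else 0) \<partial>count_space UNIV)"
        by (rule nn_integral_cong) auto
      also have "\<dots> = (if sides z z' \<and> A (en (z \<inter> z')) then 1 else 0)" by (rule nn_integral_unique_if) blast
      finally show "(if sides z z' \<and> A (en (z \<inter> z')) then 1 else 0) =
         (\<integral>\<^sup>+v. (if v = en (z \<inter> z') then (if A v \<and> sides z z' then 1 else 0) else 0 :: ennreal) \<partial>count_space UNIV)" ..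
    qed
    also have "\<dots> = (\<integral>\<^sup>+v. \<integral>\<^sup>+z'. (if v = en (z \<inter> z') then (if A v \<and> sides z z' then 1 else 0) else 0) \<partial>count_space t \<partial>count_space UNIV)"
      by (rule nn_integral_count_space_nn_integral[symmetric, OF countable_tess[OF t]]) simp
    also have "\<dots> = (\<integral>\<^sup>+v. (if A v then ecount {z' \<in> t. sides z z' \<and> v = en (z \<inter> z')} else 0) \<partial>count_space UNIV)"
    proof (rule nn_integral_cong)
      fix v
      show "(\<integral>\<^sup>+z'. (if v = en (z \<inter> z') then (if A v \<and> sides z z' then 1 else 0) else 0) \<partial>count_space t) =
        (if A v then ecount {z' \<in> t. sides z z' \<and> v = en (z \<inter> z')} else 0)"
      proof (cases "A v")
        case True
        then show ?thesis unfolding ecount_filter if_P[OF True] using True by (intro nn_integral_cong) auto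
      next
        case False
        have "(\<integral>\<^sup>+z'. (if v = en (z \<inter> z') then (if A v \<and> sides z z' then 1 else 0) else 0) \<partial>count_space t) = (\<integral>\<^sup>+z'. 0 \<partial>count_space t)"
          using False by (intro nn_integral_cong) auto
        then show ?thesis by (simp add: False)
      qed
    qed
    finally show ?thesis .
  qed
  have "(\<integral>\<^sup>+z'. (if sides z z' \<and> A (end1 (z \<inter> z')) then 1 else 0) \<partial>count_space t) +
    (\<integral>\<^sup>+z'. (if sides z z' \<and> A (end2 (z \<inter> z')) then 1 else 0) \<partial>count_space t) =
    (\<integral>\<^sup>+v. (if A v then ecount {z' \<in> t. sides z z' \<and> v = end1 (z \<inter> z')} else 0) + (if A v then ecount {z' \<in> t. sides z z' \<and> v = end2 (z \<inter> z')} else 0) \<partial>count_space UNIV)"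
    unfolding e by (rule nn_integral_add[symmetric]) auto
  also have "\<dots> = (\<integral>\<^sup>+v. 2 * indicator {v \<in> cell_corners t. v \<in> z \<and> A v} v \<partial>count_space UNIV)"
    using neighbours_at_point[OF z] by (intro nn_integral_cong) (auto simp: indicator_def)
  also have "\<dots> = 2 * ecount {v \<in> cell_corners t. v \<in> z \<and> A v}" by (subst nn_integral_cmult) auto
  finally show ?thesis by simp
qed

text \<open>Exchanging the sums over corners and over the cells containing them weights every cell
  by the number of corners it contains, and this number is expressed by side ends.\<close>

lemma corner_sum:
  assumes r: "\<And>z. z \<in> t \<Longrightarrow> 0 \<le> r z"
  shows "2 * (\<integral>\<^sup>+v. ennreal (\<Sum>z | z \<in> t \<and> v \<in> z. r z) \<partial>count_space {v \<in> cell_corners t. A v}) =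
    (\<integral>\<^sup>+z. \<integral>\<^sup>+z'. (if sides z z' \<and> A (end1 (z \<inter> z')) then ennreal (r z) else 0) \<partial>count_space t \<partial>count_space t) +
    (\<integral>\<^sup>+z. \<integral>\<^sup>+z'. (if sides z z' \<and> A (end2 (z \<inter> z')) then ennreal (r z) else 0) \<partial>count_space t \<partial>count_space t)"
proof -
  let ?C = "{v \<in> cell_corners t. A v}"
  have "(\<integral>\<^sup>+v. ennreal (\<Sum>z | z \<in> t \<and> v \<in> z. r z) \<partial>count_space ?C) =
    (\<integral>\<^sup>+v. \<integral>\<^sup>+z. ennreal (r z) * indicator z v \<partial>count_space t \<partial>count_space ?C)"
  proof (rule nn_integral_cong)
    fix v
    have fin: "finite {z. z \<in> t \<and> v \<in> z}" using finite_subset[OF _ finite_hit[of "{v}"], of "{z. z \<in> t \<and> v \<in> z}"] by auto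
    have "(\<integral>\<^sup>+z. ennreal (r z) * indicator z v \<partial>count_space t) = (\<Sum>z | z \<in> t \<and> 0 < ennreal (r z) * indicator z v. ennreal (r z) * indicator z v)"
      by (rule nn_integral_count_space) (rule finite_subset[OF _ fin], auto simp: indicator_def split: if_splits)
    also have "\<dots> = (\<Sum>z | z \<in> t \<and> v \<in> z. ennreal (r z) * indicator z v)"
      using fin by (intro sum.mono_neutral_left) (auto simp: indicator_def not_gr_zero ennreal_eq_0_iff not_le split: if_splits)
    also have "\<dots> = (\<Sum>z | z \<in> t \<and> v \<in> z. ennreal (r z))" by (rule sum.cong) auto
    also have "\<dots> = ennreal (\<Sum>z | z \<in> t \<and> v \<in> z. r z)" using r by (intro sum_ennreal) auto
    finally show "ennreal (\<Sum>z | z \<in> t \<and> v \<in> z. r z) = (\<integral>\<^sup>+z. ennreal (r z) * indicator z v \<partial>count_space t)" ..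
  qed
  also have "\<dots> = (\<integral>\<^sup>+z. \<integral>\<^sup>+v. ennreal (r z) * indicator z v \<partial>count_space ?C \<partial>count_space t)"
    by (rule nn_integral_count_space_nn_integral[OF countable_tess[OF t]]) simp
  also have "\<dots> = (\<integral>\<^sup>+z. ennreal (r z) * ecount {v \<in> cell_corners t. v \<in> z \<and> A v} \<partial>count_space t)"
  proof (rule nn_integral_cong)
    fix z
    have "(\<integral>\<^sup>+v. ennreal (r z) * indicator z v \<partial>count_space ?C) = ennreal (r z) * ecount (?C \<inter> z)"
      by (subst nn_integral_cmult) (simp_all only: nn_integral_one_count_space borel_measurable_count_space)
    also have "?C \<inter> z = {v \<in> cell_corners t. v \<in> z \<and> A v}" by auto
    finally show "(\<integral>\<^sup>+v. ennreal (r z) * indicator z v \<partial>count_space ?C) = ennreal (r z) * ecount {v \<in> cell_corners t. v \<in> z \<and> A v}" .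
  qed
  finally have 1: "(\<integral>\<^sup>+v. ennreal (\<Sum>z | z \<in> t \<and> v \<in> z. r z) \<partial>count_space ?C) =
     (\<integral>\<^sup>+z. ennreal (r z) * ecount {v \<in> cell_corners t. v \<in> z \<and> A v} \<partial>count_space t)" .
  have w: "(\<integral>\<^sup>+z'. (if P z' then c else 0) \<partial>count_space t) = c * (\<integral>\<^sup>+z'. (if P z' then 1 else 0) \<partial>count_space t)" for P and c :: ennreal
    by (subst nn_integral_cmult[symmetric]) (auto intro!: nn_integral_cong)
  have "2 * (\<integral>\<^sup>+z. ennreal (r z) * ecount {v \<in> cell_corners t. v \<in> z \<and> A v} \<partial>count_space t) =
     (\<integral>\<^sup>+z. 2 * (ennreal (r z) * ecount {v \<in> cell_corners t. v \<in> z \<and> A v}) \<partial>count_space t)"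
    by (rule nn_integral_cmult[symmetric]) simp
  also have "\<dots> = (\<integral>\<^sup>+z. (\<integral>\<^sup>+z'. (if sides z z' \<and> A (end1 (z \<inter> z')) then ennreal (r z) else 0) \<partial>count_space t) +
     (\<integral>\<^sup>+z'. (if sides z z' \<and> A (end2 (z \<inter> z')) then ennreal (r z) else 0) \<partial>count_space t) \<partial>count_space t)"
  proof (rule nn_integral_cong)
    fix z assume "z \<in> space (count_space t)"
    then have z: "z \<in> t" by simp
    have "2 * (ennreal (r z) * ecount {v \<in> cell_corners t. v \<in> z \<and> A v}) = ennreal (r z) * (2 * ecount {v \<in> cell_corners t. v \<in> z \<and> A v})"
      by (simp add: mult.left_commute)
    then show "2 * (ennreal (r z) * ecount {v \<in> cell_corners t. v \<in> z \<and> A v}) =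
      (\<integral>\<^sup>+z'. (if sides z z' \<and> A (end1 (z \<inter> z')) then ennreal (r z) else 0) \<partial>count_space t) +
      (\<integral>\<^sup>+z'. (if sides z z' \<and> A (end2 (z \<inter> z')) then ennreal (r z) else 0) \<partial>count_space t)"
      unfolding w[of _ "ennreal (r z)"] corners_as_side_ends[OF z] by (simp add: distrib_left)
  qed
  also have "\<dots> = (\<integral>\<^sup>+z. \<integral>\<^sup>+z'. (if sides z z' \<and> A (end1 (z \<inter> z')) then ennreal (r z) else 0) \<partial>count_space t \<partial>count_space t) +
    (\<integral>\<^sup>+z. \<integral>\<^sup>+z'. (if sides z z' \<and> A (end2 (z \<inter> z')) then ennreal (r z) else 0) \<partial>count_space t \<partial>count_space t)"
    by (rule nn_integral_add) auto
  finally show ?thesis unfolding 1 .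
qed

end

section \<open>Counts of primitive elements in one realization\<close>

context column_tess
begin

lemma flag_count:
  "ecount {f \<in> flags. case f of (z, z', h) \<Rightarrow> Q z z' h} =
    (\<integral>\<^sup>+p. \<integral>\<^sup>+z'. (if sides (fst p) z' \<and> Q (fst p) z' (snd p) then 1 else 0) \<partial>count_space t \<partial>count_space \<psi>)"
proof -
  let ?g = "\<lambda>(p, z'). (fst p, z', snd p)"
  let ?S = "{(p, z'). p \<in> \<psi> \<and> z' \<in> t \<and> (sides (fst p) z' \<and> Q (fst p) z' (snd p))}"
  have "{f \<in> flags. case f of (z, z', h) \<Rightarrow> Q z z' h} = ?g ` ?S"
  proof (intro set_eqI iffI)
    fix f assume f: "f \<in> {f \<in> flags. case f of (z, z', h) \<Rightarrow> Q z z' h}"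
    obtain z z' h where fe: "f = (z, z', h)" by (cases f) auto
    have fl: "(z, z', h) \<in> flags" using f fe by auto
    have "((z, h), z') \<in> ?S" using f fe flagsD[OF fl] sides_iff_touch[of z z'] by auto
    then show "f \<in> ?g ` ?S" unfolding fe by (intro image_eqI[of _ _ "((z, h), z')"]) auto
  next
    fix f assume "f \<in> ?g ` ?S"
    then obtain z h z' where fe: "f = (z, z', h)" and S: "(z, h) \<in> \<psi>" "z' \<in> t" "sides z z'" "Q z z' h" by auto
    then show "f \<in> {f \<in> flags. case f of (z, z', h) \<Rightarrow> Q z z' h}"
      using sides_iff_touch[OF in_t[OF S(1)] S(2)] by (auto simp: flags_def)
  qed
  moreover have "inj_on ?g ?S" by (auto simp: inj_on_def)
  ultimately have "ecount {f \<in> flags. case f of (z, z', h) \<Rightarrow> Q z z' h} = ecount ?S" by (simp add: ecount_image)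
  then show ?thesis unfolding ecount_Times .
qed

text \<open>A sum over cells is cast as a sum over pairs on the diagonal, so that the transfer for
  pairs of cells also serves cells and horizontal plates.\<close>

lemma cell_sum_diag:
  "ecount {p \<in> \<psi>. c (fst p) \<in> unit_cube \<and> Q (fst p) (snd p)} =
   (\<integral>\<^sup>+p. \<integral>\<^sup>+z'. (if (fst p = z' \<and> c (fst p) \<in> unit_cube) \<and> Q (fst p) (snd p) then 1 else 0) \<partial>count_space t \<partial>count_space \<psi>)"
  unfolding ecount_filter
proof (rule nn_integral_cong)
  fix p assume "p \<in> space (count_space \<psi>)"
  then have p: "fst p \<in> t" using in_t[of "fst p" "snd p"] by simp
  have "(\<integral>\<^sup>+z'. (if (fst p = z' \<and> c (fst p) \<in> unit_cube) \<and> Q (fst p) (snd p) then 1 else 0) \<partial>count_space t) =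
    ecount {z' \<in> t. (fst p = z' \<and> c (fst p) \<in> unit_cube) \<and> Q (fst p) (snd p)}" by (rule ecount_filter[symmetric])
  also have "{z' \<in> t. (fst p = z' \<and> c (fst p) \<in> unit_cube) \<and> Q (fst p) (snd p)} = (if c (fst p) \<in> unit_cube \<and> Q (fst p) (snd p) then {fst p} else {})"
    using p by auto
  also have "ecount \<dots> = (if c (fst p) \<in> unit_cube \<and> Q (fst p) (snd p) then 1 else 0)"
    by (simp add: emeasure_count_space)
  finally show "(if c (fst p) \<in> unit_cube \<and> Q (fst p) (snd p) then 1 else 0) =
    (\<integral>\<^sup>+z'. (if (fst p = z' \<and> c (fst p) \<in> unit_cube) \<and> Q (fst p) (snd p) then 1 else 0 :: ennreal) \<partial>count_space t)" ..
qed

text \<open>A vertex height belongs to one column only, so a vertex determines its plate, and the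
  vertices on a plate of \<open>z\<close> correspond to the corners contained in
  \<open>z\<close>.\<close>

lemma spot_count:
  "2 * ecount {s \<in> spots. fst s \<in> unit_cube \<and> Q (fst s) (snd s)} =
    (\<integral>\<^sup>+p. \<integral>\<^sup>+z'. (if (sides (fst p) z' \<and> end1 (fst p \<inter> z') \<in> unit_cube) \<and> Q (end1 (fst p \<inter> z')) (snd p) then 1 else 0) \<partial>count_space t \<partial>count_space \<psi>) +
    (\<integral>\<^sup>+p. \<integral>\<^sup>+z'. (if (sides (fst p) z' \<and> end2 (fst p \<inter> z') \<in> unit_cube) \<and> Q (end2 (fst p \<inter> z')) (snd p) then 1 else 0) \<partial>count_space t \<partial>count_space \<psi>)"
proof -
  let ?g = "\<lambda>(p, v). (v, snd p)"
  let ?S = "{(p, v). p \<in> \<psi> \<and> v \<in> cell_corners t \<and> (v \<in> fst p \<and> (v \<in> unit_cube \<and> Q v (snd p)))}"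
  have "{s \<in> spots. fst s \<in> unit_cube \<and> Q (fst s) (snd s)} = ?g ` ?S"
  proof (intro set_eqI iffI)
    fix s assume s: "s \<in> {s \<in> spots. fst s \<in> unit_cube \<and> Q (fst s) (snd s)}"
    then obtain v h z where se: "s = (v, h)" "v \<in> cell_corners t" "v \<in> z" "(z, h) \<in> \<psi>" by auto
    then have "((z, h), v) \<in> ?S" using s by auto
    then show "s \<in> ?g ` ?S" unfolding se by (intro image_eqI[of _ _ "((z, h), v)"]) auto
  qed auto
  \<comment> \<open>Two plates giving the same vertex would share a height, which \<open>nc\<close>
    excludes.\<close>
  moreover have "inj_on ?g ?S" using nc by (auto simp: inj_on_def)
  ultimately have "ecount {s \<in> spots. fst s \<in> unit_cube \<and> Q (fst s) (snd s)} = ecount ?S" by (simp add: ecount_image)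
  also have "\<dots> = (\<integral>\<^sup>+p. ecount {v \<in> cell_corners t. v \<in> fst p \<and> (v \<in> unit_cube \<and> Q v (snd p))} \<partial>count_space \<psi>)"
    unfolding ecount_Times ecount_filter ..
  finally have "2 * ecount {s \<in> spots. fst s \<in> unit_cube \<and> Q (fst s) (snd s)} =
    (\<integral>\<^sup>+p. 2 * ecount {v \<in> cell_corners t. v \<in> fst p \<and> (v \<in> unit_cube \<and> Q v (snd p))} \<partial>count_space \<psi>)"
    by (simp add: nn_integral_cmult)
  also have "\<dots> = (\<integral>\<^sup>+p. (\<integral>\<^sup>+z'. (if (sides (fst p) z' \<and> end1 (fst p \<inter> z') \<in> unit_cube) \<and> Q (end1 (fst p \<inter> z')) (snd p) then 1 else 0) \<partial>count_space t) +
      (\<integral>\<^sup>+z'. (if (sides (fst p) z' \<and> end2 (fst p \<inter> z') \<in> unit_cube) \<and> Q (end2 (fst p \<inter> z')) (snd p) then 1 else 0) \<partial>count_space t) \<partial>count_space \<psi>)"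
  proof (rule nn_integral_cong)
    fix p assume "p \<in> space (count_space \<psi>)"
    then have p: "fst p \<in> t" using in_t[of "fst p" "snd p"] by simp
    show "2 * ecount {v \<in> cell_corners t. v \<in> fst p \<and> (v \<in> unit_cube \<and> Q v (snd p))} =
      (\<integral>\<^sup>+z'. (if (sides (fst p) z' \<and> end1 (fst p \<inter> z') \<in> unit_cube) \<and> Q (end1 (fst p \<inter> z')) (snd p) then 1 else 0) \<partial>count_space t) +
      (\<integral>\<^sup>+z'. (if (sides (fst p) z' \<and> end2 (fst p \<inter> z') \<in> unit_cube) \<and> Q (end2 (fst p \<inter> z')) (snd p) then 1 else 0) \<partial>count_space t)"
      unfolding corners_as_side_ends[OF p, of "\<lambda>v. v \<in> unit_cube \<and> Q v (snd p)"] by (simp only: conj_assoc)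
  qed
  also have "\<dots> = (\<integral>\<^sup>+p. \<integral>\<^sup>+z'. (if (sides (fst p) z' \<and> end1 (fst p \<inter> z') \<in> unit_cube) \<and> Q (end1 (fst p \<inter> z')) (snd p) then 1 else 0) \<partial>count_space t \<partial>count_space \<psi>) +
    (\<integral>\<^sup>+p. \<integral>\<^sup>+z'. (if (sides (fst p) z' \<and> end2 (fst p \<inter> z') \<in> unit_cube) \<and> Q (end2 (fst p \<inter> z')) (snd p) then 1 else 0) \<partial>count_space t \<partial>count_space \<psi>)"
    by (rule nn_integral_add) auto
  finally show ?thesis .
qed

text \<open>The centroid of a prism has the midpoint of its height range as height, which turns the
  cube condition into \<open>window\<close>.\<close>

lemma count_cells:
  "ecount {c \<in> column_cells t \<psi>. centroid c \<in> unit_cube} =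
    ecount {p \<in> \<psi>. centroid (fst p) \<in> unit_cube \<and> window (\<psi> `` {fst p}) (snd p)}"
proof -
  have c: "centroid (case p of (z, h) \<Rightarrow> z \<times> {h..succ (heights {z}) h}) \<in> unit_cube \<longleftrightarrow>
     centroid (fst p) \<in> unit_cube \<and> window (\<psi> `` {fst p}) (snd p)" if p: "p \<in> \<psi>" for p
  proof -
    obtain z h where pe: "p = (z, h)" by (cases p)
    have z: "z \<in> t" using in_t p pe by blast
    have "centroid (z \<times> {h..succ (heights {z}) h}) = (centroid z, (h + succ (heights {z}) h) / 2)"
      using bilat_succ(2)[OF bi[OF z]] by (intro centroid_prism cell(2,4)[OF z])
    then show ?thesis unfolding pe prod.case fst_conv snd_conv half_window[OF bi[OF z], symmetric] by (simp only: mem_unit_cube_Pair)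
  qed
  show ?thesis unfolding column_cells_eq ecount_image_filter[OF inj_cells]
    using c by (intro arg_cong[where f=ecount] Collect_cong) auto
qed

lemma count_hplates:
  "ecount {p \<in> hplate ` \<psi>. centroid p \<in> unit_cube} =
    ecount {p \<in> \<psi>. centroid (fst p) \<in> unit_cube \<and> (0 \<le> snd p \<and> snd p < 1)}"
proof -
  have c: "centroid (hplate p) \<in> unit_cube \<longleftrightarrow> centroid (fst p) \<in> unit_cube \<and> (0 \<le> snd p \<and> snd p < 1)" if p: "p \<in> \<psi>" for p
  proof -
    obtain z h where pe: "p = (z, h)" by (cases p)
    have z: "z \<in> t" using in_t p pe by blast
    have "centroid (z \<times> {h}) = (centroid z, h)" by (intro centroid_horizontal_body cell(2,4)[OF z])
    then show ?thesis unfolding pe hplate_def prod.case fst_conv snd_conv by (simp only: mem_unit_cube_Pair)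
  qed
  show ?thesis unfolding ecount_image_filter[OF inj_hplate]
    using c by (intro arg_cong[where f=ecount] Collect_cong) auto
qed

lemma centroid_side:
  fixes a b :: real
  assumes "z \<in> t" "z' \<in> t" "touch z z'" "a \<le> b"
  shows "centroid ((z \<inter> z') \<times> {a..b}) = (side_mid z z', (a + b) / 2)"
  using centroid_segment_Times[OF assms(4), of "end1 (z \<inter> z')" "end2 (z \<inter> z')"] ends_of_side(1)[OF assms(1-3)] by simp

lemma count_vplates:
  "ecount {p \<in> vplate ` flags. centroid p \<in> unit_cube} =
    (\<integral>\<^sup>+p. \<integral>\<^sup>+z'. (if (sides (fst p) z' \<and> side_mid (fst p) z' \<in> unit_cube) \<and> window (\<psi> `` {y. y = fst p \<or> y = z'}) (snd p) then 1 else 0) \<partial>count_space t \<partial>count_space \<psi>)"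
proof -
  have c: "centroid (vplate f) \<in> unit_cube \<longleftrightarrow> (case f of (z, z', h) \<Rightarrow> side_mid z z' \<in> unit_cube \<and> window (\<psi> `` {y. y = z \<or> y = z'}) h)" if f: "f \<in> flags" for f
  proof -
    obtain z z' h where fe: "f = (z, z', h)" by (cases f) auto
    note fz = flagsD[OF f[unfolded fe]]
    have e: "{y. y = z \<or> y = z'} = {z, z'}" by auto
    have b: "bilat (heights {z, z'})" by (rule bilat_pair[OF fz(1,2)])
    have "centroid ((z \<inter> z') \<times> {h..succ (heights {z, z'}) h}) = (side_mid z z', (h + succ (heights {z, z'}) h) / 2)"
      using bilat_succ(2)[OF b, of h] by (intro centroid_side fz(1,2,4)) simp
    then show ?thesis unfolding fe vplate_def prod.case e half_window[OF b, symmetric] by (simp only: mem_unit_cube_Pair)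
  qed
  have "ecount {p \<in> vplate ` flags. centroid p \<in> unit_cube} =
     ecount {f \<in> flags. case f of (z, z', h) \<Rightarrow> side_mid z z' \<in> unit_cube \<and> window (\<psi> `` {y. y = z \<or> y = z'}) h}"
    unfolding ecount_image_filter[OF inj_vplate] using c by (intro arg_cong[where f=ecount] Collect_cong) auto
  then show ?thesis unfolding flag_count by (simp only: conj_assoc)
qed

lemma count_hedges:
  "ecount {p \<in> hedge ` flags. centroid p \<in> unit_cube} =
    (\<integral>\<^sup>+p. \<integral>\<^sup>+z'. (if (sides (fst p) z' \<and> side_mid (fst p) z' \<in> unit_cube) \<and> (0 \<le> snd p \<and> snd p < 1) then 1 else 0) \<partial>count_space t \<partial>count_space \<psi>)"
proof -
  have c: "centroid (hedge f) \<in> unit_cube \<longleftrightarrow> (case f of (z, z', h) \<Rightarrow> side_mid z z' \<in> unit_cube \<and> (0 \<le> h \<and> h < 1))" if f: "f \<in> flags" for f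
  proof -
    obtain z z' h where fe: "f = (z, z', h)" by (cases f) auto
    note fz = flagsD[OF f[unfolded fe]]
    have "centroid ((z \<inter> z') \<times> {h..h}) = (side_mid z z', (h + h) / 2)" by (intro centroid_side fz(1,2,4)) simp
    then have "centroid ((z \<inter> z') \<times> {h}) = (side_mid z z', h)" by simp
    then show ?thesis unfolding fe hedge_def prod.case by (simp only: mem_unit_cube_Pair)
  qed
  have "ecount {p \<in> hedge ` flags. centroid p \<in> unit_cube} =
     ecount {f \<in> flags. case f of (z, z', h) \<Rightarrow> side_mid z z' \<in> unit_cube \<and> (0 \<le> h \<and> h < 1)}"
    unfolding ecount_image_filter[OF inj_hedge] using c by (intro arg_cong[where f=ecount] Collect_cong) auto
  then show ?thesis unfolding flag_count by (simp only: conj_assoc)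
qed

lemma count_vedges:
  "ecount {p \<in> vedge ` spots. centroid p \<in> unit_cube} = ecount {s \<in> spots. fst s \<in> unit_cube \<and> window (heights_at (fst s)) (snd s)}"
proof -
  have c: "centroid (vedge s) \<in> unit_cube \<longleftrightarrow> fst s \<in> unit_cube \<and> window (heights_at (fst s)) (snd s)" for s
  proof -
    obtain v h where se: "s = (v, h)" by (cases s)
    have "h \<le> succ (heights_at v) h" using bilat_succ(2)[OF bilat_at, of h v] by simp
    from centroid_segment_Times[OF this, of v v]
    have "centroid ({v} \<times> {h..succ (heights_at v) h}) = (v, (h + succ (heights_at v) h) / 2)" by simp
    then show ?thesis unfolding se vedge_def prod.case fst_conv snd_conv half_window[OF bilat_at, symmetric] by (simp only: mem_unit_cube_Pair)
  qed
  show ?thesis unfolding ecount_image_filter[OF inj_vedge] c ..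
qed

lemma count_vertices:
  "ecount {v \<in> vertices (column_cells t \<psi>). id v \<in> unit_cube} = ecount {s \<in> spots. fst s \<in> unit_cube \<and> (0 \<le> snd s \<and> snd s < 1)}"
proof -
  have "id v \<in> unit_cube \<longleftrightarrow> fst v \<in> unit_cube \<and> (0 \<le> snd v \<and> snd v < 1)" for v :: "(real^2) \<times> real"
    by (cases v) (simp only: mem_unit_cube_Pair id_apply fst_conv snd_conv)
  then show ?thesis unfolding vertices_eq by simp
qed

lemma edge_orientation:
  "e \<in> hedge ` flags \<Longrightarrow> horizontal e \<and> \<not> vertical e" "e \<in> vedge ` spots \<Longrightarrow> vertical e \<and> \<not> horizontal e"
  by (erule imageE, hypsubst, erule orientations)+

lemma plate_orientation:
  "p \<in> hplate ` \<psi> \<Longrightarrow> horizontal p \<and> \<not> vertical p" "p \<in> vplate ` flags \<Longrightarrow> vertical p \<and> \<not> horizontal p"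
  by (erule imageE, hypsubst, erule orientations)+

lemma hedge_vedge_disjoint: "hedge ` flags \<inter> vedge ` spots = {}"
  using edge_orientation by blast

lemma vplate_hplate_disjoint: "vplate ` flags \<inter> hplate ` \<psi> = {}"
  using plate_orientation by blast

lemma horizontal_edges: "{e \<in> edges (column_cells t \<psi>). horizontal e} = hedge ` flags"
  and vertical_edges: "{e \<in> edges (column_cells t \<psi>). vertical e} = vedge ` spots"
  unfolding edges_eq using edge_orientation by blast+

lemma horizontal_plates: "{p \<in> plates (column_cells t \<psi>). horizontal p} = hplate ` \<psi>"
  and vertical_plates: "{p \<in> plates (column_cells t \<psi>). vertical p} = vplate ` flags"
  unfolding plates_eq using plate_orientation by blast+

lemma count_edges:
  "ecount {e \<in> edges (column_cells t \<psi>). centroid e \<in> unit_cube} =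
    ecount {e \<in> hedge ` flags. centroid e \<in> unit_cube} + ecount {e \<in> vedge ` spots. centroid e \<in> unit_cube}"
proof -
  have "{e \<in> edges (column_cells t \<psi>). centroid e \<in> unit_cube} = {e \<in> hedge ` flags. centroid e \<in> unit_cube} \<union> {e \<in> vedge ` spots. centroid e \<in> unit_cube}"
    unfolding edges_eq by blast
  moreover have "{e \<in> hedge ` flags. centroid e \<in> unit_cube} \<inter> {e \<in> vedge ` spots. centroid e \<in> unit_cube} = {}"
    using hedge_vedge_disjoint by blast
  ultimately show ?thesis using plus_emeasure[of "{e \<in> hedge ` flags. centroid e \<in> unit_cube}" "count_space UNIV" "{e \<in> vedge ` spots. centroid e \<in> unit_cube}"] by simp
qed

lemma count_plates:
  "ecount {e \<in> plates (column_cells t \<psi>). centroid e \<in> unit_cube} =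
    ecount {e \<in> vplate ` flags. centroid e \<in> unit_cube} + ecount {e \<in> hplate ` \<psi>. centroid e \<in> unit_cube}"
proof -
  have "{e \<in> plates (column_cells t \<psi>). centroid e \<in> unit_cube} = {e \<in> vplate ` flags. centroid e \<in> unit_cube} \<union> {e \<in> hplate ` \<psi>. centroid e \<in> unit_cube}"
    unfolding plates_eq by blast
  moreover have "{e \<in> vplate ` flags. centroid e \<in> unit_cube} \<inter> {e \<in> hplate ` \<psi>. centroid e \<in> unit_cube} = {}"
    using vplate_hplate_disjoint by blast
  ultimately show ?thesis using plus_emeasure[of "{e \<in> vplate ` flags. centroid e \<in> unit_cube}" "count_space UNIV" "{e \<in> hplate ` \<psi>. centroid e \<in> unit_cube}"] by simp
qed

end

subsection \<open>Intensities\<close>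

abbreviation body_mean :: "(real^2) set \<Rightarrow> real^2" where
  "body_mean K \<equiv> (LINT x:K|lborel. x) /\<^sub>R measure lborel K"

lemma pred_end_in_cube:
  assumes a: "a \<in> body_algebra \<rightarrow>\<^sub>M borel"
  shows "Measurable.pred (body_algebra \<Otimes>\<^sub>M body_algebra) (\<lambda>p. sides (fst p) (snd p) \<and> a (fst p \<inter> snd p) \<in> (unit_cube :: (real^2) set))"
proof -
  have "(\<lambda>p. fst p \<inter> snd p) \<in> body_algebra \<Otimes>\<^sub>M body_algebra \<rightarrow>\<^sub>M (body_algebra :: (real^2) set measure)"
    by (intro measurable_body_Int measurable_fst measurable_snd)
  from measurable_compose[OF this a] have [measurable]: "(\<lambda>p. a (fst p \<inter> snd p)) \<in> body_algebra \<Otimes>\<^sub>M body_algebra \<rightarrow>\<^sub>M borel" .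
  show ?thesis by measurable
qed

lemma pred_mean_in_cube:
  "Measurable.pred (body_algebra \<Otimes>\<^sub>M body_algebra) (\<lambda>p. fst p = snd p \<and> body_mean (fst p) \<in> (unit_cube :: (real^2) set))"
proof -
  have [measurable]: "(\<lambda>p. body_mean (fst p)) \<in> body_algebra \<Otimes>\<^sub>M (body_algebra :: (real^2) set measure) \<rightarrow>\<^sub>M borel"
    by (rule measurable_compose[OF measurable_fst measurable_body_mean])
  show ?thesis by measurable
qed

lemma measurable_midpoint_ends: "(\<lambda>K. midpoint (end1 K) (end2 K)) \<in> body_algebra \<rightarrow>\<^sub>M borel"
  unfolding midpoint_def by measurable

lemma side_ends_translate:
  assumes t: "tessellation t" and z: "z \<in> t" "z' \<in> t" "touch z z'"
  shows "end1 ((+) x ` z \<inter> (+) x ` z') = x + end1 (z \<inter> z')" "end2 ((+) x ` z \<inter> (+) x ` z') = x + end2 (z \<inter> z')"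
    "side_mid ((+) x ` z) ((+) x ` z') = x + side_mid z z'"
proof -
  interpret planar_tess t by unfold_locales (rule t)
  have i: "(+) x ` z \<inter> (+) x ` z' = (+) x ` (z \<inter> z')" by (rule image_Int[symmetric]) simp
  note e = ends_translate[OF ends_of_side(1)[OF z], of x]
  show 1: "end1 ((+) x ` z \<inter> (+) x ` z') = x + end1 (z \<inter> z')" "end2 ((+) x ` z \<inter> (+) x ` z') = x + end2 (z \<inter> z')"
    unfolding i by (rule e)+
  show "side_mid ((+) x ` z) ((+) x ` z') = x + side_mid z z'"
    unfolding 1 by (simp add: midpoint_def vec_eq_iff field_simps)
qed

lemma ennreal_half_double: "2 * a / 2 = (a :: ennreal)"
  using mult_divide_eq_ennreal[of 2 a] by (simp add: mult.commute)

text \<open>A positive finite intensity cancels against the normalization of the Palm mean.\<close>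

lemma typical_sum:
  assumes "0 < intensity M c X" "intensity M c X < \<infinity>"
  shows "intensity M c X * palm_mean M c X f = mean_sum M c X f"
proof -
  have "intensity M c X * (mean_sum M c X f / intensity M c X) = mean_sum M c X f * intensity M c X / intensity M c X"
    by (simp add: ennreal_times_divide mult.commute)
  also have "\<dots> = mean_sum M c X f" using assms by (intro mult_divide_eq_ennreal) auto
  finally show ?thesis unfolding palm_mean_def .
qed

section \<open>Intensities as planar mean sums of marks\<close>

context column_model
begin

definition side_sum :: "((real^2) set \<Rightarrow> real^2) \<Rightarrow> ennreal" where
  "side_sum a = (\<integral>\<^sup>+w. (\<integral>\<^sup>+z. \<integral>\<^sup>+z'. (if sides z z' \<and> a (z \<inter> z') \<in> unit_cube then ennreal (\<rho> (T w) z) else 0) \<partial>count_space (T w) \<partial>count_space (T w)) \<partial>M)"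

definition cell_sum :: ennreal where
  "cell_sum = (\<integral>\<^sup>+w. (\<integral>\<^sup>+z. \<integral>\<^sup>+z'. (if z = z' \<and> body_mean z \<in> unit_cube then ennreal (\<rho> (T w) z) else 0) \<partial>count_space (T w) \<partial>count_space (T w)) \<partial>M)"

abbreviation mid_sum :: ennreal where
  "mid_sum \<equiv> side_sum (\<lambda>K. midpoint (end1 K) (end2 K))"

text \<open>Ends and midpoint of a shared segment all move along with translations, so mass
  transport applies to either end and the midpoint.\<close>

lemma side_sum_ends: "side_sum end1 = mid_sum" "side_sum end2 = mid_sum"
proof -
  have m: "(\<lambda>p. a (fst p \<inter> snd p)) \<in> body_algebra \<Otimes>\<^sub>M body_algebra \<rightarrow>\<^sub>M borel"
    if "a \<in> body_algebra \<rightarrow>\<^sub>M borel" for a :: "(real^2) set \<Rightarrow> real^2"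
    by (rule measurable_compose[OF measurable_body_Int[OF measurable_fst measurable_snd] that])
  show "side_sum end1 = mid_sum" unfolding side_sum_def
    by (rule side_mass_transport[OF stat mark, of "\<lambda>z z'. end1 (z \<inter> z')" "\<lambda>z z'. side_mid z z'", OF m[OF measurable_ends(1)] m[OF measurable_midpoint_ends]])
       (intro conjI side_ends_translate)
  show "side_sum end2 = mid_sum" unfolding side_sum_def
    by (rule side_mass_transport[OF stat mark, of "\<lambda>z z'. end2 (z \<inter> z')" "\<lambda>z z'. side_mid z z'", OF m[OF measurable_ends(2)] m[OF measurable_midpoint_ends]])
       (intro conjI side_ends_translate)
qed

lemma intensity_transfer:
  assumes "AE w in M. ecount {x \<in> X w. c x \<in> unit_cube} = f w" and "(\<integral>\<^sup>+w. f w \<partial>M) = B \<and> ae_measurable f"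
  shows "intensity M c X = B \<and> ae_measurable (\<lambda>w. ecount {x \<in> X w. c x \<in> unit_cube})"
proof
  have "intensity M c X = (\<integral>\<^sup>+w. f w \<partial>M)" unfolding intensity_eq by (rule nn_integral_cong_AE) (rule assms(1))
  then show "intensity M c X = B" using assms(2) by simp
  obtain g where g: "g \<in> borel_measurable M" "AE w in M. f w = g w" using assms(2) unfolding ae_measurable_def by blast
  have "AE w in M. ecount {x \<in> X w. c x \<in> unit_cube} = g w" using assms(1) g(2) by eventually_elim simp
  then show "ae_measurable (\<lambda>w. ecount {x \<in> X w. c x \<in> unit_cube})" unfolding ae_measurable_def using g(1) by (rule bexI)
qed

text \<open>The doubled count splits into two parts with the same mean. Additivity goes through
  measurable versions, and halving is exact in \<open>ennreal\<close> also at infinity.\<close>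

lemma intensity_transfer_half:
  assumes e: "AE w in M. 2 * ecount {x \<in> X w. c x \<in> unit_cube} = f w + g w"
    and f: "(\<integral>\<^sup>+w. f w \<partial>M) = B \<and> ae_measurable f" and g: "(\<integral>\<^sup>+w. g w \<partial>M) = B \<and> ae_measurable g"
  shows "intensity M c X = B \<and> ae_measurable (\<lambda>w. ecount {x \<in> X w. c x \<in> unit_cube})"
proof (rule intensity_transfer)
  show "AE w in M. ecount {x \<in> X w. c x \<in> unit_cube} = (f w + g w) / 2"
    using e by eventually_elim (metis ennreal_half_double)
  obtain f' g' where f': "f' \<in> borel_measurable M" "AE w in M. f w = f' w" and g': "g' \<in> borel_measurable M" "AE w in M. g w = g' w"
    using f g unfolding ae_measurable_def by blast
  have ae: "AE w in M. (f w + g w) / 2 = (f' w + g' w) / 2" using f'(2) g'(2) by eventually_elim simp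
  have "(\<integral>\<^sup>+w. (f w + g w) / 2 \<partial>M) = (\<integral>\<^sup>+w. (f' w + g' w) / 2 \<partial>M)" by (rule nn_integral_cong_AE) (rule ae)
  also have "\<dots> = (\<integral>\<^sup>+w. f' w + g' w \<partial>M) / 2" by (rule nn_integral_divide) (use f' g' in measurable)
  also have "(\<integral>\<^sup>+w. f' w + g' w \<partial>M) = (\<integral>\<^sup>+w. f w + g w \<partial>M)"
    by (rule nn_integral_cong_AE) (use f'(2) g'(2) in eventually_elim, simp)
  also have "(\<integral>\<^sup>+w. f w + g w \<partial>M) = B + B" using nn_integral_add_ae f g by simp
  also have "(B + B) / 2 = B" using ennreal_half_double[of B] by (simp add: mult_2)
  finally have "(\<integral>\<^sup>+w. (f w + g w) / 2 \<partial>M) = B" .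
  moreover have "ae_measurable (\<lambda>w. (f w + g w) / 2)" unfolding ae_measurable_def
  proof (rule bexI)
    show "(\<lambda>w. (f' w + g' w) / 2) \<in> borel_measurable M" using f'(1) g'(1) by measurable
  qed (rule ae)
  ultimately show "(\<integral>\<^sup>+w. (f w + g w) / 2 \<partial>M) = B \<and> ae_measurable (\<lambda>w. (f w + g w) / 2)" ..
qed

abbreviation Y :: "'w \<Rightarrow> ((real^2) \<times> real) set set" where
  "Y w \<equiv> column_cells (T w) (\<Psi> w)"

lemma mean_height_of_sides:
  assumes en: "en \<in> body_algebra \<rightarrow>\<^sub>M borel"
  shows "(\<integral>\<^sup>+w. (\<integral>\<^sup>+p. \<integral>\<^sup>+z'. (if (sides (fst p) z' \<and> en (fst p \<inter> z') \<in> unit_cube) \<and> (0 \<le> snd p \<and> snd p < 1) then 1 else 0) \<partial>count_space (T w) \<partial>count_space (\<Psi> w)) \<partial>M) = side_sum en \<and>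
    ae_measurable (\<lambda>w. \<integral>\<^sup>+p. \<integral>\<^sup>+z'. (if (sides (fst p) z' \<and> en (fst p \<inter> z') \<in> unit_cube) \<and> (0 \<le> snd p \<and> snd p < 1) then 1 else 0) \<partial>count_space (T w) \<partial>count_space (\<Psi> w))"
  unfolding side_sum_def
  by (rule mean_height_count[where W="\<lambda>z z'. sides z z' \<and> en (z \<inter> z') \<in> unit_cube", OF pred_end_in_cube[OF en]])

lemma intensity_horizontal_edges:
  "intensity M centroid (\<lambda>w. {e \<in> edges (Y w). horizontal e}) = mid_sum \<and>
   ae_measurable (\<lambda>w. ecount {e \<in> {e \<in> edges (Y w). horizontal e}. centroid e \<in> unit_cube})"
proof (rule intensity_transfer[OF _ mean_height_of_sides[OF measurable_midpoint_ends]])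
  show "AE w in M. ecount {e \<in> {e \<in> edges (Y w). horizontal e}. centroid e \<in> unit_cube} =
    (\<integral>\<^sup>+p. \<integral>\<^sup>+z'. (if (sides (fst p) z' \<and> side_mid (fst p) z' \<in> unit_cube) \<and> (0 \<le> snd p \<and> snd p < 1) then 1 else 0) \<partial>count_space (T w) \<partial>count_space (\<Psi> w))"
    using AE_column_tess
  proof eventually_elim
    case (elim w)
    then interpret column_tess "T w" "\<Psi> w" .
    show ?case unfolding horizontal_edges by (rule count_hedges)
  qed
qed

lemma intensity_vertices:
  "intensity M id (\<lambda>w. vertices (Y w)) = mid_sum \<and> ae_measurable (\<lambda>w. ecount {v \<in> vertices (Y w). id v \<in> unit_cube})"
proof (rule intensity_transfer_half[OF _
    mean_height_of_sides[OF measurable_ends(1), unfolded side_sum_ends]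
    mean_height_of_sides[OF measurable_ends(2), unfolded side_sum_ends]])
  show "AE w in M. 2 * ecount {v \<in> vertices (Y w). id v \<in> unit_cube} =
    (\<integral>\<^sup>+p. \<integral>\<^sup>+z'. (if (sides (fst p) z' \<and> end1 (fst p \<inter> z') \<in> unit_cube) \<and> (0 \<le> snd p \<and> snd p < 1) then 1 else 0) \<partial>count_space (T w) \<partial>count_space (\<Psi> w)) +
    (\<integral>\<^sup>+p. \<integral>\<^sup>+z'. (if (sides (fst p) z' \<and> end2 (fst p \<inter> z') \<in> unit_cube) \<and> (0 \<le> snd p \<and> snd p < 1) then 1 else 0) \<partial>count_space (T w) \<partial>count_space (\<Psi> w))"
    using AE_column_tess
  proof eventually_elim
    case (elim w)
    then interpret column_tess "T w" "\<Psi> w" .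
    show ?case unfolding count_vertices by (rule spot_count[of "\<lambda>v h. 0 \<le> h \<and> h < 1"])
  qed
qed

text \<open>A vertical edge over a corner ends at the next height of any column around it, so the
  cutting columns are those of all cells containing the end point.\<close>

lemma mean_window_at_end:
  assumes en: "en \<in> body_algebra \<rightarrow>\<^sub>M borel" and mem: "\<And>t z z'. tessellation t \<Longrightarrow> z \<in> t \<Longrightarrow> z' \<in> t \<Longrightarrow> sides z z' \<Longrightarrow> en (z \<inter> z') \<in> z \<inter> z'"
  shows "(\<integral>\<^sup>+w. (\<integral>\<^sup>+p. \<integral>\<^sup>+z'. (if (sides (fst p) z' \<and> en (fst p \<inter> z') \<in> unit_cube) \<and> window (\<Psi> w `` {y. en (fst p \<inter> z') \<in> y}) (snd p) then 1 else 0) \<partial>count_space (T w) \<partial>count_space (\<Psi> w)) \<partial>M) = side_sum en \<and>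
    ae_measurable (\<lambda>w. \<integral>\<^sup>+p. \<integral>\<^sup>+z'. (if (sides (fst p) z' \<and> en (fst p \<inter> z') \<in> unit_cube) \<and> window (\<Psi> w `` {y. en (fst p \<inter> z') \<in> y}) (snd p) then 1 else 0) \<partial>count_space (T w) \<partial>count_space (\<Psi> w))"
  unfolding side_sum_def
proof (rule mean_midpoint_plate_count[where W="\<lambda>z z'. sides z z' \<and> en (z \<inter> z') \<in> unit_cube" and P="\<lambda>z z' y. en (z \<inter> z') \<in> y", OF pred_end_in_cube[OF en]])
  have "(\<lambda>q. en (fst q \<inter> fst (snd q))) \<in> body_algebra \<Otimes>\<^sub>M (body_algebra \<Otimes>\<^sub>M (body_algebra :: (real^2) set measure)) \<rightarrow>\<^sub>M borel"
    by (rule measurable_compose[OF measurable_body_Int en]) measurable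
  then show "Measurable.pred (body_algebra \<Otimes>\<^sub>M (body_algebra \<Otimes>\<^sub>M (body_algebra :: (real^2) set measure))) (\<lambda>q. en (fst q \<inter> fst (snd q)) \<in> snd (snd q))"
    by (rule pred_mem_body) measurable
  show "en (z \<inter> z') \<in> z \<and> finite {y \<in> t. en (z \<inter> z') \<in> y}"
    if "tessellation t" "z \<in> t" "z' \<in> t" "sides z z' \<and> en (z \<inter> z') \<in> unit_cube" for t z z'
    using mem[OF that(1-3)] that(4) tess.finite_cells_at[unfolded tess_def, OF that(1)] by blast
qed

lemma ends_mem:
  assumes "tessellation t" "z \<in> t" "z' \<in> t" "sides z z'"
  shows "end1 (z \<inter> z') \<in> z \<inter> z'" "end2 (z \<inter> z') \<in> z \<inter> z'"
proof -
  interpret planar_tess t by unfold_locales (rule assms)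
  have "touch z z'" using sides_iff_touch assms by blast
  from ends_of_side(1)[OF assms(2,3) this]
  show "end1 (z \<inter> z') \<in> z \<inter> z'" "end2 (z \<inter> z') \<in> z \<inter> z'" using ends_in_segment by auto
qed

lemma intensity_vertical_edges:
  "intensity M centroid (\<lambda>w. {e \<in> edges (Y w). vertical e}) = mid_sum \<and>
   ae_measurable (\<lambda>w. ecount {e \<in> {e \<in> edges (Y w). vertical e}. centroid e \<in> unit_cube})"
proof (rule intensity_transfer_half[OF _
    mean_window_at_end[OF measurable_ends(1) ends_mem(1), unfolded side_sum_ends]
    mean_window_at_end[OF measurable_ends(2) ends_mem(2), unfolded side_sum_ends]])
  show "AE w in M. 2 * ecount {e \<in> {e \<in> edges (Y w). vertical e}. centroid e \<in> unit_cube} =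
    (\<integral>\<^sup>+p. \<integral>\<^sup>+z'. (if (sides (fst p) z' \<and> end1 (fst p \<inter> z') \<in> unit_cube) \<and> window (\<Psi> w `` {y. end1 (fst p \<inter> z') \<in> y}) (snd p) then 1 else 0) \<partial>count_space (T w) \<partial>count_space (\<Psi> w)) +
    (\<integral>\<^sup>+p. \<integral>\<^sup>+z'. (if (sides (fst p) z' \<and> end2 (fst p \<inter> z') \<in> unit_cube) \<and> window (\<Psi> w `` {y. end2 (fst p \<inter> z') \<in> y}) (snd p) then 1 else 0) \<partial>count_space (T w) \<partial>count_space (\<Psi> w))"
    using AE_column_tess
  proof eventually_elim
    case (elim w)
    then interpret column_tess "T w" "\<Psi> w" .
    show ?case unfolding vertical_edges count_vedges by (rule spot_count[of "\<lambda>v h. window (heights_at v) h"])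
  qed
qed

lemma intensity_vertical_plates:
  "intensity M centroid (\<lambda>w. {p \<in> plates (Y w). vertical p}) = mid_sum \<and>
   ae_measurable (\<lambda>w. ecount {p \<in> {p \<in> plates (Y w). vertical p}. centroid p \<in> unit_cube})"
proof (rule intensity_transfer)
  show "(\<integral>\<^sup>+w. (\<integral>\<^sup>+p. \<integral>\<^sup>+z'. (if (sides (fst p) z' \<and> side_mid (fst p) z' \<in> unit_cube) \<and> window (\<Psi> w `` {y. y = fst p \<or> y = z'}) (snd p) then 1 else 0) \<partial>count_space (T w) \<partial>count_space (\<Psi> w)) \<partial>M) = mid_sum \<and>
    ae_measurable (\<lambda>w. \<integral>\<^sup>+p. \<integral>\<^sup>+z'. (if (sides (fst p) z' \<and> side_mid (fst p) z' \<in> unit_cube) \<and> window (\<Psi> w `` {y. y = fst p \<or> y = z'}) (snd p) then 1 else 0) \<partial>count_space (T w) \<partial>count_space (\<Psi> w))"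
    unfolding side_sum_def
  proof (rule mean_midpoint_plate_count[where W="\<lambda>z z'. sides z z' \<and> side_mid z z' \<in> unit_cube" and P="\<lambda>z z' y. y = z \<or> y = z'", OF pred_end_in_cube[OF measurable_midpoint_ends]])
    show "Measurable.pred (body_algebra \<Otimes>\<^sub>M (body_algebra \<Otimes>\<^sub>M (body_algebra :: (real^2) set measure))) (\<lambda>q. snd (snd q) = fst q \<or> snd (snd q) = fst (snd q))"
      by (intro pred_intros_logic pred_eq_body) measurable
    show "(z = z \<or> z = z') \<and> finite {y \<in> t. y = z \<or> y = z'}" for t :: "(real^2) set set" and z z'
      by (auto intro: finite_subset[of _ "{z, z'}"])
  qed
  show "AE w in M. ecount {p \<in> {p \<in> plates (Y w). vertical p}. centroid p \<in> unit_cube} =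
    (\<integral>\<^sup>+p. \<integral>\<^sup>+z'. (if (sides (fst p) z' \<and> side_mid (fst p) z' \<in> unit_cube) \<and> window (\<Psi> w `` {y. y = fst p \<or> y = z'}) (snd p) then 1 else 0) \<partial>count_space (T w) \<partial>count_space (\<Psi> w))"
    using AE_column_tess
  proof eventually_elim
    case (elim w)
    then interpret column_tess "T w" "\<Psi> w" .
    show ?case unfolding vertical_plates by (rule count_vplates)
  qed
qed

text \<open>Passes from \<open>centroid\<close> to the measurable \<open>body_mean\<close>; both
  agree because cells have interior points.\<close>

lemma count_diag:
  assumes "column_tess t \<psi>"
  shows "ecount {p \<in> \<psi>. centroid (fst p) \<in> unit_cube \<and> Q (fst p) (snd p)} =
   (\<integral>\<^sup>+p. \<integral>\<^sup>+z'. (if (fst p = z' \<and> body_mean (fst p) \<in> unit_cube) \<and> Q (fst p) (snd p) then 1 else 0) \<partial>count_space t \<partial>count_space \<psi>)"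
proof -
  interpret column_tess t \<psi> by (rule assms)
  have "centroid (fst p) = body_mean (fst p)" if "p \<in> \<psi>" for p
    using in_t[of "fst p" "snd p"] that cell(4) by (intro centroid_body) simp
  then have "{p \<in> \<psi>. centroid (fst p) \<in> unit_cube \<and> Q (fst p) (snd p)} = {p \<in> \<psi>. body_mean (fst p) \<in> unit_cube \<and> Q (fst p) (snd p)}"
    by auto
  then show ?thesis using cell_sum_diag[of body_mean Q] by (simp only:)
qed

lemma intensity_cells:
  "intensity M centroid Y = cell_sum \<and> ae_measurable (\<lambda>w. ecount {c \<in> Y w. centroid c \<in> unit_cube})"
proof (rule intensity_transfer)
  show "(\<integral>\<^sup>+w. (\<integral>\<^sup>+p. \<integral>\<^sup>+z'. (if (fst p = z' \<and> body_mean (fst p) \<in> unit_cube) \<and> window (\<Psi> w `` {y. y = fst p}) (snd p) then 1 else 0) \<partial>count_space (T w) \<partial>count_space (\<Psi> w)) \<partial>M) = cell_sum \<and>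
    ae_measurable (\<lambda>w. \<integral>\<^sup>+p. \<integral>\<^sup>+z'. (if (fst p = z' \<and> body_mean (fst p) \<in> unit_cube) \<and> window (\<Psi> w `` {y. y = fst p}) (snd p) then 1 else 0) \<partial>count_space (T w) \<partial>count_space (\<Psi> w))"
    unfolding cell_sum_def
  proof (rule mean_midpoint_plate_count[where W="\<lambda>z z'. z = z' \<and> body_mean z \<in> unit_cube" and P="\<lambda>z z' y. y = z", OF pred_mean_in_cube])
    show "Measurable.pred (body_algebra \<Otimes>\<^sub>M (body_algebra \<Otimes>\<^sub>M (body_algebra :: (real^2) set measure))) (\<lambda>q. snd (snd q) = fst q)"
      by (intro pred_eq_body) measurable
    show "z = z \<and> finite {y \<in> t. y = z}" for t :: "(real^2) set set" and z by auto
  qed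
  show "AE w in M. ecount {c \<in> Y w. centroid c \<in> unit_cube} =
    (\<integral>\<^sup>+p. \<integral>\<^sup>+z'. (if (fst p = z' \<and> body_mean (fst p) \<in> unit_cube) \<and> window (\<Psi> w `` {y. y = fst p}) (snd p) then 1 else 0) \<partial>count_space (T w) \<partial>count_space (\<Psi> w))"
    using AE_column_tess
  proof eventually_elim
    case (elim w)
    then interpret column_tess "T w" "\<Psi> w" .
    show ?case unfolding count_cells singleton_conv by (rule count_diag[OF elim, of "\<lambda>z h. window (\<Psi> w `` {z}) h"])
  qed
qed

lemma intensity_horizontal_plates:
  "intensity M centroid (\<lambda>w. {p \<in> plates (Y w). horizontal p}) = cell_sum \<and>
   ae_measurable (\<lambda>w. ecount {p \<in> {p \<in> plates (Y w). horizontal p}. centroid p \<in> unit_cube})"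
proof (rule intensity_transfer[OF _ mean_height_count[where W="\<lambda>z z'. z = z' \<and> body_mean z \<in> unit_cube", OF pred_mean_in_cube, folded cell_sum_def]])
  show "AE w in M. ecount {p \<in> {p \<in> plates (Y w). horizontal p}. centroid p \<in> unit_cube} =
    (\<integral>\<^sup>+p. \<integral>\<^sup>+z'. (if (fst p = z' \<and> body_mean (fst p) \<in> unit_cube) \<and> (0 \<le> snd p \<and> snd p < 1) then 1 else 0) \<partial>count_space (T w) \<partial>count_space (\<Psi> w))"
    using AE_column_tess
  proof eventually_elim
    case (elim w)
    then interpret column_tess "T w" "\<Psi> w" .
    show ?case unfolding horizontal_plates count_hplates by (rule count_diag[OF elim, of "\<lambda>z h. 0 \<le> h \<and> h < 1"])
  qed
qed

text \<open>Horizontal and vertical edges are disjoint classes exhausting all edges; their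
  intensities add because both counts are almost surely measurable.\<close>

lemma intensity_edges: "intensity M centroid (\<lambda>w. edges (Y w)) = mid_sum + mid_sum"
proof -
  have "AE w in M. ecount {e \<in> edges (Y w). centroid e \<in> unit_cube} =
    ecount {e \<in> {e \<in> edges (Y w). horizontal e}. centroid e \<in> unit_cube} + ecount {e \<in> {e \<in> edges (Y w). vertical e}. centroid e \<in> unit_cube}"
    using AE_column_tess
  proof eventually_elim
    case (elim w)
    then interpret column_tess "T w" "\<Psi> w" .
    show ?case unfolding horizontal_edges vertical_edges by (rule count_edges)
  qed
  then have "intensity M centroid (\<lambda>w. edges (Y w)) = (\<integral>\<^sup>+w. ecount {e \<in> {e \<in> edges (Y w). horizontal e}. centroid e \<in> unit_cube} + ecount {e \<in> {e \<in> edges (Y w). vertical e}. centroid e \<in> unit_cube} \<partial>M)"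
    unfolding intensity_eq by (rule nn_integral_cong_AE)
  also have "\<dots> = intensity M centroid (\<lambda>w. {e \<in> edges (Y w). horizontal e}) + intensity M centroid (\<lambda>w. {e \<in> edges (Y w). vertical e})"
    unfolding intensity_eq
    by (rule nn_integral_add_ae[OF conjunct2[OF intensity_horizontal_edges] conjunct2[OF intensity_vertical_edges]])
  finally show ?thesis using intensity_horizontal_edges intensity_vertical_edges by simp
qed

lemma intensity_plates: "intensity M centroid (\<lambda>w. plates (Y w)) = mid_sum + cell_sum"
proof -
  have "AE w in M. ecount {p \<in> plates (Y w). centroid p \<in> unit_cube} =
    ecount {p \<in> {p \<in> plates (Y w). vertical p}. centroid p \<in> unit_cube} + ecount {p \<in> {p \<in> plates (Y w). horizontal p}. centroid p \<in> unit_cube}"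
    using AE_column_tess
  proof eventually_elim
    case (elim w)
    then interpret column_tess "T w" "\<Psi> w" .
    show ?case unfolding horizontal_plates vertical_plates by (rule count_plates)
  qed
  then have "intensity M centroid (\<lambda>w. plates (Y w)) = (\<integral>\<^sup>+w. ecount {p \<in> {p \<in> plates (Y w). vertical p}. centroid p \<in> unit_cube} + ecount {p \<in> {p \<in> plates (Y w). horizontal p}. centroid p \<in> unit_cube} \<partial>M)"
    unfolding intensity_eq by (rule nn_integral_cong_AE)
  also have "\<dots> = intensity M centroid (\<lambda>w. {p \<in> plates (Y w). vertical p}) + intensity M centroid (\<lambda>w. {p \<in> plates (Y w). horizontal p})"
    unfolding intensity_eq
    by (rule nn_integral_add_ae[OF conjunct2[OF intensity_vertical_plates] conjunct2[OF intensity_horizontal_plates]])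
  finally show ?thesis using intensity_vertical_plates intensity_horizontal_plates by simp
qed

text \<open>A planar identity: \<open>corner_sum\<close> with the cube as window turns twice the sum
  into the two end sums, and mass transport identifies both with \<open>mid_sum\<close>.\<close>

lemma mark_sum_corners:
  "mean_sum M id (\<lambda>w. cell_corners (T w)) (\<lambda>w v. ennreal (\<Sum>z | z \<in> T w \<and> v \<in> z. \<rho> (T w) z)) = mid_sum"
proof -
  let ?f = "\<lambda>w. \<integral>\<^sup>+v. ennreal (\<Sum>z | z \<in> T w \<and> v \<in> z. \<rho> (T w) z) \<partial>count_space {v \<in> cell_corners (T w). id v \<in> unit_cube}"
  let ?s = "\<lambda>en w. \<integral>\<^sup>+z. \<integral>\<^sup>+z'. (if sides z z' \<and> en (z \<inter> z') \<in> unit_cube then ennreal (\<rho> (T w) z) else 0) \<partial>count_space (T w) \<partial>count_space (T w)"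
  have m: "?s en \<in> borel_measurable M" if "en \<in> body_algebra \<rightarrow>\<^sub>M borel" for en :: "(real^2) set \<Rightarrow> real^2"
    by (rule measurable_compose[OF Tm marked_sum_tess[OF pred_end_in_cube[OF that]]])
  have "?f w = (?s end1 w + ?s end2 w) / 2" if w: "w \<in> space M" for w
  proof -
    interpret planar_tess "T w" by unfold_locales (rule tT[OF w])
    have "0 \<le> \<rho> (T w) z" if "z \<in> T w" for z using mark tT[OF w] that by (auto simp: cell_mark_def intro: less_imp_le)
    from corner_sum[where r="\<rho> (T w)" and A="\<lambda>v. v \<in> unit_cube", OF this] have "2 * ?f w = ?s end1 w + ?s end2 w" by (simp only: id_apply)
    then show ?thesis using ennreal_half_double[of "?f w"] by simp
  qed
  then have "(\<integral>\<^sup>+w. ?f w \<partial>M) = (\<integral>\<^sup>+w. (?s end1 w + ?s end2 w) / 2 \<partial>M)" by (rule nn_integral_cong)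
  also have "\<dots> = (\<integral>\<^sup>+w. ?s end1 w + ?s end2 w \<partial>M) / 2"
    by (rule nn_integral_divide) (intro borel_measurable_add m measurable_ends)
  also have "(\<integral>\<^sup>+w. ?s end1 w + ?s end2 w \<partial>M) = mid_sum + mid_sum"
    by (subst nn_integral_add[OF m m]) (rule measurable_ends, rule measurable_ends, fold side_sum_def, simp only: side_sum_ends)
  also have "(mid_sum + mid_sum) / 2 = mid_sum" using ennreal_half_double[of mid_sum] by (simp add: mult_2)
  finally show ?thesis unfolding mean_sum_def .
qed

text \<open>Writes the planar mark sum as the diagonal pair sum to which the cell and horizontal
  plate counts have been reduced.\<close>

lemma mark_sum_cells: "mean_sum M centroid T (\<lambda>w z. ennreal (\<rho> (T w) z)) = cell_sum"
  unfolding mean_sum_def cell_sum_def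
proof (rule nn_integral_cong)
  fix w assume w: "w \<in> space M"
  interpret planar_tess "T w" by unfold_locales (rule tT[OF w])
  have "(\<integral>\<^sup>+z. ennreal (\<rho> (T w) z) \<partial>count_space {z \<in> T w. centroid z \<in> unit_cube}) =
     (\<integral>\<^sup>+z. ennreal (\<rho> (T w) z) * indicator {z. centroid z \<in> unit_cube} z \<partial>count_space (T w))"
    by (simp add: nn_integral_count_space_indicator) (intro nn_integral_cong, simp add: indicator_def)
  also have "\<dots> = (\<integral>\<^sup>+z. \<integral>\<^sup>+z'. (if z = z' \<and> body_mean z \<in> unit_cube then ennreal (\<rho> (T w) z) else 0) \<partial>count_space (T w) \<partial>count_space (T w))"
  proof (rule nn_integral_cong)
    fix z assume "z \<in> space (count_space (T w))"
    then have z: "z \<in> T w" by simp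
    have c: "centroid z = body_mean z" by (rule centroid_body[OF cell(4)[OF z]])
    have "(\<integral>\<^sup>+z'. (if z = z' \<and> body_mean z \<in> unit_cube then ennreal (\<rho> (T w) z) else 0) \<partial>count_space (T w)) =
       (\<integral>\<^sup>+z'. ennreal (\<rho> (T w) z) * indicator {z. centroid z \<in> unit_cube} z * indicator {z} z' \<partial>count_space (T w))"
      using c by (intro nn_integral_cong) (auto simp: indicator_def)
    also have "\<dots> = ennreal (\<rho> (T w) z) * indicator {z. centroid z \<in> unit_cube} z"
      using z by (subst nn_integral_cmult) (auto simp: emeasure_count_space_finite)
    finally show "ennreal (\<rho> (T w) z) * indicator {z. centroid z \<in> unit_cube} z = (\<integral>\<^sup>+z'. (if z = z' \<and> body_mean z \<in> unit_cube then ennreal (\<rho> (T w) z) else 0) \<partial>count_space (T w))" ..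
  qed
  finally show "(\<integral>\<^sup>+z. ennreal (\<rho> (T w) z) \<partial>count_space {z \<in> T w. centroid z \<in> unit_cube}) = (\<integral>\<^sup>+z. \<integral>\<^sup>+z'. (if z = z' \<and> body_mean z \<in> unit_cube then ennreal (\<rho> (T w) z) else 0) \<partial>count_space (T w) \<partial>count_space (T w))" .
qed

end

theorem proposition4p1:
  fixes M :: "'w measure"
    and T :: "'w \<Rightarrow> (real^2) set set"
    and \<rho> :: "(real^2) set set \<Rightarrow> (real^2) set \<Rightarrow> real"
    and \<Psi> :: "'w \<Rightarrow> ((real^2) set \<times> real) set"
    and Y :: "'w \<Rightarrow> ((real^2) \<times> real) set set"
    and lV' lZ' rho_bar alpha_bar :: ennreal
  assumes "prob_space M"
    and "stationary_tessellation M T"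
    and "cell_mark \<rho>"
    and "column_process M T \<rho> \<Psi>"
    and Y: "\<And>w. Y w = column_cells (T w) (\<Psi> w)"
    and "AE w in M. tessellation (Y w)"
    and lV': "lV' = intensity M id (\<lambda>w. cell_corners (T w))"
    and lZ': "lZ' = intensity M centroid T"
    and "0 < lV'" "lV' < \<infinity>" "0 < lZ'" "lZ' < \<infinity>"
    and rho_bar: "rho_bar = palm_mean M centroid T (\<lambda>w z. ennreal (\<rho> (T w) z))"
    and alpha_bar: "alpha_bar = palm_mean M id (\<lambda>w. cell_corners (T w))
           (\<lambda>w v. ennreal (\<Sum>z | z \<in> T w \<and> v \<in> z. \<rho> (T w) z))"
  shows "intensity M id (\<lambda>w. vertices (Y w)) = lV' * alpha_bar \<and>
         intensity M centroid (\<lambda>w. edges (Y w)) = 2 * lV' * alpha_bar \<and>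
         intensity M centroid (\<lambda>w. plates (Y w)) = lV' * alpha_bar + lZ' * rho_bar \<and>
         intensity M centroid Y = lZ' * rho_bar \<and>
         intensity M centroid (\<lambda>w. {e \<in> edges (Y w). horizontal e}) = lV' * alpha_bar \<and>
         intensity M centroid (\<lambda>w. {e \<in> edges (Y w). vertical e}) = lV' * alpha_bar \<and>
         intensity M centroid (\<lambda>w. {p \<in> plates (Y w). horizontal p}) = lZ' * rho_bar \<and>
         intensity M centroid (\<lambda>w. {p \<in> plates (Y w). vertical p}) = lV' * alpha_bar"
proof -
  obtain \<kappa> where \<kappa>: "conditional_distribution M tess_algebra T (config_algebra (body_algebra \<Otimes>\<^sub>M borel)) \<Psi> \<kappa>"
      "AE t in distr M tess_algebra T.
         prob_space.indep_vars (\<kappa> t) (\<lambda>z. config_algebra borel) (\<lambda>z \<psi>. \<psi> `` {z}) t \<and>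
         (\<forall>z\<in>t. stationary_line_process (\<kappa> t) (\<lambda>\<psi>. \<psi> `` {z}) (\<rho> t z))"
    using assms(4) unfolding column_process_def by (elim conjE exE) (rule that)
  have sub: "\<And>w. w \<in> space M \<Longrightarrow> \<Psi> w \<subseteq> T w \<times> UNIV"
    using assms(4) unfolding column_process_def by blast
  have Ye: "Y = (\<lambda>w. column_cells (T w) (\<Psi> w))" by (rule ext) (rule Y)
  interpret C: column_model M T \<rho> \<Psi> \<kappa>
    unfolding column_model_def column_model_axioms_def
    using assms(1-3,6) sub \<kappa> unfolding Ye by simp
  \<comment> \<open>Intensity times Palm mean is the mean sum of the marks over corners, whatever
    the typical object; the same step for cells follows.\<close>
  have a: "lV' * alpha_bar = C.mid_sum"
    unfolding alpha_bar lV' C.mark_sum_corners[symmetric] using assms(9,10) unfolding lV' by (rule typical_sum)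
  have r: "lZ' * rho_bar = C.cell_sum"
    unfolding rho_bar lZ' C.mark_sum_cells[symmetric] using assms(11,12) unfolding lZ' by (rule typical_sum)
  have "2 * lV' * alpha_bar = C.mid_sum + C.mid_sum" unfolding mult.assoc a by (rule mult_2)
  then show ?thesis unfolding a r Ye
    using C.intensity_vertices C.intensity_edges C.intensity_plates C.intensity_cells
      C.intensity_horizontal_edges C.intensity_vertical_edges C.intensity_horizontal_plates C.intensity_vertical_plates
    by simp
qed

end
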